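(* Let $\Omega\subset\mathbb{R}^d$ be uniformly convex, let $f\in C(\Omega)\cap L^\infty(\Omega)$ satisfy $f\ge 0$, and let $g\in C(\partial\Omega)$. For $\varepsilon=(h,\delta,\theta)$ let $u_\varepsilon$ be the discrete solution of the two-scale method, extended from $\overline\Omega_h$ to $\Omega$ by the closest-point extension (all defined in the context). Then $u_\varepsilon$ converges uniformly to the unique convex viscosity solution $u\in C(\overline\Omega)$ of $\det D^2u=f$ in $\Omega$, $u=g$ on $\partial\Omega$, as $\varepsilon=(h,\delta,\theta)\to 0$ and $\frac{h}{\delta}\to 0$.
   Context: Setting. $d\ge 2$ and $\Omega\subset\mathbb{R}^d$ is a bounded domain. Uniformly convex means: $\Omega$ is convex and there is $R>0$ such that for every $z_0\in\partial\Omega$ and every inward unit normal $\nu$ of a supporting hyperplane of $\Omega$ at $z_0$, $\Omega$ is contained in the closed ball of radius $R$ centered at $z_0+R\nu$ (no smoothness of $\partial\Omega$ is assumed). Mesh. $\{\mathcal{T}_h\}$ is a shape-regular and quasi-uniform family of conforming simplicial triangulations with mesh size $h$ discretizing $\Omega$; $\Omega_h$ is the union of the elements of $\mathcal{T}_h$ (the computational domain); $\mathcal{N}_h$ is the set of nodes (vertices), $\mathcal{N}_h^b=\mathcal{N}_h\cap\partial\Omega_h$ the boundary nodes, $\mathcal{N}_h^0=\mathcal{N}_h\setminus\mathcal{N}_h^b$ the interior nodes. It is required that $\mathcal{N}_h^b\subset\partial\Omega$; in view of the convexity of $\Omega$, $\Omega_h$ is then convex and $\Omega_h\subset\Omega$,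 and $\Omega_h$ approximates $\Omega$ in the sense that the Hausdorff distance $\mathrm{dist}_H(\Omega,\Omega_h)\to 0$ as $h\to0$. $\mathbb{V}_h$ is the space of continuous functions on $\overline\Omega_h$ that are affine on each element of $\mathcal{T}_h$. Discrete operator. $\delta>0$ is the coarse scale. $\mathbb{S}$ is the unit sphere of $\mathbb{R}^d$ and $\mathbb{S}^\perp$ the set of orthonormal bases $\mathbf{v}=(v_1,\dots,v_d)$ of $\mathbb{R}^d$. For $\theta>0$, $\mathbb{S}_\theta\subset\mathbb{S}$ is a finite set such that every $v\in\mathbb{S}$ is within distance $\theta$ of some element of $\mathbb{S}_\theta$, and $\mathbb{S}^\perp_\theta\subset\mathbb{S}^\perp$ is a finite set of orthonormal bases with all components in $\mathbb{S}_\theta$ such that for every $\mathbf{v}\in\mathbb{S}^\perp$ there is $\mathbf{v}^\theta\in\mathbb{S}^\perp_\theta$ with $|v_j-v_j^\theta|\le\theta$ for all $1\le j\le d$. For $x_i\in\mathcal{N}_h^0$, $v\in\mathbb{S}$ and a continuous function $w$, $$\nabla^2_\delta w(x_i;v)=\frac{w(x_i+\rho\delta v)-2w(x_i)+w(x_i-\rho\delta v)}{\rho^2\delta^2},$$ where $\rho=\rho(x_i)\in(0,1]$ is the largest number with $x_i\pm\rho\delta v\in\overline\Omega_h$ for all $v\in\mathbb{S}$. Set $\nabla^{2,+}_\delta w=\max(\nabla^2_\delta w,0)$, $\nabla^{2,-}_\delta w=-\min(\nabla^2_\delta w,0)$ and $$T_\varepsilon[w](x_i)=\min_{\mathbf{v}\in\mathbb{S}^\perp_\theta}\Big(\prod_{j=1}^d\nabla^{2,+}_\delta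 w(x_i;v_j)-\sum_{j=1}^d\nabla^{2,-}_\delta w(x_i;v_j)\Big).$$ Discrete solution. $u_\varepsilon\in\mathbb{V}_h$ is the unique function with $u_\varepsilon(x_i)=g(x_i)$ for $x_i\in\mathcal{N}_h^b$ and $T_\varepsilon[u_\varepsilon](x_i)=f(x_i)$ for all $x_i\in\mathcal{N}_h^0$. It is extended to $\Omega$ by $u_\varepsilon(x):=u_\varepsilon(z)$ for $x\in\Omega\setminus\Omega_h$, where $z\in\partial\Omega_h$ is the (unique) closest point of $\overline\Omega_h$ to $x$. Viscosity solution. A convex function $u\in C(\overline\Omega)$ is a viscosity solution of the Dirichlet problem if $u=g$ on $\partial\Omega$ and, for every convex $\phi\in C^2(\Omega)$ and $x_0\in\Omega$: if $u-\phi$ has a local maximum at $x_0$ then $\det D^2\phi(x_0)\ge f(x_0)$, and if $u-\phi$ has a local minimum at $x_0$ then $\det D^2\phi(x_0)\le f(x_0)$. *)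

theory Defs
  imports "HOL-Analysis.Analysis"
begin

section \<open>Uniformly convex domains\<close>

text \<open>A unit vector \<open>\<nu>\<close> is the inward normal of a supporting hyperplane at \<open>z\<close> iff \<open>\<Omega>\<close> lies in the
  half-space \<open>\<nu> \<bullet> (x - z) \<ge> 0\<close>.\<close>

definition uniformly_convex :: "'a::euclidean_space set \<Rightarrow> bool" where
  "uniformly_convex \<Omega> \<longleftrightarrow> convex \<Omega> \<and>
     (\<exists>R>0. \<forall>z\<in>frontier \<Omega>. \<forall>\<nu>. norm \<nu> = 1 \<and> (\<forall>x\<in>\<Omega>. \<nu> \<bullet> (x - z) \<ge> 0) \<longrightarrow>
        \<Omega> \<subseteq> cball (z + R *\<^sub>R \<nu>) R)"


section \<open>Meshes\<close>

definition mesh_nodes :: "'a::euclidean_space set set \<Rightarrow> 'a set" where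
  "mesh_nodes \<T> = {x. \<exists>K\<in>\<T>. x extreme_point_of K}"

definition boundary_nodes :: "'a::euclidean_space set set \<Rightarrow> 'a set" where
  "boundary_nodes \<T> = mesh_nodes \<T> \<inter> frontier (\<Union>\<T>)"

definition interior_nodes :: "'a::euclidean_space set set \<Rightarrow> 'a set" where
  "interior_nodes \<T> = mesh_nodes \<T> - boundary_nodes \<T>"

text \<open>The computational domain is \<open>\<Union>\<T>\<close>, which is closed. Its convexity is listed explicitly: in
  dimension \<open>3\<close> and above it does not follow from the boundary nodes lying on \<open>frontier \<Omega>\<close> (cutting
  the tetrahedron spanned by two adjacent boundary triangles off an inscribed polytope keeps the
  nodes but destroys convexity), and the closest-point extension relies on it. That
  \<open>\<Union>\<T> \<subseteq> closure \<Omega>\<close> is then a consequence.\<close>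

definition mesh_of :: "'a::euclidean_space set \<Rightarrow> real \<Rightarrow> 'a set set \<Rightarrow> bool" where
  "mesh_of \<Omega> h \<T> \<longleftrightarrow>
     \<T> \<noteq> {} \<and> triangulation \<T> \<and> (\<forall>K\<in>\<T>. int DIM('a) simplex K) \<and>
     h = Max (diameter ` \<T>) \<and>
     boundary_nodes \<T> \<subseteq> frontier \<Omega> \<and>
     convex (\<Union>\<T>)"

text \<open>Only for nonempty bounded sets.\<close>

definition hausdorff_dist :: "'a::metric_space set \<Rightarrow> 'a set \<Rightarrow> real" where
  "hausdorff_dist A B = max (SUP x\<in>A. infdist x B) (SUP y\<in>B. infdist y A)"

text \<open>\<open>H\<close> is the set of mesh sizes occurring in the family.\<close>

definition shape_regular :: "real set \<Rightarrow> (real \<Rightarrow> 'a::euclidean_space set set) \<Rightarrow> bool" where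
  "shape_regular H \<T> \<longleftrightarrow>
     (\<exists>\<sigma>>0. \<forall>h\<in>H. \<forall>K\<in>\<T> h. \<exists>x. cball x (diameter K / \<sigma>) \<subseteq> K)"

definition quasi_uniform :: "real set \<Rightarrow> (real \<Rightarrow> 'a::euclidean_space set set) \<Rightarrow> bool" where
  "quasi_uniform H \<T> \<longleftrightarrow> (\<exists>\<sigma>>0. \<forall>h\<in>H. \<forall>K\<in>\<T> h. h \<le> \<sigma> * diameter K)"

definition mesh_family ::
  "'a::euclidean_space set \<Rightarrow> real set \<Rightarrow> (real \<Rightarrow> 'a set set) \<Rightarrow> bool" where
  "mesh_family \<Omega> H \<T> \<longleftrightarrow>
     H \<subseteq> {0<..} \<and> 0 islimpt H \<and>
     (\<forall>h\<in>H. mesh_of \<Omega> h (\<T> h)) \<and>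
     shape_regular H \<T> \<and> quasi_uniform H \<T> \<and>
     ((\<lambda>h. hausdorff_dist \<Omega> (\<Union>(\<T> h))) \<longlongrightarrow> 0) (at 0 within H)"

text \<open>Functions on \<open>\<Union>\<T>\<close> are represented by total functions that are \<open>undefined\<close> elsewhere, so that
  uniqueness in this space is literal equality.\<close>

definition fe_space :: "'a::euclidean_space set set \<Rightarrow> ('a \<Rightarrow> real) set" where
  "fe_space \<T> = {w \<in> extensional (\<Union>\<T>). continuous_on (\<Union>\<T>) w \<and>
     (\<forall>K\<in>\<T>. \<exists>a b. \<forall>x\<in>K. w x = a \<bullet> x + b)}"


section \<open>The two-scale operator\<close>

text \<open>Ordered bases of \<open>d\<close>-dimensional space are indexed by the coordinate type \<open>'n\<close>.\<close>

definition orthonormal_bases :: "('n \<Rightarrow> real ^ 'n) set" where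
  "orthonormal_bases = {v. \<forall>i j. v i \<bullet> v j = (if i = j then 1 else 0)}"

definition direction_sets ::
  "real \<Rightarrow> (real ^ 'n) set \<Rightarrow> ('n \<Rightarrow> real ^ 'n) set \<Rightarrow> bool" where
  "direction_sets \<theta> S B \<longleftrightarrow>
     finite S \<and> S \<subseteq> sphere 0 1 \<and> (\<forall>v\<in>sphere 0 1. \<exists>s\<in>S. norm (v - s) \<le> \<theta>) \<and>
     finite B \<and> B \<subseteq> orthonormal_bases \<and> (\<forall>v\<in>B. \<forall>j. v j \<in> S) \<and>
     (\<forall>v\<in>orthonormal_bases. \<exists>v'\<in>B. \<forall>j. norm (v j - v' j) \<le> \<theta>)"

text \<open>Below, \<open>D\<close> is the closed computational domain \<open>\<Union>\<T>\<close>.\<close>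

definition step_scale :: "'a::euclidean_space set \<Rightarrow> real \<Rightarrow> 'a \<Rightarrow> real" where
  "step_scale D \<delta> x = (GREATEST \<rho>. 0 < \<rho> \<and> \<rho> \<le> 1 \<and>
     (\<forall>v\<in>sphere 0 1. x + (\<rho> * \<delta>) *\<^sub>R v \<in> D \<and> x - (\<rho> * \<delta>) *\<^sub>R v \<in> D))"

definition second_difference ::
  "'a::euclidean_space set \<Rightarrow> real \<Rightarrow> ('a \<Rightarrow> real) \<Rightarrow> 'a \<Rightarrow> 'a \<Rightarrow> real" where
  "second_difference D \<delta> w x v = (let \<rho> = step_scale D \<delta> x in
     (w (x + (\<rho> * \<delta>) *\<^sub>R v) - 2 * w x + w (x - (\<rho> * \<delta>) *\<^sub>R v)) / (\<rho>\<^sup>2 * \<delta>\<^sup>2))"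

definition two_scale_operator ::
  "(real ^ 'n) set \<Rightarrow> real \<Rightarrow> ('n \<Rightarrow> real ^ 'n) set \<Rightarrow> (real ^ 'n \<Rightarrow> real) \<Rightarrow> real ^ 'n \<Rightarrow> real" where
  "two_scale_operator D \<delta> B w x = Min ((\<lambda>v.
     (\<Prod>j\<in>UNIV. max (second_difference D \<delta> w x (v j)) 0) -
     (\<Sum>j\<in>UNIV. - min (second_difference D \<delta> w x (v j)) 0)) ` B)"


section \<open>The discrete solution\<close>

definition is_discrete_solution ::
  "(real ^ 'n \<Rightarrow> real) \<Rightarrow> (real ^ 'n \<Rightarrow> real) \<Rightarrow> (real ^ 'n) set set \<Rightarrow> real \<Rightarrow>
   ('n \<Rightarrow> real ^ 'n) set \<Rightarrow> (real ^ 'n \<Rightarrow> real) \<Rightarrow> bool" where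
  "is_discrete_solution f g \<T> \<delta> B w \<longleftrightarrow>
     w \<in> fe_space \<T> \<and>
     (\<forall>x\<in>boundary_nodes \<T>. w x = g x) \<and>
     (\<forall>x\<in>interior_nodes \<T>. two_scale_operator (\<Union>\<T>) \<delta> B w x = f x)"

definition discrete_solution ::
  "(real ^ 'n \<Rightarrow> real) \<Rightarrow> (real ^ 'n \<Rightarrow> real) \<Rightarrow> (real ^ 'n) set set \<Rightarrow> real \<Rightarrow>
   ('n \<Rightarrow> real ^ 'n) set \<Rightarrow> real ^ 'n \<Rightarrow> real" where
  "discrete_solution f g \<T> \<delta> B = (THE w. is_discrete_solution f g \<T> \<delta> B w)"

definition closest_point_extension ::
  "'a::euclidean_space set \<Rightarrow> ('a \<Rightarrow> real) \<Rightarrow> 'a \<Rightarrow> real" where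
  "closest_point_extension D w x = (if x \<in> D then w x else w (closest_point D x))"

text \<open>The limit \<open>(h, \<delta>, \<theta>) \<rightarrow> 0\<close> with \<open>h / \<delta> \<rightarrow> 0\<close>, over \<open>h \<in> H\<close> and all positive \<open>\<delta>\<close>, \<open>\<theta>\<close>.\<close>

definition two_scale_limit :: "real set \<Rightarrow> (real \<times> real \<times> real) filter" where
  "two_scale_limit H =
     inf ((at 0 within H) \<times>\<^sub>F at_right 0 \<times>\<^sub>F at_right 0)
         (filtercomap (\<lambda>(h, \<delta>, \<theta>). h / \<delta>) (nhds 0))"


section \<open>Viscosity solutions of the Monge-Ampere equation\<close>

definition gradient :: "(real ^ 'n \<Rightarrow> real) \<Rightarrow> real ^ 'n \<Rightarrow> real ^ 'n" where
  "gradient \<phi> x = (\<chi> i. frechet_derivative \<phi> (at x) (axis i 1))"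

definition hessian :: "(real ^ 'n \<Rightarrow> real) \<Rightarrow> real ^ 'n \<Rightarrow> real ^ 'n ^ 'n" where
  "hessian \<phi> x = matrix (frechet_derivative (gradient \<phi>) (at x))"

text \<open>Only for open \<open>\<Omega>\<close>.\<close>

definition C2_on :: "(real ^ 'n) set \<Rightarrow> (real ^ 'n \<Rightarrow> real) \<Rightarrow> bool" where
  "C2_on \<Omega> \<phi> \<longleftrightarrow>
     (\<forall>x\<in>\<Omega>. \<phi> differentiable (at x) \<and> gradient \<phi> differentiable (at x)) \<and>
     continuous_on \<Omega> (hessian \<phi>)"

text \<open>As in \<open>fe_space\<close>, an element of \<open>C(closure \<Omega>)\<close> is \<open>undefined\<close> off \<open>closure \<Omega>\<close>.\<close>

definition is_viscosity_solution ::
  "(real ^ 'n) set \<Rightarrow> (real ^ 'n \<Rightarrow> real) \<Rightarrow> (real ^ 'n \<Rightarrow> real) \<Rightarrow> (real ^ 'n \<Rightarrow> real) \<Rightarrow> bool" where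
  "is_viscosity_solution \<Omega> f g u \<longleftrightarrow>
     u \<in> extensional (closure \<Omega>) \<and> continuous_on (closure \<Omega>) u \<and> convex_on (closure \<Omega>) u \<and>
     (\<forall>x\<in>frontier \<Omega>. u x = g x) \<and>
     (\<forall>\<phi>. convex_on \<Omega> \<phi> \<and> C2_on \<Omega> \<phi> \<longrightarrow> (\<forall>x\<in>\<Omega>.
        ((\<forall>\<^sub>F y in nhds x. u y - \<phi> y \<le> u x - \<phi> x) \<longrightarrow> det (hessian \<phi> x) \<ge> f x) \<and>
        ((\<forall>\<^sub>F y in nhds x. u y - \<phi> y \<ge> u x - \<phi> x) \<longrightarrow> det (hessian \<phi> x) \<le> f x)))"

end

theory Submission
  imports Defs "HOL-Probability.Distributions"
begin

text \<open>The half-relaxed upper and lower limits of the discrete solutions are a viscosity sub- and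
  supersolution: at a nodal contact with a paraboloid the centred differences are controlled by its
  Hessian up to an error of order \<open>(h / \<delta>)\<^sup>2\<close>, and every orthonormal basis is within \<open>\<theta>\<close> of an
  admissible one. Uniform convexity provides an affine barrier above and a quadratic barrier below
  at every boundary point, uniformly in the discretization, so both limits take the boundary
  values \<open>g\<close>. A comparison principle then shows that they coincide, which gives existence and
  uniform convergence at once; uniqueness is comparison again.

  Comparison does not need second-order differentiability almost everywhere. The \<open>n\<close>-th root of
  the determinant of a positive matrix is an infimum of linear functionals \<open>L\<close> of trace type, so a
  subsolution satisfies a family of linear differential inequalities with constant coefficients.
  These survive mollification, hence a mollified subsolution plus a small multiple of
  \<open>(norm x)\<^sup>2\<close> is a classical strict subsolution and can serve as a test function for the
  supersolution.\<close>

section \<open>Determinants and orthonormal bases\<close>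

text \<open>The discrete solutions come with bounds and boundary control but with no interior
  modulus of continuity, so compactness has to be recovered from comparison. The obstacle is
  regularity: the relaxed limits are a priori only semicontinuous, whereas mollification acts on a
  continuous function. The subsolution property closes this gap, because it forces the upper limit
  to be convex and hence continuous in \<open>\<Omega>\<close>. Comparison needs a strict margin
  that survives the return from linear functionals to the determinant. Minkowski's inequality
  provides it: adding s times the identity raises a determinant that is at least F to at least F +
  s^n, while f stays below F + s^n near the contact point. Contact is sought among the nodes, since
  the equation is prescribed only there. Nodal maxima control the values at the stencil points up to
  the interpolation error of a paraboloid, of order h^2; division by \<delta>^2 is what makes h /
  \<delta> the relevant ratio.\<close>

definition pos_def :: "real ^ 'n ^ 'n \<Rightarrow> bool" where
  "pos_def M \<longleftrightarrow> transpose M = M \<and> (\<forall>h. h \<noteq> 0 \<longrightarrow> 0 < h \<bullet> (M *v h))"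

lemma symmetric_matrix_inner:
  fixes M :: "real ^ 'n ^ 'n"
  assumes "transpose M = M"
  shows "x \<bullet> (M *v y) = y \<bullet> (M *v x)"
  by (metis assms dot_lmul_matrix inner_commute transpose_matrix_vector)

lemma orthonormal_basesD:
  assumes "v \<in> orthonormal_bases"
  shows "v i \<bullet> v i = 1" "i \<noteq> j \<Longrightarrow> v i \<bullet> v j = 0" "norm (v i) = 1"
  using assms by (auto simp: orthonormal_bases_def norm_eq_1)

lemma axis_orthonormal: "(\<lambda>i. axis i 1) \<in> orthonormal_bases"
  by (auto simp: orthonormal_bases_def inner_axis_axis)

text \<open>Bases are stored as the rows of a matrix, so that Heine-Borel applies to the set over
  which \<open>pos_def_diagonalization\<close> minimises.\<close>

lemma orthonormal_compact:
  "compact {Q :: real ^ 'n ^ 'n. \<forall>i j. Q $ i \<bullet> Q $ j = (if i = j then 1 else 0)}" (is "compact ?K")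
proof -
  have "closed ?K"
    by (intro closed_Collect_all closed_Collect_eq continuous_intros)
  moreover have "bounded ?K"
  proof (rule boundedI)
    fix Q assume Q: "Q \<in> ?K"
    have "norm Q \<le> (\<Sum>i\<in>UNIV. norm (Q $ i))"
      unfolding norm_vec_def by (rule L2_set_le_sum) auto
    also have "\<dots> = real CARD('n)"
      using Q by (simp add: norm_eq_sqrt_inner)
    finally show "norm Q \<le> real CARD('n)" .
  qed
  ultimately show ?thesis
    by (simp add: compact_eq_bounded_closed)
qed

text \<open>A Givens rotation in the plane of \<open>v i\<close> and \<open>v k\<close>: the
  competitor in the minimisation below.\<close>

lemma rotation_orthonormal:
  fixes v :: "'n::finite \<Rightarrow> real ^ 'n"
  assumes v: "v \<in> orthonormal_bases" and ik: "i \<noteq> k" and cs: "c\<^sup>2 + s\<^sup>2 = (1::real)"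
  shows "v(i := c *\<^sub>R v i + s *\<^sub>R v k, k := c *\<^sub>R v k - s *\<^sub>R v i) \<in> orthonormal_bases"
proof -
  have o: "v a \<bullet> v b = (if a = b then 1 else 0)" for a b
    using v by (auto simp: orthonormal_bases_def)
  show ?thesis
    using ik cs unfolding orthonormal_bases_def
    by (auto simp: o inner_add_left inner_add_right inner_diff_left inner_diff_right power2_eq_square
        algebra_simps)
qed

text \<open>Compactness yields a basis that minimises the product of the diagonal entries of M. A
  nonzero off-diagonal entry would allow a Jacobi rotation that strictly lowers the product, so M is
  diagonal in the minimising basis and the minimum equals \<open>det M\<close>. Minimality against
  all other bases is then Hadamard's inequality.\<close>

lemma pos_def_diagonalization:
  fixes M :: "real ^ 'n ^ 'n"
  assumes M: "pos_def M"
  obtains v where "v \<in> orthonormal_bases" "det M = (\<Prod>j\<in>UNIV. v j \<bullet> (M *v v j))"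
    "\<And>w. w \<in> orthonormal_bases \<Longrightarrow> det M \<le> (\<Prod>j\<in>UNIV. w j \<bullet> (M *v w j))"
proof -
  have sym: "transpose M = M" and pos: "\<And>h. h \<noteq> 0 \<Longrightarrow> 0 < h \<bullet> (M *v h)"
    using M by (auto simp: pos_def_def)
  define K where "K = {Q :: real ^ 'n ^ 'n. \<forall>i j. Q $ i \<bullet> Q $ j = (if i = j then 1 else 0)}"
  define F where "F = (\<lambda>Q :: real ^ 'n ^ 'n. \<Prod>j\<in>UNIV. Q $ j \<bullet> (M *v (Q $ j)))"
  have conv: "(\<chi> j. w j) \<in> K" "F (\<chi> j. w j) = (\<Prod>j\<in>UNIV. w j \<bullet> (M *v w j))"
    if "w \<in> orthonormal_bases" for w
    using that by (auto simp: K_def F_def orthonormal_bases_def)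
  have "continuous_on K F"
    unfolding F_def by (intro continuous_intros matrix_vector_mult_linear_continuous_on
      linear_continuous_on_compose[OF _ matrix_vector_mul_linear])
  moreover have "K \<noteq> {}"
    using conv(1)[OF axis_orthonormal] by auto
  ultimately obtain Q where Q: "Q \<in> K" and Qmin: "\<And>P. P \<in> K \<Longrightarrow> F Q \<le> F P"
    using continuous_attains_inf[of K F] orthonormal_compact unfolding K_def by blast
  define v where "v = (\<lambda>j. Q $ j)"
  have v: "v \<in> orthonormal_bases" using Q by (auto simp: v_def K_def orthonormal_bases_def)
  have Qv: "Q = (\<chi> j. v j)" by (simp add: v_def vec_eq_iff)
  have vmin: "(\<Prod>j\<in>UNIV. v j \<bullet> (M *v v j)) \<le> (\<Prod>j\<in>UNIV. w j \<bullet> (M *v w j))"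
    if "w \<in> orthonormal_bases" for w
    using Qmin[OF conv(1)[OF that]] conv(2)[OF that] conv(2)[OF v] Qv by simp
  have nz: "w j \<noteq> 0" if "w \<in> orthonormal_bases" for w :: "'n \<Rightarrow> real ^ 'n" and j
    using orthonormal_basesD(1)[OF that, of j] by auto
  have offdiag: "v i \<bullet> (M *v v k) = 0" if ik: "i \<noteq> k" for i k
  proof (rule ccontr)
    define a b m where "a = v i \<bullet> (M *v v i)" and "b = v k \<bullet> (M *v v k)" and "m = v i \<bullet> (M *v v k)"
    assume "v i \<bullet> (M *v v k) \<noteq> 0"
    hence m: "m \<noteq> 0" by (simp add: m_def)
    have m': "v k \<bullet> (M *v v i) = m"
      unfolding m_def by (rule symmetric_matrix_inner[OF sym])
    \<comment> \<open>The difference of the eigenvalues of the 2x2 block with diagonal a, b and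
      off-diagonal entry m. Rotating by half the angle of the vector (a - b, 2m) keeps the trace a +
      b and turns the difference of the diagonal entries into \<open>D\<close>, so their product
      drops by m^2.\<close>
    define D where "D = sqrt ((a - b)\<^sup>2 + (2 * m)\<^sup>2)"
    have D: "D > 0" "D\<^sup>2 = (a - b)\<^sup>2 + (2 * m)\<^sup>2"
      using m unfolding D_def by (auto intro!: add_nonneg_pos)
    have "((a - b) / D)\<^sup>2 + (2 * m / D)\<^sup>2 = 1"
      unfolding power_divide add_divide_distrib[symmetric] D(2)[symmetric] using D(1) by simp
    then obtain t where t: "(a - b) / D = cos t" "2 * m / D = sin t"
      using sincos_total_2pi by blast
    define c s where "c = cos (t / 2)" and "s = sin (t / 2)"
    have cs: "c\<^sup>2 + s\<^sup>2 = 1" by (simp add: c_def s_def)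
    have c2: "c\<^sup>2 - s\<^sup>2 = cos t" "2 * c * s = sin t"
      using cos_double[of "t/2"] sin_double[of "t/2"] by (auto simp: c_def s_def)
    define w where "w = v(i := c *\<^sub>R v i + s *\<^sub>R v k, k := c *\<^sub>R v k - s *\<^sub>R v i)"
    have w: "w \<in> orthonormal_bases"
      unfolding w_def by (rule rotation_orthonormal[OF v ik cs])
    have wi: "w i = c *\<^sub>R v i + s *\<^sub>R v k" and wk: "w k = c *\<^sub>R v k - s *\<^sub>R v i"
      using ik by (auto simp: w_def)
    define a' b' where "a' = w i \<bullet> (M *v w i)" and "b' = w k \<bullet> (M *v w k)"
    have a': "a' = a * c\<^sup>2 + 2 * m * c * s + b * s\<^sup>2"
      unfolding a'_def wi
      by (simp add: matrix_vector_mult_add_rdistrib matrix_vector_mult_scaleR vec.add vec.scale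
          inner_add_left inner_add_right m' a_def[symmetric] b_def[symmetric] m_def[symmetric]
          power2_eq_square algebra_simps matrix_vector_right_distrib)
    have b': "b' = a * s\<^sup>2 - 2 * m * c * s + b * c\<^sup>2"
      unfolding b'_def wk
      by (simp add: matrix_vector_mult_scaleR matrix_vector_mult_diff_distrib
          inner_diff_left inner_diff_right m' a_def[symmetric] b_def[symmetric] m_def[symmetric]
          power2_eq_square algebra_simps)
    have "a' + b' = (a + b) * (c\<^sup>2 + s\<^sup>2)" unfolding a' b' by (simp add: algebra_simps)
    hence sum: "a' + b' = a + b" using cs by simp
    have "a' - b' = (a - b) * (c\<^sup>2 - s\<^sup>2) + 2 * m * (2 * c * s)"
      unfolding a' b' by (simp add: algebra_simps)
    also have "\<dots> = (a - b) * ((a - b) / D) + 2 * m * (2 * m / D)"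
      using c2 t by simp
    also have "\<dots> = ((a - b)\<^sup>2 + (2 * m)\<^sup>2) / D"
      by (simp add: power2_eq_square add_divide_distrib)
    also have "\<dots> = D" unfolding D(2)[symmetric] using D(1) by (simp add: power2_eq_square)
    finally have diff: "a' - b' = D" .
    have "4 * (a' * b') = (a' + b')\<^sup>2 - (a' - b')\<^sup>2" by (simp add: power2_eq_square algebra_simps)
    also have "\<dots> = 4 * (a * b) - 4 * m\<^sup>2"
      unfolding sum diff D(2) by (simp add: power2_eq_square algebra_simps)
    finally have "4 * (a' * b') = 4 * (a * b) - 4 * m\<^sup>2" .
    moreover have "m\<^sup>2 > 0" using m by simp
    ultimately have less: "a' * b' < a * b" by linarith
    define R where "R = (\<Prod>j\<in>UNIV - {i, k}. v j \<bullet> (M *v v j))"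
    have Rpos: "R > 0" unfolding R_def by (rule prod_pos) (use pos nz[OF v] in auto)
    have split: "(\<Prod>j\<in>UNIV. g j) = g i * g k * (\<Prod>j\<in>UNIV - {i, k}. g j)" for g :: "'n \<Rightarrow> real"
    proof -
      have "(\<Prod>j\<in>UNIV. g j) = (\<Prod>j\<in>{i,k}. g j) * (\<Prod>j\<in>UNIV - {i, k}. g j)"
        by (subst mult.commute, rule prod.subset_diff) auto
      thus ?thesis using ik by simp
    qed
    have "(\<Prod>j\<in>UNIV. w j \<bullet> (M *v w j)) = a' * b' * R"
      unfolding split[of "\<lambda>j. w j \<bullet> (M *v w j)"] a'_def b'_def R_def by (simp add: w_def)
    also have "\<dots> < a * b * R" using less Rpos by simp
    also have "\<dots> = (\<Prod>j\<in>UNIV. v j \<bullet> (M *v v j))"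
      unfolding split[of "\<lambda>j. v j \<bullet> (M *v v j)"] a_def b_def R_def by simp
    finally show False using vmin[OF w] by simp
  qed
  have QQ: "Q ** transpose Q = mat 1"
    using Q unfolding K_def
    by (auto simp: vec_eq_iff matrix_matrix_mult_def transpose_def mat_def inner_vec_def)
  hence detQ: "det Q * det Q = 1" by (metis det_I det_mul det_transpose)
  have entry: "(Q ** M ** transpose Q) $ i $ j = v i \<bullet> (M *v v j)" for i j
  proof -
    have "(Q ** M ** transpose Q) $ i $ j = (Q *v (M *v v j)) $ i"
      unfolding matrix_vector_mul_assoc
      by (simp add: matrix_matrix_mult_def matrix_vector_mult_def transpose_def v_def)
    also have "\<dots> = v i \<bullet> (M *v v j)"
      by (simp add: matrix_vector_mult_def inner_vec_def v_def)
    finally show ?thesis .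
  qed
  have "det (Q ** M ** transpose Q) = (\<Prod>j\<in>UNIV. v j \<bullet> (M *v v j))"
    by (subst det_diagonal) (auto simp: entry offdiag)
  moreover have "det (Q ** M ** transpose Q) = det M"
    using detQ by (simp add: det_mul)
  ultimately have "det M = (\<Prod>j\<in>UNIV. v j \<bullet> (M *v v j))" by simp
  thus thesis using that v vmin by simp
qed

lemma quadratic_form_lower_bound:
  fixes M :: "real ^ 'n ^ 'n"
  assumes "pos_def M"
  obtains c where "c > 0" "\<And>h. c * (norm h)\<^sup>2 \<le> h \<bullet> (M *v h)"
proof -
  have "continuous_on (sphere 0 1) (\<lambda>h. h \<bullet> (M *v h))"
    by (intro continuous_intros matrix_vector_mult_linear_continuous_on)
  then obtain x where x: "x \<in> sphere 0 1"
    "\<And>y. y \<in> sphere 0 1 \<Longrightarrow> x \<bullet> (M *v x) \<le> y \<bullet> (M *v y)"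
    using continuous_attains_inf[of "sphere (0::real^'n) 1" "\<lambda>h. h \<bullet> (M *v h)"] by auto
  show thesis
  proof
    have "x \<noteq> 0" using x(1) by auto
    thus "0 < x \<bullet> (M *v x)" using assms by (auto simp: pos_def_def)
    fix h :: "real ^ 'n"
    show "x \<bullet> (M *v x) * (norm h)\<^sup>2 \<le> h \<bullet> (M *v h)"
    proof (cases "h = 0")
      case False
      define k where "k = (1 / norm h) *\<^sub>R h"
      have h: "h = norm h *\<^sub>R k" using False by (simp add: k_def)
      have "x \<bullet> (M *v x) \<le> k \<bullet> (M *v k)" by (rule x(2)) (use False in \<open>simp add: k_def\<close>)
      moreover have "h \<bullet> (M *v h) = (norm h)\<^sup>2 * (k \<bullet> (M *v k))"
        by (subst (1 2) h) (simp add: matrix_vector_mult_scaleR power2_eq_square)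
      ultimately show ?thesis by (metis mult.commute mult_left_mono zero_le_power2)
    qed simp
  qed
qed

lemma sum_inner_orthonormal:
  assumes "v \<in> orthonormal_bases"
  shows "(\<Sum>j\<in>UNIV. (z \<bullet> v j)\<^sup>2) = (norm (z :: real ^ 'n))\<^sup>2"
    and "(\<Sum>j\<in>UNIV. (z \<bullet> v j) *\<^sub>R v j) = z"
proof -
  have o: "v a \<bullet> v b = (if a = b then 1 else 0)" for a b
    using assms by (auto simp: orthonormal_bases_def)
  have inj: "inj v"
    by (rule injI) (metis o zero_neq_one)
  have "pairwise orthogonal (range v)"
    by (auto simp: pairwise_def orthogonal_def o)
  moreover have "0 \<notin> range v" using o by (metis imageE inner_zero_left zero_neq_one)
  ultimately have "independent (range v)" by (rule pairwise_orthogonal_independent)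
  moreover have "card (range v) = DIM(real ^ 'n)" using inj by (simp add: card_image)
  ultimately have span: "span (range v) = UNIV"
    using dim_eq_full[of "range v"] dim_eq_card_independent by fastforce
  define y where "y = z - (\<Sum>j\<in>UNIV. (z \<bullet> v j) *\<^sub>R v j)"
  have "orthogonal y x" if "x \<in> range v" for x
    using that by (auto simp: orthogonal_def y_def inner_diff_left inner_sum_left o if_distrib
        cong: if_cong)
  hence "orthogonal y y" using span by (metis UNIV_I orthogonal_to_span)
  hence "y = 0" by (simp add: orthogonal_def)
  thus sum: "(\<Sum>j\<in>UNIV. (z \<bullet> v j) *\<^sub>R v j) = z" by (simp add: y_def)
  have "(norm z)\<^sup>2 = z \<bullet> (\<Sum>j\<in>UNIV. (z \<bullet> v j) *\<^sub>R v j)"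
    by (simp only: sum power2_norm_eq_inner)
  thus "(\<Sum>j\<in>UNIV. (z \<bullet> v j)\<^sup>2) = (norm z)\<^sup>2"
    by (simp add: inner_sum_right power2_eq_square)
qed

section \<open>Second-order jets\<close>

text \<open>The second-order superjet of viscosity theory. The remainder o(|y - x|^2) is spelled out
  with a separate \<open>e\<close>, which avoids a quotient at y = x.\<close>

definition superjet :: "(real ^ 'n \<Rightarrow> real) \<Rightarrow> real ^ 'n \<Rightarrow> real ^ 'n \<Rightarrow> real ^ 'n ^ 'n \<Rightarrow> bool" where
  "superjet u x b M \<longleftrightarrow> transpose M = M \<and> (\<forall>e>0. \<forall>\<^sub>F y in nhds x.
     u y \<le> u x + b \<bullet> (y - x) + (y - x) \<bullet> (M *v (y - x)) / 2 + e * (norm (y - x))\<^sup>2)"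

text \<open>Defined by reflection, so that the calculus of superjets transfers by a change of
  sign.\<close>

definition subjet :: "(real ^ 'n \<Rightarrow> real) \<Rightarrow> real ^ 'n \<Rightarrow> real ^ 'n \<Rightarrow> real ^ 'n ^ 'n \<Rightarrow> bool" where
  "subjet u x b M \<longleftrightarrow> superjet (\<lambda>y. - u y) x (- b) (- M)"

text \<open>Quantifying over orthonormal bases avoids the determinant of a matrix that is not known to be
  positive: by Hadamard's inequality the condition says that \<open>M\<close> is positive semidefinite and
  \<open>det M \<ge> f x\<close>. It is also the form in which the discrete operator passes to the limit.\<close>

definition ma_subsolution :: "(real ^ 'n) set \<Rightarrow> (real ^ 'n \<Rightarrow> real) \<Rightarrow> (real ^ 'n \<Rightarrow> real) \<Rightarrow> bool" where
  "ma_subsolution \<Omega> f u \<longleftrightarrow> (\<forall>x\<in>\<Omega>. \<forall>b M. superjet u x b M \<longrightarrow> (\<forall>v\<in>orthonormal_bases.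
     (\<forall>j. 0 \<le> v j \<bullet> (M *v v j)) \<and> f x \<le> (\<Prod>j\<in>UNIV. v j \<bullet> (M *v v j))))"

text \<open>Restricting to positive definite matrices corresponds to testing with convex functions,
  where the determinant is monotone. Degenerate convex test functions are recovered in
  \<open>ma_imp_viscosity_test\<close>, because their determinant vanishes and f is
  nonnegative.\<close>

definition ma_supersolution :: "(real ^ 'n) set \<Rightarrow> (real ^ 'n \<Rightarrow> real) \<Rightarrow> (real ^ 'n \<Rightarrow> real) \<Rightarrow> bool" where
  "ma_supersolution \<Omega> f u \<longleftrightarrow> (\<forall>x\<in>\<Omega>. \<forall>b M. subjet u x b M \<and> pos_def M \<longrightarrow> det M \<le> f x)"

lemma uminus_matrix_vector: "(- M) *v x = - ((M :: real ^ 'n ^ 'm) *v x)"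
  by (simp add: matrix_vector_mult_def vec_eq_iff sum_negf)

lemma matrix_vector_uminus: "M *v (- x) = - ((M :: real ^ 'n ^ 'm) *v x)"
  by (simp add: matrix_vector_mult_def vec_eq_iff sum_negf)

lemma scaleR_matrix_vector: "(c *\<^sub>R M) *v x = c *\<^sub>R ((M :: real ^ 'n ^ 'm) *v x)"
  by (simp add: matrix_vector_mult_def vec_eq_iff sum_distrib_left mult.assoc)

lemma transpose_uminus: "transpose (- M) = - transpose (M :: real ^ 'n ^ 'm)"
  by (simp add: transpose_def vec_eq_iff)

lemma transpose_add: "transpose (M + N) = transpose M + transpose (N :: real ^ 'n ^ 'm)"
  by (simp add: transpose_def vec_eq_iff)

lemma transpose_scaleR: "transpose (c *\<^sub>R M) = c *\<^sub>R transpose (M :: real ^ 'n ^ 'm)"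
  by (simp add: transpose_def vec_eq_iff)

lemma subjet_def2:
  "subjet u x b M \<longleftrightarrow> transpose M = M \<and> (\<forall>e>0. \<forall>\<^sub>F y in nhds x.
     u y \<ge> u x + b \<bullet> (y - x) + (y - x) \<bullet> (M *v (y - x)) / 2 - e * (norm (y - x))\<^sup>2)"
proof -
  have "- u y \<le> - u x + (- b) \<bullet> (y - x) + (y - x) \<bullet> ((- M) *v (y - x)) / 2 + e * (norm (y - x))\<^sup>2 \<longleftrightarrow>
    u y \<ge> u x + b \<bullet> (y - x) + (y - x) \<bullet> (M *v (y - x)) / 2 - e * (norm (y - x))\<^sup>2" for y e
    unfolding uminus_matrix_vector inner_minus_left inner_minus_right by (rule iffI; linarith)
  thus ?thesis unfolding subjet_def superjet_def by (simp add: transpose_uminus)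
qed

lemma superjet_add:
  assumes "superjet f x b M" "superjet g x c N"
  shows "superjet (\<lambda>y. f y + g y) x (b + c) (M + N)"
  unfolding superjet_def
proof (intro conjI allI impI)
  show "transpose (M + N) = M + N"
    using assms by (simp add: superjet_def transpose_add)
  fix e :: real assume "e > 0"
  hence e: "e / 2 > 0" by simp
  have "\<forall>\<^sub>F y in nhds x. f y \<le> f x + b \<bullet> (y - x) + (y - x) \<bullet> (M *v (y - x)) / 2 + e/2 * (norm (y - x))\<^sup>2"
    "\<forall>\<^sub>F y in nhds x. g y \<le> g x + c \<bullet> (y - x) + (y - x) \<bullet> (N *v (y - x)) / 2 + e/2 * (norm (y - x))\<^sup>2"
    using assms e unfolding superjet_def by blast+
  thus "\<forall>\<^sub>F y in nhds x. f y + g y \<le> f x + g x + (b + c) \<bullet> (y - x) +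
      (y - x) \<bullet> ((M + N) *v (y - x)) / 2 + e * (norm (y - x))\<^sup>2"
    by eventually_elim
      (simp add: matrix_vector_mult_add_rdistrib inner_add_left inner_add_right field_simps)
qed

lemma superjet_touch:
  assumes "superjet w x b M" "\<forall>\<^sub>F y in nhds x. u y - w y \<le> u x - w x"
  shows "superjet u x b M"
  unfolding superjet_def
proof (intro conjI allI impI)
  show "transpose M = M" using assms by (simp add: superjet_def)
  fix e :: real assume "e > 0"
  hence "\<forall>\<^sub>F y in nhds x. w y \<le> w x + b \<bullet> (y - x) + (y - x) \<bullet> (M *v (y - x)) / 2 + e * (norm (y - x))\<^sup>2"
    using assms unfolding superjet_def by blast
  with assms(2) show "\<forall>\<^sub>F y in nhds x. u y \<le> u x + b \<bullet> (y - x) + (y - x) \<bullet> (M *v (y - x)) / 2 +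
      e * (norm (y - x))\<^sup>2"
    by eventually_elim simp
qed

lemma subjet_add:
  assumes "subjet f x b M" "subjet g x c N"
  shows "subjet (\<lambda>y. f y + g y) x (b + c) (M + N)"
  using superjet_add[of "\<lambda>y. - f y" x "-b" "-M" "\<lambda>y. - g y" "-c" "-N"] assms
  by (simp add: subjet_def)

lemma subjet_touch:
  assumes "subjet w x b M" "\<forall>\<^sub>F y in nhds x. u y - w y \<ge> u x - w x"
  shows "subjet u x b M"
  unfolding subjet_def
  by (rule superjet_touch[OF assms(1)[unfolded subjet_def]])
     (use assms(2) in eventually_elim, simp)

text \<open>Adding the expansions at x + t h and x - t h cancels the gradients b and c; division by
  t^2 leaves the two quadratic forms and an arbitrarily small error.\<close>

lemma superjet_subjet_le:
  assumes sup: "superjet u x b M" and sub: "subjet u x c N"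
  shows "h \<bullet> (N *v h) \<le> h \<bullet> (M *v h)"
proof (rule field_le_epsilon)
  fix e :: real assume e: "e > 0"
  \<comment> \<open>Keeps the total error 4 k |h|^2 below e; the summand 1 takes care of h =
    0.\<close>
  define k where "k = e * inverse ((norm h)\<^sup>2 + 1) / 4"
  have k: "k > 0" unfolding k_def using e by (intro divide_pos_pos mult_pos_pos add_nonneg_pos) (auto intro: add_nonneg_pos)
  have kh: "4 * k * (norm h)\<^sup>2 \<le> e"
  proof -
    have "4 * k * (norm h)\<^sup>2 = e * (inverse ((norm h)\<^sup>2 + 1) * (norm h)\<^sup>2)" by (simp add: k_def)
    also have "inverse ((norm h)\<^sup>2 + 1) * (norm h)\<^sup>2 \<le> 1"
      by (simp add: inverse_eq_divide divide_le_eq_1 add_nonneg_pos)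
    hence "e * (inverse ((norm h)\<^sup>2 + 1) * (norm h)\<^sup>2) \<le> e * 1"
      using e by (intro mult_left_mono) auto
    finally show ?thesis by simp
  qed
  have "\<forall>\<^sub>F y in nhds x. u y \<le> u x + b \<bullet> (y - x) + (y - x) \<bullet> (M *v (y - x)) / 2 + k * (norm (y - x))\<^sup>2"
    "\<forall>\<^sub>F y in nhds x. u y \<ge> u x + c \<bullet> (y - x) + (y - x) \<bullet> (N *v (y - x)) / 2 - k * (norm (y - x))\<^sup>2"
    using sup sub k unfolding superjet_def subjet_def2 by blast+
  hence "\<forall>\<^sub>F y in nhds x. u y \<le> u x + b \<bullet> (y - x) + (y - x) \<bullet> (M *v (y - x)) / 2 + k * (norm (y - x))\<^sup>2 \<and>
    u y \<ge> u x + c \<bullet> (y - x) + (y - x) \<bullet> (N *v (y - x)) / 2 - k * (norm (y - x))\<^sup>2"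
    by (rule eventually_conj)
  then obtain d where d: "d > 0" and D: "\<And>y. dist y x < d \<Longrightarrow>
    u y \<le> u x + b \<bullet> (y - x) + (y - x) \<bullet> (M *v (y - x)) / 2 + k * (norm (y - x))\<^sup>2 \<and>
    u y \<ge> u x + c \<bullet> (y - x) + (y - x) \<bullet> (N *v (y - x)) / 2 - k * (norm (y - x))\<^sup>2"
    unfolding eventually_nhds_metric by blast
  define n where "n = norm h + 1"
  define t where "t = d / (2 * n)"
  have np: "n > 0" unfolding n_def by (smt (verit) norm_ge_zero)
  have t: "t > 0" using d np by (simp add: t_def)
  have "t * norm h < d"
  proof -
    have "t * norm h \<le> t * n" using t by (simp add: n_def)
    also have "\<dots> = d / 2" using np by (simp add: t_def)
    finally show ?thesis using d by simp
  qed
  hence "dist (x + t *\<^sub>R h) x < d" "dist (x + (- t) *\<^sub>R h) x < d"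
    using t by (simp_all add: dist_norm)
  note conjunct1[OF D[OF this(1)]] conjunct2[OF D[OF this(1)]] conjunct1[OF D[OF this(2)]] conjunct2[OF D[OF this(2)]]
  hence "t\<^sup>2 * (h \<bullet> (N *v h)) - 2 * k * t\<^sup>2 * (norm h)\<^sup>2 \<le> t\<^sup>2 * (h \<bullet> (M *v h)) + 2 * k * t\<^sup>2 * (norm h)\<^sup>2"
    by (simp add: matrix_vector_mult_scaleR matrix_vector_uminus
        power_mult_distrib power2_eq_square algebra_simps)
  hence "t\<^sup>2 * (h \<bullet> (N *v h)) \<le> t\<^sup>2 * (h \<bullet> (M *v h) + 4 * k * (norm h)\<^sup>2)"
    by (simp add: algebra_simps)
  hence "h \<bullet> (N *v h) \<le> h \<bullet> (M *v h) + 4 * k * (norm h)\<^sup>2"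
    using t by simp
  thus "h \<bullet> (N *v h) \<le> h \<bullet> (M *v h) + e" using kh by simp
qed

lemma superjet_scale:
  fixes M :: "real ^ 'n ^ 'n"
  assumes "superjet w x b M" "c > 0"
  shows "superjet (\<lambda>y. c * w y) x (c *\<^sub>R b) (c *\<^sub>R M)"
  unfolding superjet_def
proof (intro conjI allI impI)
  show "transpose (c *\<^sub>R M) = c *\<^sub>R M" using assms by (simp add: superjet_def transpose_scaleR)
  fix e :: real assume "e > 0"
  hence "e / c > 0" using assms by simp
  hence "\<forall>\<^sub>F y in nhds x. w y \<le> w x + b \<bullet> (y - x) + (y - x) \<bullet> (M *v (y - x)) / 2 + e / c * (norm (y - x))\<^sup>2"
    using assms unfolding superjet_def by blast
  thus "\<forall>\<^sub>F y in nhds x. c * w y \<le> c * w x + c *\<^sub>R b \<bullet> (y - x) + (y - x) \<bullet> (c *\<^sub>R M *v (y - x)) / 2 +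
      e * (norm (y - x))\<^sup>2"
  proof eventually_elim
    case (elim y)
    from mult_left_mono[OF this, of c] show ?case
      using assms(2) by (simp add: scaleR_matrix_vector distrib_left)
  qed
qed

text \<open>The bridge from the explicit cubic remainders of the convolution kernels to jets: close
  to x, the cube is absorbed by e times the square.\<close>

lemma third_order_jets:
  assumes sym: "transpose M = M" and r: "r > 0"
    and rem: "\<And>h. norm h \<le> r \<Longrightarrow>
      \<bar>w (x + h) - w x - b \<bullet> h - h \<bullet> (M *v h) / 2\<bar> \<le> K * (norm h) ^ 3"
  shows "superjet w x b M" "subjet w x b M"
proof -
  have "\<forall>\<^sub>F y in nhds x. \<bar>w y - w x - b \<bullet> (y - x) - (y - x) \<bullet> (M *v (y - x)) / 2\<bar> \<le> e * (norm (y - x))\<^sup>2"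
    if e: "e > 0" for e
  proof -
    define d where "d = min r (e / (\<bar>K\<bar> + 1))"
    have d: "d > 0" using e r by (simp add: d_def add_nonneg_pos)
    have "\<bar>w y - w x - b \<bullet> (y - x) - (y - x) \<bullet> (M *v (y - x)) / 2\<bar> \<le> e * (norm (y - x))\<^sup>2"
      if y: "dist y x < d" for y
    proof -
      have n: "norm (y - x) \<le> r" "norm (y - x) \<le> e / (\<bar>K\<bar> + 1)"
        using y by (auto simp: d_def dist_norm)
      have "(\<bar>K\<bar> + 1) * norm (y - x) \<le> e" using n(2) by (simp add: field_simps)
      hence "K * norm (y - x) \<le> e"
        by (smt (verit) mult_right_mono norm_ge_zero)
      hence "K * norm (y - x) * (norm (y - x))\<^sup>2 \<le> e * (norm (y - x))\<^sup>2"
        by (intro mult_right_mono) auto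
      thus ?thesis using rem[OF n(1)] by (simp add: power3_eq_cube power2_eq_square mult.assoc)
    qed
    thus ?thesis using d unfolding eventually_nhds_metric by blast
  qed
  note ev = this
  show "superjet w x b M" unfolding superjet_def
  proof (intro conjI allI impI sym)
    fix e :: real assume "e > 0"
    from ev[OF this] show "\<forall>\<^sub>F y in nhds x. w y \<le> w x + b \<bullet> (y - x) + (y - x) \<bullet> (M *v (y - x)) / 2 +
      e * (norm (y - x))\<^sup>2" by eventually_elim simp
  qed
  show "subjet w x b M" unfolding subjet_def2
  proof (intro conjI allI impI sym)
    fix e :: real assume "e > 0"
    from ev[OF this] show "\<forall>\<^sub>F y in nhds x. w y \<ge> w x + b \<bullet> (y - x) + (y - x) \<bullet> (M *v (y - x)) / 2 -
      e * (norm (y - x))\<^sup>2" by eventually_elim simp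
  qed
qed

lemma quadratic_jets:
  fixes M :: "real ^ 'n ^ 'n"
  assumes sym: "transpose M = M"
  shows "superjet (\<lambda>y. k + b \<bullet> (y - c) + (y - c) \<bullet> (M *v (y - c)) / 2) x (b + M *v (x - c)) M"
    and "subjet (\<lambda>y. k + b \<bullet> (y - c) + (y - c) \<bullet> (M *v (y - c)) / 2) x (b + M *v (x - c)) M"
proof -
  have *: "k + b \<bullet> (x + h - c) + (x + h - c) \<bullet> (M *v (x + h - c)) / 2 -
    (k + b \<bullet> (x - c) + (x - c) \<bullet> (M *v (x - c)) / 2) - (b + M *v (x - c)) \<bullet> h - h \<bullet> (M *v h) / 2 = 0" for h
  proof -
    have e: "x + h - c = (x - c) + h" by simp
    have s: "(x - c) \<bullet> (M *v h) = h \<bullet> (M *v (x - c))" by (rule symmetric_matrix_inner[OF sym])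
    have s': "(M *v (x - c)) \<bullet> h = h \<bullet> (M *v (x - c))" by (rule inner_commute)
    show ?thesis
      unfolding e matrix_vector_right_distrib inner_add_left inner_add_right s s' by (simp add: add_divide_distrib)
  qed
  show "superjet (\<lambda>y. k + b \<bullet> (y - c) + (y - c) \<bullet> (M *v (y - c)) / 2) x (b + M *v (x - c)) M"
    by (rule third_order_jets(1)[OF sym, of 1 _ _ _ 0]) (use * in auto)
  show "subjet (\<lambda>y. k + b \<bullet> (y - c) + (y - c) \<bullet> (M *v (y - c)) / 2) x (b + M *v (x - c)) M"
    by (rule third_order_jets(2)[OF sym, of 1 _ _ _ 0]) (use * in auto)
qed

lemma norm_square_jets:
  "superjet (\<lambda>y. a * (norm (y - c))\<^sup>2) x ((2 * a) *\<^sub>R (x - c)) ((2 * a) *\<^sub>R mat 1)"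
  "subjet (\<lambda>y. a * (norm (y - c))\<^sup>2) x ((2 * a) *\<^sub>R (x - c)) ((2 * a) *\<^sub>R mat 1)"
  using quadratic_jets[of "(2 * a) *\<^sub>R mat 1" 0 0 c x]
  by (simp_all add: transpose_scaleR scaleR_matrix_vector power2_norm_eq_inner)

section \<open>Smoothing by convolution\<close>

lemma compact_support_integral:
  fixes F :: "'a::euclidean_space \<Rightarrow> 'b::euclidean_space"
  assumes "continuous_on UNIV F" "\<And>x. x \<notin> cbox a b \<Longrightarrow> F x = 0"
  shows "integrable lborel F" "(LINT x|lborel. F x) = integral (cbox a b) F"
proof -
  have i: "integrable lborel (\<lambda>x. indicator (cbox a b) x *\<^sub>R F x)"
    by (rule borel_integrable_compact[OF compact_cbox continuous_on_subset[OF assms(1)]]) auto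
  moreover have e: "(\<lambda>x. indicator (cbox a b) x *\<^sub>R F x) = F"
    using assms(2) by (auto simp: indicator_def fun_eq_iff)
  ultimately show I: "integrable lborel F" by simp
  have "(LINT x|lborel. F x) = integral UNIV F" using integral_lborel[OF I] by simp
  also have "\<dots> = integral (cbox a b) F"
    by (subst integral_restrict_UNIV[of "cbox a b" F, symmetric], rule integral_cong) (use assms(2) in auto)
  finally show "(LINT x|lborel. F x) = integral (cbox a b) F" .
qed

text \<open>Negative \<open>c\<close> is the case of interest: the reflection y = t + c z turns a
  kernel evaluated at t - y into a fixed kernel evaluated at z.\<close>

lemma lborel_integral_affine:
  fixes G :: "'a::euclidean_space \<Rightarrow> real"
  assumes c: "c \<noteq> 0" and G: "G \<in> borel_measurable borel"
  shows "(LINT y|lborel. G y) = \<bar>c\<bar> ^ DIM('a) * (LINT z|lborel. G (t + c *\<^sub>R z))"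
proof -
  have "(LINT y|lborel. G y) = (LINT y|density (distr lborel borel (\<lambda>x. t + c *\<^sub>R x)) (\<lambda>_. \<bar>c\<bar> ^ DIM('a)). G y)"
    by (subst lborel_affine[OF c, of t]) simp
  also have "\<dots> = (LINT y|distr lborel borel (\<lambda>x. t + c *\<^sub>R x). \<bar>c\<bar> ^ DIM('a) *\<^sub>R G y)"
    by (rule integral_density) (use G in auto)
  also have "\<dots> = (LINT z|lborel. \<bar>c\<bar> ^ DIM('a) *\<^sub>R G (t + c *\<^sub>R z))"
    by (rule integral_distr) (use G in auto)
  finally show ?thesis by simp
qed

text \<open>The Gaussian factorises over the coordinates, which reduces the claim to one dimension
  by way of the product measure behind \<open>lborel\<close>.\<close>

lemma gaussian_integrable:
  assumes "l > 0"
  shows "integrable lborel (\<lambda>x::'a::euclidean_space. exp (- l * (norm x)\<^sup>2))"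
proof -
  interpret product_sigma_finite "\<lambda>_::'a. lborel :: real measure"
    by standard
  have one: "integrable lborel (\<lambda>x::real. exp (- l * x\<^sup>2))"
  proof -
    have "integrable lborel (\<lambda>x::real. exp (-x\<^sup>2))"
      using has_bochner_integral_even_function[OF gaussian_moment_0]
      by (auto simp: has_bochner_integral_iff)
    from lborel_integrable_real_affine[OF this, of "sqrt l" 0]
    show ?thesis using assms by (simp add: power_mult_distrib)
  qed
  have "integrable (\<Pi>\<^sub>M b\<in>Basis. lborel) (\<lambda>f. \<Prod>b\<in>(Basis::'a set). exp (- l * (f b)\<^sup>2))"
    by (rule product_integrable_prod) (use one in auto)
  moreover have "(\<Prod>b\<in>(Basis::'a set). exp (- l * (f b)\<^sup>2)) =
      exp (- l * (norm (\<Sum>b\<in>Basis. f b *\<^sub>R b))\<^sup>2)" for f :: "'a \<Rightarrow> real"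
  proof -
    have "(norm (\<Sum>b\<in>Basis. f b *\<^sub>R (b::'a)))\<^sup>2 = (\<Sum>b\<in>(Basis::'a set). (f b)\<^sup>2)"
      unfolding power2_norm_eq_inner
      by (subst euclidean_inner) (simp add: power2_eq_square)
    thus ?thesis by (simp add: exp_sum sum_distrib_left)
  qed
  ultimately have "integrable (\<Pi>\<^sub>M b\<in>Basis. lborel) (\<lambda>f. exp (- l * (norm (\<Sum>b\<in>Basis. f b *\<^sub>R (b::'a)))\<^sup>2))"
    by simp
  thus ?thesis
    unfolding lborel_def[where 'a='a]
    by (subst integrable_distr_eq) (auto simp: lborel_eq_real)
qed

section \<open>Kernels built from a quadratic form and the jets of their convolutions\<close>

definition outer :: "real ^ 'n \<Rightarrow> real ^ 'n ^ 'n" where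
  "outer z = (\<chi> i j. z $ i * z $ j)"

lemma outer_vector: "outer z *v h = (z \<bullet> h) *\<^sub>R z"
  by (simp add: outer_def matrix_vector_mult_def vec_eq_iff inner_vec_def sum_distrib_left
      sum_distrib_right mult_ac)

lemma transpose_outer: "transpose (outer z) = outer z"
  by (simp add: outer_def transpose_def vec_eq_iff mult.commute)

lemma continuous_on_outer [continuous_intros]:
  "continuous_on S f \<Longrightarrow> continuous_on S (\<lambda>x. outer (f x))"
  unfolding outer_def by (intro continuous_intros)

lemma continuous_on_matrix_vector [continuous_intros]:
  fixes M :: "real ^ 'n ^ 'm"
  shows "continuous_on S f \<Longrightarrow> continuous_on S (\<lambda>x. M *v f x)"
  by (rule continuous_on_compose2[OF matrix_vector_mult_linear_continuous_on[of UNIV M]]) auto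

text \<open>The condition on \<open>p\<close> is a third-order Taylor estimate with derivatives \<open>p1\<close> and \<open>p2\<close>.\<close>

definition taylor3 :: "(real \<Rightarrow> real) \<Rightarrow> (real \<Rightarrow> real) \<Rightarrow> (real \<Rightarrow> real) \<Rightarrow> bool" where
  "taylor3 p p1 p2 \<longleftrightarrow> continuous_on UNIV p \<and> continuous_on UNIV p1 \<and> continuous_on UNIV p2 \<and>
     (\<forall>S. \<exists>C\<ge>0. \<forall>s a. \<bar>s\<bar> \<le> S \<longrightarrow> \<bar>a\<bar> \<le> S \<longrightarrow>
        \<bar>p (s + a) - p s - p1 s * a - p2 s * a\<^sup>2 / 2\<bar> \<le> C * \<bar>a\<bar> ^ 3)"

text \<open>One format for two kernels: with an exponential \<open>p\<close> it is the heat flow of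
  a constant-coefficient operator, with \<open>B\<close> the identity and \<open>p\<close> a cubed
  positive part it is the mollification.\<close>

definition kernel_conv :: "(real ^ 'n) set \<Rightarrow> (real ^ 'n \<Rightarrow> real) \<Rightarrow> (real \<Rightarrow> real) \<Rightarrow> real ^ 'n ^ 'n \<Rightarrow>
    real ^ 'n \<Rightarrow> real" where
  "kernel_conv Q u p B x = integral Q (\<lambda>y. u y * p ((x - y) \<bullet> (B *v (x - y))))"

text \<open>The Hessian of z \<mapsto> p (z . B z) is 2 p' B + 4 p'' (B z)(B z)^T for symmetric B;
  here it is integrated against u. All derivatives fall on the kernel, so a merely continuous u
  suffices.\<close>

definition kernel_hess :: "(real ^ 'n) set \<Rightarrow> (real ^ 'n \<Rightarrow> real) \<Rightarrow> (real \<Rightarrow> real) \<Rightarrow> (real \<Rightarrow> real) \<Rightarrow>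
    real ^ 'n ^ 'n \<Rightarrow> real ^ 'n \<Rightarrow> real ^ 'n ^ 'n" where
  "kernel_hess Q u p1 p2 B x = integral Q (\<lambda>y. u y *\<^sub>R
     ((2 * p1 ((x - y) \<bullet> (B *v (x - y)))) *\<^sub>R B +
      (4 * p2 ((x - y) \<bullet> (B *v (x - y)))) *\<^sub>R outer (B *v (x - y))))"

text \<open>Serves three functionals: transposition (symmetry of the Hessian), a quadratic form (the
  Taylor estimate) and the operator L (the heat equation).\<close>

lemma kernel_hess_linear:
  fixes B :: "real ^ 'n ^ 'n" and l :: "real ^ 'n ^ 'n \<Rightarrow> 'b::real_normed_vector"
  assumes u: "continuous_on UNIV u" and t: "taylor3 p p1 p2" and l: "bounded_linear l"
  shows "l (kernel_hess (cbox c d) u p1 p2 B x) = integral (cbox c d) (\<lambda>y. u y *\<^sub>R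
     ((2 * p1 ((x - y) \<bullet> (B *v (x - y)))) *\<^sub>R l B +
      (4 * p2 ((x - y) \<bullet> (B *v (x - y)))) *\<^sub>R l (outer (B *v (x - y)))))"
proof -
  have c1: "continuous_on UNIV p1" "continuous_on UNIV p2" using t by (auto simp: taylor3_def)
  have cu: "continuous_on S u" for S using u continuous_on_subset by blast
  have cc: "continuous_on S (\<lambda>y. p1 (f y))" "continuous_on S (\<lambda>y. p2 (f y))"
    if "continuous_on S f" for S and f :: "real ^ 'n \<Rightarrow> real"
    using continuous_on_compose2[OF c1(1) that] continuous_on_compose2[OF c1(2) that] by auto
  have "(\<lambda>y. u y *\<^sub>R
     ((2 * p1 ((x - y) \<bullet> (B *v (x - y)))) *\<^sub>R B +
      (4 * p2 ((x - y) \<bullet> (B *v (x - y)))) *\<^sub>R outer (B *v (x - y)))) integrable_on cbox c d"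
    by (intro integrable_continuous continuous_intros cu cc)
  from integral_linear[OF this l] show ?thesis
    unfolding kernel_hess_def o_def
    by (simp add: linear_cmul[OF bounded_linear.linear[OF l]] linear_add[OF bounded_linear.linear[OF l]])
qed

lemma bounded_linear_quadratic: "bounded_linear (\<lambda>M :: real ^ 'n ^ 'n. h \<bullet> (M *v k))"
  by (intro linear_linear[THEN iffD2] linearI)
    (simp_all add: matrix_vector_mult_add_rdistrib inner_add_right scaleR_matrix_vector)

text \<open>The integrand has a third-order Taylor remainder that is uniform in y over the box, so
  integration gives a cubic remainder for the convolution.\<close>

lemma kernel_conv_jets:
  fixes B :: "real ^ 'n ^ 'n"
  assumes u: "continuous_on UNIV u" and t: "taylor3 p p1 p2" and sym: "transpose B = B"
  shows "\<exists>b. superjet (kernel_conv (cbox c d) u p B) x b (kernel_hess (cbox c d) u p1 p2 B x) \<and>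
    subjet (kernel_conv (cbox c d) u p B) x b (kernel_hess (cbox c d) u p1 p2 B x)"
proof -
  let ?Q = "cbox c d"
  let ?M = "kernel_hess ?Q u p1 p2 B x"
  define q where "q = (\<lambda>y. (x - y) \<bullet> (B *v (x - y)))"
  define b where "b = integral ?Q (\<lambda>y. u y *\<^sub>R (2 * p1 (q y)) *\<^sub>R (B *v (x - y)))"
  have c0: "continuous_on UNIV p" "continuous_on UNIV p1" "continuous_on UNIV p2" using t by (auto simp: taylor3_def)
  have cu: "continuous_on S u" for S using u continuous_on_subset by blast
  have cc: "continuous_on S (\<lambda>y. p (f y))" "continuous_on S (\<lambda>y. p1 (f y))" "continuous_on S (\<lambda>y. p2 (f y))"
    if "continuous_on S f" for S and f :: "real ^ 'n \<Rightarrow> real"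
    using continuous_on_compose2[OF c0(1) that] continuous_on_compose2[OF c0(2) that]
      continuous_on_compose2[OF c0(3) that] by auto
  have cq: "continuous_on S q" for S unfolding q_def by (intro continuous_intros)
  obtain U where U: "\<And>y. y \<in> ?Q \<Longrightarrow> \<bar>u y\<bar> \<le> U" "U \<ge> 0"
  proof -
    have "bounded (u ` ?Q)" using compact_continuous_image[OF cu compact_cbox] compact_imp_bounded by blast
    then obtain a where "\<forall>y\<in>?Q. \<bar>u y\<bar> \<le> a" by (auto simp: bounded_real)
    thus thesis using that[of "max a 0"] by fastforce
  qed
  obtain P where P: "\<And>y. y \<in> ?Q \<Longrightarrow> \<bar>p2 (q y)\<bar> \<le> P" "P \<ge> 0"
  proof -
    have "bounded ((\<lambda>y. p2 (q y)) ` ?Q)"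
      using compact_continuous_image[OF cc(3)[OF cq] compact_cbox] compact_imp_bounded by blast
    then obtain a where "\<forall>y\<in>?Q. \<bar>p2 (q y)\<bar> \<le> a" by (auto simp: bounded_real)
    thus thesis using that[of "max a 0"] by fastforce
  qed
  obtain \<beta> where \<beta>: "\<beta> > 0" "\<And>z. norm (B *v z) \<le> norm z * \<beta>"
    using bounded_linear.pos_bounded[OF matrix_vector_mul_bounded_linear[of B]] by blast
  obtain Z where Z: "\<And>y. y \<in> ?Q \<Longrightarrow> norm (x - y) \<le> Z" "Z \<ge> 0"
  proof -
    have "compact ((\<lambda>y. x - y) ` ?Q)"
      by (rule compact_continuous_image) (auto intro!: continuous_intros)
    hence "bounded ((\<lambda>y. x - y) ` ?Q)" using compact_imp_bounded by blast
    then obtain a where "\<forall>y\<in>?Q. norm (x - y) \<le> a" unfolding bounded_iff by blast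
    thus thesis using that[of "max a 0"] by fastforce
  qed
  \<comment> \<open>With |h| \<le> 1 the increment a of the quadratic form satisfies |a| \<le> A
    |h|. \<open>S\<close> bounds both the form and its increment, so that a single constant C of
    \<open>taylor3\<close> covers all y.\<close>
  define A where "A = 2 * (Z * \<beta>) + \<beta>"
  define S where "S = max (Z * (Z * \<beta>)) A"
  have A0: "A \<ge> 0" using \<beta>(1) Z(2) by (simp add: A_def)
  obtain C where C: "C \<ge> 0" "\<And>s a. \<bar>s\<bar> \<le> S \<Longrightarrow> \<bar>a\<bar> \<le> S \<Longrightarrow>
        \<bar>p (s + a) - p s - p1 s * a - p2 s * a\<^sup>2 / 2\<bar> \<le> C * \<bar>a\<bar> ^ 3"
    using t unfolding taylor3_def by blast
  \<comment> \<open>Two errors add up: the Taylor remainder of p, of size C (A |h|)^3, and the part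
    2 m g + g^2 / 2 of a^2 / 2 (with a = 2 m + g) that has order three or higher in h and so does
    not belong to the Hessian.\<close>
  define K where "K = U * (C * A ^ 3 + P * (2 * (Z * \<beta>) * \<beta> + \<beta>\<^sup>2))"
  have K0: "K \<ge> 0" unfolding K_def using U(2) C(1) A0 P(2) Z(2) \<beta>(1) by simp
  have point: "\<bar>u y * p ((x + h - y) \<bullet> (B *v (x + h - y))) - u y * p (q y)
        - h \<bullet> (u y *\<^sub>R (2 * p1 (q y)) *\<^sub>R (B *v (x - y)))
        - u y *\<^sub>R ((2 * p1 (q y)) *\<^sub>R (h \<bullet> (B *v h)) + (4 * p2 (q y)) *\<^sub>R (h \<bullet> (outer (B *v (x - y)) *v h))) / 2\<bar>
      \<le> K * norm h ^ 3" if y: "y \<in> ?Q" and h: "norm h \<le> 1" for y h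
  proof -
    define m where "m = h \<bullet> (B *v (x - y))"
    define g where "g = h \<bullet> (B *v h)"
    have m: "\<bar>m\<bar> \<le> norm h * (Z * \<beta>)"
    proof -
      have "\<bar>m\<bar> \<le> norm h * norm (B *v (x - y))" unfolding m_def by (rule Cauchy_Schwarz_ineq2)
      also have "\<dots> \<le> norm h * (norm (x - y) * \<beta>)" by (intro mult_left_mono \<beta>) auto
      also have "\<dots> \<le> norm h * (Z * \<beta>)" by (intro mult_left_mono mult_right_mono Z y) (use \<beta>(1) in auto)
      finally show ?thesis .
    qed
    have g: "\<bar>g\<bar> \<le> norm h * norm h * \<beta>"
    proof -
      have "\<bar>g\<bar> \<le> norm h * norm (B *v h)" unfolding g_def by (rule Cauchy_Schwarz_ineq2)
      also have "\<dots> \<le> norm h * (norm h * \<beta>)" by (intro mult_left_mono \<beta>) auto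
      finally show ?thesis by simp
    qed
    have g': "\<bar>g\<bar> \<le> norm h * \<beta>"
    proof -
      have "norm h * norm h * \<beta> \<le> norm h * 1 * \<beta>"
        using h \<beta>(1) by (intro mult_right_mono mult_left_mono) auto
      thus ?thesis using g by simp
    qed
    define a where "a = 2 * m + g"
    have a: "\<bar>a\<bar> \<le> norm h * A" using m g' unfolding a_def A_def by (simp add: algebra_simps)
    have aS: "\<bar>a\<bar> \<le> S"
      using a mult_right_mono[OF h A0] by (simp add: S_def)
    have qS: "\<bar>q y\<bar> \<le> S"
    proof -
      have "\<bar>q y\<bar> \<le> norm (x - y) * norm (B *v (x - y))" unfolding q_def by (rule Cauchy_Schwarz_ineq2)
      also have "\<dots> \<le> Z * (Z * \<beta>)"
        using Z(1)[OF y] \<beta>(2)[of "x - y"] \<beta>(1) Z(2)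
        by (intro mult_mono) (auto intro: order_trans mult_right_mono)
      finally show ?thesis by (simp add: S_def)
    qed
    have e: "x + h - y = (x - y) + h" by simp
    have qa: "(x + h - y) \<bullet> (B *v (x + h - y)) = q y + a"
      unfolding e matrix_vector_right_distrib inner_add_left inner_add_right q_def a_def m_def g_def
      using symmetric_matrix_inner[OF sym, of "x - y" h] by simp
    have "\<bar>a\<bar> ^ 3 \<le> (norm h * A) ^ 3" using a by (intro power_mono) auto
    hence r1: "\<bar>p (q y + a) - p (q y) - p1 (q y) * a - p2 (q y) * a\<^sup>2 / 2\<bar> \<le> C * A ^ 3 * norm h ^ 3"
      using C(2)[OF qS aS] mult_left_mono[OF _ C(1), of "\<bar>a\<bar> ^ 3" "(norm h * A) ^ 3"]
      by (simp add: power_mult_distrib mult_ac)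
    have r2: "\<bar>2 * m * g + g\<^sup>2 / 2\<bar> \<le> (2 * (Z * \<beta>) * \<beta> + \<beta>\<^sup>2) * norm h ^ 3"
    proof -
      have "\<bar>m * g\<bar> \<le> (norm h * (Z * \<beta>)) * (norm h * norm h * \<beta>)"
        unfolding abs_mult using m g by (intro mult_mono) (use Z \<beta> in auto)
      moreover have "\<bar>g * g\<bar> \<le> (norm h * \<beta>) * (norm h * norm h * \<beta>)"
        unfolding abs_mult using g' g by (intro mult_mono) (use \<beta> in auto)
      moreover have "\<bar>2 * m * g + g\<^sup>2 / 2\<bar> \<le> 2 * \<bar>m * g\<bar> + \<bar>g * g\<bar>"
      proof -
        have "\<bar>2 * m * g\<bar> = 2 * \<bar>m * g\<bar>" by (simp add: abs_mult)
        moreover have "\<bar>g\<^sup>2 / 2\<bar> \<le> \<bar>g * g\<bar>" by (simp add: power2_eq_square)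
        ultimately show ?thesis using abs_triangle_ineq[of "2 * m * g" "g\<^sup>2 / 2"] by linarith
      qed
      ultimately have "\<bar>2 * m * g + g\<^sup>2 / 2\<bar> \<le>
        2 * ((norm h * (Z * \<beta>)) * (norm h * norm h * \<beta>)) + (norm h * \<beta>) * (norm h * norm h * \<beta>)"
        by linarith
      also have "\<dots> = (2 * (Z * \<beta>) * \<beta> + \<beta>\<^sup>2) * norm h ^ 3"
        by (simp only: power2_eq_square power3_eq_cube ring_distribs mult_ac)
      finally show ?thesis .
    qed
    have ho: "h \<bullet> (outer (B *v (x - y)) *v h) = m\<^sup>2"
      by (simp add: outer_vector m_def power2_eq_square inner_commute)
    have "u y * p (q y + a) - u y * p (q y)
        - h \<bullet> (u y *\<^sub>R (2 * p1 (q y)) *\<^sub>R (B *v (x - y)))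
        - u y *\<^sub>R ((2 * p1 (q y)) *\<^sub>R g + (4 * p2 (q y)) *\<^sub>R m\<^sup>2) / 2
      = u y * ((p (q y + a) - p (q y) - p1 (q y) * a - p2 (q y) * a\<^sup>2 / 2) + p2 (q y) * (2 * m * g + g\<^sup>2 / 2))"
      by (simp only: m_def[symmetric] a_def power2_eq_square inner_scaleR_right real_scaleR_def)
        (simp add: algebra_simps add_divide_distrib)
    moreover have "\<bar>\<dots>\<bar> \<le> U * (C * A ^ 3 * norm h ^ 3 + P * ((2 * (Z * \<beta>) * \<beta> + \<beta>\<^sup>2) * norm h ^ 3))"
      unfolding abs_mult
    proof (intro mult_mono U(1)[OF y] U(2) order_trans[OF abs_triangle_ineq] add_mono r1)
      show "\<bar>p2 (q y) * (2 * m * g + g\<^sup>2 / 2)\<bar> \<le> P * ((2 * (Z * \<beta>) * \<beta> + \<beta>\<^sup>2) * norm h ^ 3)"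
        unfolding abs_mult by (intro mult_mono P(1)[OF y] P(2) r2) auto
    qed auto
    ultimately show ?thesis
      unfolding qa ho g_def[symmetric] K_def by (simp add: algebra_simps)
  qed
  have symM: "transpose ?M = ?M"
  proof -
    have "bounded_linear (transpose :: real ^ 'n ^ 'n \<Rightarrow> _)"
      by (intro linear_linear[THEN iffD2] linearI) (simp_all add: transpose_add transpose_scaleR)
    from kernel_hess_linear[OF u t this] show ?thesis
      unfolding kernel_hess_def by (simp add: sym transpose_outer)
  qed
  have "\<bar>kernel_conv ?Q u p B (x + h) - kernel_conv ?Q u p B x - b \<bullet> h - h \<bullet> (?M *v h) / 2\<bar>
      \<le> (K * measure lborel ?Q) * norm h ^ 3" if h: "norm h \<le> 1" for h
  proof -
    let ?F = "\<lambda>y. u y * p ((x + h - y) \<bullet> (B *v (x + h - y)))"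
    let ?G = "\<lambda>y. u y * p (q y)"
    let ?b = "\<lambda>y. h \<bullet> (u y *\<^sub>R (2 * p1 (q y)) *\<^sub>R (B *v (x - y)))"
    let ?m = "\<lambda>y. u y *\<^sub>R ((2 * p1 (q y)) *\<^sub>R (h \<bullet> (B *v h)) + (4 * p2 (q y)) *\<^sub>R (h \<bullet> (outer (B *v (x - y)) *v h)))"
    have iF: "?F integrable_on ?Q" and iG: "?G integrable_on ?Q"
      and ib: "(\<lambda>y. u y *\<^sub>R (2 * p1 (q y)) *\<^sub>R (B *v (x - y))) integrable_on ?Q"
      and ib': "?b integrable_on ?Q"
      by (intro integrable_continuous continuous_intros cu cc cq)+
    have im: "?m integrable_on ?Q"
      unfolding outer_vector
      by (intro integrable_continuous continuous_intros cu cc cq)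
    have "b \<bullet> h = integral ?Q ?b"
      using integral_linear[OF ib bounded_linear_inner_right[of h]]
      by (simp add: b_def o_def inner_commute)
    moreover have "h \<bullet> (?M *v h) = integral ?Q ?m"
      using kernel_hess_linear[OF u t bounded_linear_quadratic[of h h]] by (simp add: q_def)
    moreover have "kernel_conv ?Q u p B (x + h) = integral ?Q ?F" "kernel_conv ?Q u p B x = integral ?Q ?G"
      by (simp_all add: kernel_conv_def q_def)
    ultimately have "kernel_conv ?Q u p B (x + h) - kernel_conv ?Q u p B x - b \<bullet> h - h \<bullet> (?M *v h) / 2 =
        integral ?Q ?F - integral ?Q ?G - integral ?Q ?b - integral ?Q (\<lambda>y. ?m y / 2)"
      by simp
    also have "\<dots> = integral ?Q (\<lambda>y. ?F y - ?G y - ?b y - ?m y / 2)"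
      using iF iG ib' im by (simp add: integral_diff integrable_diff integrable_on_divide)
    finally have eq: "kernel_conv ?Q u p B (x + h) - kernel_conv ?Q u p B x - b \<bullet> h - h \<bullet> (?M *v h) / 2 =
      integral ?Q (\<lambda>y. ?F y - ?G y - ?b y - ?m y / 2)" .
    have int: "(\<lambda>y. ?F y - ?G y - ?b y - ?m y / 2) integrable_on ?Q"
      by (intro integrable_diff iF iG ib' integrable_on_divide im)
    have "norm (integral ?Q (\<lambda>y. ?F y - ?G y - ?b y - ?m y / 2)) \<le> integral ?Q (\<lambda>y. K * norm h ^ 3)"
      by (rule integral_norm_bound_integral[OF int]) (use point[OF _ h] in \<open>auto simp: real_norm_def\<close>)
    also have "\<dots> = (K * measure lborel ?Q) * norm h ^ 3"
      by simp
    finally show ?thesis unfolding eq by simp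
  qed
  from third_order_jets[OF symM zero_less_one this] show ?thesis by blast
qed

lemma kernel_hess_continuous:
  fixes B :: "real ^ 'n ^ 'n"
  assumes u: "continuous_on UNIV u" and t: "taylor3 p p1 p2"
  shows "continuous_on UNIV (kernel_hess (cbox c d) u p1 p2 B)"
proof -
  have c0: "continuous_on UNIV p1" "continuous_on UNIV p2" using t by (auto simp: taylor3_def)
  have cu: "continuous_on S (\<lambda>y. u (g y))" if "continuous_on S g" for S and g :: "(real ^ 'n) \<times> (real ^ 'n) \<Rightarrow> _"
    using continuous_on_compose2[OF u that] by auto
  have cc: "continuous_on S (\<lambda>y. p1 (f y))" "continuous_on S (\<lambda>y. p2 (f y))"
    if "continuous_on S f" for S and f :: "(real ^ 'n) \<times> (real ^ 'n) \<Rightarrow> real"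
    using continuous_on_compose2[OF c0(1) that(1)] continuous_on_compose2[OF c0(2) that(1)] by auto
  show ?thesis
    unfolding kernel_hess_def
    by (rule integral_continuous_on_param) (unfold case_prod_beta, intro continuous_intros cu cc)
qed

lemma kernel_conv_continuous:
  fixes B :: "real ^ 'n ^ 'n"
  assumes u: "continuous_on UNIV u" and t: "continuous_on UNIV p"
  shows "continuous_on UNIV (kernel_conv (cbox c d) u p B)"
proof -
  have cu: "continuous_on S (\<lambda>y. u (g y))" if "continuous_on S g" for S and g :: "(real ^ 'n) \<times> (real ^ 'n) \<Rightarrow> _"
    using continuous_on_compose2[OF u that] by auto
  have cc: "continuous_on S (\<lambda>y. p (f y))"
    if "continuous_on S f" for S and f :: "(real ^ 'n) \<times> (real ^ 'n) \<Rightarrow> real"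
    using continuous_on_compose2[OF t that(1)] by auto
  show ?thesis
    unfolding kernel_conv_def
    by (rule integral_continuous_on_param) (unfold case_prod_beta, intro continuous_intros cu cc)
qed

lemma taylor3_exp:
  assumes k: "k > 0"
  shows "taylor3 (\<lambda>s. exp (- s / k)) (\<lambda>s. - exp (- s / k) / k) (\<lambda>s. exp (- s / k) / k\<^sup>2)"
  unfolding taylor3_def
proof (intro conjI allI)
  fix S :: real
  have "\<bar>exp (- (s + a) / k) - exp (- s / k) - - exp (- s / k) / k * a - exp (- s / k) / k\<^sup>2 * a\<^sup>2 / 2\<bar>
      \<le> exp (2 * S / k) / k ^ 3 * \<bar>a\<bar> ^ 3" if s: "\<bar>s\<bar> \<le> S" and a: "\<bar>a\<bar> \<le> S" for s a
  proof -
    define x where "x = - a / k"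
    obtain t where t: "\<bar>t\<bar> \<le> \<bar>x\<bar>" "exp x = (\<Sum>m<3. x ^ m / fact m) + exp t / fact 3 * x ^ 3"
      using Maclaurin_exp_le[of x 3] by blast
    have ex: "exp x - 1 - x - x\<^sup>2 / 2 = exp t / 6 * x ^ 3"
      using t(2) by (simp add: eval_nat_numeral field_simps)
    have "exp (- (s + a) / k) = exp (- s / k) * exp x"
      by (simp add: x_def exp_add[symmetric] diff_divide_distrib add_divide_distrib)
    hence "exp (- (s + a) / k) - exp (- s / k) - - exp (- s / k) / k * a - exp (- s / k) / k\<^sup>2 * a\<^sup>2 / 2
      = exp (- s / k) * (exp x - 1 - x - x\<^sup>2 / 2)"
      by (simp add: x_def algebra_simps power_divide)
    also have "\<bar>\<dots>\<bar> = exp (- s / k + t) / 6 * \<bar>x\<bar> ^ 3"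
      unfolding ex exp_add by (simp add: abs_mult power_abs)
    also have "\<dots> \<le> exp (2 * S / k) * \<bar>x\<bar> ^ 3"
    proof (rule mult_right_mono)
      have "\<bar>x\<bar> \<le> S / k" using a k by (simp add: x_def abs_mult divide_right_mono)
      moreover have "- s / k \<le> S / k" using s k by (intro divide_right_mono) auto
      ultimately have "- s / k + t \<le> 2 * S / k" using t(1) by linarith
      thus "exp (- s / k + t) / 6 \<le> exp (2 * S / k)"
        using order_trans[of "exp (- s / k + t) / 6" "exp (- s / k + t)" "exp (2 * S / k)"] by simp
    qed simp
    also have "\<dots> = exp (2 * S / k) / k ^ 3 * \<bar>a\<bar> ^ 3"
      using k by (simp add: x_def power_divide)
    finally show ?thesis .
  qed
  thus "\<exists>C\<ge>0. \<forall>s a. \<bar>s\<bar> \<le> S \<longrightarrow> \<bar>a\<bar> \<le> S \<longrightarrow>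
    \<bar>exp (- (s + a) / k) - exp (- s / k) - - exp (- s / k) / k * a - exp (- s / k) / k\<^sup>2 * a\<^sup>2 / 2\<bar>
      \<le> C * \<bar>a\<bar> ^ 3"
    using k by (intro exI[of _ "exp (2 * S / k) / k ^ 3"]) auto
qed (use k in \<open>auto intro!: continuous_intros\<close>)

text \<open>The cube is the lowest integer power of the positive part with a Lipschitz second
  derivative. Where t and t - a are both nonnegative the remainder is exactly -a^3; the remaining
  cases are bounded by the same cube, so k is the constant for every S.\<close>

lemma taylor3_bump:
  assumes "k > (0::real)"
  shows "taylor3 (\<lambda>s. k * max 0 (\<rho> - s) ^ 3) (\<lambda>s. - 3 * k * max 0 (\<rho> - s) ^ 2) (\<lambda>s. 6 * k * max 0 (\<rho> - s))"
  unfolding taylor3_def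
proof (intro conjI allI)
  fix S :: real
  have "\<bar>k * max 0 (\<rho> - (s + a)) ^ 3 - k * max 0 (\<rho> - s) ^ 3 - - 3 * k * max 0 (\<rho> - s) ^ 2 * a -
      6 * k * max 0 (\<rho> - s) * a\<^sup>2 / 2\<bar> \<le> k * \<bar>a\<bar> ^ 3" for s a
  proof -
    define t where "t = \<rho> - s"
    have eq: "k * max 0 (\<rho> - (s + a)) ^ 3 - k * max 0 (\<rho> - s) ^ 3 - - 3 * k * max 0 (\<rho> - s) ^ 2 * a -
      6 * k * max 0 (\<rho> - s) * a\<^sup>2 / 2 =
      k * (max 0 (t - a) ^ 3 - max 0 t ^ 3 + 3 * max 0 t ^ 2 * a - 3 * max 0 t * a\<^sup>2)"
      by (simp add: t_def algebra_simps)
    have "\<bar>max 0 (t - a) ^ 3 - max 0 t ^ 3 + 3 * max 0 t ^ 2 * a - 3 * max 0 t * a\<^sup>2\<bar> \<le> \<bar>a\<bar> ^ 3"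
    proof (cases "t \<ge> 0")
      case True
      show ?thesis
      proof (cases "t - a \<ge> 0")
        case False
        have "max 0 (t - a) ^ 3 - max 0 t ^ 3 + 3 * max 0 t ^ 2 * a - 3 * max 0 t * a\<^sup>2 = (a - t) ^ 3 - a ^ 3"
          using True False by (simp add: power2_eq_square power3_eq_cube algebra_simps)
        moreover have "(a - t) ^ 3 \<le> a ^ 3" "0 \<le> (a - t) ^ 3" "0 \<le> a ^ 3"
          using True False by (auto intro!: power_mono)
        ultimately show ?thesis using True False by (simp add: power_abs)
      next
        case nn: True
        have "max 0 (t - a) ^ 3 - max 0 t ^ 3 + 3 * max 0 t ^ 2 * a - 3 * max 0 t * a\<^sup>2 = - (a ^ 3)"
          using True nn by (simp add: power2_eq_square power3_eq_cube algebra_simps)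
        thus ?thesis by (simp add: power_abs)
      qed
    next
      case False
      show ?thesis
      proof (cases "t - a \<ge> 0")
        case True
        have "(t - a) ^ 3 \<le> (- a) ^ 3" using True False by (intro power_mono) auto
        moreover have "(t - a) ^ 3 \<ge> 0" using True by simp
        ultimately show ?thesis using True False by (simp add: abs_if)
      qed (use False in simp)
    qed
    thus ?thesis unfolding eq abs_mult using assms by simp
  qed
  thus "\<exists>C\<ge>0. \<forall>s a. \<bar>s\<bar> \<le> S \<longrightarrow> \<bar>a\<bar> \<le> S \<longrightarrow>
    \<bar>k * max 0 (\<rho> - (s + a)) ^ 3 - k * max 0 (\<rho> - s) ^ 3 - - 3 * k * max 0 (\<rho> - s) ^ 2 * a -
      6 * k * max 0 (\<rho> - s) * a\<^sup>2 / 2\<bar> \<le> C * \<bar>a\<bar> ^ 3"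
    using assms by (intro exI[of _ k]) auto
qed (auto intro!: continuous_intros)

lemma symmetric_matrixI:
  fixes M :: "real ^ 'n ^ 'n"
  assumes "\<And>x y. x \<bullet> (M *v y) = y \<bullet> (M *v x)"
  shows "transpose M = M"
proof -
  have "M $ i $ j = axis i 1 \<bullet> (M *v axis j 1)" for i j
    by (simp add: matrix_vector_mult_basis column_def inner_axis' )
  thus ?thesis using assms by (simp add: vec_eq_iff transpose_def)
qed

lemma lborel_integral_pos:
  fixes f :: "'a::euclidean_space \<Rightarrow> real"
  assumes f: "continuous_on UNIV f" "\<And>x. f x \<ge> 0" "integrable lborel f" "f c > 0"
  shows "(LINT x|lborel. f x) > 0"
proof -
  have "isCont f c" using f(1) by (simp add: continuous_on_eq_continuous_at)
  moreover have "f c / 2 > 0" using f(4) by simp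
  ultimately obtain d where d: "d > 0" "\<And>x. dist x c < d \<Longrightarrow> dist (f x) (f c) < f c / 2"
    unfolding continuous_at_eps_delta by blast
  have lower: "f c / 2 * indicator (ball c d) x \<le> f x" for x
  proof (cases "x \<in> ball c d")
    case True
    hence "dist (f x) (f c) < f c / 2" using d(2)[of x] by (simp add: dist_commute[of x c])
    thus ?thesis using True by (auto simp: dist_real_def abs_if split: if_splits)
  qed (use f(2) in simp)
  have "f c / 2 * measure lborel (ball c d) = (LINT x|lborel. f c / 2 * indicator (ball c d) x)"
    by simp
  also have "\<dots> \<le> (LINT x|lborel. f x)"
  proof (rule integral_mono)
    show "integrable lborel (\<lambda>x. f c / 2 * indicator (ball c d) x)"
      using emeasure_lborel_ball_finite[of c d]
      by (intro integrable_mult_right integrable_real_indicator) (simp_all add: infinity_ennreal_def)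
  qed (use lower f(3) in auto)
  finally show ?thesis using content_ball_pos[OF d(1), of c] f(4)
    by (smt (verit) half_gt_zero mult_pos_pos)
qed

text \<open>Lower bounds on \<open>L M\<close> over the superjets of \<open>u\<close> survive convolution. By the maximum
  principle such a bound makes \<open>u\<close> grow at a definite rate under the heat flow of \<open>L\<close>; this growth
  is inherited by \<open>u * \<eta>\<close> because the heat flow commutes with convolution; and the same maximum
  principle, applied to the \<open>C\<^sup>2\<close> function \<open>- u * \<eta>\<close>, turns it back into a bound on the Hessian.\<close>

locale heat_operator =
  fixes v :: "'n::finite \<Rightarrow> real ^ 'n" and \<alpha> :: "'n \<Rightarrow> real"
  assumes v: "v \<in> orthonormal_bases" and \<alpha>: "\<And>j. \<alpha> j > 0"
begin

definition L :: "real ^ 'n ^ 'n \<Rightarrow> real" where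
  "L M = (\<Sum>j\<in>UNIV. \<alpha> j * (v j \<bullet> (M *v v j)))"

text \<open>The inverse of the coefficient matrix of L, which is the sum of \<alpha> j times the
  projection onto \<open>v j\<close>. With it exp (- q z / (4 t)) is, up to the factor t^(-n/2), the
  heat kernel of L.\<close>

definition B :: "real ^ 'n ^ 'n" where
  "B = matrix (\<lambda>z. \<Sum>j\<in>UNIV. ((z \<bullet> v j) / \<alpha> j) *\<^sub>R v j)"

definition q :: "real ^ 'n \<Rightarrow> real" where
  "q z = z \<bullet> (B *v z)"

definition gauss :: "real ^ 'n \<Rightarrow> real" where
  "gauss z = exp (- q z / 4)"

definition mass :: real where
  "mass = (LINT z|lborel. gauss z)"

text \<open>The heat flow after the substitution y = x - sqrt t z. The weight no longer depends on t
  or x, which makes the limit t \<rightarrow> 0 and the commutation with translations visible; the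
  smoothing form is regained in \<open>heat_kernel\<close>.\<close>

definition heat :: "(real ^ 'n \<Rightarrow> real) \<Rightarrow> real \<Rightarrow> real ^ 'n \<Rightarrow> real" where
  "heat u t x = (LINT z|lborel. gauss z * u (x - sqrt t *\<^sub>R z)) / mass"

lemma vv: "v a \<bullet> v b = (if a = b then 1 else 0)"
  using v by (auto simp: orthonormal_bases_def)

lemma B_vector: "B *v z = (\<Sum>j\<in>UNIV. ((z \<bullet> v j) / \<alpha> j) *\<^sub>R v j)"
proof -
  have "linear (\<lambda>z. \<Sum>j\<in>UNIV. ((z \<bullet> v j) / \<alpha> j) *\<^sub>R v j)"
    by (rule linearI)
      (simp_all add: inner_add_left add_divide_distrib scaleR_add_left sum.distrib scaleR_sum_right)
  from matrix_works[OF this[unfolded linear_matrix_vector_mul_eq[symmetric]]] show ?thesis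
    unfolding B_def by simp
qed

lemma v_B: "v j \<bullet> (B *v z) = (z \<bullet> v j) / \<alpha> j"
  by (simp add: B_vector inner_sum_right vv if_distrib cong: if_cong)

lemma symB: "transpose B = B"
  by (rule symmetric_matrixI) (simp add: B_vector inner_sum_right mult.commute)

lemma q_eq: "q z = (\<Sum>j\<in>UNIV. (z \<bullet> v j)\<^sup>2 / \<alpha> j)"
  by (simp add: q_def B_vector inner_sum_right power2_eq_square)

lemma q_scale: "q (c *\<^sub>R z) = c\<^sup>2 * q z"
  by (simp add: q_eq power_mult_distrib sum_distrib_left)

lemma q_cont [continuous_intros]: "continuous_on S f \<Longrightarrow> continuous_on S (\<lambda>x. q (f x))"
  unfolding q_def by (intro continuous_intros)

lemma sum_\<alpha>_pos: "(\<Sum>j\<in>UNIV. \<alpha> j) > 0"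
  by (rule sum_pos) (use \<alpha> in auto)

text \<open>Each 1 / \<alpha> j is at least the inverse of the sum, and Parseval does the rest. This
  dominates \<open>gauss\<close> by an isotropic Gaussian.\<close>

lemma q_lower: "q z \<ge> inverse (\<Sum>j\<in>UNIV. \<alpha> j) * (norm z)\<^sup>2"
proof -
  have "inverse (\<Sum>j\<in>UNIV. \<alpha> j) * (norm z)\<^sup>2 = (\<Sum>j\<in>UNIV. (z \<bullet> v j)\<^sup>2 / (\<Sum>j\<in>UNIV. \<alpha> j))"
    by (simp add: sum_inner_orthonormal(1)[OF v, of z, symmetric] sum_divide_distrib[symmetric]
        divide_inverse mult.commute sum_distrib_left)
  also have "\<dots> \<le> (\<Sum>j\<in>UNIV. (z \<bullet> v j)\<^sup>2 / \<alpha> j)"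
    by (intro sum_mono divide_left_mono member_le_sum mult_pos_pos sum_\<alpha>_pos \<alpha>)
      (use \<alpha> in \<open>auto intro: less_imp_le\<close>)
  finally show ?thesis by (simp add: q_eq)
qed

lemma L_linear: "bounded_linear L"
  unfolding L_def
  by (intro linear_linear[THEN iffD2] linearI)
    (simp_all add: matrix_vector_mult_add_rdistrib inner_add_right scaleR_matrix_vector
      distrib_left sum.distrib sum_distrib_left mult_ac)

lemma L_add: "L (M + N) = L M + L N"
  by (rule linear_add[OF bounded_linear.linear[OF L_linear]])

lemma L_scale: "L (c *\<^sub>R M) = c * L M"
  using linear_cmul[OF bounded_linear.linear[OF L_linear], of c M] by simp

lemma L_uminus: "L (- M) = - L M"
  by (rule linear_neg[OF bounded_linear.linear[OF L_linear]])

lemma L_mono: "(\<And>h. h \<bullet> (M *v h) \<le> h \<bullet> (N *v h)) \<Longrightarrow> L M \<le> L N"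
  unfolding L_def by (intro sum_mono mult_left_mono) (use \<alpha> in \<open>auto intro: less_imp_le\<close>)

text \<open>Together with \<open>L_outer\<close> this evaluates L on the kernel Hessian: the
  dimension from B and q from the rank-one part are exactly the two terms of the time derivative of
  the kernel.\<close>

lemma L_B: "L B = real CARD('n)"
proof -
  have "\<alpha> j * (v j \<bullet> (B *v v j)) = 1" for j using \<alpha>[of j] by (simp add: v_B vv)
  thus ?thesis by (simp add: L_def)
qed

lemma L_outer: "L (outer (B *v z)) = q z"
proof -
  have "\<alpha> j * (v j \<bullet> (outer (B *v z) *v v j)) = (z \<bullet> v j)\<^sup>2 / \<alpha> j" for j
    using \<alpha>[of j] by (simp add: outer_vector inner_commute[of "B *v z"] v_B power2_eq_square)
  thus ?thesis by (simp add: L_def q_eq)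
qed

lemma L_mat: "L (mat 1) = (\<Sum>j\<in>UNIV. \<alpha> j)"
  by (simp add: L_def vv)

section \<open>The heat flow of L: smoothing, heat equation, initial values\<close>

lemma gauss_pos: "gauss z > 0" by (simp add: gauss_def)

lemma gauss_cont [continuous_intros]: "continuous_on S f \<Longrightarrow> continuous_on S (\<lambda>x. gauss (f x))"
  unfolding gauss_def by (intro continuous_intros) auto

lemma gauss_integrable: "integrable lborel gauss"
proof (rule Bochner_Integration.integrable_bound)
  show "integrable lborel (\<lambda>z::real^'n. exp (- (inverse (\<Sum>j\<in>UNIV. \<alpha> j) / 4) * (norm z)\<^sup>2))"
    by (rule gaussian_integrable) (use sum_\<alpha>_pos in simp)
  show "gauss \<in> borel_measurable lborel"
    using borel_measurable_continuous_onI[OF gauss_cont[OF continuous_on_id]] by simp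
  show "AE x in lborel. norm (gauss x) \<le> norm (exp (- (inverse (sum \<alpha> UNIV) / 4) * (norm x)\<^sup>2))"
    using q_lower by (auto simp: gauss_def)
qed

lemma mass_pos: "mass > 0"
  unfolding mass_def
  by (rule lborel_integral_pos[OF gauss_cont[OF continuous_on_id] _ gauss_integrable gauss_pos])
    (use gauss_pos less_imp_le in blast)

lemma gauss_mult_integrable:
  assumes u: "continuous_on UNIV u" and U: "\<And>x. \<bar>u x\<bar> \<le> U"
  shows "integrable lborel (\<lambda>z. gauss z * u (x - c *\<^sub>R z))"
proof (rule Bochner_Integration.integrable_bound)
  show "integrable lborel (\<lambda>z. U * gauss z)" using gauss_integrable by simp
  have "continuous_on UNIV (\<lambda>z. gauss z * u (x - c *\<^sub>R z))"
    by (intro continuous_intros continuous_on_compose2[OF u]) auto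
  thus "(\<lambda>z. gauss z * u (x - c *\<^sub>R z)) \<in> borel_measurable lborel"
    using borel_measurable_continuous_onI by simp
  show "AE z in lborel. norm (gauss z * u (x - c *\<^sub>R z)) \<le> norm (U * gauss z)"
  proof (rule AE_I2)
    fix z :: "real ^ 'n"
    have "\<bar>u (x - c *\<^sub>R z)\<bar> \<le> \<bar>U\<bar>" using U[of "x - c *\<^sub>R z"] by linarith
    thus "norm (gauss z * u (x - c *\<^sub>R z)) \<le> norm (U * gauss z)"
      by (simp add: abs_mult mult.commute[of "\<bar>U\<bar>"] mult_left_mono)
  qed
qed

lemma heat_uminus: "heat (\<lambda>y. - u y) t x = - heat u t x"
  by (simp add: heat_def)

text \<open>Undoing the substitution moves x and t from the argument of u into the kernel, where
  they can be differentiated although u is only continuous.\<close>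

lemma heat_kernel:
  assumes u: "continuous_on UNIV u" "\<And>x. x \<notin> cbox a b \<Longrightarrow> u x = 0" and t: "t > 0"
  shows "heat u t x = (t powr (- real CARD('n) / 2) / mass) * kernel_conv (cbox a b) u (\<lambda>s. exp (- s / (4 * t))) B x"
proof -
  define G where "G = (\<lambda>y. u y * exp (- q (x - y) / (4 * t)))"
  have cG: "continuous_on UNIV G"
    unfolding G_def using t by (intro continuous_intros continuous_on_compose2[OF u(1)]) auto
  have "kernel_conv (cbox a b) u (\<lambda>s. exp (- s / (4 * t))) B x = integral (cbox a b) G"
    by (simp add: kernel_conv_def G_def q_def)
  also have "\<dots> = (LINT y|lborel. G y)"
    by (rule compact_support_integral(2)[symmetric, OF cG]) (simp add: G_def u(2))
  also have "\<dots> = \<bar>- sqrt t\<bar> ^ CARD('n) * (LINT z|lborel. G (x + (- sqrt t) *\<^sub>R z))"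
    using lborel_integral_affine[of "- sqrt t" G x] borel_measurable_continuous_onI[OF cG] t by simp
  also have "(\<lambda>z. G (x + (- sqrt t) *\<^sub>R z)) = (\<lambda>z. gauss z * u (x - sqrt t *\<^sub>R z))"
    using t by (auto simp: G_def gauss_def q_scale fun_eq_iff)
  also have "(LINT z|lborel. gauss z * u (x - sqrt t *\<^sub>R z)) = mass * heat u t x"
    using mass_pos by (simp add: heat_def)
  finally have e: "kernel_conv (cbox a b) u (\<lambda>s. exp (- s / (4 * t))) B x = sqrt t ^ CARD('n) * mass * heat u t x"
    using t by simp
  have "sqrt t ^ CARD('n) = t powr (real CARD('n) / 2)"
    using t by (simp add: powr_half_sqrt[symmetric] powr_realpow[symmetric] powr_powr)
  hence "t powr (- real CARD('n) / 2) * sqrt t ^ CARD('n) = 1"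
    using t by (simp add: powr_add[symmetric])
  hence "(t powr (- real CARD('n) / 2) / mass) * (sqrt t ^ CARD('n) * mass * heat u t x) = heat u t x"
    using mass_pos by (simp add: field_simps)
  thus ?thesis unfolding e by simp
qed

definition heat_hess where
  "heat_hess Q u t x = (t powr (- real CARD('n) / 2) / mass) *\<^sub>R
     kernel_hess Q u (\<lambda>s. - exp (- s / (4 * t)) / (4 * t)) (\<lambda>s. exp (- s / (4 * t)) / (4 * t)\<^sup>2) B x"

lemma heat_superjet:
  assumes u: "continuous_on UNIV u" "\<And>x. x \<notin> cbox a b \<Longrightarrow> u x = 0" and t: "t > 0"
  shows "\<exists>c. superjet (heat u t) x c (heat_hess (cbox a b) u t x)"
proof -
  have "4 * t > 0" using t by simp
  from kernel_conv_jets[OF u(1) taylor3_exp[OF this] symB] obtain c where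
    c: "superjet (kernel_conv (cbox a b) u (\<lambda>s. exp (- s / (4 * t))) B) x c
     (kernel_hess (cbox a b) u (\<lambda>s. - exp (- s / (4 * t)) / (4 * t)) (\<lambda>s. exp (- s / (4 * t)) / (4 * t)\<^sup>2) B x)"
    by blast
  have h: "heat u t = (\<lambda>x. (t powr (- real CARD('n) / 2) / mass) * kernel_conv (cbox a b) u (\<lambda>s. exp (- s / (4 * t))) B x)"
    by (rule ext) (rule heat_kernel[OF u t])
  have "t powr (- real CARD('n) / 2) / mass > 0" using t mass_pos by simp
  from superjet_scale[OF c this] show ?thesis unfolding h heat_hess_def by blast
qed

text \<open>The heat equation. Both sides are the integral of u against the kernel times q / (4 t^2)
  - n / (2 t): the left one by the Leibniz rule, the right one by \<open>L_B\<close> and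
  \<open>L_outer\<close>.\<close>

lemma heat_time_derivative:
  assumes u: "continuous_on UNIV u" "\<And>x. x \<notin> cbox a b \<Longrightarrow> u x = 0" and t: "t > 0"
  shows "((\<lambda>t. heat u t x) has_real_derivative L (heat_hess (cbox a b) u t x)) (at t)"
proof -
  define n where "n = real CARD('n)"
  define N where "N = (\<lambda>t::real. t powr (- n / 2))"
  define f where "f = (\<lambda>t y. u y * (N t * exp (- q (x - y) / (4 * t))))"
  define f' where "f' = (\<lambda>t y. u y * (N t * exp (- q (x - y) / (4 * t)) * (q (x - y) / (4 * t\<^sup>2) - n / (2 * t))))"
  have cu: "continuous_on S (\<lambda>y. u (g y))" if "continuous_on S g" for S and g :: "real \<times> (real ^ 'n) \<Rightarrow> _"
    using continuous_on_compose2[OF u(1) that] by auto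
  have cu1: "continuous_on S u" for S using u(1) continuous_on_subset by blast
  have der: "((\<lambda>t. f t y) has_real_derivative f' t y) (at t within {0<..})" if "t > 0" for t y
  proof -
    have "(N has_real_derivative (- n / 2) * t powr (- n / 2 - 1)) (at t)"
      unfolding N_def by (rule has_real_derivative_powr[OF that])
    also have "(- n / 2) * t powr (- n / 2 - 1) = N t * (- (n / (2 * t)))"
      using that by (simp add: powr_diff N_def)
    finally have dN: "(N has_real_derivative N t * (- (n / (2 * t)))) (at t)" .
    have dE: "((\<lambda>t. exp (- q (x - y) / (4 * t))) has_real_derivative
        exp (- q (x - y) / (4 * t)) * (q (x - y) / (4 * t\<^sup>2))) (at t)"
      using that by (auto intro!: derivative_eq_intros simp: power2_eq_square)
    have "(f t' y = u y * (N t' * exp (- q (x - y) / (4 * t'))))" for t' by (simp add: f_def)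
    moreover have "((\<lambda>t. u y * (N t * exp (- q (x - y) / (4 * t)))) has_real_derivative f' t y) (at t)"
      using DERIV_cmult[OF DERIV_mult[OF dN dE], of "u y"] by (simp add: f'_def algebra_simps)
    ultimately show ?thesis by (simp add: has_field_derivative_at_within)
  qed
  have cf': "continuous_on ({0<..} \<times> cbox a b) (\<lambda>(t, y). f' t y)"
    unfolding f'_def N_def case_prod_beta
    by (intro continuous_intros cu) auto
  have int: "f t integrable_on cbox a b" if "t > 0" for t
    unfolding f_def using that by (intro integrable_continuous continuous_intros cu1) auto
  have "((\<lambda>t. integral (cbox a b) (f t)) has_real_derivative integral (cbox a b) (f' t)) (at t within {0<..})"
    by (rule leibniz_rule_field_derivative) (use der int cf' t in auto)
  hence d: "((\<lambda>t. integral (cbox a b) (f t)) has_real_derivative integral (cbox a b) (f' t)) (at t)"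
    using t by (simp add: at_within_open[OF _ open_greaterThan])
  have "((\<lambda>t. integral (cbox a b) (f t) / mass) has_real_derivative integral (cbox a b) (f' t) / mass) (at t)"
    by (rule DERIV_cdivide[OF d])
  moreover have ev: "\<forall>\<^sub>F s in nhds t. heat u s x = integral (cbox a b) (f s) / mass"
  proof -
    have "\<forall>\<^sub>F s in nhds t. s \<in> {0<..}"
      by (rule eventually_nhds_in_open) (use t in auto)
    thus ?thesis
    proof eventually_elim
      case (elim s)
      have "f s = (\<lambda>y. N s * (u y * exp (- ((x - y) \<bullet> (B *v (x - y))) / (4 * s))))"
        by (auto simp: f_def q_def fun_eq_iff)
      hence "integral (cbox a b) (f s) = N s * kernel_conv (cbox a b) u (\<lambda>r. exp (- r / (4 * s))) B x"
        by (simp add: kernel_conv_def)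
      thus ?case using heat_kernel[OF u, where t = s and x = x] elim by (simp add: N_def n_def)
    qed
  qed
  moreover have eq: "integral (cbox a b) (f' t) / mass = L (heat_hess (cbox a b) u t x)"
  proof -
    have "4 * t > 0" using t by simp
    have "L (heat_hess (cbox a b) u t x) = N t / mass *
      integral (cbox a b) (\<lambda>y. u y *\<^sub>R
     ((2 * (- exp (- ((x - y) \<bullet> (B *v (x - y))) / (4 * t)) / (4 * t))) *\<^sub>R L B +
      (4 * (exp (- ((x - y) \<bullet> (B *v (x - y))) / (4 * t)) / (4 * t)\<^sup>2)) *\<^sub>R L (outer (B *v (x - y)))))"
      unfolding heat_hess_def L_scale kernel_hess_linear[OF u(1) taylor3_exp[OF \<open>4 * t > 0\<close>] L_linear]
      by (simp add: N_def n_def)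
    also have "(\<lambda>y. u y *\<^sub>R
     ((2 * (- exp (- ((x - y) \<bullet> (B *v (x - y))) / (4 * t)) / (4 * t))) *\<^sub>R L B +
      (4 * (exp (- ((x - y) \<bullet> (B *v (x - y))) / (4 * t)) / (4 * t)\<^sup>2)) *\<^sub>R L (outer (B *v (x - y)))))
      = (\<lambda>y. u y * (exp (- q (x - y) / (4 * t)) * (q (x - y) / (4 * t\<^sup>2) - n / (2 * t))))"
      unfolding L_B L_outer q_def[symmetric] using t
      by (auto simp: fun_eq_iff n_def field_simps power2_eq_square)
    also have "N t / mass * integral (cbox a b) \<dots> = integral (cbox a b) (f' t) / mass"
    proof -
      have "f' t = (\<lambda>y. N t * (u y * (exp (- q (x - y) / (4 * t)) * (q (x - y) / (4 * t\<^sup>2) - n / (2 * t)))))"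
        by (auto simp: f'_def fun_eq_iff)
      thus ?thesis by simp
    qed
    finally show ?thesis by simp
  qed
  ultimately show ?thesis
    using DERIV_cong_ev[OF refl ev eq[symmetric]] by blast
qed

lemma heat_continuous:
  assumes u: "continuous_on UNIV u" "\<And>x. x \<notin> cbox a b \<Longrightarrow> u x = 0"
  shows "continuous_on ({0<..} \<times> UNIV) (\<lambda>(t, x). heat u t x)"
proof -
  have cu: "continuous_on S (\<lambda>y. u (g y))" if "continuous_on S g"
    for S and g :: "(real \<times> (real ^ 'n)) \<times> (real ^ 'n) \<Rightarrow> _"
    using continuous_on_compose2[OF u(1) that] by auto
  have "continuous_on ({0<..} \<times> UNIV) (\<lambda>p. (fst p powr (- real CARD('n) / 2) / mass) *
      integral (cbox a b) (\<lambda>y. u y * exp (- q (snd p - y) / (4 * fst p))))"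
  proof (rule continuous_on_mult)
    show "continuous_on ({0<..} \<times> (UNIV :: (real ^ 'n) set)) (\<lambda>p. fst p powr (- real CARD('n) / 2) / mass)"
      using mass_pos by (intro continuous_intros) auto
    show "continuous_on ({0<..} \<times> UNIV) (\<lambda>p. integral (cbox a b) (\<lambda>y. u y * exp (- q (snd p - y) / (4 * fst p))))"
      by (rule integral_continuous_on_param) (unfold case_prod_beta, intro continuous_intros cu, auto)
  qed
  thus ?thesis
    by (rule continuous_on_eq)
      (auto simp: case_prod_beta heat_kernel[OF u] kernel_conv_def q_def)
qed

text \<open>The Gaussian integral is split at radius N. Inside, a small t keeps the argument within
  the uniform modulus of continuity of u; outside, the Gaussian tail is small by dominated
  convergence.\<close>

lemma heat_uniform:
  assumes u: "continuous_on UNIV u" "\<And>x. x \<notin> cbox a b \<Longrightarrow> u x = 0" and e: "e > 0"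
  shows "\<exists>\<tau>>0. \<forall>t x. 0 < t \<longrightarrow> t < \<tau> \<longrightarrow> \<bar>heat u t x - u x\<bar> \<le> e"
proof -
  obtain U where U: "\<And>x. \<bar>u x\<bar> \<le> U" "U \<ge> 0"
  proof -
    have "bounded (u ` cbox a b)"
      using compact_continuous_image[OF continuous_on_subset[OF u(1)] compact_cbox] compact_imp_bounded by blast
    then obtain c where "\<forall>y\<in>cbox a b. \<bar>u y\<bar> \<le> c" by (auto simp: bounded_real)
    thus thesis using that[of "max c 0"] u(2) by (metis abs_zero max.coboundedI1 max.cobounded2)
  qed
  have unif: "\<exists>d>0. \<forall>x y. dist x y < d \<longrightarrow> \<bar>u x - u y\<bar> < e / 2"
  proof -
    \<comment> \<open>The box thickened by 1. Two points at distance less than 1 either both lie in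
      \<open>K\<close>, or u vanishes at both.\<close>
    define K where "K = {x + y | x y. x \<in> cbox a b \<and> y \<in> cball 0 1}"
    have cK: "compact K" unfolding K_def by (rule compact_sums) auto
    have "uniformly_continuous_on K u"
      by (rule compact_uniformly_continuous[OF continuous_on_subset[OF u(1)] cK]) auto
    then obtain d where d: "d > 0" "\<And>x y. x \<in> K \<Longrightarrow> y \<in> K \<Longrightarrow> dist y x < d \<Longrightarrow> dist (u y) (u x) < e / 2"
      unfolding uniformly_continuous_on_def using e by (meson half_gt_zero)
    have "\<bar>u x - u y\<bar> < e / 2" if xy: "dist x y < min d 1" for x y
    proof (cases "x \<in> cbox a b \<or> y \<in> cbox a b")
      case True
      have inK: "p \<in> K" "p' \<in> K" if "p \<in> cbox a b" "dist p p' < 1" for p p'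
      proof -
        show "p \<in> K" unfolding K_def using that(1)
          by (intro CollectI) (rule exI[of _ p], rule exI[of _ 0], simp)
        show "p' \<in> K" unfolding K_def using that
          by (intro CollectI) (rule exI[of _ p], rule exI[of _ "p' - p"], simp add: dist_norm norm_minus_commute)
      qed
      have "x \<in> K \<and> y \<in> K" using True inK[of x y] inK[of y x] xy by (auto simp: dist_commute)
      thus ?thesis using d(2)[of y x] xy by (auto simp: dist_real_def)
    next
      case False thus ?thesis using u(2) e by simp
    qed
    thus ?thesis using d(1) by (intro exI[of _ "min d 1"]) auto
  qed
  then obtain d where d: "d > 0" "\<And>x y. dist x y < d \<Longrightarrow> \<bar>u x - u y\<bar> < e / 2" by blast
  have "(\<lambda>n. LINT z|lborel. gauss z * indicator (- cball 0 (real n)) z) \<longlonglongrightarrow> (LINT z|lborel. (0::real) * gauss z)"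
  proof (rule integral_dominated_convergence[where w = gauss])
    have gm: "gauss \<in> borel_measurable lborel" using gauss_integrable by auto
    show "(\<lambda>z. gauss z * indicator (- cball 0 (real n)) z) \<in> borel_measurable lborel" for n
      using gm by (intro borel_measurable_times) auto
    show "(\<lambda>z. (0::real) * gauss z) \<in> borel_measurable lborel" by simp
    show "AE z in lborel. (\<lambda>n. gauss z * indicator (- cball 0 (real n)) z) \<longlonglongrightarrow> 0 * gauss z"
    proof (rule AE_I2)
      fix z :: "real ^ 'n"
      obtain N where N: "norm z \<le> real N" using real_arch_simple by blast
      have "\<forall>\<^sub>F n in sequentially. gauss z * indicator (- cball 0 (real n)) z = 0"
        using eventually_ge_at_top[of N] by eventually_elim (use N in \<open>auto simp: indicator_def\<close>)
      thus "(\<lambda>n. gauss z * indicator (- cball 0 (real n)) z) \<longlonglongrightarrow> 0 * gauss z"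
        by (simp add: tendsto_eventually)
    qed
    show "AE z in lborel. norm (gauss z * indicator (- cball 0 (real n)) z) \<le> gauss z" for n
      using gauss_pos by (auto simp: indicator_def less_imp_le)
  qed (rule gauss_integrable)
  hence lim: "(\<lambda>n. LINT z|lborel. gauss z * indicator (- cball 0 (real n)) z) \<longlonglongrightarrow> 0" by simp
  \<comment> \<open>Tail threshold that makes 2 U times the tail at most half of e times the mass; U
    + 1 avoids division by zero.\<close>
  have "e * mass / (4 * (U + 1)) > 0" using e mass_pos U(2) by simp
  from order_tendstoD(2)[OF lim this] obtain N where
    N: "(LINT z|lborel. gauss z * indicator (- cball 0 (real N)) z) < e * mass / (4 * (U + 1))"
    by (auto simp: eventually_sequentially)
  define T where "T = (LINT z|lborel. gauss z * indicator (- cball 0 (real N)) z)"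
  have iT: "integrable lborel (\<lambda>z. gauss z * indicator (- cball 0 (real N)) z)"
    by (intro integrable_mult_indicator[where 'b=real, unfolded real_scaleR_def, simplified mult.commute] gauss_integrable) auto
  define \<tau> where "\<tau> = (d / (real N + 1))\<^sup>2"
  show ?thesis
  proof (intro exI[of _ \<tau>] conjI allI impI)
    show "\<tau> > 0" unfolding \<tau>_def using d(1) by (intro zero_less_power divide_pos_pos) auto
    fix t :: real and x :: "real ^ 'n" assume t: "0 < t" "t < \<tau>"
    have st: "sqrt t * (real N + 1) < d"
    proof -
      have "sqrt t < d / (real N + 1)" using t d(1) unfolding \<tau>_def by (intro real_less_lsqrt) auto
      thus ?thesis by (simp add: pos_less_divide_eq)
    qed
    have ig: "integrable lborel (\<lambda>z. gauss z * u (x - sqrt t *\<^sub>R z))"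
      by (rule gauss_mult_integrable[OF u(1) U(1)])
    have "heat u t x - u x = (LINT z|lborel. gauss z * u (x - sqrt t *\<^sub>R z) - gauss z * u x) / mass"
      using mass_pos ig gauss_integrable by (simp add: heat_def mass_def diff_divide_distrib)
    moreover have "\<bar>LINT z|lborel. gauss z * u (x - sqrt t *\<^sub>R z) - gauss z * u x\<bar> \<le>
        (LINT z|lborel. e / 2 * gauss z + 2 * U * (gauss z * indicator (- cball 0 (real N)) z))"
    proof (rule order_trans[OF integral_abs_bound integral_mono])
      fix z :: "real ^ 'n"
      show "\<bar>gauss z * u (x - sqrt t *\<^sub>R z) - gauss z * u x\<bar> \<le>
        e / 2 * gauss z + 2 * U * (gauss z * indicator (- cball 0 (real N)) z)"
      proof (cases "z \<in> cball 0 (real N)")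
        case True
        have "sqrt t * norm z \<le> sqrt t * (real N + 1)"
          using True t by (intro mult_left_mono) auto
        hence "sqrt t * norm z < d" using st by (rule order.strict_trans1)
        hence "dist (x - sqrt t *\<^sub>R z) x < d" using t by (simp add: dist_norm)
        from d(2)[OF this] have "gauss z * \<bar>u (x - sqrt t *\<^sub>R z) - u x\<bar> \<le> gauss z * (e / 2)"
          using gauss_pos by (intro mult_left_mono) (auto intro: less_imp_le)
        moreover have "\<bar>gauss z * u (x - sqrt t *\<^sub>R z) - gauss z * u x\<bar> = gauss z * \<bar>u (x - sqrt t *\<^sub>R z) - u x\<bar>"
          using gauss_pos[of z] by (simp add: right_diff_distrib[symmetric] abs_mult)
        ultimately show ?thesis using True by (simp add: mult_ac)
      next
        case False
        have "\<bar>u (x - sqrt t *\<^sub>R z) - u x\<bar> \<le> 2 * U" using U(1)[of "x - sqrt t *\<^sub>R z"] U(1)[of x] by linarith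
        hence "gauss z * \<bar>u (x - sqrt t *\<^sub>R z) - u x\<bar> \<le> gauss z * (2 * U)"
          using gauss_pos by (intro mult_left_mono) (auto intro: less_imp_le)
        moreover have "e / 2 * gauss z \<ge> 0" using e gauss_pos[of z] by simp
        moreover have "\<bar>gauss z * u (x - sqrt t *\<^sub>R z) - gauss z * u x\<bar> = gauss z * \<bar>u (x - sqrt t *\<^sub>R z) - u x\<bar>"
          using gauss_pos[of z] by (simp add: right_diff_distrib[symmetric] abs_mult)
        ultimately show ?thesis using False by (simp add: mult_ac)
      qed
    qed (use ig iT gauss_integrable in auto)
    moreover have "(LINT z|lborel. e / 2 * gauss z + 2 * U * (gauss z * indicator (- cball 0 (real N)) z))
        = e / 2 * mass + 2 * U * T"
      using iT gauss_integrable by (simp add: T_def mass_def)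
    moreover have "2 * U * T \<le> e / 2 * mass"
    proof -
      have "T * (4 * (U + 1)) \<le> e * mass" using N U(2) unfolding T_def[symmetric] by (simp add: pos_less_divide_eq less_imp_le)
      moreover have "T \<ge> 0" unfolding T_def using gauss_pos by (intro integral_nonneg_AE) (auto simp: less_imp_le)
      ultimately show ?thesis by (simp add: algebra_simps)
    qed
    ultimately have "\<bar>(heat u t x - u x) * mass\<bar> \<le> e * mass"
      using mass_pos by simp
    hence "\<bar>heat u t x - u x\<bar> * mass \<le> e * mass" using mass_pos by (simp add: abs_mult)
    thus "\<bar>heat u t x - u x\<bar> \<le> e" using mass_pos by simp
  qed
qed

text \<open>A parabolic maximum principle by contradiction. The excess \<open>\<Phi>\<close> of u +
  (\<kappa> - s) t over the heat flow, penalised by A |x - c|^2, attains its maximum on a cylinder,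
  away from the side and the bottom. There the heat flow plus the penalty touches u from above, so
  the assumption on superjets bounds L of its Hessian from below; by the heat equation
  \<open>\<Phi>\<close> was then larger slightly earlier.\<close>

lemma heat_lower_bound:
  assumes u: "continuous_on UNIV u" "\<And>x. x \<notin> cbox a b \<Longrightarrow> u x = 0"
    and sub: "\<And>y c M. y \<in> ball x0 R \<Longrightarrow> superjet u y c M \<Longrightarrow> \<kappa> \<le> L M"
    and s: "s > 0" and R: "R' < R"
  shows "\<exists>\<tau>>0. \<forall>t c. 0 < t \<longrightarrow> t < \<tau> \<longrightarrow> c \<in> cball x0 R' \<longrightarrow> u c + (\<kappa> - s) * t \<le> heat u t c"
proof -
  define \<Sigma> where "\<Sigma> = (\<Sum>j\<in>UNIV. \<alpha> j)"
  have \<Sigma>: "\<Sigma> > 0" unfolding \<Sigma>_def by (rule sum_\<alpha>_pos)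
  \<comment> \<open>The Hessian of the penalty contributes 2 A \<Sigma> = s / 2 to L, so half of s
    remains as strictness.\<close>
  define A where "A = s / (4 * \<Sigma>)"
  have A: "A > 0" "2 * A * \<Sigma> = s / 2" using s \<Sigma> by (auto simp: A_def)
  define \<rho> where "\<rho> = (R - R') / 2"
  have \<rho>: "\<rho> > 0" using R by (simp add: \<rho>_def)
  define \<eta> where "\<eta> = A * \<rho>\<^sup>2"
  have \<eta>: "\<eta> > 0" using A \<rho> by (simp add: \<eta>_def)
  obtain \<tau>1 where \<tau>1: "\<tau>1 > 0" "\<And>t x. 0 < t \<Longrightarrow> t < \<tau>1 \<Longrightarrow> \<bar>heat u t x - u x\<bar> \<le> \<eta> / 3"
    using heat_uniform[where u = u and a = a and b = b and e = "\<eta> / 3"] u \<eta> by auto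
  \<comment> \<open>On the side of the cylinder the penalty equals \<open>\<eta>\<close>, whereas
    the change of the heat flow and the drift are at most a third of \<open>\<eta>\<close> each for
    t below \<open>\<tau>\<close>.\<close>
  define \<tau> where "\<tau> = min \<tau>1 (\<eta> / (3 * (\<bar>\<kappa> - s\<bar> + 1)))"
  have "\<eta> / (3 * (\<bar>\<kappa> - s\<bar> + 1)) > 0" using \<eta> by (intro divide_pos_pos mult_pos_pos add_nonneg_pos) auto
  hence \<tau>: "\<tau> > 0" using \<tau>1(1) unfolding \<tau>_def by (rule min_less_iff_conj[THEN iffD2, OF conjI, rotated])
  have small: "\<bar>\<kappa> - s\<bar> * t \<le> \<eta> / 3" if "0 < t" "t < \<tau>" for t
  proof -
    have P: "0 < 3 * (\<bar>\<kappa> - s\<bar> + 1)" by (intro mult_pos_pos add_nonneg_pos) auto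
    have "t < \<eta> / (3 * (\<bar>\<kappa> - s\<bar> + 1))" using that unfolding \<tau>_def by linarith
    hence "t * (3 * (\<bar>\<kappa> - s\<bar> + 1)) < \<eta>" unfolding pos_less_divide_eq[OF P] .
    thus ?thesis using that by (simp add: algebra_simps)
  qed
  show ?thesis
  proof (intro exI[of _ \<tau>] conjI allI impI \<tau>)
    fix t1 c assume t1: "0 < t1" "t1 < \<tau>" and c: "c \<in> cball x0 R'"
    show "u c + (\<kappa> - s) * t1 \<le> heat u t1 c"
    proof (rule ccontr)
      assume "\<not> u c + (\<kappa> - s) * t1 \<le> heat u t1 c"
      define \<Phi> where "\<Phi> = (\<lambda>t x. u x - heat u t x + (\<kappa> - s) * t - A * (norm (x - c))\<^sup>2)"
      define m where "m = \<Phi> t1 c"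
      have m: "m > 0" using \<open>\<not> u c + _ \<le> _\<close> by (simp add: m_def \<Phi>_def)
      obtain \<tau>2 where \<tau>2: "\<tau>2 > 0" "\<And>t x. 0 < t \<Longrightarrow> t < \<tau>2 \<Longrightarrow> \<bar>heat u t x - u x\<bar> \<le> m / 4"
        using heat_uniform[where u = u and a = a and b = b and e = "m / 4"] u m by auto
      \<comment> \<open>The cylinder starts at a positive time, since the flow is smooth only for t
        > 0. This time depends on the assumed excess m: at t0 both the flow increment and the drift
        are at most m / 4, so the maximum is not on the bottom.\<close>
      define t0 where "t0 = min (min t1 \<tau>2) (m / (4 * (\<bar>\<kappa> - s\<bar> + 1))) / 2"
      have "0 < m / (4 * (\<bar>\<kappa> - s\<bar> + 1))" using m by (intro divide_pos_pos mult_pos_pos add_nonneg_pos) auto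
      moreover have "0 < min (min t1 \<tau>2) x / 2 \<and> min (min t1 \<tau>2) x / 2 < t1 \<and> min (min t1 \<tau>2) x / 2 < \<tau>2"
        if "0 < x" for x :: real
        using that t1 \<tau>2(1) by (auto simp: min_def)
      ultimately have t0: "0 < t0" "t0 < t1" "t0 < \<tau>2" unfolding t0_def by blast+
      have "t0 * (4 * (\<bar>\<kappa> - s\<bar> + 1)) \<le> m"
      proof -
        have "0 < m / (4 * (\<bar>\<kappa> - s\<bar> + 1))" using m by (intro divide_pos_pos mult_pos_pos add_nonneg_pos) auto
        moreover have "min (min t1 \<tau>2) x / 2 \<le> x" if "0 < x" for x :: real
          using that t1 \<tau>2(1) by (auto simp: min_def)
        ultimately have "t0 \<le> m / (4 * (\<bar>\<kappa> - s\<bar> + 1))" unfolding t0_def by blast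
        moreover have P: "0 < 4 * (\<bar>\<kappa> - s\<bar> + 1)" by (intro mult_pos_pos add_nonneg_pos) auto
        ultimately show ?thesis unfolding pos_le_divide_eq[OF P] by blast
      qed
      hence small0: "\<bar>\<kappa> - s\<bar> * t0 \<le> m / 4" using t0(1) by (simp add: algebra_simps)
      define S where "S = {t0..t1} \<times> cball c \<rho>"
      have cS: "compact S" unfolding S_def by (intro compact_Times compact_cball) auto
      have S0: "(t1, c) \<in> S" using t0 \<rho> by (auto simp: S_def)
      have "continuous_on S (\<lambda>(t, x). heat u t x)"
        by (rule continuous_on_subset[OF heat_continuous[OF u]]) (use t0 in \<open>auto simp: S_def\<close>)
      hence ch: "continuous_on S (\<lambda>p. heat u (fst p) (snd p))" by (simp add: case_prod_beta)
      have "continuous_on S (\<lambda>p. \<Phi> (fst p) (snd p))"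
        unfolding \<Phi>_def by (intro continuous_intros ch continuous_on_compose2[OF u(1)]) auto
      from continuous_attains_sup[OF cS _ this] S0 obtain p where p: "p \<in> S"
        "\<And>p'. p' \<in> S \<Longrightarrow> \<Phi> (fst p') (snd p') \<le> \<Phi> (fst p) (snd p)" by blast
      obtain t x where tx: "p = (t, x)" by (cases p)
      have t: "t0 \<le> t" "t \<le> t1" and x: "dist c x \<le> \<rho>" using p(1) by (auto simp: tx S_def)
      have mx: "\<Phi> t' x' \<le> \<Phi> t x" if "t0 \<le> t'" "t' \<le> t1" "dist c x' \<le> \<rho>" for t' x'
        using p(2)[of "(t', x')"] that by (simp add: tx S_def)
      have ge: "m \<le> \<Phi> t x" unfolding m_def by (rule mx) (use t0 \<rho> in auto)
      have tpos: "t > 0" using t t0 by simp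
      have "dist c x \<noteq> \<rho>"
      proof
        assume "dist c x = \<rho>"
        hence "\<Phi> t x = u x - heat u t x + (\<kappa> - s) * t - \<eta>"
          by (simp add: \<Phi>_def \<eta>_def dist_norm norm_minus_commute)
        moreover have "\<bar>heat u t x - u x\<bar> \<le> \<eta> / 3" using \<tau>1(2)[OF tpos] t t1 by (simp add: \<tau>_def)
        moreover have "(\<kappa> - s) * t \<le> \<bar>\<kappa> - s\<bar> * t" using tpos by (intro mult_right_mono) auto
        moreover have "\<bar>\<kappa> - s\<bar> * t \<le> \<eta> / 3" using small[OF tpos] t t1 by simp
        ultimately show False using ge m \<eta> by linarith
      qed
      hence x': "dist c x < \<rho>" using x by simp
      have "t \<noteq> t0"
      proof
        assume "t = t0"
        have "\<bar>heat u t0 x - u x\<bar> \<le> m / 4" using \<tau>2(2)[OF t0(1) t0(3)] .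
        moreover have "(\<kappa> - s) * t0 \<le> \<bar>\<kappa> - s\<bar> * t0" using t0 by (intro mult_right_mono) auto
        moreover have "A * (norm (x - c))\<^sup>2 \<ge> 0" using A by simp
        moreover have "\<Phi> t x = u x - heat u t0 x + (\<kappa> - s) * t0 - A * (norm (x - c))\<^sup>2"
          using \<open>t = t0\<close> by (simp add: \<Phi>_def)
        ultimately show False using ge m small0 by linarith
      qed
      hence tt0: "t0 < t" using t by simp
      obtain b' where b': "superjet (heat u t) x b' (heat_hess (cbox a b) u t x)"
        using heat_superjet[OF u tpos] by blast
      have "superjet u x (b' + (2 * A) *\<^sub>R (x - c)) (heat_hess (cbox a b) u t x + (2 * A) *\<^sub>R mat 1)"
      proof (rule superjet_touch[OF superjet_add[OF b' norm_square_jets(1)]])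
        have "\<forall>\<^sub>F y in nhds x. y \<in> ball c \<rho>"
          by (rule eventually_nhds_in_open) (use x' in auto)
        thus "\<forall>\<^sub>F y in nhds x. u y - (heat u t y + A * (norm (y - c))\<^sup>2)
           \<le> u x - (heat u t x + A * (norm (x - c))\<^sup>2)"
        proof eventually_elim
          case (elim y)
          have "\<Phi> t y \<le> \<Phi> t x" by (rule mx) (use elim t in auto)
          thus ?case by (simp add: \<Phi>_def)
        qed
      qed
      moreover have "x \<in> ball x0 R"
      proof -
        have "dist x0 x \<le> dist x0 c + dist c x" by (rule dist_triangle)
        also have "\<dots> < R' + \<rho>" using c x' by simp
        also have "\<dots> < R" using R by (simp add: \<rho>_def field_simps)
        finally show ?thesis by simp
      qed
      ultimately have "\<kappa> \<le> L (heat_hess (cbox a b) u t x + (2 * A) *\<^sub>R mat 1)" using sub by blast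
      hence Lge: "\<kappa> - s / 2 \<le> L (heat_hess (cbox a b) u t x)"
        using A(2) by (simp add: L_add L_scale L_mat \<Sigma>_def)
      define d where "d = L (heat_hess (cbox a b) u t x)"
      have "((\<lambda>t. \<Phi> t x) has_real_derivative (0 - d + (\<kappa> - s) - 0)) (at t)"
        unfolding \<Phi>_def d_def
        by (intro DERIV_diff DERIV_add DERIV_const heat_time_derivative[OF u tpos] DERIV_cmult_Id)
      moreover have "0 - d + (\<kappa> - s) - 0 < 0" using Lge s by (simp add: d_def)
      \<comment> \<open>Only earlier times are compared, because the maximum may lie on the final
        slice t = t1.\<close>
      ultimately obtain e where e: "e > 0" "\<And>h. 0 < h \<Longrightarrow> h < e \<Longrightarrow> \<Phi> t x < \<Phi> (t - h) x"
        using DERIV_neg_dec_left[of "\<lambda>t. \<Phi> t x"] by blast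
      define h where "h = min e (t - t0) / 2"
      have h: "0 < h" "h < e" "t0 \<le> t - h" using e(1) tt0 by (auto simp: h_def min_def field_simps)
      have "\<Phi> (t - h) x \<le> \<Phi> t x" by (rule mx) (use h t x in auto)
      thus False using e(2)[OF h(1,2)] by simp
    qed
  qed
qed

text \<open>Both operations average translates of u, so they commute by Fubini; compact supports
  make the double integrand integrable.\<close>

lemma heat_convolution:
  fixes \<eta> :: "real ^ 'n \<Rightarrow> real"
  assumes u: "continuous_on UNIV u" "\<And>x. x \<notin> cbox a b \<Longrightarrow> u x = 0"
    and \<eta>: "continuous_on UNIV \<eta>" "\<And>x. x \<notin> cbox c d \<Longrightarrow> \<eta> x = 0" and t: "t > 0"
  shows "heat (\<lambda>x. LINT \<xi>|lborel. \<eta> \<xi> * u (x - \<xi>)) t x = (LINT \<xi>|lborel. \<eta> \<xi> * heat u t (x - \<xi>))"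
proof -
  define F where "F = (\<lambda>z \<xi>. gauss z * (\<eta> \<xi> * u (x - sqrt t *\<^sub>R z - \<xi>)))"
  \<comment> \<open>The integrand can be nonzero only for z = (x - \<xi> - y) / sqrt t with \<xi>
    and y in the two boxes; \<open>k\<close> bounds these z.\<close>
  have "compact ((\<lambda>p. (1 / sqrt t) *\<^sub>R (x - fst p - snd p)) ` (cbox c d \<times> cbox a b))"
    by (intro compact_continuous_image compact_Times compact_cbox continuous_intros)
  from bounded_subset_cbox_symmetric[OF compact_imp_bounded[OF this]] obtain k where
    k: "(\<lambda>p. (1 / sqrt t) *\<^sub>R (x - fst p - snd p)) ` (cbox c d \<times> cbox a b) \<subseteq> cbox (- k) k" by blast
  have zero: "F z \<xi> = 0" if "(z, \<xi>) \<notin> cbox (- k, c) (k, d)" for z \<xi>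
  proof (rule ccontr)
    assume nz: "F z \<xi> \<noteq> 0"
    hence "\<xi> \<in> cbox c d" "x - sqrt t *\<^sub>R z - \<xi> \<in> cbox a b" using u(2) \<eta>(2) by (auto simp: F_def)
    hence "(1 / sqrt t) *\<^sub>R (x - \<xi> - (x - sqrt t *\<^sub>R z - \<xi>)) \<in> cbox (- k) k"
      using k by (force simp: image_subset_iff)
    hence "z \<in> cbox (- k) k" using t by simp
    with \<open>\<xi> \<in> cbox c d\<close> that show False by (simp add: cbox_Pair_eq)
  qed
  have cF: "continuous_on UNIV (\<lambda>p. F (fst p) (snd p))"
    unfolding F_def by (intro continuous_intros continuous_on_compose2[OF u(1)] continuous_on_compose2[OF \<eta>(1)]) auto
  have "integrable lborel (\<lambda>p. F (fst p) (snd p))"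
  proof (rule compact_support_integral(1)[OF cF])
    show "F (fst p) (snd p) = 0" if "p \<notin> cbox (- k, c) (k, d)" for p
      using zero[of "fst p" "snd p"] that by simp
  qed
  hence "integrable (lborel \<Otimes>\<^sub>M lborel) (\<lambda>(z, \<xi>). F z \<xi>)"
    by (simp add: lborel_prod case_prod_beta')
  from lborel_pair.Fubini_integral[OF this]
  have swap: "(LINT \<xi>|lborel. LINT z|lborel. F z \<xi>) = (LINT z|lborel. LINT \<xi>|lborel. F z \<xi>)" .
  have "heat (\<lambda>x. LINT \<xi>|lborel. \<eta> \<xi> * u (x - \<xi>)) t x = (LINT z|lborel. LINT \<xi>|lborel. F z \<xi>) / mass"
    by (simp add: heat_def F_def)
  also have "\<dots> = (LINT \<xi>|lborel. LINT z|lborel. F z \<xi>) / mass" by (simp add: swap)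
  also have "(\<lambda>\<xi>. LINT z|lborel. F z \<xi>) = (\<lambda>\<xi>. \<eta> \<xi> * (heat u t (x - \<xi>) * mass))"
  proof
    fix \<xi>
    have "(\<lambda>z. F z \<xi>) = (\<lambda>z. \<eta> \<xi> * (gauss z * u (x - \<xi> - sqrt t *\<^sub>R z)))"
      by (auto simp: F_def fun_eq_iff algebra_simps)
    thus "(LINT z|lborel. F z \<xi>) = \<eta> \<xi> * (heat u t (x - \<xi>) * mass)"
      using mass_pos by (simp add: heat_def)
  qed
  also have "(LINT \<xi>|lborel. \<eta> \<xi> * (heat u t (x - \<xi>) * mass)) / mass = (LINT \<xi>|lborel. \<eta> \<xi> * heat u t (x - \<xi>))"
    using mass_pos by (simp add: mult.assoc[symmetric])
  finally show ?thesis .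
qed

lemma mollified_superjet_bound:
  fixes p :: "real \<Rightarrow> real"
  defines "\<eta> \<equiv> \<lambda>z :: real ^ 'n. p (z \<bullet> z)"
  assumes u: "continuous_on UNIV u" "\<And>x. x \<notin> cbox a b \<Longrightarrow> u x = 0"
    and p: "taylor3 p p1 p2" "\<And>s. p s \<ge> 0" "\<And>s. s \<ge> r\<^sup>2 \<Longrightarrow> p s = 0" "r > 0"
    and one: "(LINT z|lborel. \<eta> z) = 1"
    and W: "\<And>x. kernel_conv (cbox a b) u p (mat 1) x = (LINT \<xi>|lborel. \<eta> \<xi> * u (x - \<xi>))"
    and W0: "\<And>x. x \<notin> cbox a' b' \<Longrightarrow> kernel_conv (cbox a b) u p (mat 1) x = 0"
    and sub: "\<And>y c M. y \<in> ball x0 R \<Longrightarrow> superjet u y c M \<Longrightarrow> \<kappa> \<le> L M" and R: "r < R"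
  shows "\<kappa> \<le> L (kernel_hess (cbox a b) u p1 p2 (mat 1) x0)"
proof (rule ccontr)
  define W where "W = kernel_conv (cbox a b) u p (mat 1)"
  define M where "M = kernel_hess (cbox a b) u p1 p2 (mat 1)"
  have cp: "continuous_on UNIV p" using p(1) by (simp add: taylor3_def)
  have c\<eta>: "continuous_on UNIV \<eta>"
    unfolding \<eta>_def by (intro continuous_on_compose2[OF cp] continuous_intros) auto
  have \<eta>0: "\<eta> z = 0" if "z \<notin> cball 0 r" for z
  proof -
    have "r\<^sup>2 \<le> (norm z)\<^sup>2" using that p(4) by (intro power_mono) auto
    thus ?thesis using p(3) by (simp add: \<eta>_def power2_norm_eq_inner)
  qed
  obtain k where k: "cball (0::real^'n) r \<subseteq> cbox (- k) k"
    using bounded_subset_cbox_symmetric[OF bounded_cball] by blast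
  have \<eta>k: "\<eta> z = 0" if "z \<notin> cbox (- k) k" for z using \<eta>0 k that by blast
  have i\<eta>: "integrable lborel \<eta>" by (rule compact_support_integral(1)[OF c\<eta> \<eta>k])
  have W_eq: "W = (\<lambda>x. LINT \<xi>|lborel. \<eta> \<xi> * u (x - \<xi>))" using W by (auto simp: W_def)
  have cW: "continuous_on UNIV W" unfolding W_def by (rule kernel_conv_continuous[OF u(1) cp])
  have cM: "continuous_on UNIV M" unfolding M_def by (rule kernel_hess_continuous[OF u(1) p(1)])
  have sym1: "transpose (mat 1 :: real ^ 'n ^ 'n) = mat 1" by simp
  assume "\<not> \<kappa> \<le> L (kernel_hess (cbox a b) u p1 p2 (mat 1) x0)"
  hence less: "L (M x0) < \<kappa>" by (simp add: M_def)
  \<comment> \<open>With a quarter of the deficit, the growth rate \<kappa> - s inherited from u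
    still exceeds the rate L (M x0) + 2 s allowed by the Hessian of W.\<close>
  define s where "s = (\<kappa> - L (M x0)) / 4"
  have s: "s > 0" using less by (simp add: s_def)
  obtain \<tau>1 where \<tau>1: "\<tau>1 > 0" "\<And>t c. 0 < t \<Longrightarrow> t < \<tau>1 \<Longrightarrow> c \<in> cball x0 r \<Longrightarrow> u c + (\<kappa> - s) * t \<le> heat u t c"
  proof -
    have "\<exists>\<tau>>0. \<forall>t c. 0 < t \<longrightarrow> t < \<tau> \<longrightarrow> c \<in> cball x0 r \<longrightarrow> u c + (\<kappa> - s) * t \<le> heat u t c"
      by (rule heat_lower_bound[OF u sub s R])
    thus thesis using that by blast
  qed
  have "continuous_on UNIV (\<lambda>x. L (M x))"
    by (rule continuous_on_compose2[OF linear_continuous_on[OF L_linear] cM]) auto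
  hence "isCont (\<lambda>x. L (M x)) x0" by (simp add: continuous_on_eq_continuous_at)
  then obtain R1 where R1: "R1 > 0" "\<And>x. dist x x0 < R1 \<Longrightarrow> dist (L (M x)) (L (M x0)) < s"
    unfolding continuous_at_eps_delta using s by blast
  \<comment> \<open>Superjets of - W lie above its Hessian - M, which near x0 gives a constant lower
    bound. The growth lemma applied to - W then bounds the heat flow of W at x0 from above.\<close>
  have subW: "- (L (M x0) + s) \<le> L N" if y: "y \<in> ball x0 R1" and N: "superjet (\<lambda>y. - W y) y c N" for y c N
  proof -
    obtain b' where "superjet W y b' (M y)"
      using kernel_conv_jets[OF u(1) p(1) sym1] unfolding W_def M_def by blast
    hence "subjet (\<lambda>y. - W y) y (- b') (- M y)" by (simp add: subjet_def)
    from superjet_subjet_le[OF N this] have "L (- M y) \<le> L N" by (intro L_mono)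
    moreover have "dist (L (M y)) (L (M x0)) < s" using R1(2)[of y] y by (simp add: dist_commute[of x0])
    ultimately show ?thesis by (auto simp: L_uminus dist_real_def abs_if split: if_splits)
  qed
  have cW': "continuous_on UNIV (\<lambda>y. - W y)" by (intro continuous_intros cW)
  obtain \<tau>2 where \<tau>2: "\<tau>2 > 0" "\<And>t c. 0 < t \<Longrightarrow> t < \<tau>2 \<Longrightarrow> c \<in> cball x0 0 \<Longrightarrow>
     - W c + (- (L (M x0) + s) - s) * t \<le> heat (\<lambda>y. - W y) t c"
  proof -
    have "\<exists>\<tau>>0. \<forall>t c. 0 < t \<longrightarrow> t < \<tau> \<longrightarrow> c \<in> cball x0 0 \<longrightarrow>
        - W c + (- (L (M x0) + s) - s) * t \<le> heat (\<lambda>y. - W y) t c"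
      by (rule heat_lower_bound[OF cW' _ subW s R1(1), of a' b']) (simp add: W_def W0)
    thus thesis using that by blast
  qed
  define t where "t = min \<tau>1 \<tau>2 / 2"
  have t: "0 < t" "t < \<tau>1" "t < \<tau>2" using \<tau>1(1) \<tau>2(1) by (auto simp: t_def)
  have up: "heat W t x0 \<le> W x0 + (L (M x0) + 2 * s) * t"
    using \<tau>2(2)[OF t(1,3), of x0] by (simp add: heat_uminus algebra_simps)
  have cu: "continuous_on UNIV (\<lambda>\<xi>. \<eta> \<xi> * u (x0 - \<xi>))"
    by (intro continuous_intros c\<eta> continuous_on_compose2[OF u(1)]) auto
  have iu: "integrable lborel (\<lambda>\<xi>. \<eta> \<xi> * u (x0 - \<xi>))"
    by (rule compact_support_integral(1)[OF cu, of "- k" k]) (simp add: \<eta>k)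
  have chx: "continuous_on UNIV (\<lambda>\<xi>. heat u t (x0 - \<xi>))"
  proof -
    have "continuous_on UNIV (\<lambda>\<xi>. (\<lambda>(t, x). heat u t x) (t, x0 - \<xi>))"
      by (rule continuous_on_compose2[OF heat_continuous[OF u]]) (use t(1) in \<open>auto intro!: continuous_intros\<close>)
    thus ?thesis by simp
  qed
  have ih: "integrable lborel (\<lambda>\<xi>. \<eta> \<xi> * heat u t (x0 - \<xi>))"
    by (rule compact_support_integral(1)[of _ "- k" k]) (auto simp: \<eta>k intro!: continuous_intros c\<eta> chx)
  have "W x0 + (\<kappa> - s) * t = (LINT \<xi>|lborel. \<eta> \<xi> * u (x0 - \<xi>) + (\<kappa> - s) * t * \<eta> \<xi>)"
    using iu i\<eta> one by (simp add: W_eq)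
  also have "\<dots> \<le> (LINT \<xi>|lborel. \<eta> \<xi> * heat u t (x0 - \<xi>))"
  proof (rule integral_mono)
    fix \<xi> :: "real ^ 'n"
    show "\<eta> \<xi> * u (x0 - \<xi>) + (\<kappa> - s) * t * \<eta> \<xi> \<le> \<eta> \<xi> * heat u t (x0 - \<xi>)"
    proof (cases "\<xi> \<in> cball 0 r")
      case True
      hence "x0 - \<xi> \<in> cball x0 r" by (simp add: dist_norm)
      from \<tau>1(2)[OF t(1,2) this] have "\<eta> \<xi> * (u (x0 - \<xi>) + (\<kappa> - s) * t) \<le> \<eta> \<xi> * heat u t (x0 - \<xi>)"
        using p(2) by (intro mult_left_mono) (auto simp: \<eta>_def)
      thus ?thesis by (simp add: algebra_simps)
    qed (simp add: \<eta>0)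
  qed (use iu i\<eta> ih in auto)
  also have "\<dots> = heat W t x0"
    unfolding W_eq by (rule heat_convolution[OF u c\<eta> \<eta>k t(1), symmetric])
  finally have "(\<kappa> - s) * t \<le> (L (M x0) + 2 * s) * t" using up by simp
  hence "\<kappa> - s \<le> L (M x0) + 2 * s" using t(1) by simp
  thus False using s by (simp add: s_def field_simps)
qed

end

text \<open>What matters is uniformity: the same W and M serve all bases and weights at once,
  because the mollifier is chosen independently of the operator. The weights can therefore be
  optimised afterwards, at the contact point and depending on M there.\<close>

lemma mollification:
  fixes u :: "real ^ 'n \<Rightarrow> real"
  assumes u: "continuous_on UNIV u" "\<And>x. x \<notin> cbox a b \<Longrightarrow> u x = 0" and r: "r > 0"
  shows "\<exists>W M. continuous_on UNIV W \<and> (\<forall>x. \<exists>c. subjet W x c (M x)) \<and>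
    (\<forall>x e. (\<forall>y\<in>cball x r. \<bar>u y - u x\<bar> \<le> e) \<longrightarrow> \<bar>W x - u x\<bar> \<le> e) \<and>
    (\<forall>x. \<forall>v\<in>orthonormal_bases. \<forall>\<alpha> R \<kappa>. (\<forall>j. \<alpha> j > 0) \<longrightarrow> r < R \<longrightarrow>
       (\<forall>y\<in>ball x R. \<forall>c N. superjet u y c N \<longrightarrow> \<kappa> \<le> (\<Sum>j\<in>UNIV. \<alpha> j * (v j \<bullet> (N *v v j)))) \<longrightarrow>
       \<kappa> \<le> (\<Sum>j\<in>UNIV. \<alpha> j * (v j \<bullet> (M x *v v j))))"
proof -
  define \<rho> where "\<rho> = r\<^sup>2"
  have \<rho>: "\<rho> > 0" using r by (simp add: \<rho>_def)
  \<comment> \<open>A C^2 bump supported in the ball of radius r and of the form required by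
    \<open>kernel_conv\<close>; it is normalised below by its own integral.\<close>
  define \<eta>0 where "\<eta>0 = (\<lambda>z :: real ^ 'n. max 0 (\<rho> - z \<bullet> z) ^ 3)"
  obtain k where k: "cball (0::real^'n) r \<subseteq> cbox (- k) k"
    using bounded_subset_cbox_symmetric[OF bounded_cball] by blast
  have out: "z \<bullet> z \<ge> \<rho>" if "z \<notin> cball 0 r" for z :: "real ^ 'n"
  proof -
    have "r\<^sup>2 \<le> (norm z)\<^sup>2" using that r by (intro power_mono) auto
    thus ?thesis by (simp add: \<rho>_def power2_norm_eq_inner)
  qed
  have c0: "continuous_on UNIV \<eta>0" unfolding \<eta>0_def by (intro continuous_intros)
  have i0: "integrable lborel \<eta>0"
    by (rule compact_support_integral(1)[OF c0, of "- k" k]) (use out k in \<open>force simp: \<eta>0_def\<close>)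
  have pos: "(LINT z|lborel. \<eta>0 z) > 0"
    by (rule lborel_integral_pos[OF c0 _ i0, of 0]) (use \<rho> in \<open>auto simp: \<eta>0_def\<close>)
  define l where "l = 1 / (LINT z|lborel. \<eta>0 z)"
  have l: "l > 0" using pos by (simp add: l_def)
  define p where "p = (\<lambda>s. l * max 0 (\<rho> - s) ^ 3)"
  define \<eta> where "\<eta> = (\<lambda>z :: real ^ 'n. p (z \<bullet> z))"
  note t3 = taylor3_bump[OF l, of \<rho>, folded p_def]
  have p: "\<And>s. p s \<ge> 0" "\<And>s. s \<ge> r\<^sup>2 \<Longrightarrow> p s = 0" using l by (auto simp: p_def \<rho>_def)
  have one: "(LINT z|lborel. \<eta> z) = 1"
  proof -
    have "\<eta> = (\<lambda>z. l * \<eta>0 z)" by (auto simp: \<eta>_def p_def \<eta>0_def)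
    thus ?thesis using pos by (simp add: l_def)
  qed
  have cp: "continuous_on UNIV p" using t3 by (simp add: taylor3_def)
  have c\<eta>: "continuous_on UNIV \<eta>"
    unfolding \<eta>_def by (intro continuous_on_compose2[OF cp] continuous_intros) auto
  have \<eta>r: "\<eta> z = 0" if "z \<notin> cball 0 r" for z using out[OF that] p(2) by (auto simp: \<eta>_def \<rho>_def)
  have \<eta>k: "\<eta> z = 0" if "z \<notin> cbox (- k) k" for z
    using \<eta>r[of z] k that by blast
  have i\<eta>: "integrable lborel \<eta>" by (rule compact_support_integral(1)[OF c\<eta> \<eta>k])
  define W where "W = kernel_conv (cbox a b) u p (mat 1)"
  define M where "M = kernel_hess (cbox a b) u (\<lambda>s. - 3 * l * max 0 (\<rho> - s) ^ 2) (\<lambda>s. 6 * l * max 0 (\<rho> - s)) (mat 1)"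
  have W_eq: "W x = (LINT \<xi>|lborel. \<eta> \<xi> * u (x - \<xi>))" for x
  proof -
    define G where "G = (\<lambda>y. u y * \<eta> (x - y))"
    have cG: "continuous_on UNIV G"
      unfolding G_def by (intro continuous_intros u(1) continuous_on_compose2[OF c\<eta>]) auto
    have "W x = integral (cbox a b) G" by (simp add: W_def kernel_conv_def G_def \<eta>_def)
    also have "\<dots> = (LINT y|lborel. G y)"
      by (rule compact_support_integral(2)[symmetric, OF cG]) (simp add: G_def u(2))
    also have "\<dots> = (LINT \<xi>|lborel. G (x + (- 1) *\<^sub>R \<xi>))"
      using lborel_integral_affine[of "- 1" G x] borel_measurable_continuous_onI[OF cG] by simp
    also have "\<dots> = (LINT \<xi>|lborel. \<eta> \<xi> * u (x - \<xi>))" by (simp add: G_def mult.commute)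
    finally show ?thesis .
  qed
  have "compact ((\<lambda>p. fst p + snd p) ` (cbox a b \<times> cbox (- k) k))"
    by (intro compact_continuous_image compact_Times compact_cbox continuous_intros)
  from bounded_subset_cbox_symmetric[OF compact_imp_bounded[OF this]] obtain k' where
    k': "(\<lambda>p. fst p + snd p) ` (cbox a b \<times> cbox (- k) k) \<subseteq> cbox (- k') k'" by blast
  have W0: "W x = 0" if x: "x \<notin> cbox (- k') k'" for x
  proof -
    have "\<eta> \<xi> * u (x - \<xi>) = 0" for \<xi>
    proof (rule ccontr)
      assume "\<eta> \<xi> * u (x - \<xi>) \<noteq> 0"
      hence "\<xi> \<in> cbox (- k) k" "x - \<xi> \<in> cbox a b" using \<eta>k u(2) by auto
      hence "(x - \<xi>) + \<xi> \<in> cbox (- k') k'" using k' by (force simp: image_subset_iff)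
      thus False using x by simp
    qed
    thus ?thesis by (simp only: W_eq Bochner_Integration.integral_zero)
  qed
  show ?thesis
  proof (rule exI[of _ W], rule exI[of _ M], intro conjI allI ballI impI)
    show "continuous_on UNIV W" unfolding W_def by (rule kernel_conv_continuous[OF u(1) cp])
    show "\<exists>c. subjet W x c (M x)" for x
      unfolding W_def M_def using kernel_conv_jets[OF u(1) t3, of "mat 1"] transpose_mat by blast
    show "\<bar>W x - u x\<bar> \<le> e" if e: "\<forall>y\<in>cball x r. \<bar>u y - u x\<bar> \<le> e" for x e
    proof -
      have cu: "continuous_on UNIV (\<lambda>\<xi>. \<eta> \<xi> * u (x - \<xi>))"
        by (intro continuous_intros c\<eta> continuous_on_compose2[OF u(1)]) auto
      have iu: "integrable lborel (\<lambda>\<xi>. \<eta> \<xi> * u (x - \<xi>))"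
        by (rule compact_support_integral(1)[OF cu, of "- k" k]) (simp add: \<eta>k)
      have "W x - u x = (LINT \<xi>|lborel. \<eta> \<xi> * u (x - \<xi>) - u x * \<eta> \<xi>)"
        using iu i\<eta> one by (simp add: W_eq)
      also have "\<bar>\<dots>\<bar> \<le> (LINT \<xi>|lborel. e * \<eta> \<xi>)"
      proof (rule order_trans[OF integral_abs_bound integral_mono])
        fix \<xi> :: "real ^ 'n"
        show "\<bar>\<eta> \<xi> * u (x - \<xi>) - u x * \<eta> \<xi>\<bar> \<le> e * \<eta> \<xi>"
        proof (cases "\<xi> \<in> cball 0 r")
          case True
          hence "\<bar>u (x - \<xi>) - u x\<bar> \<le> e" by (intro e[rule_format]) (simp add: dist_norm)
          hence "\<eta> \<xi> * \<bar>u (x - \<xi>) - u x\<bar> \<le> \<eta> \<xi> * e" using p(1) by (intro mult_left_mono) (auto simp: \<eta>_def)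
          moreover have "\<eta> \<xi> * u (x - \<xi>) - u x * \<eta> \<xi> = \<eta> \<xi> * (u (x - \<xi>) - u x)" by (simp add: algebra_simps)
          ultimately show ?thesis using p(1) by (simp add: abs_mult \<eta>_def mult.commute)
        qed (simp add: \<eta>r)
      qed (use iu i\<eta> in auto)
      also have "\<dots> = e" using one by simp
      finally show ?thesis .
    qed
    show "\<kappa> \<le> (\<Sum>j\<in>UNIV. \<alpha> j * (v j \<bullet> (M x *v v j)))"
      if v: "v \<in> orthonormal_bases" and \<alpha>: "\<forall>j. \<alpha> j > 0" and R: "r < R"
        and sub: "\<forall>y\<in>ball x R. \<forall>c N. superjet u y c N \<longrightarrow> \<kappa> \<le> (\<Sum>j\<in>UNIV. \<alpha> j * (v j \<bullet> (N *v v j)))"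
      for x v \<alpha> R \<kappa>
    proof -
      interpret heat_operator v \<alpha> by standard (use v \<alpha> in auto)
      have "\<kappa> \<le> L (M x)" unfolding M_def
        by (rule mollified_superjet_bound[where a = a and b = b and a' = "- k'" and b' = k' and p = p and r = r and R = R])
          (use u t3 p r R one W_eq W0 sub in \<open>auto simp: \<eta>_def W_def L_def\<close>)
      thus ?thesis by (simp add: L_def)
    qed
  qed
qed

section \<open>Comparison of viscosity sub- and supersolutions\<close>

definition usc_on :: "'a::metric_space set \<Rightarrow> ('a \<Rightarrow> real) \<Rightarrow> bool" where
  "usc_on S u \<longleftrightarrow> (\<forall>x\<in>S. \<forall>c. u x < c \<longrightarrow> (\<exists>d>0. \<forall>y\<in>S. dist y x < d \<longrightarrow> u y < c))"

lemma usc_on_subset: "usc_on S u \<Longrightarrow> T \<subseteq> S \<Longrightarrow> usc_on T u"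
  unfolding usc_on_def by (meson subsetD)

lemma continuous_on_imp_usc: "continuous_on S u \<Longrightarrow> usc_on S u"
  unfolding usc_on_def
proof (intro ballI allI impI)
  fix x c assume c: "continuous_on S u" and x: "x \<in> S" and uc: "u x < c"
  obtain d where d: "d > 0" "\<And>y. y \<in> S \<Longrightarrow> dist y x < d \<Longrightarrow> dist (u y) (u x) < c - u x"
    using c x uc unfolding continuous_on_iff by (metis diff_gt_0_iff_gt)
  have "u y < c" if "y \<in> S" "dist y x < d" for y
    using d(2)[OF that] by (auto simp: dist_real_def abs_if split: if_splits)
  with d(1) show "\<exists>d>0. \<forall>y\<in>S. dist y x < d \<longrightarrow> u y < c" by blast
qed

lemma usc_on_add:
  assumes "usc_on S u" "usc_on S w"
  shows "usc_on S (\<lambda>x. u x + w x)"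
  unfolding usc_on_def
proof (intro ballI allI impI)
  fix x c assume x: "x \<in> S" and c: "u x + w x < c"
  define e where "e = (c - u x - w x) / 2"
  have "u x < u x + e" "w x < w x + e" using c by (auto simp: e_def)
  then obtain d1 d2 where d: "d1 > 0" "\<And>y. y \<in> S \<Longrightarrow> dist y x < d1 \<Longrightarrow> u y < u x + e"
     "d2 > 0" "\<And>y. y \<in> S \<Longrightarrow> dist y x < d2 \<Longrightarrow> w y < w x + e"
    using assms x unfolding usc_on_def by meson
  have "u y + w y < c" if "y \<in> S" "dist y x < min d1 d2" for y
    using d(2)[of y] d(4)[of y] that by (auto simp: e_def field_simps)
  with d(1,3) show "\<exists>d>0. \<forall>y\<in>S. dist y x < d \<longrightarrow> u y + w y < c"
    by (intro exI[of _ "min d1 d2"]) auto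
qed

text \<open>If no maximum existed, every x would be beaten by some \<open>g x\<close>, and by
  semicontinuity so would a whole neighbourhood of x. Finitely many neighbourhoods cover S, and the
  largest of their finitely many values u (g x) would be beaten itself.\<close>

lemma usc_attains_sup:
  assumes S: "compact S" "S \<noteq> {}" and u: "usc_on S u"
  shows "\<exists>x\<in>S. \<forall>y\<in>S. u y \<le> u x"
proof (rule ccontr)
  assume "\<not> ?thesis"
  hence "\<forall>x\<in>S. \<exists>y\<in>S. u x < u y" by (meson not_le)
  then obtain g where g: "\<And>x. x \<in> S \<Longrightarrow> g x \<in> S \<and> u x < u (g x)" by metis
  hence "\<forall>x\<in>S. \<exists>d>0. \<forall>y\<in>S. dist y x < d \<longrightarrow> u y < u (g x)" using u unfolding usc_on_def by blast
  then obtain d where d: "\<And>x. x \<in> S \<Longrightarrow> d x > 0 \<and> (\<forall>y\<in>S. dist y x < d x \<longrightarrow> u y < u (g x))" by metis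
  have "S \<subseteq> (\<Union>x\<in>S. ball x (d x))" using d by auto
  then obtain D where D: "D \<subseteq> S" "finite D" "S \<subseteq> (\<Union>x\<in>D. ball x (d x))"
    by (rule compactE_image[OF S(1), rotated]) auto
  have "D \<noteq> {}" using D(3) S(2) by auto
  hence "Max ((\<lambda>y. u (g y)) ` D) \<in> (\<lambda>y. u (g y)) ` D" using D(2) by (intro Max_in) auto
  then obtain z where z: "z \<in> D" "Max ((\<lambda>y. u (g y)) ` D) = u (g z)" by blast
  have z': "u (g y) \<le> u (g z)" if "y \<in> D" for y
    unfolding z(2)[symmetric] using that D(2) by (intro Max_ge) auto
  have "g z \<in> S" using g z D by blast
  then obtain w where w: "w \<in> D" "g z \<in> ball w (d w)" using D(3) by blast
  hence "u (g z) < u (g w)" using d[of w] D(1) \<open>g z \<in> S\<close> by (auto simp: dist_commute)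
  thus False using z'[OF w(1)] by simp
qed

section \<open>From bases and linear functionals back to matrices and determinants\<close>

text \<open>Lets a statement quantified over orthonormal bases be read as one about every single
  direction.\<close>

lemma unit_vector_in_basis:
  fixes h :: "real ^ 'n"
  assumes "norm h = 1"
  obtains v k where "v \<in> orthonormal_bases" "v k = h"
proof -
  fix k :: 'n
  obtain f where f: "orthogonal_transformation f" "f (axis k (1::real)) = h"
    using orthogonal_transformation_exists_1[OF norm_axis_1[of k] assms] by blast
  have "(\<lambda>j. f (axis j 1)) \<in> orthonormal_bases"
    using f(1) by (auto simp: orthonormal_bases_def orthogonal_transformation_def inner_axis_axis)
  thus thesis using that[of "\<lambda>j. f (axis j 1)" k] f(2) by simp
qed

lemma quadratic_form_unit:
  fixes M :: "real ^ 'n ^ 'n"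
  assumes "\<And>v j. v \<in> orthonormal_bases \<Longrightarrow> l \<le> v j \<bullet> (M *v v j)"
  shows "l * (norm h)\<^sup>2 \<le> h \<bullet> (M *v h)"
proof (cases "h = 0")
  case False
  define k where "k = (1 / norm h) *\<^sub>R h"
  have h: "h = norm h *\<^sub>R k" and k: "norm k = 1" using False by (auto simp: k_def)
  obtain v j where "v \<in> orthonormal_bases" "v j = k" using unit_vector_in_basis[OF k] by blast
  hence "l \<le> k \<bullet> (M *v k)" using assms by metis
  moreover have "h \<bullet> (M *v h) = (norm h)\<^sup>2 * (k \<bullet> (M *v k))"
    by (subst (1 2) h) (simp add: matrix_vector_mult_scaleR power2_eq_square)
  ultimately show ?thesis by (metis mult.commute mult_left_mono zero_le_power2)
qed simp

lemma amgm_prod: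
  fixes x :: "'n::finite \<Rightarrow> real"
  assumes "\<And>j. x j \<ge> 0"
  shows "real CARD('n) * (\<Prod>j\<in>UNIV. x j) powr (1 / CARD('n)) \<le> (\<Sum>j\<in>UNIV. x j)"
  using arith_geom_mean[of UNIV x] assms
  by (simp add: sum_divide_distrib[symmetric] pos_le_divide_eq mult.commute)

lemma power_superadditive:
  fixes a b :: real
  assumes "a \<ge> 0" "b \<ge> 0" "n > 0"
  shows "a ^ n + b ^ n \<le> (a + b) ^ n"
  using assms(3)
proof (induction n rule: nat_induct_non_zero)
  case (Suc n)
  have "a ^ Suc n + b ^ Suc n \<le> (a + b) * (a ^ n + b ^ n)"
    using assms by (simp add: algebra_simps)
  also have "\<dots> \<le> (a + b) * (a + b) ^ n" using Suc assms by (intro mult_left_mono) auto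
  finally show ?case by simp
qed simp

text \<open>The determinant of a positive matrix is recovered from the linear functionals dominating its
  \<open>n\<close>-th root: the weights \<open>1 / (m j + s)\<close> are optimal in the arithmetic-geometric mean inequality.\<close>

lemma prod_lower_bound_from_sums:
  fixes m :: "'n::finite \<Rightarrow> real"
  assumes sums: "\<And>\<alpha>. (\<And>j. \<alpha> j > 0) \<Longrightarrow> real CARD('n) * (F * (\<Prod>j\<in>UNIV. \<alpha> j)) powr (1 / CARD('n)) \<le> (\<Sum>j\<in>UNIV. \<alpha> j * m j)"
    and F: "F \<ge> 0" and s: "s > 0"
  shows "m i \<ge> 0" "F + s ^ CARD('n) \<le> (\<Prod>j\<in>UNIV. m j + s)"
proof -
  show m0: "m i \<ge> 0" for i
  proof (rule ccontr)
    assume "\<not> m i \<ge> 0"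
    hence mi: "m i < 0" by simp
    define S where "S = (\<Sum>j\<in>UNIV - {i}. m j)"
    \<comment> \<open>A weight this large on the negative entry, with weight 1 elsewhere, makes the
      weighted sum equal to S - |S| - 1 < 0, although its lower bound is nonnegative.\<close>
    define T where "T = (\<bar>S\<bar> + 1) / (- m i)"
    have T: "T > 0" unfolding T_def using mi by (intro divide_pos_pos) auto
    have "0 \<le> real CARD('n) * (F * (\<Prod>j\<in>UNIV. if j = i then T else 1)) powr (1 / CARD('n))"
      by simp
    also have "\<dots> \<le> (\<Sum>j\<in>UNIV. (if j = i then T else 1) * m j)" by (rule sums) (use T in auto)
    also have "\<dots> = T * m i + S" by (subst sum.remove[of _ i]) (auto simp: S_def intro!: sum.cong)
    also have "\<dots> = - (\<bar>S\<bar> + 1) + S" using mi by (simp add: T_def)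
    finally show False by linarith
  qed
  define n where "n = CARD('n)"
  have n: "n > 0" by (simp add: n_def)
  define P where "P = (\<Prod>j\<in>UNIV. m j + s)"
  have ms: "m j + s > 0" for j using m0[of j] s by simp
  have P: "P > 0" unfolding P_def by (rule prod_pos) (use ms in auto)
  \<comment> \<open>The target is a + s \<le> p, Minkowski's determinant inequality for n-th roots.
    The chosen weights give n a / p \<le> n - s \<Sum> 1 / (m j + s), and the arithmetic-geometric
    mean inequality bounds that last sum below by n / p.\<close>
  define a where "a = F powr (1 / n)"
  define p where "p = P powr (1 / n)"
  have p: "p > 0" "p ^ n = P" using P n by (auto simp: p_def powr_realpow[symmetric] powr_powr)
  have a: "a \<ge> 0" "a ^ n = F"
  proof -
    show "a \<ge> 0" by (simp add: a_def)
    show "a ^ n = F" using F n by (cases "F = 0") (auto simp: a_def powr_realpow[symmetric] powr_powr)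
  qed
  have prod_inv: "(\<Prod>j\<in>UNIV. 1 / (m j + s)) = 1 / P" by (simp add: P_def prod_dividef)
  have "n * (a / p) = n * (F * (\<Prod>j\<in>UNIV. 1 / (m j + s))) powr (1 / n)"
    unfolding prod_inv using F P by (simp add: a_def p_def powr_divide)
  also have "\<dots> \<le> (\<Sum>j\<in>UNIV. 1 / (m j + s) * m j)"
    unfolding n_def by (rule sums) (use ms in auto)
  also have "\<dots> = (\<Sum>j\<in>UNIV. 1 - s * (1 / (m j + s)))"
  proof (rule sum.cong[OF refl])
    fix j show "1 / (m j + s) * m j = 1 - s * (1 / (m j + s))"
      using ms[of j] by (simp add: field_simps)
  qed
  also have "\<dots> = n - s * (\<Sum>j\<in>UNIV. 1 / (m j + s))" by (simp add: sum_subtractf sum_distrib_left n_def)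
  also have "\<dots> \<le> n - s * (n * (1 / p))"
  proof -
    have "n * (\<Prod>j\<in>UNIV. 1 / (m j + s)) powr (1 / n) \<le> (\<Sum>j\<in>UNIV. 1 / (m j + s))"
      unfolding n_def by (rule amgm_prod) (use ms in \<open>auto intro: less_imp_le\<close>)
    hence "n * (1 / p) \<le> (\<Sum>j\<in>UNIV. 1 / (m j + s))"
      unfolding prod_inv using P by (simp add: p_def powr_divide)
    hence "s * (n * (1 / p)) \<le> s * (\<Sum>j\<in>UNIV. 1 / (m j + s))"
      by (rule mult_left_mono) (use s in simp)
    thus ?thesis by linarith
  qed
  finally have "n * (a / p + s / p) \<le> n * 1" by (simp add: algebra_simps)
  hence "(a + s) / p \<le> 1" using n by (simp add: add_divide_distrib)
  hence "a + s \<le> p" using p by simp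
  hence "(a + s) ^ n \<le> p ^ n" using a s by (intro power_mono) auto
  moreover have "a ^ n + s ^ n \<le> (a + s) ^ n" using a s n by (intro power_superadditive) auto
  ultimately show "F + s ^ CARD('n) \<le> (\<Prod>j\<in>UNIV. m j + s)" using a p by (simp add: P_def n_def)
qed

text \<open>If U - V were positive somewhere, U + s |x|^2 - V would have an interior maximum at some
  x0. Near x0 U is replaced by its mollification W; then W + s |x|^2 - (s/2) |x - x0|^2 touches V
  from below at a nearby z with Hessian N = M z + s I. The linear inequalities inherited by M z give
  det N \<ge> F + s^n, which exceeds f z and contradicts the supersolution property.\<close>

lemma ma_comparison:
  fixes U V :: "real ^ 'n \<Rightarrow> real"
  assumes \<Omega>: "open \<Omega>" "bounded \<Omega>"
    and U: "usc_on (closure \<Omega>) U" "continuous_on \<Omega> U" "ma_subsolution \<Omega> f U"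
    and V: "usc_on (closure \<Omega>) (\<lambda>x. - V x)" "ma_supersolution \<Omega> f V"
    and f: "continuous_on \<Omega> f" "\<And>x. x \<in> \<Omega> \<Longrightarrow> f x \<ge> 0"
    and bd: "\<And>x. x \<in> frontier \<Omega> \<Longrightarrow> U x \<le> V x" and x1: "x1 \<in> closure \<Omega>"
  shows "U x1 \<le> V x1"
proof (rule ccontr)
  assume "\<not> U x1 \<le> V x1"
  define m where "m = U x1 - V x1"
  have m: "m > 0" using \<open>\<not> U x1 \<le> V x1\<close> by (simp add: m_def)
  have "bounded (closure \<Omega>)" using \<Omega>(2) by (rule bounded_closure)
  then obtain R0 where R0: "R0 > 0" "\<And>x. x \<in> closure \<Omega> \<Longrightarrow> norm x \<le> R0"
    unfolding bounded_pos by blast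
  \<comment> \<open>On the boundary U \<le> V, so the perturbation s |x|^2 reaches at most m / 2
    there, less than the value m at x1: the maximum is interior.\<close>
  define s where "s = m / (2 * R0\<^sup>2)"
  have s: "s > 0" "s * R0\<^sup>2 = m / 2" using m R0(1) by (auto simp: s_def)
  define \<Theta> where "\<Theta> = (\<lambda>x. U x + s * (norm x)\<^sup>2 + (- V x))"
  have usc\<Theta>: "usc_on (closure \<Omega>) \<Theta>"
    unfolding \<Theta>_def by (intro usc_on_add U V continuous_on_imp_usc continuous_intros)
  have cc: "compact (closure \<Omega>)" "closure \<Omega> \<noteq> {}" using \<Omega>(2) x1 by auto
  obtain x0 where x0: "x0 \<in> closure \<Omega>" "\<And>y. y \<in> closure \<Omega> \<Longrightarrow> \<Theta> y \<le> \<Theta> x0"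
    using usc_attains_sup[OF cc usc\<Theta>] by blast
  have "m \<le> \<Theta> x1" using s by (simp add: \<Theta>_def m_def)
  hence ge: "m \<le> \<Theta> x0" using x0(2)[OF x1] by linarith
  have "x0 \<notin> frontier \<Omega>"
  proof
    assume "x0 \<in> frontier \<Omega>"
    hence "\<Theta> x0 \<le> s * (norm x0)\<^sup>2" using bd[of x0] by (simp add: \<Theta>_def)
    also have "\<dots> \<le> s * R0\<^sup>2" using R0(2)[OF x0(1)] s by (intro mult_left_mono power_mono) auto
    finally show False using ge m s by simp
  qed
  hence x0\<Omega>: "x0 \<in> \<Omega>" using x0(1) \<Omega>(1) by (simp add: frontier_def interior_open)
  define n where "n = CARD('n)"
  have sn: "s ^ n / 2 > 0" using s by simp
  obtain r1 where r1: "r1 > 0" "ball x0 r1 \<subseteq> \<Omega>" using x0\<Omega> \<Omega>(1) open_contains_ball by blast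
  obtain r2 where r2: "r2 > 0" "\<And>y. y \<in> \<Omega> \<Longrightarrow> dist y x0 < r2 \<Longrightarrow> dist (f y) (f x0) < s ^ n / 2"
    using f(1) x0\<Omega> sn unfolding continuous_on_iff by meson
  define r where "r = min r1 r2 / 4"
  have r: "r > 0" "4 * r \<le> r1" "4 * r \<le> r2" using r1(1) r2(1) by (auto simp: r_def)
  have in\<Omega>: "y \<in> \<Omega>" if "dist x0 y \<le> 3 * r" for y using r1(2) r that by (auto simp: subset_iff)
  \<comment> \<open>A constant with F \<le> f < F + s^n near x0. Truncation at 0 keeps its n-th root
    meaningful.\<close>
  define F where "F = max 0 (f x0 - s ^ n / 2)"
  have Fl: "F \<le> f y" and Fu: "f y < F + s ^ n" if "dist x0 y \<le> 3 * r" for y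
  proof -
    have "dist (f y) (f x0) < s ^ n / 2" using r2(2)[OF in\<Omega>[OF that]] that r by (simp add: dist_commute)
    thus "F \<le> f y" "f y < F + s ^ n" using f(2)[OF in\<Omega>[OF that]] sn
      by (auto simp: F_def dist_real_def abs_if max_def split: if_splits)
  qed
  have F0: "F \<ge> 0" by (simp add: F_def)
  \<comment> \<open>Equal to 1 up to radius 2 r and to 0 beyond 3 r. The product with U is
    continuous on the whole space with compact support and has the superjets of U inside radius 2
    r.\<close>
  define cut where "cut = (\<lambda>y. max 0 (min 1 (3 - dist x0 y / r)))"
  define u where "u = (\<lambda>y. cut y * U y)"
  have u_eq: "u y = U y" if "dist x0 y \<le> 2 * r" for y
  proof -
    have "dist x0 y / r \<le> 2" using that r(1) by (simp add: pos_divide_le_eq)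
    thus ?thesis by (simp add: u_def cut_def)
  qed
  have u0: "u y = 0" if "dist x0 y > 3 * r" for y
  proof -
    have "dist x0 y / r > 3" using that r(1) by (simp add: pos_less_divide_eq)
    thus ?thesis by (simp add: u_def cut_def)
  qed
  have cu: "continuous_on UNIV u"
  proof -
    have "continuous_on \<Omega> u" unfolding u_def cut_def by (intro continuous_intros U(2)) (use r in auto)
    moreover have "continuous_on (- cball x0 (3 * r)) u"
      by (rule continuous_on_eq[OF continuous_on_const[of _ 0]]) (use u0 in auto)
    ultimately have "continuous_on (\<Omega> \<union> - cball x0 (3 * r)) u"
      using \<Omega>(1) by (intro continuous_on_open_Un) auto
    moreover have "\<Omega> \<union> - cball x0 (3 * r) = UNIV" using in\<Omega> by auto
    ultimately show ?thesis by simp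
  qed
  obtain k where k: "cball x0 (3 * r) \<subseteq> cbox (- k) k"
    using bounded_subset_cbox_symmetric[OF bounded_cball] by blast
  have u0': "u y = 0" if "y \<notin> cbox (- k) k" for y using u0[of y] that k by (meson mem_cball not_le subsetD)
  \<comment> \<open>Mollification errors at the two compared points cost at most 2 e = s r^2 / 4,
    less than the drop s r^2 / 2 of the localising term on the sphere of radius r.\<close>
  define e where "e = s * r\<^sup>2 / 8"
  have e: "e > 0" using s r by (simp add: e_def)
  have "uniformly_continuous_on (cball x0 (2 * r)) u"
    by (rule compact_uniformly_continuous[OF continuous_on_subset[OF cu] compact_cball]) auto
  then obtain d where d: "d > 0" "\<And>x y. x \<in> cball x0 (2 * r) \<Longrightarrow> y \<in> cball x0 (2 * r) \<Longrightarrow> dist y x < d \<Longrightarrow> dist (u y) (u x) < e"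
    using e unfolding uniformly_continuous_on_def by meson
  define \<rho> where "\<rho> = min d r / 2"
  have \<rho>: "\<rho> > 0" "\<rho> < d" "\<rho> < r" using d(1) r(1) by (auto simp: \<rho>_def)
  obtain W M where W: "continuous_on UNIV W" "\<forall>x. \<exists>c. subjet W x c (M x)"
    "\<forall>x e. (\<forall>y\<in>cball x \<rho>. \<bar>u y - u x\<bar> \<le> e) \<longrightarrow> \<bar>W x - u x\<bar> \<le> e"
    and WL: "\<forall>x. \<forall>v\<in>orthonormal_bases. \<forall>\<alpha> R \<kappa>. (\<forall>j. \<alpha> j > 0) \<longrightarrow> \<rho> < R \<longrightarrow>
       (\<forall>y\<in>ball x R. \<forall>c N. superjet u y c N \<longrightarrow> \<kappa> \<le> (\<Sum>j\<in>UNIV. \<alpha> j * (v j \<bullet> (N *v v j)))) \<longrightarrow>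
       \<kappa> \<le> (\<Sum>j\<in>UNIV. \<alpha> j * (v j \<bullet> (M x *v v j)))"
    using mollification[of u "- k" k \<rho>] cu u0' \<rho>(1) by blast
  have Wu: "\<bar>W x - U x\<bar> \<le> e" if x: "dist x0 x \<le> r" for x
  proof -
    have "\<bar>W x - u x\<bar> \<le> e"
    proof (rule W(3)[rule_format])
      fix y assume y: "y \<in> cball x \<rho>"
      have "dist x0 y \<le> dist x0 x + dist x y" by (rule dist_triangle)
      hence "y \<in> cball x0 (2 * r)" "x \<in> cball x0 (2 * r)" "dist y x < d"
        using x y \<rho> r(1) by (auto simp: dist_commute)
      thus "\<bar>u y - u x\<bar> \<le> e" using d(2)[of x y] by (simp add: dist_real_def)
    qed
    thus ?thesis using u_eq x r(1) by simp
  qed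
  \<comment> \<open>The subtracted half of s makes the maximum at x0 strict, so that it survives
    mollification inside the ball; of the Hessian 2 s I of the perturbation, s I is left.\<close>
  define \<Psi> where "\<Psi> = (\<lambda>y. W y + (s * (norm (y - 0))\<^sup>2 + (- s / 2) * (norm (y - x0))\<^sup>2))"
  have "usc_on (cball x0 r) (\<lambda>y. \<Psi> y + (- V y))"
  proof (rule usc_on_add)
    show "usc_on (cball x0 r) \<Psi>" unfolding \<Psi>_def
      by (intro continuous_on_imp_usc continuous_intros continuous_on_subset[OF W(1)]) auto
    show "usc_on (cball x0 r) (\<lambda>y. - V y)"
    proof (rule usc_on_subset[OF V(1)])
      have "cball x0 r \<subseteq> \<Omega>" using in\<Omega> r(1) by auto
      thus "cball x0 r \<subseteq> closure \<Omega>" using closure_subset by blast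
    qed
  qed
  hence "\<exists>z\<in>cball x0 r. \<forall>y\<in>cball x0 r. \<Psi> y + (- V y) \<le> \<Psi> z + (- V z)"
    using r(1) by (intro usc_attains_sup) auto
  then obtain z where z: "z \<in> cball x0 r" "\<And>y. y \<in> cball x0 r \<Longrightarrow> \<Psi> y - V y \<le> \<Psi> z - V z"
    by auto
  have "dist x0 z \<noteq> r"
  proof
    assume zr: "dist x0 z = r"
    have "\<Psi> z - V z \<le> \<Theta> z + e - s / 2 * r\<^sup>2"
      using Wu[of z] zr by (simp add: \<Psi>_def \<Theta>_def dist_norm norm_minus_commute abs_le_iff)
    moreover have "\<Theta> z \<le> \<Theta> x0" using x0(2)[of z] in\<Omega>[of z] zr r(1) closure_subset[of \<Omega>] by auto
    moreover have "\<Theta> x0 - e \<le> \<Psi> x0 - V x0" using Wu[of x0] r(1) by (simp add: \<Psi>_def \<Theta>_def abs_le_iff)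
    moreover have "\<Psi> x0 - V x0 \<le> \<Psi> z - V z" using z(2) r(1) by simp
    ultimately have "s / 2 * r\<^sup>2 \<le> 2 * e" by linarith
    moreover have "s * r\<^sup>2 > 0" using s r by simp
    ultimately show False by (simp add: e_def)
  qed
  hence zb: "dist x0 z < r" using z(1) by simp
  obtain c where c: "subjet W z c (M z)" using W(2) by blast
  define N where "N = M z + ((2 * s) *\<^sub>R mat 1 + (2 * (- s / 2)) *\<^sub>R mat 1)"
  have jet: "subjet V z (c + ((2 * s) *\<^sub>R (z - 0) + (2 * (- s / 2)) *\<^sub>R (z - x0))) N"
  proof (rule subjet_touch)
    show "subjet \<Psi> z (c + ((2 * s) *\<^sub>R (z - 0) + (2 * (- s / 2)) *\<^sub>R (z - x0))) N"
      unfolding \<Psi>_def N_def by (intro subjet_add c norm_square_jets)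
    have "\<forall>\<^sub>F y in nhds z. y \<in> ball x0 r" by (rule eventually_nhds_in_open) (use zb in auto)
    thus "\<forall>\<^sub>F y in nhds z. V z - \<Psi> z \<le> V y - \<Psi> y"
    proof eventually_elim
      case (elim y) thus ?case using z(2)[of y] by simp
    qed
  qed
  have "(2 * s) *\<^sub>R mat 1 + (2 * (- s / 2)) *\<^sub>R mat 1 = s *\<^sub>R (mat 1 :: real ^ 'n ^ 'n)"
    unfolding scaleR_add_left[symmetric] by simp
  hence N_eq: "N = M z + s *\<^sub>R mat 1" by (simp add: N_def)
  have Nv: "h \<bullet> (N *v h) = h \<bullet> (M z *v h) + s * (norm h)\<^sup>2" for h
    by (simp add: N_eq matrix_vector_mult_add_rdistrib scaleR_matrix_vector inner_add_right power2_norm_eq_inner)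
  \<comment> \<open>For each superjet of U near z the determinant condition and the
    arithmetic-geometric mean inequality yield this linear inequality. Its left side is constant, so
    it passes through \<open>mollification\<close> to M z.\<close>
  have sums: "n * (F * (\<Prod>j\<in>UNIV. \<alpha> j)) powr (1 / n) \<le> (\<Sum>j\<in>UNIV. \<alpha> j * (v j \<bullet> (M z *v v j)))"
    if v: "v \<in> orthonormal_bases" and \<alpha>: "\<And>j. \<alpha> j > 0" for v \<alpha>
  proof (rule WL[rule_format, OF v \<alpha> \<rho>(3)])
    fix y b K assume y: "y \<in> ball z r" and K: "superjet u y b K"
    have "dist x0 y \<le> dist x0 z + dist z y" by (rule dist_triangle)
    hence y2: "dist x0 y < 2 * r" using y zb by simp
    have "superjet U y b K"
    proof (rule superjet_touch[OF K])
      have "\<forall>\<^sub>F w in nhds y. w \<in> ball x0 (2 * r)" by (rule eventually_nhds_in_open) (use y2 in auto)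
      thus "\<forall>\<^sub>F w in nhds y. U w - u w \<le> U y - u y"
        by eventually_elim (use u_eq y2 in auto)
    qed
    hence K2: "\<And>j. 0 \<le> v j \<bullet> (K *v v j)" "f y \<le> (\<Prod>j\<in>UNIV. v j \<bullet> (K *v v j))"
      using U(3) v in\<Omega>[of y] y2 r(1) unfolding ma_subsolution_def by auto
    have "F \<le> (\<Prod>j\<in>UNIV. v j \<bullet> (K *v v j))" using K2(2) Fl[of y] y2 r(1) by simp
    moreover have P: "(\<Prod>j\<in>UNIV. \<alpha> j) > 0" by (rule prod_pos) (use \<alpha> in auto)
    ultimately have "F * (\<Prod>j\<in>UNIV. \<alpha> j) \<le> (\<Prod>j\<in>UNIV. \<alpha> j * (v j \<bullet> (K *v v j)))"
      by (simp add: prod.distrib mult.commute)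
    hence "n * (F * (\<Prod>j\<in>UNIV. \<alpha> j)) powr (1 / n) \<le> n * (\<Prod>j\<in>UNIV. \<alpha> j * (v j \<bullet> (K *v v j))) powr (1 / n)"
      using F0 P by (intro mult_left_mono powr_mono2) auto
    also have "\<dots> \<le> (\<Sum>j\<in>UNIV. \<alpha> j * (v j \<bullet> (K *v v j)))"
      unfolding n_def by (intro amgm_prod mult_nonneg_nonneg K2(1) less_imp_le[OF \<alpha>])
    finally show "n * (F * (\<Prod>j\<in>UNIV. \<alpha> j)) powr (1 / n) \<le> (\<Sum>j\<in>UNIV. \<alpha> j * (v j \<bullet> (K *v v j)))" .
  qed
  have Mv: "0 \<le> v i \<bullet> (M z *v v i)"
    and prod: "F + s ^ n \<le> (\<Prod>j\<in>UNIV. v j \<bullet> (M z *v v j) + s)"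
    if v: "v \<in> orthonormal_bases" for v i
    using prod_lower_bound_from_sums[of F "\<lambda>j. v j \<bullet> (M z *v v j)" s] sums[OF v] F0 s(1)
    unfolding n_def by auto
  have "pos_def N"
    unfolding pos_def_def
  proof (intro conjI allI impI)
    show "transpose N = N" using jet by (simp add: subjet_def2)
    fix h :: "real ^ 'n" assume "h \<noteq> 0"
    moreover have "0 * (norm h)\<^sup>2 \<le> h \<bullet> (M z *v h)" by (rule quadratic_form_unit) (use Mv in auto)
    ultimately show "0 < h \<bullet> (N *v h)" using s by (simp add: Nv add_nonneg_pos)
  qed
  moreover have "z \<in> \<Omega>" using in\<Omega> zb r(1) by simp
  ultimately have "det N \<le> f z" using V(2) jet unfolding ma_supersolution_def by blast
  moreover obtain v where v: "v \<in> orthonormal_bases" "det N = (\<Prod>j\<in>UNIV. v j \<bullet> (N *v v j))"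
    using pos_def_diagonalization[OF \<open>pos_def N\<close>] by metis
  have "det N = (\<Prod>j\<in>UNIV. v j \<bullet> (M z *v v j) + s)"
    unfolding v(2) Nv by (simp add: orthonormal_basesD(3)[OF v(1)])
  moreover have "f z < F + s ^ n" using Fu[of z] zb r(1) by simp
  ultimately show False using prod[OF v(1)] by simp
qed

text \<open>Were \<open>U\<close> not convex along a segment, a paraboloid strictly concave along the segment and
  steep across it would touch \<open>U\<close> from above.\<close>

lemma ma_subsolution_convex:
  fixes U :: "real ^ 'n \<Rightarrow> real"
  assumes \<Omega>: "open \<Omega>" "convex \<Omega>" and U: "usc_on \<Omega> U" "ma_subsolution \<Omega> f U"
  shows "convex_on \<Omega> U"
proof (rule convex_onI[OF _ \<Omega>(2)], rule ccontr)
  fix t x y assume t: "0 < t" "t < (1::real)" and x: "x \<in> \<Omega>" and y: "y \<in> \<Omega>"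
    and "\<not> U ((1 - t) *\<^sub>R x + t *\<^sub>R y) \<le> (1 - t) * U x + t * U y"
  define m where "m = U ((1 - t) *\<^sub>R x + t *\<^sub>R y) - ((1 - t) * U x + t * U y)"
  have m: "m > 0" using \<open>\<not> U _ \<le> _\<close> by (simp add: m_def)
  have xy: "x \<noteq> y"
  proof
    assume "x = y" thus False using m by (simp add: m_def algebra_simps scaleR_add_left[symmetric])
  qed
  define l where "l = norm (y - x)"
  have l: "l > 0" using xy by (simp add: l_def)
  define e where "e = (1 / l) *\<^sub>R (y - x)"
  have e1: "norm e = 1" and e3: "y = x + l *\<^sub>R e" using l by (simp_all add: e_def l_def)
  note e = e1 e1[unfolded norm_eq_1] e3
  \<comment> \<open>Along the segment \<kappa> t (1 - t) is at most \<kappa> / 4 = m / 2, so the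
    concave correction uses up at most half of the convexity defect m.\<close>
  define \<kappa> where "\<kappa> = 2 * m"
  define P where "P = (\<lambda>z. (z - x) - ((z - x) \<bullet> e) *\<^sub>R e)"
  have P2: "(norm (P z))\<^sup>2 = (norm (z - x))\<^sup>2 - ((z - x) \<bullet> e)\<^sup>2" for z
  proof -
    define w where "w = z - x"
    have "e \<bullet> w = w \<bullet> e" by (rule inner_commute)
    thus ?thesis unfolding P_def power2_norm_eq_inner w_def[symmetric]
      by (simp add: inner_diff_left inner_diff_right e(2) power2_eq_square)
  qed
  have dec: "z = x + ((z - x) \<bullet> e) *\<^sub>R e + P z" for z by (simp add: P_def)
  have seg: "x + a *\<^sub>R e \<in> closed_segment x y" if "0 \<le> a" "a \<le> l" for a
  proof -
    have "x + a *\<^sub>R e = (1 - a / l) *\<^sub>R x + (a / l) *\<^sub>R y" using l by (simp add: e(3) algebra_simps)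
    thus ?thesis using that l by (auto simp: in_segment intro!: exI[of _ "a / l"])
  qed
  have "closed_segment x y \<subseteq> \<Omega>" using closed_segment_subset[OF x y \<Omega>(2)] .
  then obtain \<rho>0 where \<rho>0: "\<rho>0 > 0" "(\<Union>z\<in>closed_segment x y. ball z \<rho>0) \<subseteq> \<Omega>"
    using compact_subset_open_imp_ball_epsilon_subset[OF compact_segment \<Omega>(1)] by blast
  obtain d1 where d1: "d1 > 0" "\<And>z. z \<in> \<Omega> \<Longrightarrow> dist z x < d1 \<Longrightarrow> U z < U x + m / 2"
    using U(1) x m unfolding usc_on_def by (metis half_gt_zero less_add_same_cancel1)
  obtain d2 where d2: "d2 > 0" "\<And>z. z \<in> \<Omega> \<Longrightarrow> dist z y < d2 \<Longrightarrow> U z < U y + m / 2"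
    using U(1) y m unfolding usc_on_def by (metis half_gt_zero less_add_same_cancel1)
  \<comment> \<open>Keeps the tube \<open>C\<close> around the segment inside
    \<open>\<Omega>\<close>, and keeps U below its endpoint value plus m / 2 on the two end
    faces.\<close>
  define \<rho> where "\<rho> = min \<rho>0 (min d1 d2) / 2"
  have \<rho>: "\<rho> > 0" "\<rho> < \<rho>0" "\<rho> < d1" "\<rho> < d2" using \<rho>0(1) d1(1) d2(1) by (auto simp: \<rho>_def)
  define C where "C = {z. 0 \<le> (z - x) \<bullet> e \<and> (z - x) \<bullet> e \<le> l \<and> norm (P z) \<le> \<rho>}"
  have C\<Omega>: "C \<subseteq> \<Omega>"
  proof
    fix z assume z: "z \<in> C"
    have "dist (x + ((z - x) \<bullet> e) *\<^sub>R e) z = norm (P z)"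
      by (subst dec[of z], simp add: dist_norm)
    hence "z \<in> ball (x + ((z - x) \<bullet> e) *\<^sub>R e) \<rho>0" using z \<rho> by (simp add: C_def)
    moreover have "x + ((z - x) \<bullet> e) *\<^sub>R e \<in> closed_segment x y" using seg z by (simp add: C_def)
    ultimately show "z \<in> \<Omega>" using \<rho>0(2) by blast
  qed
  have cC: "compact C"
  proof -
    have "closed C" unfolding C_def P_def
      by (intro closed_Collect_conj closed_Collect_le continuous_intros)
    moreover have "bounded C"
    proof (rule boundedI)
      fix z assume z: "z \<in> C"
      have "norm z \<le> norm x + norm (((z - x) \<bullet> e) *\<^sub>R e) + norm (P z)"
        by (subst dec[of z], rule order_trans[OF norm_triangle_ineq add_right_mono[OF norm_triangle_ineq]])
      also have "\<dots> \<le> norm x + l + \<rho>" using z by (simp add: C_def e)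
      finally show "norm z \<le> norm x + l + \<rho>" .
    qed
    ultimately show ?thesis by (simp add: compact_eq_bounded_closed)
  qed
  have xC: "x \<in> C" using l \<rho> by (simp add: C_def P_def)
  have uscC: "usc_on C U" by (rule usc_on_subset[OF U(1) C\<Omega>])
  obtain zm where zm: "zm \<in> C" "\<And>z. z \<in> C \<Longrightarrow> U z \<le> U zm"
    using usc_attains_sup[OF cC _ uscC] xC by blast
  define K where "K = U zm + \<bar>U x\<bar> + \<bar>U y\<bar>"
  \<comment> \<open>On the lateral surface the paraboloid gains A \<rho>^2 = |K| + 1, more than U
    can exceed the interpolated endpoint values.\<close>
  define A where "A = (\<bar>K\<bar> + 1) / \<rho>\<^sup>2"
  have A: "A * \<rho>\<^sup>2 = \<bar>K\<bar> + 1" "A > 0" using \<rho> by (auto simp: A_def add_nonneg_pos)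
  \<comment> \<open>Curvature 2 A across the segment and -2 \<kappa> / l^2 along it: the negative
    direction contradicts the nonnegativity demanded of superjets.\<close>
  define M where "M = (2 * A) *\<^sub>R mat 1 + (- (2 * A + 2 * \<kappa> / l\<^sup>2)) *\<^sub>R outer e"
  have symM: "transpose M = M" by (simp add: M_def transpose_add transpose_scaleR transpose_outer)
  have Mw: "w \<bullet> (M *v w) / 2 = A * ((norm w)\<^sup>2 - (w \<bullet> e)\<^sup>2) - \<kappa> * (w \<bullet> e / l)\<^sup>2" for w
  proof -
    have "e \<bullet> w = w \<bullet> e" "w \<bullet> w = norm w * norm w"
      by (rule inner_commute, simp add: dot_square_norm power2_eq_square)
    thus ?thesis
      by (simp add: M_def matrix_vector_mult_add_rdistrib scaleR_matrix_vector outer_vector inner_add_right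
        power2_eq_square add_divide_distrib diff_divide_distrib algebra_simps)
  qed
  \<comment> \<open>Makes the paraboloid on the segment equal to the linear interpolation of U x and
    U y plus \<kappa> \<sigma> (1 - \<sigma>), with \<sigma> the relative position.\<close>
  define b where "b = ((U y - U x + \<kappa>) / l) *\<^sub>R e"
  define \<phi> where "\<phi> = (\<lambda>z. U x + b \<bullet> (z - x) + (z - x) \<bullet> (M *v (z - x)) / 2)"
  have \<phi>: "\<phi> z = U x + (U y - U x) * \<sigma> - \<kappa> * \<sigma> * (\<sigma> - 1) + A * (norm (P z))\<^sup>2"
    if "\<sigma> = (z - x) \<bullet> e / l" for z \<sigma>
  proof -
    define w where "w = z - x"
    have "e \<bullet> w = w \<bullet> e" by (rule inner_commute)
    thus ?thesis unfolding \<phi>_def Mw P2 that b_def w_def[symmetric]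
      by (simp add: power2_eq_square algebra_simps add_divide_distrib diff_divide_distrib)
  qed
  have "usc_on C (\<lambda>z. U z + (- \<phi> z))"
    unfolding \<phi>_def by (intro usc_on_add uscC continuous_on_imp_usc continuous_intros) auto
  hence "\<exists>z0\<in>C. \<forall>z\<in>C. U z + (- \<phi> z) \<le> U z0 + (- \<phi> z0)"
    using xC by (intro usc_attains_sup cC) auto
  then obtain z0 where z0: "z0 \<in> C" "\<And>z. z \<in> C \<Longrightarrow> U z - \<phi> z \<le> U z0 - \<phi> z0"
    by auto
  define zt where "zt = (1 - t) *\<^sub>R x + t *\<^sub>R y"
  have zt: "zt = x + (t * l) *\<^sub>R e" by (simp add: zt_def e(3) algebra_simps)
  have Pzt: "P zt = 0" "(zt - x) \<bullet> e / l = t" using l by (auto simp: P_def zt e)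
  have ztC: "zt \<in> C" using Pzt t l \<rho> by (auto simp: C_def zt e mult_le_cancel_right1)
  have "\<phi> zt = U x + (U y - U x) * t - \<kappa> * t * (t - 1)"
    using \<phi>[OF Pzt(2)[symmetric]] Pzt(1) by simp
  moreover have "m = U zt - ((1 - t) * U x + t * U y)" by (simp add: m_def zt_def)
  ultimately have "U zt - \<phi> zt = m + \<kappa> * (t * (t - 1))" by (simp add: algebra_simps)
  moreover have "t * (t - 1) \<ge> - 1 / 4"
  proof -
    have "0 \<le> (t - 1 / 2)\<^sup>2" by simp
    thus ?thesis by (simp add: power2_eq_square algebra_simps)
  qed
  hence "\<kappa> * (t * (t - 1)) \<ge> \<kappa> * (- 1 / 4)" using m by (intro mult_left_mono) (auto simp: \<kappa>_def)
  ultimately have "m / 2 \<le> U zt - \<phi> zt" by (simp add: \<kappa>_def)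
  hence ge: "m / 2 \<le> U z0 - \<phi> z0" using z0(2)[OF ztC] by linarith
  define \<sigma> where "\<sigma> = (z0 - x) \<bullet> e / l"
  have \<sigma>: "0 \<le> \<sigma>" "\<sigma> \<le> 1" using z0(1) l by (auto simp: C_def \<sigma>_def)
  note \<phi>0 = \<phi>[OF \<sigma>_def]
  have Ap: "A * (norm (P z0))\<^sup>2 \<ge> 0" using A by simp
  have s0: "\<sigma> \<noteq> 0"
  proof
    assume "\<sigma> = 0"
    hence "(z0 - x) \<bullet> e = 0" using l by (simp add: \<sigma>_def)
    hence "dist z0 x = norm (P z0)" by (simp add: P_def dist_norm)
    hence "U z0 < U x + m / 2" using d1(2) z0(1) C\<Omega> \<rho> by (auto simp: C_def)
    thus False using ge \<phi>0 \<open>\<sigma> = 0\<close> Ap by simp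
  qed
  have s1: "\<sigma> \<noteq> 1"
  proof
    assume "\<sigma> = 1"
    hence "(z0 - x) \<bullet> e = l" using l by (simp add: \<sigma>_def)
    hence "dist z0 y = norm (P z0)" by (simp add: P_def dist_norm e(3) algebra_simps)
    hence "U z0 < U y + m / 2" using d2(2) z0(1) C\<Omega> \<rho> by (auto simp: C_def)
    thus False using ge \<phi>0 \<open>\<sigma> = 1\<close> Ap by simp
  qed
  have s2: "norm (P z0) \<noteq> \<rho>"
  proof
    assume "norm (P z0) = \<rho>"
    hence "\<phi> z0 = ((1 - \<sigma>) * U x + \<sigma> * U y) + \<kappa> * (\<sigma> * (1 - \<sigma>)) + (\<bar>K\<bar> + 1)"
      unfolding \<phi>0 using A(1) by (simp add: algebra_simps)
    moreover have "\<kappa> * (\<sigma> * (1 - \<sigma>)) \<ge> 0" using m \<sigma> by (simp add: \<kappa>_def)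
    moreover have "(1 - \<sigma>) * U x \<ge> - \<bar>U x\<bar>"
    proof -
      have "\<bar>(1 - \<sigma>) * U x\<bar> \<le> 1 * \<bar>U x\<bar>" unfolding abs_mult using \<sigma> by (intro mult_right_mono) auto
      thus ?thesis by linarith
    qed
    moreover have "\<sigma> * U y \<ge> - \<bar>U y\<bar>"
    proof -
      have "\<bar>\<sigma> * U y\<bar> \<le> 1 * \<bar>U y\<bar>" unfolding abs_mult using \<sigma> by (intro mult_right_mono) auto
      thus ?thesis by linarith
    qed
    moreover have "U z0 \<le> U zm" using zm(2)[OF z0(1)] .
    ultimately show False using ge m abs_ge_self[of K] unfolding K_def by linarith
  qed
  define I where "I = {z. 0 < (z - x) \<bullet> e \<and> (z - x) \<bullet> e < l \<and> norm (P z) < \<rho>}"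
  have "open I" unfolding I_def P_def
    by (intro open_Collect_conj open_Collect_less continuous_intros)
  moreover have "z0 \<in> I" using s0 s1 s2 z0(1) l by (auto simp: I_def C_def \<sigma>_def)
  ultimately have ev: "\<forall>\<^sub>F z in nhds z0. z \<in> I" by (rule eventually_nhds_in_open)
  have "superjet U z0 (b + M *v (z0 - x)) M"
  proof (rule superjet_touch[OF quadratic_jets(1)[OF symM]])
    show "\<forall>\<^sub>F z in nhds z0. U z - (U x + b \<bullet> (z - x) + (z - x) \<bullet> (M *v (z - x)) / 2) \<le>
        U z0 - (U x + b \<bullet> (z0 - x) + (z0 - x) \<bullet> (M *v (z0 - x)) / 2)"
      using ev
    proof eventually_elim
      case (elim z)
      hence "z \<in> C" by (simp add: I_def C_def)
      from z0(2)[OF this] show ?case by (simp add: \<phi>_def)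
    qed
  qed
  moreover obtain v k where v: "v \<in> orthonormal_bases" "v k = e" using unit_vector_in_basis[OF e(1)] by blast
  ultimately have "0 \<le> e \<bullet> (M *v e)"
    using U(2) z0(1) C\<Omega> unfolding ma_subsolution_def by (metis subsetD)
  moreover have "e \<bullet> (M *v e) / 2 < 0"
    unfolding Mw using m l by (simp add: e \<kappa>_def)
  ultimately show False by simp
qed

section \<open>Viscosity solutions and jets\<close>

lemma gradient_has_derivative:
  assumes "\<phi> differentiable (at x)"
  shows "(\<phi> has_derivative (\<lambda>h. gradient \<phi> x \<bullet> h)) (at x)"
proof -
  have d: "(\<phi> has_derivative frechet_derivative \<phi> (at x)) (at x)"
    using assms frechet_derivative_works by blast
  have lin: "linear (frechet_derivative \<phi> (at x))"
    using has_derivative_bounded_linear[OF d] bounded_linear.linear by blast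
  have "frechet_derivative \<phi> (at x) h = gradient \<phi> x \<bullet> h" for h
  proof -
    have "h = (\<Sum>i\<in>UNIV. h $ i *\<^sub>R axis i 1)"
      using basis_expansion[of h] by (simp add: scalar_mult_eq_scaleR)
    hence "frechet_derivative \<phi> (at x) h = frechet_derivative \<phi> (at x) (\<Sum>i\<in>UNIV. h $ i *\<^sub>R axis i 1)" by simp
    also have "\<dots> = (\<Sum>i\<in>UNIV. h $ i * frechet_derivative \<phi> (at x) (axis i 1))"
      by (simp add: linear_sum[OF lin] linear_cmul[OF lin])
    also have "\<dots> = gradient \<phi> x \<bullet> h" by (simp add: gradient_def inner_vec_def mult.commute)
    finally show ?thesis .
  qed
  thus ?thesis using d by (metis (no_types, lifting) ext)
qed

lemma hessian_has_derivative:
  assumes "gradient \<phi> differentiable (at x)"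
  shows "(gradient \<phi> has_derivative (\<lambda>h. hessian \<phi> x *v h)) (at x)"
proof -
  have d: "(gradient \<phi> has_derivative frechet_derivative (gradient \<phi>) (at x)) (at x)"
    using assms frechet_derivative_works by blast
  have lin: "linear (frechet_derivative (gradient \<phi>) (at x))"
    using has_derivative_bounded_linear[OF d] bounded_linear.linear by blast
  have "frechet_derivative (gradient \<phi>) (at x) h = hessian \<phi> x *v h" for h
    unfolding hessian_def using matrix_works[OF lin[unfolded linear_matrix_vector_mul_eq[symmetric]]] by simp
  thus ?thesis using d by (metis (no_types, lifting) ext)
qed

lemma gradient_difference_bound:
  assumes "gradient \<phi> differentiable (at x)" "e > 0"
  obtains d where "d > 0" "\<And>k. norm k < d \<Longrightarrow>
    norm (gradient \<phi> (x + k) - gradient \<phi> x - hessian \<phi> x *v k) \<le> e * norm k"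
proof -
  obtain d where d: "d > 0" "\<And>y. norm (y - x) < d \<Longrightarrow>
    norm (gradient \<phi> y - gradient \<phi> x - hessian \<phi> x *v (y - x)) \<le> e * norm (y - x)"
    using hessian_has_derivative[OF assms(1)] assms(2) unfolding has_derivative_at_alt by meson
  show thesis by (rule that[OF d(1)]) (use d(2)[of "x + _"] in simp)
qed

text \<open>Symmetry from differentiability of the gradient at the single point x: the mixed second
  difference is symmetric in h and k, and the mean value theorem in direction h identifies it with
  s^2 times h . D k up to a small multiple of s^2.\<close>

lemma hessian_symmetric:
  fixes \<phi> :: "real ^ 'n \<Rightarrow> real"
  assumes \<Omega>: "open \<Omega>" "x \<in> \<Omega>" and \<phi>: "\<And>y. y \<in> \<Omega> \<Longrightarrow> \<phi> differentiable (at y)"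
    and g: "gradient \<phi> differentiable (at x)"
  shows "transpose (hessian \<phi> x) = hessian \<phi> x"
proof (rule symmetric_matrixI)
  fix h k :: "real ^ 'n"
  let ?D = "hessian \<phi> x"
  \<comment> \<open>Formulated for arbitrary h and k, since it is applied a second time with their
    roles exchanged.\<close>
  have half: "\<bar>\<phi> (x + s *\<^sub>R h + s *\<^sub>R k) - \<phi> (x + s *\<^sub>R h) - \<phi> (x + s *\<^sub>R k) + \<phi> x - s\<^sup>2 * (h \<bullet> (?D *v k))\<bar>
      \<le> 2 * e * s\<^sup>2 * (norm h + norm k)\<^sup>2"
    if e: "e > 0" and d: "\<And>z. norm z < d \<Longrightarrow> norm (gradient \<phi> (x + z) - gradient \<phi> x - ?D *v z) \<le> e * norm z"
      and s: "s > 0" "s * (norm h + norm k) < d" and ball: "ball x d \<subseteq> \<Omega>" for e d s and h k :: "real ^ 'n"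
  proof -
    define G where "G = (\<lambda>t. \<phi> (x + t *\<^sub>R (s *\<^sub>R h) + s *\<^sub>R k) - \<phi> (x + t *\<^sub>R (s *\<^sub>R h)))"
    define r where "r = (\<lambda>z. gradient \<phi> (x + z) - gradient \<phi> x - ?D *v z)"
    have small: "norm (t *\<^sub>R (s *\<^sub>R h) + s *\<^sub>R k) \<le> s * (norm h + norm k)" "norm (t *\<^sub>R (s *\<^sub>R h)) \<le> s * (norm h + norm k)"
      if "0 \<le> t" "t \<le> 1" for t
    proof -
      have "t * (s * norm h) \<le> 1 * (s * norm h)" using that s by (intro mult_right_mono) auto
      hence a: "norm (t *\<^sub>R (s *\<^sub>R h)) \<le> s * norm h" using that s by simp
      have "norm (t *\<^sub>R (s *\<^sub>R h) + s *\<^sub>R k) \<le> norm (t *\<^sub>R (s *\<^sub>R h)) + norm (s *\<^sub>R k)" by (rule norm_triangle_ineq)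
      thus "norm (t *\<^sub>R (s *\<^sub>R h) + s *\<^sub>R k) \<le> s * (norm h + norm k)" using a s by (simp add: distrib_left)
      have "0 \<le> s * norm k" using s by simp
      thus "norm (t *\<^sub>R (s *\<^sub>R h)) \<le> s * (norm h + norm k)" using a by (simp add: distrib_left)
    qed
    have der: "(G has_real_derivative
        (gradient \<phi> (x + (t *\<^sub>R (s *\<^sub>R h) + s *\<^sub>R k)) - gradient \<phi> (x + t *\<^sub>R (s *\<^sub>R h))) \<bullet> (s *\<^sub>R h)) (at t)"
      if t: "0 \<le> t" "t \<le> 1" for t
    proof -
      have i: "x + t *\<^sub>R (s *\<^sub>R h) + s *\<^sub>R k \<in> \<Omega>" "x + t *\<^sub>R (s *\<^sub>R h) \<in> \<Omega>"
      proof -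
        have "dist x (x + w) = norm w" for w :: "real ^ 'n" by (simp add: dist_norm)
        hence "dist x (x + (t *\<^sub>R (s *\<^sub>R h) + s *\<^sub>R k)) < d" using le_less_trans[OF small(1)[OF t] s(2)] by metis
        thus "x + t *\<^sub>R (s *\<^sub>R h) + s *\<^sub>R k \<in> \<Omega>" using ball by (auto simp: add.assoc)
        have "dist x (x + t *\<^sub>R (s *\<^sub>R h)) < d" using small(2)[OF t] s by (simp add: dist_norm)
        thus "x + t *\<^sub>R (s *\<^sub>R h) \<in> \<Omega>" using ball by auto
      qed
      have l1: "((\<lambda>t. x + t *\<^sub>R (s *\<^sub>R h) + s *\<^sub>R k) has_derivative (\<lambda>u. u *\<^sub>R (s *\<^sub>R h))) (at t)"
        and l2: "((\<lambda>t. x + t *\<^sub>R (s *\<^sub>R h)) has_derivative (\<lambda>u. u *\<^sub>R (s *\<^sub>R h))) (at t)"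
        by (auto intro!: derivative_eq_intros)
      have "(G has_derivative (\<lambda>u. gradient \<phi> (x + t *\<^sub>R (s *\<^sub>R h) + s *\<^sub>R k) \<bullet> (u *\<^sub>R (s *\<^sub>R h)) -
         gradient \<phi> (x + t *\<^sub>R (s *\<^sub>R h)) \<bullet> (u *\<^sub>R (s *\<^sub>R h)))) (at t)"
        unfolding G_def
        by (intro has_derivative_diff has_derivative_compose[OF l1 gradient_has_derivative[OF \<phi>[OF i(1)]]]
           has_derivative_compose[OF l2 gradient_has_derivative[OF \<phi>[OF i(2)]]])
      thus ?thesis unfolding has_field_derivative_def
        by (rule has_derivative_eq_rhs) (auto simp: inner_diff_left algebra_simps)
    qed
    obtain t where t: "0 < t" "t < 1" "G 1 - G 0 = (1 - 0) *
       ((gradient \<phi> (x + (t *\<^sub>R (s *\<^sub>R h) + s *\<^sub>R k)) - gradient \<phi> (x + t *\<^sub>R (s *\<^sub>R h))) \<bullet> (s *\<^sub>R h))"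
      using MVT2[of 0 1 G, OF _ der] by auto
    define z w where "z = t *\<^sub>R (s *\<^sub>R h) + s *\<^sub>R k" and "w = t *\<^sub>R (s *\<^sub>R h)"
    have "gradient \<phi> (x + z) - gradient \<phi> (x + w) = ?D *v (z - w) + r z - r w"
      by (simp add: r_def matrix_vector_mult_diff_distrib)
    hence "G 1 - G 0 = (?D *v (s *\<^sub>R k) + r z - r w) \<bullet> (s *\<^sub>R h)"
      using t(3) by (simp add: z_def w_def)
    also have "\<dots> = s\<^sup>2 * (h \<bullet> (?D *v k)) + s * ((r z - r w) \<bullet> h)"
      by (simp add: inner_add_left inner_diff_left matrix_vector_mult_scaleR inner_commute power2_eq_square algebra_simps)
    finally have "G 1 - G 0 - s\<^sup>2 * (h \<bullet> (?D *v k)) = s * ((r z - r w) \<bullet> h)" by simp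
    moreover have "\<bar>s * ((r z - r w) \<bullet> h)\<bar> \<le> 2 * e * s\<^sup>2 * (norm h + norm k)\<^sup>2"
    proof -
      have z: "norm z \<le> s * (norm h + norm k)" "norm w \<le> s * (norm h + norm k)"
        using small[of t] t by (auto simp: z_def w_def)
      have "norm (r z) \<le> e * (s * (norm h + norm k))"
        using d[of z] z(1) s e unfolding r_def by (meson le_less_trans mult_left_mono order_trans less_imp_le)
      moreover have "norm (r w) \<le> e * (s * (norm h + norm k))"
        using d[of w] z(2) s e unfolding r_def by (meson le_less_trans mult_left_mono order_trans less_imp_le)
      ultimately have rr: "norm (r z - r w) \<le> 2 * e * s * (norm h + norm k)"
        using norm_triangle_ineq4[of "r z" "r w"] by (simp add: mult.assoc)
      have "\<bar>(r z - r w) \<bullet> h\<bar> \<le> norm (r z - r w) * norm h" by (rule Cauchy_Schwarz_ineq2)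
      also have "\<dots> \<le> (2 * e * s * (norm h + norm k)) * (norm h + norm k)"
        using rr by (intro mult_mono) (use e s in auto)
      finally have "s * \<bar>(r z - r w) \<bullet> h\<bar> \<le> s * ((2 * e * s * (norm h + norm k)) * (norm h + norm k))"
        using s by (intro mult_left_mono) auto
      thus ?thesis using s by (simp add: abs_mult power2_eq_square mult_ac)
    qed
    moreover have "G 1 - G 0 = \<phi> (x + s *\<^sub>R h + s *\<^sub>R k) - \<phi> (x + s *\<^sub>R h) - \<phi> (x + s *\<^sub>R k) + \<phi> x"
      by (simp add: G_def)
    ultimately show ?thesis by simp
  qed
  have "\<bar>h \<bullet> (?D *v k) - k \<bullet> (?D *v h)\<bar> \<le> 0"
  proof (rule field_le_epsilon)
    fix e :: real assume e: "e > 0"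
    define N where "N = norm h + norm k + 1"
    have N: "N > 0" unfolding N_def by (simp add: add_nonneg_pos)
    define e' where "e' = e / (4 * N\<^sup>2)"
    have e': "e' > 0" using e N by (simp add: e'_def)
    obtain d1 where d1: "d1 > 0" "\<And>z. norm z < d1 \<Longrightarrow> norm (gradient \<phi> (x + z) - gradient \<phi> x - ?D *v z) \<le> e' * norm z"
      using gradient_difference_bound[OF g e'] by blast
    obtain d2 where d2: "d2 > 0" "ball x d2 \<subseteq> \<Omega>" using \<Omega> open_contains_ball by blast
    define d where "d = min d1 d2"
    have d: "d > 0" "ball x d \<subseteq> \<Omega>" "\<And>z. norm z < d \<Longrightarrow> norm (gradient \<phi> (x + z) - gradient \<phi> x - ?D *v z) \<le> e' * norm z"
      using d1 d2 by (auto simp: d_def)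
    define s where "s = d / (2 * N)"
    have s: "s > 0" using d N by (simp add: s_def)
    have "s * (norm h + norm k) \<le> s * N" using s by (simp add: N_def)
    also have "\<dots> < d" using N d by (simp add: s_def)
    finally have sd: "s * (norm h + norm k) < d" "s * (norm k + norm h) < d" by (simp_all add: add.commute)
    note A = half[OF e' d(3) s sd(1) d(2)] and B = half[OF e' d(3) s sd(2) d(2)]
    have eq: "x + s *\<^sub>R k + s *\<^sub>R h = x + s *\<^sub>R h + s *\<^sub>R k" by simp
    have "\<bar>s\<^sup>2 * (h \<bullet> (?D *v k)) - s\<^sup>2 * (k \<bullet> (?D *v h))\<bar> \<le> 4 * e' * s\<^sup>2 * (norm h + norm k)\<^sup>2"
      using A B unfolding eq by (simp add: add.commute[of "norm k"])
    also have "\<dots> \<le> 4 * e' * s\<^sup>2 * N\<^sup>2"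
      using e' by (intro mult_left_mono power_mono) (auto simp: N_def)
    also have "\<dots> = s\<^sup>2 * e" using N by (simp add: e'_def)
    finally have "s\<^sup>2 * \<bar>h \<bullet> (?D *v k) - k \<bullet> (?D *v h)\<bar> \<le> s\<^sup>2 * e"
      by (simp add: right_diff_distrib[symmetric] abs_mult)
    thus "\<bar>h \<bullet> (?D *v k) - k \<bullet> (?D *v h)\<bar> \<le> 0 + e" using s by simp
  qed
  thus "h \<bullet> (?D *v k) = k \<bullet> (?D *v h)" by simp
qed

text \<open>The Peano form of Taylor's theorem: the mean value theorem along the segment, applied to
  \<phi> minus its quadratic polynomial, reduces the claim to the differentiability of the gradient
  at x.\<close>

lemma differentiable_jets:
  fixes \<phi> :: "real ^ 'n \<Rightarrow> real"
  assumes \<Omega>: "open \<Omega>" "x \<in> \<Omega>" and \<phi>: "\<And>y. y \<in> \<Omega> \<Longrightarrow> \<phi> differentiable (at y)"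
    and g: "gradient \<phi> differentiable (at x)"
  shows "superjet \<phi> x (gradient \<phi> x) (hessian \<phi> x)" "subjet \<phi> x (gradient \<phi> x) (hessian \<phi> x)"
proof -
  let ?D = "hessian \<phi> x"
  have sym: "transpose ?D = ?D" by (rule hessian_symmetric[OF assms])
  have "\<forall>\<^sub>F y in nhds x. \<bar>\<phi> y - \<phi> x - gradient \<phi> x \<bullet> (y - x) - (y - x) \<bullet> (?D *v (y - x)) / 2\<bar> \<le> e * (norm (y - x))\<^sup>2"
    if e: "e > 0" for e
  proof -
    obtain d1 where d1: "d1 > 0" "\<And>z. norm z < d1 \<Longrightarrow> norm (gradient \<phi> (x + z) - gradient \<phi> x - ?D *v z) \<le> e * norm z"
      using gradient_difference_bound[OF g e] by blast
    obtain d2 where d2: "d2 > 0" "ball x d2 \<subseteq> \<Omega>" using \<Omega> open_contains_ball by blast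
    have "\<bar>\<phi> y - \<phi> x - gradient \<phi> x \<bullet> (y - x) - (y - x) \<bullet> (?D *v (y - x)) / 2\<bar> \<le> e * (norm (y - x))\<^sup>2"
      if y: "dist y x < min d1 d2" for y
    proof -
      define h where "h = y - x"
      have h: "norm h < d1" "norm h < d2" using y by (auto simp: h_def dist_norm)
      define G where "G = (\<lambda>t. \<phi> (x + t *\<^sub>R h) - t * (gradient \<phi> x \<bullet> h) - t\<^sup>2 * (h \<bullet> (?D *v h)) / 2)"
      have th: "norm (t *\<^sub>R h) \<le> norm h" if "0 \<le> t" "t \<le> 1" for t
        using that by (simp add: mult_left_le_one_le)
      have der: "(G has_real_derivative (gradient \<phi> (x + t *\<^sub>R h) - gradient \<phi> x - ?D *v (t *\<^sub>R h)) \<bullet> h) (at t)"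
        if t: "0 \<le> t" "t \<le> 1" for t
      proof -
        have "dist x (x + t *\<^sub>R h) < d2" using th[OF t] h by (simp add: dist_norm)
        hence i: "x + t *\<^sub>R h \<in> \<Omega>" using d2 by auto
        have l: "((\<lambda>t. x + t *\<^sub>R h) has_derivative (\<lambda>u. u *\<^sub>R h)) (at t)"
          by (auto intro!: derivative_eq_intros)
        have "((\<lambda>t. \<phi> (x + t *\<^sub>R h)) has_derivative (\<lambda>u. gradient \<phi> (x + t *\<^sub>R h) \<bullet> (u *\<^sub>R h))) (at t)"
          by (rule has_derivative_compose[OF l gradient_has_derivative[OF \<phi>[OF i]]])
        hence "((\<lambda>t. \<phi> (x + t *\<^sub>R h)) has_real_derivative gradient \<phi> (x + t *\<^sub>R h) \<bullet> h) (at t)"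
          unfolding has_field_derivative_def by (rule has_derivative_eq_rhs) (auto simp: mult.commute)
        thus ?thesis unfolding G_def
          by (auto intro!: derivative_eq_intros simp: inner_diff_left inner_diff_right matrix_vector_mult_scaleR inner_commute)
      qed
      obtain t where t: "0 < t" "t < 1" "G 1 - G 0 = (1 - 0) *
          ((gradient \<phi> (x + t *\<^sub>R h) - gradient \<phi> x - ?D *v (t *\<^sub>R h)) \<bullet> h)"
        using MVT2[of 0 1 G, OF _ der] by auto
      have "\<bar>G 1 - G 0\<bar> \<le> norm (gradient \<phi> (x + t *\<^sub>R h) - gradient \<phi> x - ?D *v (t *\<^sub>R h)) * norm h"
        using t(3) Cauchy_Schwarz_ineq2 by simp
      also have "\<dots> \<le> (e * norm h) * norm h"
      proof (rule mult_right_mono)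
        have "norm (t *\<^sub>R h) \<le> norm h" using th t by simp
        moreover from this have "norm (gradient \<phi> (x + t *\<^sub>R h) - gradient \<phi> x - ?D *v (t *\<^sub>R h)) \<le> e * norm (t *\<^sub>R h)"
          using h by (intro d1(2)) simp
        moreover have "e * norm (t *\<^sub>R h) \<le> e * norm h" using calculation(1) e by (intro mult_left_mono) auto
        ultimately show "norm (gradient \<phi> (x + t *\<^sub>R h) - gradient \<phi> x - ?D *v (t *\<^sub>R h)) \<le> e * norm h" by linarith
      qed simp
      finally show ?thesis by (simp add: G_def h_def power2_eq_square)
    qed
    thus ?thesis unfolding eventually_nhds_metric using d1(1) d2(1)
      by (intro exI[of _ "min d1 d2"]) auto
  qed
  note ev = this
  show "superjet \<phi> x (gradient \<phi> x) ?D" unfolding superjet_def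
  proof (intro conjI allI impI sym)
    fix e :: real assume "e > 0"
    from ev[OF this] show "\<forall>\<^sub>F y in nhds x. \<phi> y \<le> \<phi> x + gradient \<phi> x \<bullet> (y - x) + (y - x) \<bullet> (?D *v (y - x)) / 2 +
      e * (norm (y - x))\<^sup>2" by eventually_elim simp
  qed
  show "subjet \<phi> x (gradient \<phi> x) ?D" unfolding subjet_def2
  proof (intro conjI allI impI sym)
    fix e :: real assume "e > 0"
    from ev[OF this] show "\<forall>\<^sub>F y in nhds x. \<phi> y \<ge> \<phi> x + gradient \<phi> x \<bullet> (y - x) + (y - x) \<bullet> (?D *v (y - x)) / 2 -
      e * (norm (y - x))\<^sup>2" by eventually_elim simp
  qed
qed

text \<open>Midpoint convexity at x between x + t h and x - t h, inserted into the superjet bound;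
  the gradient cancels.\<close>

lemma convex_superjet_nonneg:
  fixes u :: "real ^ 'n \<Rightarrow> real"
  assumes u: "convex_on \<Omega> u" and \<Omega>: "open \<Omega>" "x \<in> \<Omega>" and jet: "superjet u x b M"
  shows "0 \<le> h \<bullet> (M *v h)"
proof (cases "h = 0")
  case False
  show ?thesis
  proof (rule field_le_epsilon)
    fix e :: real assume e: "e > 0"
    define k where "k = e / (2 * (norm h)\<^sup>2)"
    have k: "k > 0" "2 * k * (norm h)\<^sup>2 = e" using e False by (auto simp: k_def)
    have "\<forall>\<^sub>F y in nhds x. u y \<le> u x + b \<bullet> (y - x) + (y - x) \<bullet> (M *v (y - x)) / 2 + k * (norm (y - x))\<^sup>2"
      using jet k unfolding superjet_def by blast
    moreover have "\<forall>\<^sub>F y in nhds x. y \<in> \<Omega>" by (rule eventually_nhds_in_open[OF \<Omega>])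
    ultimately have "\<forall>\<^sub>F y in nhds x. y \<in> \<Omega> \<and>
      u y \<le> u x + b \<bullet> (y - x) + (y - x) \<bullet> (M *v (y - x)) / 2 + k * (norm (y - x))\<^sup>2"
      by eventually_elim simp
    then obtain d where d: "d > 0" "\<And>y. dist y x < d \<Longrightarrow> y \<in> \<Omega> \<and>
      u y \<le> u x + b \<bullet> (y - x) + (y - x) \<bullet> (M *v (y - x)) / 2 + k * (norm (y - x))\<^sup>2"
      unfolding eventually_nhds_metric by blast
    define t where "t = d / (2 * norm h)"
    have t: "t > 0" "t * norm h < d" using d(1) False by (auto simp: t_def)
    have p: "dist (x + t *\<^sub>R h) x < d" "dist (x + (- t) *\<^sub>R h) x < d" using t by (simp_all add: dist_norm)
    have mid: "(1 - 1 / 2) *\<^sub>R (x + t *\<^sub>R h) + (1 / 2) *\<^sub>R (x + (- t) *\<^sub>R h) = x"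
      by (simp add: algebra_simps scaleR_add_left[symmetric])
    have "u x \<le> (1 - 1 / 2) * u (x + t *\<^sub>R h) + (1 / 2) * u (x + (- t) *\<^sub>R h)"
      using convex_onD[OF u, of "1 / 2" "x + t *\<^sub>R h" "x + (- t) *\<^sub>R h"] d(2)[OF p(1)] d(2)[OF p(2)]
      unfolding mid by simp
    moreover note conjunct2[OF d(2)[OF p(1)]] conjunct2[OF d(2)[OF p(2)]]
    ultimately have "0 \<le> t\<^sup>2 * (h \<bullet> (M *v h)) + 2 * k * t\<^sup>2 * (norm h)\<^sup>2"
      using t(1) by (simp add: matrix_vector_mult_scaleR matrix_vector_uminus power_mult_distrib power2_eq_square algebra_simps)
    hence "0 \<le> t\<^sup>2 * (h \<bullet> (M *v h) + 2 * k * (norm h)\<^sup>2)" by (simp add: algebra_simps)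
    thus "0 \<le> h \<bullet> (M *v h) + e" using t(1) k(2) by (simp add: zero_le_mult_iff)
  qed
qed simp

lemma quadratic_C2:
  fixes M :: "real ^ 'n ^ 'n" and b c :: "real ^ 'n" and k :: real
  assumes sym: "transpose M = M"
  defines "\<phi> \<equiv> \<lambda>y. k + b \<bullet> (y - c) + (y - c) \<bullet> (M *v (y - c)) / 2"
  shows "C2_on S \<phi>" "hessian \<phi> x = M"
    and "(\<And>h. 0 \<le> h \<bullet> (M *v h)) \<Longrightarrow> convex S \<Longrightarrow> convex_on S \<phi>"
proof -
  have d0: "((\<lambda>y. y - c) has_derivative (\<lambda>h. h)) (at y)" for y
    by (auto intro!: derivative_eq_intros)
  have d: "(\<phi> has_derivative (\<lambda>h. (b + M *v (y - c)) \<bullet> h)) (at y)" for y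
  proof -
    have l: "((\<lambda>y. M *v (y - c)) has_derivative (\<lambda>h. M *v h)) (at y)"
      by (rule bounded_linear.has_derivative[OF matrix_vector_mul_bounded_linear[of M] d0])
    have "(\<phi> has_derivative (\<lambda>h. b \<bullet> h + ((y - c) \<bullet> (M *v h) + h \<bullet> (M *v (y - c))) / 2)) (at y)"
      unfolding \<phi>_def by (auto intro!: derivative_eq_intros l simp: add_divide_distrib)
    moreover have "b \<bullet> h + ((y - c) \<bullet> (M *v h) + h \<bullet> (M *v (y - c))) / 2 = (b + M *v (y - c)) \<bullet> h" for h
      using symmetric_matrix_inner[OF sym, of "y - c" h] by (simp add: inner_add_left inner_add_right inner_commute)
    ultimately show ?thesis by simp
  qed
  have g: "gradient \<phi> = (\<lambda>y. b + M *v (y - c))"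
  proof
    fix y
    show "gradient \<phi> y = b + M *v (y - c)"
      unfolding gradient_def frechet_derivative_at[OF d, symmetric] by (simp add: vec_eq_iff inner_axis)
  qed
  have dg: "(gradient \<phi> has_derivative (\<lambda>h. M *v h)) (at y)" for y
    unfolding g
    using has_derivative_add[OF has_derivative_const[of b]
       bounded_linear.has_derivative[OF matrix_vector_mul_bounded_linear[of M] d0[of y]]] by simp
  show h: "hessian \<phi> x = M" for x
    unfolding hessian_def frechet_derivative_at[OF dg, symmetric] by simp
  have "hessian \<phi> = (\<lambda>_. M)" using h by auto
  thus "C2_on S \<phi>" unfolding C2_on_def using d dg by (auto simp: differentiable_def)
  assume psd: "\<And>h. 0 \<le> h \<bullet> (M *v h)" and S: "convex S"
  show "convex_on S \<phi>"
  proof (rule convex_onI[OF _ S])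
    fix t x y assume t: "0 < t" "t < (1::real)"
    have "(1 - t) * \<phi> x + t * \<phi> y - \<phi> ((1 - t) *\<^sub>R x + t *\<^sub>R y) = t * (1 - t) * ((x - y) \<bullet> (M *v (x - y))) / 2"
    proof -
      define X Y where "X = x - c" and "Y = y - c"
      have e: "(1 - t) *\<^sub>R x + t *\<^sub>R y - c = (1 - t) *\<^sub>R X + t *\<^sub>R Y" "x - y = X - Y"
        by (simp_all add: X_def Y_def algebra_simps)
      show ?thesis
        unfolding \<phi>_def e X_def[symmetric] Y_def[symmetric]
        using symmetric_matrix_inner[OF sym, of X Y]
        by (simp add: matrix_vector_right_distrib matrix_vector_mult_diff_distrib matrix_vector_mult_scaleR
            inner_add_left inner_add_right inner_diff_left inner_diff_right field_simps)
    qed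
    moreover have "t * (1 - t) * ((x - y) \<bullet> (M *v (x - y))) / 2 \<ge> 0" using t psd by simp
    ultimately show "\<phi> ((1 - t) *\<^sub>R x + t *\<^sub>R y) \<le> (1 - t) * \<phi> x + t * \<phi> y" by linarith
  qed
qed

lemma tendsto_det_shift:
  fixes M :: "real ^ 'n ^ 'n"
  shows "((\<lambda>e. det (M + (c * e) *\<^sub>R mat 1)) \<longlongrightarrow> det M) (at_right 0)"
proof -
  have "((\<lambda>e. det (M + (c * e) *\<^sub>R mat 1)) \<longlongrightarrow> det (M + (c * 0) *\<^sub>R mat 1)) (at_right 0)"
    unfolding det_def by (intro tendsto_intros)
  thus ?thesis by simp
qed

lemma pos_def_shift:
  fixes M :: "real ^ 'n ^ 'n"
  assumes "transpose M = M" "\<And>h. 0 \<le> h \<bullet> (M *v h)" "e > 0"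
  shows "pos_def (M + e *\<^sub>R mat 1)"
  using assms
  by (auto simp: pos_def_def transpose_add transpose_scaleR matrix_vector_mult_add_rdistrib
      scaleR_matrix_vector inner_add_right intro!: add_nonneg_pos)

text \<open>A jet touches only up to e |y - x|^2, so M is shifted by 2 e I to obtain a paraboloid
  that really touches, and e tends to 0 afterwards. Convexity of u makes superjet matrices
  semidefinite; Hadamard's inequality passes from the determinant to an arbitrary basis.\<close>

lemma viscosity_solution_imp_ma:
  fixes u :: "real ^ 'n \<Rightarrow> real"
  assumes \<Omega>: "open \<Omega>" "convex \<Omega>" and u: "is_viscosity_solution \<Omega> f g u"
  shows "ma_subsolution \<Omega> f u" "ma_supersolution \<Omega> f u"
proof -
  have cu: "convex_on \<Omega> u"
    using u closure_subset \<Omega>(2) unfolding is_viscosity_solution_def by (meson convex_on_subset)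
  have test1: "det M \<ge> f x" if x: "x \<in> \<Omega>" and M: "transpose M = M" "\<And>h. 0 \<le> h \<bullet> (M *v h)"
    and ev: "\<forall>\<^sub>F y in nhds x. u y \<le> u x + b \<bullet> (y - x) + (y - x) \<bullet> (M *v (y - x)) / 2" for x b M
  proof -
    define \<phi> where "\<phi> = (\<lambda>y. 0 + b \<bullet> (y - x) + (y - x) \<bullet> (M *v (y - x)) / 2)"
    have "\<forall>\<^sub>F y in nhds x. u y - \<phi> y \<le> u x - \<phi> x" using ev by eventually_elim (simp add: \<phi>_def)
    moreover have "convex_on \<Omega> \<phi>" "C2_on \<Omega> \<phi>" "hessian \<phi> x = M"
      unfolding \<phi>_def using quadratic_C2[OF M(1)] M(2) \<Omega>(2) by blast+
    ultimately show ?thesis using u x unfolding is_viscosity_solution_def by blast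
  qed
  have test2: "det M \<le> f x" if x: "x \<in> \<Omega>" and M: "transpose M = M" "\<And>h. 0 \<le> h \<bullet> (M *v h)"
    and ev: "\<forall>\<^sub>F y in nhds x. u y \<ge> u x + b \<bullet> (y - x) + (y - x) \<bullet> (M *v (y - x)) / 2" for x b M
  proof -
    define \<phi> where "\<phi> = (\<lambda>y. 0 + b \<bullet> (y - x) + (y - x) \<bullet> (M *v (y - x)) / 2)"
    have "\<forall>\<^sub>F y in nhds x. u y - \<phi> y \<ge> u x - \<phi> x" using ev by eventually_elim (simp add: \<phi>_def)
    moreover have "convex_on \<Omega> \<phi>" "C2_on \<Omega> \<phi>" "hessian \<phi> x = M"
      unfolding \<phi>_def using quadratic_C2[OF M(1)] M(2) \<Omega>(2) by blast+
    ultimately show ?thesis using u x unfolding is_viscosity_solution_def by blast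
  qed
  show "ma_subsolution \<Omega> f u"
    unfolding ma_subsolution_def
  proof (intro ballI allI impI)
    fix x b and M :: "real ^ 'n ^ 'n" and v :: "'n \<Rightarrow> real ^ 'n"
    assume x: "x \<in> \<Omega>" and jet: "superjet u x b M" and v: "v \<in> orthonormal_bases"
    have sym: "transpose M = M" using jet by (simp add: superjet_def)
    have psd: "0 \<le> h \<bullet> (M *v h)" for h by (rule convex_superjet_nonneg[OF cu \<Omega>(1) x jet])
    have "f x \<le> (\<Prod>j\<in>UNIV. v j \<bullet> (M *v v j) + 2 * e)" if e: "e > 0" for e
    proof -
      have pd: "pos_def (M + (2 * e) *\<^sub>R mat 1)" using pos_def_shift[OF sym psd] e by simp
      have ev: "\<forall>\<^sub>F y in nhds x. u y \<le> u x + b \<bullet> (y - x) + (y - x) \<bullet> (M *v (y - x)) / 2 + e * (norm (y - x))\<^sup>2"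
        using jet e unfolding superjet_def by blast
      have "det (M + (2 * e) *\<^sub>R mat 1) \<ge> f x"
      proof (rule test1[OF x])
        show "transpose (M + (2 * e) *\<^sub>R mat 1) = M + (2 * e) *\<^sub>R mat 1" using pd by (simp add: pos_def_def)
        show "0 \<le> h \<bullet> ((M + (2 * e) *\<^sub>R mat 1) *v h)" for h
          using pd unfolding pos_def_def by (cases "h = 0") (auto intro: less_imp_le)
        show "\<forall>\<^sub>F y in nhds x. u y \<le> u x + b \<bullet> (y - x) + (y - x) \<bullet> ((M + (2 * e) *\<^sub>R mat 1) *v (y - x)) / 2"
          using ev by eventually_elim (simp add: matrix_vector_mult_add_rdistrib scaleR_matrix_vector inner_add_right
            power2_norm_eq_inner add_divide_distrib)
      qed
      also have "det (M + (2 * e) *\<^sub>R mat 1) \<le> (\<Prod>j\<in>UNIV. v j \<bullet> ((M + (2 * e) *\<^sub>R mat 1) *v v j))"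
        using pos_def_diagonalization[OF pd] v by metis
      also have "\<dots> = (\<Prod>j\<in>UNIV. v j \<bullet> (M *v v j) + 2 * e)"
        using orthonormal_basesD(1)[OF v]
        by (simp add: matrix_vector_mult_add_rdistrib scaleR_matrix_vector inner_add_right)
      finally show ?thesis .
    qed
    hence "\<forall>\<^sub>F e in at_right 0. f x \<le> (\<Prod>j\<in>UNIV. v j \<bullet> (M *v v j) + 2 * e)"
      by (auto simp: eventually_at_filter)
    moreover have "((\<lambda>e. \<Prod>j\<in>UNIV. v j \<bullet> (M *v v j) + 2 * e) \<longlongrightarrow> (\<Prod>j\<in>UNIV. v j \<bullet> (M *v v j) + 2 * 0)) (at_right 0)"
      by (intro tendsto_intros)
    ultimately have "f x \<le> (\<Prod>j\<in>UNIV. v j \<bullet> (M *v v j) + 2 * 0)"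
      by (intro tendsto_lowerbound) auto
    thus "(\<forall>j. 0 \<le> v j \<bullet> (M *v v j)) \<and> f x \<le> (\<Prod>j\<in>UNIV. v j \<bullet> (M *v v j))" using psd by simp
  qed
  show "ma_supersolution \<Omega> f u"
    unfolding ma_supersolution_def
  proof (intro ballI allI impI, elim conjE)
    fix x b and M :: "real ^ 'n ^ 'n"
    assume x: "x \<in> \<Omega>" and jet: "subjet u x b M" and pd: "pos_def M"
    have sym: "transpose M = M" using pd by (simp add: pos_def_def)
    \<comment> \<open>Subjets are shifted downwards, and the test paraboloid must stay convex: 2 e <
      c ensures this.\<close>
    obtain c where c: "c > 0" "\<And>h. c * (norm h)\<^sup>2 \<le> h \<bullet> (M *v h)" using quadratic_form_lower_bound[OF pd] by blast
    have "det (M + ((- 2) * e) *\<^sub>R mat 1) \<le> f x" if e: "e > 0" "2 * e < c" for e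
    proof (rule test2[OF x])
      show "transpose (M + ((- 2) * e) *\<^sub>R mat 1) = M + ((- 2) * e) *\<^sub>R mat 1"
        unfolding transpose_add transpose_scaleR sym transpose_mat ..
      show "0 \<le> h \<bullet> ((M + ((- 2) * e) *\<^sub>R mat 1) *v h)" for h
      proof -
        have "2 * e * (norm h)\<^sup>2 \<le> c * (norm h)\<^sup>2" using e by (intro mult_right_mono) auto
        thus ?thesis using c(2)[of h]
          by (simp add: matrix_vector_mult_add_rdistrib scaleR_matrix_vector inner_add_right power2_norm_eq_inner
            del: scaleR_minus_left mult_minus_left)
      qed
      have "\<forall>\<^sub>F y in nhds x. u y \<ge> u x + b \<bullet> (y - x) + (y - x) \<bullet> (M *v (y - x)) / 2 - e * (norm (y - x))\<^sup>2"
        using jet e unfolding subjet_def2 by blast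
      thus "\<forall>\<^sub>F y in nhds x. u y \<ge> u x + b \<bullet> (y - x) + (y - x) \<bullet> ((M + ((- 2) * e) *\<^sub>R mat 1) *v (y - x)) / 2"
        by eventually_elim (simp add: matrix_vector_mult_add_rdistrib scaleR_matrix_vector inner_add_right
            power2_norm_eq_inner diff_divide_distrib add_divide_distrib del: scaleR_minus_left mult_minus_left)
    qed
    hence "\<forall>\<^sub>F e in at_right 0. det (M + ((- 2) * e) *\<^sub>R mat 1) \<le> f x"
      using c(1) unfolding eventually_at_right_field by (intro exI[of _ "c / 2"]) auto
    with tendsto_det_shift[of M "-2"] show "det M \<le> f x" by (intro tendsto_upperbound) auto
  qed
qed

text \<open>The Hessian of a convex test function may be singular. From above it is shifted by e I
  before diagonalisation; from below the singular case is settled by f x \<ge> 0.\<close>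

lemma ma_imp_viscosity_test:
  fixes u \<phi> :: "real ^ 'n \<Rightarrow> real"
  assumes \<Omega>: "open \<Omega>" and u: "ma_subsolution \<Omega> f u" "ma_supersolution \<Omega> f u"
    and \<phi>: "convex_on \<Omega> \<phi>" "C2_on \<Omega> \<phi>" and x: "x \<in> \<Omega>" and f: "f x \<ge> 0"
  shows "\<forall>\<^sub>F y in nhds x. u y - \<phi> y \<le> u x - \<phi> x \<Longrightarrow> det (hessian \<phi> x) \<ge> f x"
    and "\<forall>\<^sub>F y in nhds x. u y - \<phi> y \<ge> u x - \<phi> x \<Longrightarrow> det (hessian \<phi> x) \<le> f x"
proof -
  let ?M = "hessian \<phi> x"
  have jets: "superjet \<phi> x (gradient \<phi> x) ?M" "subjet \<phi> x (gradient \<phi> x) ?M"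
    using differentiable_jets[OF \<Omega> x] \<phi>(2) x unfolding C2_on_def by blast+
  have sym: "transpose ?M = ?M" using jets by (simp add: superjet_def)
  have psd: "0 \<le> h \<bullet> (?M *v h)" for h by (rule convex_superjet_nonneg[OF \<phi>(1) \<Omega> x jets(1)])
  show "det ?M \<ge> f x" if ev: "\<forall>\<^sub>F y in nhds x. u y - \<phi> y \<le> u x - \<phi> x"
  proof -
    have "f x \<le> det (?M + (1 * e) *\<^sub>R mat 1)" if e: "e > 0" for e
    proof -
      have pd: "pos_def (?M + e *\<^sub>R mat 1)" by (rule pos_def_shift[OF sym psd e])
      then obtain v where v: "v \<in> orthonormal_bases"
        "det (?M + e *\<^sub>R mat 1) = (\<Prod>j\<in>UNIV. v j \<bullet> ((?M + e *\<^sub>R mat 1) *v v j))"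
        using pos_def_diagonalization by metis
      have "superjet u x (gradient \<phi> x) ?M" by (rule superjet_touch[OF jets(1) ev])
      hence "\<And>j. 0 \<le> v j \<bullet> (?M *v v j)" "f x \<le> (\<Prod>j\<in>UNIV. v j \<bullet> (?M *v v j))"
        using u(1) x v(1) unfolding ma_subsolution_def by blast+
      moreover have "(\<Prod>j\<in>UNIV. v j \<bullet> (?M *v v j)) \<le> (\<Prod>j\<in>UNIV. v j \<bullet> ((?M + e *\<^sub>R mat 1) *v v j))"
        using calculation(1) e orthonormal_basesD(1)[OF v(1)]
        by (intro prod_mono) (auto simp: matrix_vector_mult_add_rdistrib scaleR_matrix_vector inner_add_right)
      ultimately show ?thesis using v(2) by simp
    qed
    hence "\<forall>\<^sub>F e in at_right 0. f x \<le> det (?M + (1 * e) *\<^sub>R mat 1)"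
      by (auto simp: eventually_at_filter)
    with tendsto_det_shift[of ?M 1] show ?thesis by (intro tendsto_lowerbound) auto
  qed
  show "det ?M \<le> f x" if ev: "\<forall>\<^sub>F y in nhds x. u y - \<phi> y \<ge> u x - \<phi> x"
  proof (cases "pos_def ?M")
    case True
    moreover have "subjet u x (gradient \<phi> x) ?M" by (rule subjet_touch[OF jets(2) ev])
    ultimately show ?thesis using u(2) x unfolding ma_supersolution_def by blast
  next
    \<comment> \<open>A semidefinite form that vanishes at some nonzero h has h in the kernel of its
      matrix, hence the determinant is 0.\<close>
    case False
    then obtain h where h: "h \<noteq> 0" "h \<bullet> (?M *v h) = 0" using sym psd unfolding pos_def_def
      by (meson antisym not_less)
    have "k \<bullet> (?M *v h) = 0" for k
    proof (rule ccontr)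
      define a where "a = k \<bullet> (?M *v h)"
      define q where "q = k \<bullet> (?M *v k)"
      assume "k \<bullet> (?M *v h) \<noteq> 0"
      hence a: "a \<noteq> 0" by (simp add: a_def)
      have q: "q \<ge> 0" using psd by (simp add: q_def)
      \<comment> \<open>Moves from h along k so that the quadratic form becomes negative if a
        \<noteq> 0; q + 1 replaces the minimising denominator q, which may be 0.\<close>
      define t where "t = - a / (q + 1)"
      have "0 \<le> (h + t *\<^sub>R k) \<bullet> (?M *v (h + t *\<^sub>R k))" by (rule psd)
      also have "\<dots> = 2 * t * a + t\<^sup>2 * q"
        using symmetric_matrix_inner[OF sym, of h k] h(2)
        by (simp add: matrix_vector_right_distrib matrix_vector_mult_scaleR inner_add_left inner_add_right
            a_def q_def power2_eq_square algebra_simps)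
      also have "\<dots> = - (a\<^sup>2 / (q + 1)) * (2 - q / (q + 1))"
      proof -
        have "2 * (- a / r) * a + (- a / r)\<^sup>2 * q = - (a\<^sup>2 / r) * (2 - q / r)" for r
          by (simp add: power2_eq_square algebra_simps)
        thus ?thesis unfolding t_def .
      qed
      also have "\<dots> < 0"
      proof -
        have "q / (q + 1) \<le> 1" using q by simp
        moreover have "a\<^sup>2 / (q + 1) > 0" using a q by simp
        ultimately have "(a\<^sup>2 / (q + 1)) * (2 - q / (q + 1)) > 0" by (intro mult_pos_pos) linarith+
        thus ?thesis by (simp only: mult_minus_left neg_less_0_iff_less)
      qed
      finally show False by simp
    qed
    hence "?M *v h = 0" by (metis inner_eq_zero_iff)
    hence "\<not> invertible ?M" using h(1) by (metis invertible_def matrix_vector_mul_assoc matrix_vector_mul_lid matrix_vector_mult_0_right)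
    thus ?thesis using f by (simp add: invertible_det_nz)
  qed
qed

section \<open>Finite elements\<close>

lemma affine_interpolation:
  fixes C :: "'a::euclidean_space set" and W :: "'a \<Rightarrow> real"
  assumes "\<not> affine_dependent C"
  shows "\<exists>a b. \<forall>v\<in>C. a \<bullet> v + b = W v"
proof (cases "C = {}")
  case False
  then obtain v0 where v0: "v0 \<in> C" by blast
  have ind: "independent ((\<lambda>x. - v0 + x) ` (C - {v0}))"
    using affine_dependent_iff_dependent2[OF v0] assms by simp
  obtain F where F: "linear F" "\<And>y. y \<in> (\<lambda>x. - v0 + x) ` (C - {v0}) \<Longrightarrow> F y = W (v0 + y) - W v0"
    using linear_independent_extend[OF ind, of "\<lambda>y. W (v0 + y) - W v0"] by blast
  define a where "a = (\<Sum>i\<in>Basis. F i *\<^sub>R i)"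
  have Fa: "F y = a \<bullet> y" for y
  proof -
    have "F y = F (\<Sum>i\<in>Basis. (y \<bullet> i) *\<^sub>R i)" by (simp add: euclidean_representation)
    also have "\<dots> = (\<Sum>i\<in>Basis. (y \<bullet> i) * F i)" by (simp add: linear_sum[OF F(1)] linear_cmul[OF F(1)])
    also have "\<dots> = (\<Sum>i\<in>Basis. F i * (i \<bullet> y))" by (simp add: inner_commute mult.commute)
    also have "\<dots> = a \<bullet> y" by (simp add: a_def inner_sum_left)
    finally show ?thesis .
  qed
  have "a \<bullet> v + (W v0 - a \<bullet> v0) = W v" if v: "v \<in> C" for v
  proof (cases "v = v0")
    case False
    hence "F (- v0 + v) = W v - W v0" using F(2)[of "- v0 + v"] v by simp
    thus ?thesis by (simp add: Fa inner_add_right inner_diff_right)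
  qed simp
  thus ?thesis by blast
qed simp

definition vertices :: "'a::euclidean_space set \<Rightarrow> 'a set" where
  "vertices K = {x. x extreme_point_of K}"

locale simplicial_mesh =
  fixes \<T> :: "'a::euclidean_space set set"
  assumes tri: "triangulation \<T>" and ne: "\<T> \<noteq> {}"
begin

lemma finite_mesh: "finite \<T>"
  using tri by (simp add: triangulation_def)

lemma simplexE:
  assumes "K \<in> \<T>"
  obtains C where "\<not> affine_dependent C" "K = convex hull C" "finite C" "vertices K = C"
proof -
  obtain n where "n simplex K" using tri assms unfolding triangulation_def by blast
  then obtain C where C: "\<not> affine_dependent C" "K = convex hull C"
    unfolding simplex_def by blast
  moreover have "finite C" using C(1) aff_independent_finite by blast
  moreover have "vertices K = C"
    using extreme_point_of_convex_hull_affine_independent[OF C(1)] by (auto simp: vertices_def C(2))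
  ultimately show thesis using that by blast
qed

lemma finite_vertices: "K \<in> \<T> \<Longrightarrow> finite (vertices K)"
  by (metis simplexE)

lemma simplex_hull: "K \<in> \<T> \<Longrightarrow> K = convex hull (vertices K)"
  by (metis simplexE)

lemma compact_element: "K \<in> \<T> \<Longrightarrow> compact K"
  by (metis finite_imp_compact_convex_hull simplexE)

lemma mesh_nodes_eq: "mesh_nodes \<T> = (\<Union>K\<in>\<T>. vertices K)"
  by (auto simp: mesh_nodes_def vertices_def)

lemma finite_nodes: "finite (mesh_nodes \<T>)"
  unfolding mesh_nodes_eq using finite_mesh finite_vertices by blast

lemma vertices_subset: "vertices K \<subseteq> K"
  by (auto simp: vertices_def extreme_point_of_def)

lemma nodes_subset: "mesh_nodes \<T> \<subseteq> \<Union>\<T>"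
  unfolding mesh_nodes_eq using vertices_subset by blast

lemma compact_domain: "compact (\<Union>\<T>)"
  using finite_mesh compact_element by (rule compact_Union)

lemma closed_domain: "closed (\<Union>\<T>)"
  using compact_domain by (rule compact_imp_closed)

text \<open>The barycentric weights are independent of w: evaluation at x is one fixed convex
  combination of nodal values for all piecewise affine functions. Only affinity on elements is
  required of w, so the lemma also covers negated discrete solutions, which need not be
  extensional.\<close>

lemma fe_weights:
  assumes K: "K \<in> \<T>" and x: "x \<in> K"
  obtains p where "\<And>v. v \<in> vertices K \<Longrightarrow> p v \<ge> 0" "sum p (vertices K) = 1"
    "(\<Sum>v\<in>vertices K. p v *\<^sub>R v) = x"
    "\<And>w. (\<And>K. K \<in> \<T> \<Longrightarrow> \<exists>a b. \<forall>x\<in>K. w x = a \<bullet> x + b) \<Longrightarrow> w x = (\<Sum>v\<in>vertices K. p v * w v)"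
proof -
  have "x \<in> convex hull (vertices K)" using simplex_hull[OF K] x by simp
  then obtain p where l: "\<And>v. v \<in> vertices K \<Longrightarrow> p v \<ge> 0" "sum p (vertices K) = 1"
    "(\<Sum>v\<in>vertices K. p v *\<^sub>R v) = x"
    using convex_hull_finite[OF finite_vertices[OF K]] by auto
  have "w x = (\<Sum>v\<in>vertices K. p v * w v)" if w: "\<And>K. K \<in> \<T> \<Longrightarrow> \<exists>a b. \<forall>x\<in>K. w x = a \<bullet> x + b" for w
  proof -
    obtain a b where ab: "\<And>y. y \<in> K \<Longrightarrow> w y = a \<bullet> y + b" using w[OF K] by blast
    have "(\<Sum>v\<in>vertices K. p v * w v) = (\<Sum>v\<in>vertices K. a \<bullet> (p v *\<^sub>R v) + b * p v)"
    proof (rule sum.cong[OF refl])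
      fix v assume "v \<in> vertices K"
      hence "w v = a \<bullet> v + b" using ab vertices_subset by blast
      thus "p v * w v = a \<bullet> (p v *\<^sub>R v) + b * p v" by (simp add: algebra_simps)
    qed
    also have "\<dots> = a \<bullet> x + b"
      by (simp add: sum.distrib inner_sum_right[symmetric] l sum_distrib_left[symmetric] del: inner_scaleR_right)
    finally show ?thesis using ab x by simp
  qed
  with l that show thesis by blast
qed

lemma node_weights:
  assumes x: "x \<in> \<Union>\<T>"
  obtains K p where "K \<in> \<T>" "x \<in> K" "\<And>v. v \<in> vertices K \<Longrightarrow> p v \<ge> 0" "sum p (vertices K) = 1"
    "(\<Sum>v\<in>vertices K. p v *\<^sub>R v) = x"
    "\<And>w. w \<in> fe_space \<T> \<Longrightarrow> w x = (\<Sum>v\<in>vertices K. p v * w v)"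
    "\<And>v. v \<in> vertices K \<Longrightarrow> v \<in> mesh_nodes \<T>" "finite (vertices K)"
proof -
  obtain K where K: "K \<in> \<T>" "x \<in> K" using x by blast
  show thesis
    by (rule fe_weights[OF K], rule that[OF K]) (use K finite_vertices mesh_nodes_eq in \<open>auto simp: fe_space_def\<close>)
qed

lemma fe_le:
  assumes w: "w1 \<in> fe_space \<T>" "w2 \<in> fe_space \<T>" and le: "\<And>v. v \<in> mesh_nodes \<T> \<Longrightarrow> w1 v \<le> w2 v + c"
    and x: "x \<in> \<Union>\<T>"
  shows "w1 x \<le> w2 x + c"
proof (rule node_weights[OF x])
  fix K p assume K: "\<And>v. v \<in> vertices K \<Longrightarrow> 0 \<le> p v" "sum p (vertices K) = 1"
    "\<And>w. w \<in> fe_space \<T> \<Longrightarrow> w x = (\<Sum>v\<in>vertices K. p v * w v)" "\<And>v. v \<in> vertices K \<Longrightarrow> v \<in> mesh_nodes \<T>"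
  have "w1 x = (\<Sum>v\<in>vertices K. p v * w1 v)" using K w by blast
  also have "\<dots> \<le> (\<Sum>v\<in>vertices K. p v * (w2 v + c))" by (intro sum_mono mult_left_mono le K)
  also have "\<dots> = (\<Sum>v\<in>vertices K. p v * w2 v) + c * sum p (vertices K)"
    by (simp add: distrib_left sum.distrib sum_distrib_left mult.commute)
  finally show ?thesis using K(2) K(3)[OF w(2)] by simp
qed

text \<open>Jensen's inequality for the barycentric weights: a convex function that lies below w at
  the nodes lies below it throughout.\<close>

lemma fe_ge_convex:
  assumes w: "w \<in> fe_space \<T>" and \<phi>: "convex_on UNIV \<phi>" and ge: "\<And>v. v \<in> mesh_nodes \<T> \<Longrightarrow> \<phi> v \<le> w v"
    and x: "x \<in> \<Union>\<T>"
  shows "\<phi> x \<le> w x"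
proof (rule node_weights[OF x])
  fix K p assume K: "\<And>v. v \<in> vertices K \<Longrightarrow> 0 \<le> p v" "sum p (vertices K) = 1"
    "(\<Sum>v\<in>vertices K. p v *\<^sub>R v) = x"
    "\<And>w. w \<in> fe_space \<T> \<Longrightarrow> w x = (\<Sum>v\<in>vertices K. p v * w v)" "\<And>v. v \<in> vertices K \<Longrightarrow> v \<in> mesh_nodes \<T>"
    "finite (vertices K)"
  have "vertices K \<noteq> {}" using K(2) by auto
  hence "\<phi> x \<le> (\<Sum>v\<in>vertices K. p v * \<phi> v)"
    using convex_on_sum[OF K(6) _ \<phi> K(2) K(1), of id] K(3) by simp
  also have "\<dots> \<le> (\<Sum>v\<in>vertices K. p v * w v)" by (intro sum_mono mult_left_mono ge K)
  finally show ?thesis using K(4)[OF w] by simp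
qed

lemma fe_eqI:
  assumes w: "w1 \<in> fe_space \<T>" "w2 \<in> fe_space \<T>" and eq: "\<And>v. v \<in> mesh_nodes \<T> \<Longrightarrow> w1 v = w2 v"
  shows "w1 = w2"
proof
  fix x
  show "w1 x = w2 x"
  proof (cases "x \<in> \<Union>\<T>")
    case True
    have "w1 x \<le> w2 x + 0" "w2 x \<le> w1 x + 0" by (rule fe_le; use w eq True in auto)+
    thus ?thesis by simp
  next
    case False
    thus ?thesis using w unfolding fe_space_def by (metis (no_types, lifting) extensional_arb mem_Collect_eq)
  qed
qed

text \<open>On each simplex the nodal values determine an affine function. Two of them agree on K
  \<inter> K' because conformity makes it a face of both elements, hence the hull of common
  vertices, where both take the prescribed values.\<close>

lemma fe_interpolant_exists: "\<exists>w\<in>fe_space \<T>. \<forall>v\<in>mesh_nodes \<T>. w v = W v"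
proof -
  have "\<exists>a b. \<forall>v\<in>vertices K. a \<bullet> v + b = W v" if "K \<in> \<T>" for K
    by (rule simplexE[OF that]) (use affine_interpolation in blast)
  then obtain a b where ab: "\<And>K v. K \<in> \<T> \<Longrightarrow> v \<in> vertices K \<Longrightarrow> a K \<bullet> v + b K = W v" by metis
  have agree: "a K \<bullet> x + b K = a K' \<bullet> x + b K'" if K: "K \<in> \<T>" "K' \<in> \<T>" "x \<in> K" "x \<in> K'" for K K' x
  proof -
    have f: "(K \<inter> K') face_of K" "(K' \<inter> K) face_of K'" using tri K unfolding triangulation_def by blast+
    have "compact (K \<inter> K')" using K compact_element by (simp add: compact_Int)
    moreover have "convex (K \<inter> K')" using face_of_imp_convex[OF f(1)] .
    ultimately have h: "K \<inter> K' = convex hull {v. v extreme_point_of (K \<inter> K')}" by (rule Krein_Milman_Minkowski)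
    let ?E = "{y. (a K - a K') \<bullet> y = b K' - b K}"
    have "{v. v extreme_point_of (K \<inter> K')} \<subseteq> ?E"
    proof
      fix v assume "v \<in> {v. v extreme_point_of (K \<inter> K')}"
      hence "v extreme_point_of (K \<inter> K')" "v extreme_point_of (K' \<inter> K)" by (simp_all add: Int_commute)
      hence "v \<in> vertices K" "v \<in> vertices K'"
        using extreme_point_of_face[OF f(1)] extreme_point_of_face[OF f(2)] by (auto simp: vertices_def)
      thus "v \<in> ?E" using ab[OF K(1)] ab[OF K(2)] by (simp add: inner_diff_left algebra_simps)
    qed
    hence "convex hull {v. v extreme_point_of (K \<inter> K')} \<subseteq> ?E" by (rule hull_minimal) (rule convex_hyperplane)
    hence "x \<in> ?E" using h K by blast
    thus ?thesis by (simp add: inner_diff_left algebra_simps)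
  qed
  define w where "w = (\<lambda>x. if x \<in> \<Union>\<T> then (let K = (SOME K. K \<in> \<T> \<and> x \<in> K) in a K \<bullet> x + b K) else undefined)"
  have w: "w x = a K \<bullet> x + b K" if K: "K \<in> \<T>" "x \<in> K" for K x
  proof -
    define K' where "K' = (SOME K. K \<in> \<T> \<and> x \<in> K)"
    have "K' \<in> \<T> \<and> x \<in> K'" unfolding K'_def by (rule someI[of _ K]) (use K in simp)
    moreover have "w x = a K' \<bullet> x + b K'" using K by (auto simp: w_def Let_def K'_def)
    ultimately show ?thesis using agree K by metis
  qed
  have "continuous_on (\<Union>K\<in>\<T>. K) w"
  proof (rule continuous_on_closed_Union[OF finite_mesh])
    fix K assume K: "K \<in> \<T>"
    show "closed K" using compact_element[OF K] compact_imp_closed by blast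
    have "continuous_on K (\<lambda>x. a K \<bullet> x + b K)" by (intro continuous_intros)
    thus "continuous_on K w" by (rule continuous_on_eq) (use w[OF K] in simp)
  qed
  moreover have "w \<in> extensional (\<Union>\<T>)" by (auto simp: w_def extensional_def)
  ultimately have "w \<in> fe_space \<T>" unfolding fe_space_def using w by auto
  moreover have "w v = W v" if "v \<in> mesh_nodes \<T>" for v
    using that w ab vertices_subset unfolding mesh_nodes_eq by (metis UN_E subsetD)
  ultimately show ?thesis by blast
qed

definition interp :: "('a \<Rightarrow> real) \<Rightarrow> 'a \<Rightarrow> real" where
  "interp W = (SOME w. w \<in> fe_space \<T> \<and> (\<forall>v\<in>mesh_nodes \<T>. w v = W v))"

lemma interp_fe: "interp W \<in> fe_space \<T>" and interp_node: "v \<in> mesh_nodes \<T> \<Longrightarrow> interp W v = W v"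
proof -
  have "\<exists>w. w \<in> fe_space \<T> \<and> (\<forall>v\<in>mesh_nodes \<T>. w v = W v)" using fe_interpolant_exists by blast
  hence "interp W \<in> fe_space \<T> \<and> (\<forall>v\<in>mesh_nodes \<T>. interp W v = W v)"
    unfolding interp_def by (rule someI_ex)
  thus "interp W \<in> fe_space \<T>" "v \<in> mesh_nodes \<T> \<Longrightarrow> interp W v = W v" by auto
qed

lemma interp_affine: "x \<in> \<Union>\<T> \<Longrightarrow> interp (\<lambda>y. a \<bullet> y + b) x = a \<bullet> x + b"
proof (rule node_weights)
  fix K p assume K: "sum p (vertices K) = 1" "(\<Sum>v\<in>vertices K. p v *\<^sub>R v) = x"
    "\<And>w. w \<in> fe_space \<T> \<Longrightarrow> w x = (\<Sum>v\<in>vertices K. p v * w v)" "\<And>v. v \<in> vertices K \<Longrightarrow> v \<in> mesh_nodes \<T>"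
  have "interp (\<lambda>y. a \<bullet> y + b) x = (\<Sum>v\<in>vertices K. a \<bullet> (p v *\<^sub>R v) + b * p v)"
    unfolding K(3)[OF interp_fe] by (rule sum.cong) (use interp_node K(4) in \<open>auto simp: algebra_simps\<close>)
  also have "\<dots> = a \<bullet> x + b"
    by (simp add: sum.distrib inner_sum_right[symmetric] K sum_distrib_left[symmetric] del: inner_scaleR_right)
  finally show ?thesis .
qed

lemma node_frontier_or_interior:
  assumes "x \<in> interior_nodes \<T>"
  shows "x \<in> interior (\<Union>\<T>)" "x \<in> mesh_nodes \<T>"
  using assms nodes_subset closed_domain
  by (auto simp: interior_nodes_def boundary_nodes_def frontier_def)

end

section \<open>The discrete operator\<close>

text \<open>Separates the algebra of the operator from the mesh: the scheme is the minimum of this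
  function of the second differences. Its monotonicity in each of them underlies the discrete
  comparison, Perron's method and the passage to the limit.\<close>

definition ma_flux :: "('n::finite \<Rightarrow> real) \<Rightarrow> real" where
  "ma_flux s = (\<Prod>j\<in>UNIV. max (s j) 0) - (\<Sum>j\<in>UNIV. - min (s j) 0)"

lemma two_scale_operator_flux:
  "two_scale_operator D \<delta> B w x = Min ((\<lambda>v. ma_flux (\<lambda>j. second_difference D \<delta> w x (v j))) ` B)"
  by (simp add: two_scale_operator_def ma_flux_def)

lemma ma_flux_mono: "(\<And>j. s j \<le> t j) \<Longrightarrow> ma_flux s \<le> ma_flux t"
  unfolding ma_flux_def by (intro diff_mono prod_mono sum_mono) (auto simp: min_def max_def intro: order_trans)

lemma ma_flux_eq_prod: "(\<And>j. s j \<ge> 0) \<Longrightarrow> ma_flux s = (\<Prod>j\<in>UNIV. s j)"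
  unfolding ma_flux_def by (simp add: max_absorb1 min_absorb2)

text \<open>If all entries are nonnegative the product increases strictly; otherwise the sum of
  negative parts decreases strictly.\<close>

lemma ma_flux_strict_mono:
  fixes s :: "'n::finite \<Rightarrow> real"
  assumes "c > 0"
  shows "ma_flux s < ma_flux (\<lambda>j. s j + c)"
proof (cases "\<forall>j. s j \<ge> 0")
  case True
  have "(\<Prod>j\<in>(UNIV::'n set). s j) < (\<Prod>j\<in>UNIV. s j + c)"
    by (rule prod_mono_strict[of undefined]) (use True assms in \<open>auto intro: add_nonneg_pos\<close>)
  thus ?thesis using True assms by (subst (1 2) ma_flux_eq_prod) (auto intro: add_nonneg_nonneg less_imp_le)
next
  case False
  then obtain i where i: "s i < 0" by (auto simp: not_le)
  have "(\<Prod>j\<in>(UNIV::'n set). max (s j) 0) \<le> (\<Prod>j\<in>UNIV. max (s j + c) 0)"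
    by (rule prod_mono) (use assms in auto)
  moreover have "(\<Sum>j\<in>(UNIV::'n set). - min (s j + c) 0) < (\<Sum>j\<in>UNIV. - min (s j) 0)"
    by (rule sum_strict_mono_ex1) (use assms i in \<open>auto simp: min_def intro!: exI[of _ i]\<close>)
  ultimately show ?thesis unfolding ma_flux_def by linarith
qed

lemma ma_flux_tendsto: "((\<lambda>e. ma_flux (\<lambda>j. s j + c * e)) \<longlongrightarrow> ma_flux s) (at_right 0)"
proof -
  have "((\<lambda>e. ma_flux (\<lambda>j. s j + c * e)) \<longlongrightarrow> ma_flux (\<lambda>j. s j + c * 0)) (at_right 0)"
    unfolding ma_flux_def by (intro tendsto_intros)
  thus ?thesis by simp
qed

text \<open>A negative entry annihilates the product and leaves a strictly negative sum. This is how
  the scheme encodes convexity.\<close>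

lemma ma_flux_nonneg_imp:
  assumes "ma_flux s \<ge> F" "F \<ge> 0"
  shows "s j \<ge> 0" "(\<Prod>j\<in>UNIV. s j) \<ge> F"
proof -
  have s: "s j \<ge> 0" for j
  proof (rule ccontr)
    assume "\<not> s j \<ge> 0"
    hence j: "s j < 0" by simp
    have "(\<Prod>j\<in>UNIV. max (s j) 0) = 0" by (rule prod_zero) (use j in \<open>auto intro!: exI[of _ j]\<close>)
    moreover have "(\<Sum>i\<in>UNIV. - min (s i) 0) \<ge> - min (s j) 0"
      by (rule member_le_sum) auto
    ultimately show False using assms j unfolding ma_flux_def by linarith
  qed
  thus "s j \<ge> 0" "(\<Prod>j\<in>UNIV. s j) \<ge> F" using assms ma_flux_eq_prod[of s] by auto
qed

text \<open>The greatest scale is attained: an interior point admits some scale r0 > 0, and the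
  admissible scales in [r0, 1] form a compact set because D is closed.\<close>

lemma step_scale_props:
  fixes D :: "'a::euclidean_space set"
  assumes D: "closed D" and x: "x \<in> interior D" and \<delta>: "\<delta> > 0"
  shows "0 < step_scale D \<delta> x" "step_scale D \<delta> x \<le> 1"
    "norm v = 1 \<Longrightarrow> x + (step_scale D \<delta> x * \<delta>) *\<^sub>R v \<in> D"
    "norm v = 1 \<Longrightarrow> x - (step_scale D \<delta> x * \<delta>) *\<^sub>R v \<in> D"
    "cball x \<delta> \<subseteq> D \<Longrightarrow> step_scale D \<delta> x = 1"
proof -
  define P where "P = (\<lambda>\<rho>. 0 < \<rho> \<and> \<rho> \<le> 1 \<and>
     (\<forall>v\<in>sphere 0 1. x + (\<rho> * \<delta>) *\<^sub>R v \<in> D \<and> x - (\<rho> * \<delta>) *\<^sub>R v \<in> D))"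
  have ss: "step_scale D \<delta> x = (GREATEST \<rho>. P \<rho>)" by (simp add: step_scale_def P_def)
  obtain r where r: "r > 0" "cball x r \<subseteq> D" using x mem_interior_cball by blast
  define r0 where "r0 = min 1 (r / \<delta>)"
  have r0: "r0 > 0" "r0 \<le> 1" "r0 * \<delta> \<le> r" using r \<delta> by (auto simp: r0_def min_def pos_le_divide_eq)
  have P0: "P r0" unfolding P_def
  proof (intro conjI ballI r0)
    fix v :: 'a assume "v \<in> sphere 0 1"
    hence "dist x (x + (r0 * \<delta>) *\<^sub>R v) \<le> r" "dist x (x - (r0 * \<delta>) *\<^sub>R v) \<le> r"
      using r0 \<delta> by (simp_all add: dist_norm)
    thus "x + (r0 * \<delta>) *\<^sub>R v \<in> D" "x - (r0 * \<delta>) *\<^sub>R v \<in> D" using r by auto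
  qed
  define S where "S = {r0..1} \<inter> (\<Inter>v\<in>sphere 0 1. {\<rho>. x + (\<rho> * \<delta>) *\<^sub>R v \<in> D} \<inter> {\<rho>. x - (\<rho> * \<delta>) *\<^sub>R v \<in> D})"
  have "closed {\<rho>. x + (\<rho> * \<delta>) *\<^sub>R v \<in> D}" "closed {\<rho>. x - (\<rho> * \<delta>) *\<^sub>R v \<in> D}" for v
    using continuous_closed_vimage[OF D, of "\<lambda>\<rho>. x + (\<rho> * \<delta>) *\<^sub>R v"] continuous_closed_vimage[OF D, of "\<lambda>\<rho>. x - (\<rho> * \<delta>) *\<^sub>R v"]
    by (auto simp: vimage_def intro!: continuous_intros)
  hence "closed (\<Inter>v\<in>sphere 0 1. {\<rho>. x + (\<rho> * \<delta>) *\<^sub>R v \<in> D} \<inter> {\<rho>. x - (\<rho> * \<delta>) *\<^sub>R v \<in> D})" by auto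
  hence cS: "compact S" unfolding S_def by (intro compact_Int_closed) auto
  have "r0 \<in> S" using P0 r0 by (auto simp: S_def P_def)
  then obtain m where m: "m \<in> S" "\<And>s. s \<in> S \<Longrightarrow> s \<le> m" using compact_attains_sup[OF cS] by blast
  have Pm: "P m" using m(1) r0 by (auto simp: S_def P_def)
  have top: "s \<le> m" if "P s" for s
  proof (cases "s \<ge> r0")
    case True thus ?thesis using that by (intro m(2)) (auto simp: S_def P_def)
  next
    case False thus ?thesis using m(1) by (auto simp: S_def)
  qed
  have eq: "step_scale D \<delta> x = m" unfolding ss by (rule Greatest_equality[where P = P and x = m]) (use Pm top in auto)
  show "0 < step_scale D \<delta> x" "step_scale D \<delta> x \<le> 1"
    "norm v = 1 \<Longrightarrow> x + (step_scale D \<delta> x * \<delta>) *\<^sub>R v \<in> D"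
    "norm v = 1 \<Longrightarrow> x - (step_scale D \<delta> x * \<delta>) *\<^sub>R v \<in> D"
    using Pm unfolding eq by (auto simp: P_def)
  assume c: "cball x \<delta> \<subseteq> D"
  have "P 1" unfolding P_def
  proof (intro conjI ballI)
    fix v :: 'a assume "v \<in> sphere 0 1"
    hence "dist x (x + (1 * \<delta>) *\<^sub>R v) \<le> \<delta>" "dist x (x - (1 * \<delta>) *\<^sub>R v) \<le> \<delta>"
      using \<delta> by (simp_all add: dist_norm)
    thus "x + (1 * \<delta>) *\<^sub>R v \<in> D" "x - (1 * \<delta>) *\<^sub>R v \<in> D" using c by auto
  qed auto
  from top[OF this] show "step_scale D \<delta> x = 1" using Pm unfolding eq P_def by simp
qed

text \<open>The slack \<open>c\<close> serves Perron's method, where the supremum is only approached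
  and where one nodal value is raised.\<close>

lemma second_difference_le:
  assumes D: "closed D" "x \<in> interior D" "\<delta> > 0" "norm v = 1"
    and le: "\<And>y. y \<in> D \<Longrightarrow> w1 y - w1 x \<le> w2 y - w2 x + c"
  shows "second_difference D \<delta> w1 x v \<le> second_difference D \<delta> w2 x v + 2 * c / ((step_scale D \<delta> x)\<^sup>2 * \<delta>\<^sup>2)"
proof -
  let ?\<rho> = "step_scale D \<delta> x"
  note s = step_scale_props[OF D(1-3)]
  have "w1 (x + (?\<rho> * \<delta>) *\<^sub>R v) - 2 * w1 x + w1 (x - (?\<rho> * \<delta>) *\<^sub>R v)
     \<le> (w2 (x + (?\<rho> * \<delta>) *\<^sub>R v) - 2 * w2 x + w2 (x - (?\<rho> * \<delta>) *\<^sub>R v)) + 2 * c"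
    using le[OF s(3)[OF D(4)]] le[OF s(4)[OF D(4)]] by simp
  hence "(w1 (x + (?\<rho> * \<delta>) *\<^sub>R v) - 2 * w1 x + w1 (x - (?\<rho> * \<delta>) *\<^sub>R v)) / (?\<rho>\<^sup>2 * \<delta>\<^sup>2)
     \<le> ((w2 (x + (?\<rho> * \<delta>) *\<^sub>R v) - 2 * w2 x + w2 (x - (?\<rho> * \<delta>) *\<^sub>R v)) + 2 * c) / (?\<rho>\<^sup>2 * \<delta>\<^sup>2)"
    by (rule divide_right_mono) simp
  thus ?thesis unfolding second_difference_def Let_def by (simp add: add_divide_distrib)
qed

lemma second_difference_add:
  "second_difference D \<delta> (\<lambda>y. w1 y + c * w2 y) x v = second_difference D \<delta> w1 x v + c * second_difference D \<delta> w2 x v"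
  unfolding second_difference_def Let_def by (simp add: add_divide_distrib diff_divide_distrib algebra_simps)

text \<open>The step cancels, so the identity is exact even near the boundary, where the stencil
  shrinks; barriers can therefore be checked there without a consistency estimate.\<close>

lemma second_difference_quadratic:
  assumes D: "closed D" "x \<in> interior D" "\<delta> > 0" "norm v = 1"
  shows "second_difference D \<delta> (\<lambda>y. A * (norm (y - c))\<^sup>2 + (a \<bullet> y + b)) x v = 2 * A"
proof -
  define t where "t = step_scale D \<delta> x * \<delta>"
  have t: "t > 0" using step_scale_props(1)[OF D(1-3)] D(3) by (simp add: t_def)
  have vv: "v \<bullet> v = 1" using D(4) by (simp add: norm_eq_1)
  define z where "z = x - c"
  have e: "x + t *\<^sub>R v - c = z + t *\<^sub>R v" "x - t *\<^sub>R v - c = z - t *\<^sub>R v" by (simp_all add: z_def)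
  have "A * (norm (x + t *\<^sub>R v - c))\<^sup>2 + (a \<bullet> (x + t *\<^sub>R v) + b) - 2 * (A * (norm (x - c))\<^sup>2 + (a \<bullet> x + b)) +
      (A * (norm (x - t *\<^sub>R v - c))\<^sup>2 + (a \<bullet> (x - t *\<^sub>R v) + b)) = 2 * A * t\<^sup>2"
    unfolding e z_def[symmetric] power2_norm_eq_inner
    by (simp add: inner_add_left inner_add_right inner_diff_left inner_diff_right vv inner_commute[of v z] power2_eq_square algebra_simps)
  hence "second_difference D \<delta> (\<lambda>y. A * (norm (y - c))\<^sup>2 + (a \<bullet> y + b)) x v = 2 * A * t\<^sup>2 / t\<^sup>2"
    unfolding second_difference_def Let_def t_def by (simp add: power_mult_distrib)
  thus ?thesis using t by simp
qed

lemma convex_on_quadratic: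
  fixes a c :: "'a::euclidean_space"
  assumes "A \<ge> 0"
  shows "convex_on UNIV (\<lambda>y. A * (norm (y - c))\<^sup>2 + (a \<bullet> y + b))"
proof (rule convex_onI)
  fix t and x y :: 'a assume t: "0 < t" "t < (1::real)"
  define X Y where "X = x - c" and "Y = y - c"
  have e: "(1 - t) *\<^sub>R x + t *\<^sub>R y - c = (1 - t) *\<^sub>R X + t *\<^sub>R Y"
    by (simp add: X_def Y_def algebra_simps)
  have "(1 - t) * (norm X)\<^sup>2 + t * (norm Y)\<^sup>2 - (norm ((1 - t) *\<^sub>R X + t *\<^sub>R Y))\<^sup>2 = t * (1 - t) * (norm (X - Y))\<^sup>2"
    unfolding power2_norm_eq_inner
    by (simp add: inner_add_left inner_add_right inner_diff_left inner_diff_right inner_commute[of Y X] power2_eq_square algebra_simps)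
  moreover have "t * (1 - t) * (norm (X - Y))\<^sup>2 \<ge> 0" using t by simp
  ultimately have "A * (norm ((1 - t) *\<^sub>R X + t *\<^sub>R Y))\<^sup>2 \<le> A * ((1 - t) * (norm X)\<^sup>2 + t * (norm Y)\<^sup>2)"
    using assms by (intro mult_left_mono) auto
  thus "A * (norm ((1 - t) *\<^sub>R x + t *\<^sub>R y - c))\<^sup>2 + (a \<bullet> ((1 - t) *\<^sub>R x + t *\<^sub>R y) + b)
      \<le> (1 - t) * (A * (norm (x - c))\<^sup>2 + (a \<bullet> x + b)) + t * (A * (norm (y - c))\<^sup>2 + (a \<bullet> y + b))"
    unfolding e X_def[symmetric] Y_def[symmetric] by (simp add: inner_add_right algebra_simps)
qed simp

locale discrete_problem = simplicial_mesh \<T> for \<T> :: "(real ^ 'n) set set" +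
  fixes \<delta> :: real and B :: "('n \<Rightarrow> real ^ 'n) set"
  assumes \<delta>: "\<delta> > 0" and B: "finite B" "B \<noteq> {}" "B \<subseteq> orthonormal_bases"
begin

abbreviation "D \<equiv> \<Union>\<T>"

abbreviation "T \<equiv> two_scale_operator D \<delta> B"

abbreviation "sd \<equiv> second_difference D \<delta>"

lemma norm_B: "v \<in> B \<Longrightarrow> norm (v j) = 1"
  using B(3) orthonormal_basesD(3) by blast

lemma T_le: "v \<in> B \<Longrightarrow> T w x \<le> ma_flux (\<lambda>j. sd w x (v j))"
  unfolding two_scale_operator_flux using B by (intro Min_le) auto

lemma T_attained: "\<exists>v\<in>B. T w x = ma_flux (\<lambda>j. sd w x (v j))"
proof -
  have "T w x \<in> (\<lambda>v. ma_flux (\<lambda>j. sd w x (v j))) ` B"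
    unfolding two_scale_operator_flux using B by (intro Min_in) auto
  thus ?thesis by blast
qed

text \<open>Adding e times the interpolant q of |y|^2 makes w1 strictly better. At a nodal maximum
  of w1 + e q - w2, which by convex combination is a maximum over D, second differences are ordered.
  Since q lies above |y|^2 with equality at the node, its second differences are at least 2, and
  strict monotonicity of the flux contradicts the ordering of the operators.\<close>

lemma discrete_comparison:
  assumes w: "w1 \<in> fe_space \<T>" "w2 \<in> fe_space \<T>"
    and T: "\<And>x. x \<in> interior_nodes \<T> \<Longrightarrow> T w2 x \<le> T w1 x"
    and bd: "\<And>x. x \<in> boundary_nodes \<T> \<Longrightarrow> w1 x \<le> w2 x" and x: "x \<in> D"
  shows "w1 x \<le> w2 x"
proof (rule ccontr)
  assume "\<not> w1 x \<le> w2 x"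
  have "\<exists>v\<in>mesh_nodes \<T>. w1 v > w2 v"
  proof (rule ccontr)
    assume "\<not> ?thesis"
    hence "w1 x \<le> w2 x + 0" by (intro fe_le[OF w _ x]) force
    thus False using \<open>\<not> w1 x \<le> w2 x\<close> by simp
  qed
  then obtain v1 where v1: "v1 \<in> mesh_nodes \<T>" "w1 v1 > w2 v1" by blast
  define m where "m = w1 v1 - w2 v1"
  have m: "m > 0" using v1 by (simp add: m_def)
  obtain R where R: "R > 0" "\<And>y. y \<in> D \<Longrightarrow> norm y \<le> R"
    using compact_imp_bounded[OF compact_domain] unfolding bounded_pos by blast
  define q where "q = interp (\<lambda>y. (norm y)\<^sup>2)"
  have q: "q v = (norm v)\<^sup>2" if "v \<in> mesh_nodes \<T>" for v
    using that by (simp add: q_def interp_node)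
  have q_ge: "(norm y)\<^sup>2 \<le> q y" if "y \<in> D" for y
    using fe_ge_convex[OF interp_fe convex_on_quadratic[of 1 0 0 0] _ that, of "\<lambda>y. (norm y)\<^sup>2"] q
    by (simp add: q_def)
  \<comment> \<open>The perturbation is at most m / 2 on D, so the maximum cannot sit at a boundary
    node.\<close>
  define e where "e = m / (2 * R\<^sup>2)"
  have e: "e > 0" "e * R\<^sup>2 = m / 2" using m R(1) by (auto simp: e_def)
  define d where "d = (\<lambda>y. w1 y + e * q y - w2 y)"
  have "finite (d ` mesh_nodes \<T>)" "d ` mesh_nodes \<T> \<noteq> {}" using finite_nodes v1 by auto
  then obtain z where z: "z \<in> mesh_nodes \<T>" "\<And>v. v \<in> mesh_nodes \<T> \<Longrightarrow> d v \<le> d z"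
    using Max_in[of "d ` mesh_nodes \<T>"] Max_ge[of "d ` mesh_nodes \<T>"] by (metis (no_types, lifting) imageE imageI)
  have "m \<le> d v1" using e q[OF v1(1)] by (simp add: d_def m_def)
  hence dz: "m \<le> d z" using z(2)[OF v1(1)] by linarith
  have zi: "z \<in> interior_nodes \<T>"
  proof (rule ccontr)
    assume "z \<notin> interior_nodes \<T>"
    hence "w1 z \<le> w2 z" using bd z by (simp add: interior_nodes_def)
    hence "d z \<le> e * (norm z)\<^sup>2" using q[OF z(1)] by (simp add: d_def)
    also have "\<dots> \<le> e * R\<^sup>2" using R(2)[of z] z(1) nodes_subset e by (intro mult_left_mono power_mono) auto
    finally show False using dz m e by simp
  qed
  note zint = node_frontier_or_interior(1)[OF zi]
  have d_le: "d y \<le> d z" if y: "y \<in> D" for y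
  proof (rule node_weights[OF y])
    fix K p assume K: "\<And>v. v \<in> vertices K \<Longrightarrow> 0 \<le> p v" "sum p (vertices K) = 1"
      "\<And>w. w \<in> fe_space \<T> \<Longrightarrow> w y = (\<Sum>v\<in>vertices K. p v * w v)" "\<And>v. v \<in> vertices K \<Longrightarrow> v \<in> mesh_nodes \<T>"
    have "d y = (\<Sum>v\<in>vertices K. p v * d v)"
      unfolding d_def K(3)[OF w(1)] K(3)[OF w(2)] K(3)[OF interp_fe[of "\<lambda>y. (norm y)\<^sup>2"], folded q_def]
      by (simp add: sum.distrib sum_subtractf sum_distrib_left algebra_simps)
    also have "\<dots> \<le> (\<Sum>v\<in>vertices K. p v * d z)" by (intro sum_mono mult_left_mono z K)
    also have "\<dots> = d z" using K(2) by (simp add: sum_distrib_right[symmetric])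
    finally show ?thesis .
  qed
  obtain v where v: "v \<in> B" "T w2 z = ma_flux (\<lambda>j. sd w2 z (v j))" using T_attained by blast
  have "sd w1 z (v j) + 2 * e \<le> sd w2 z (v j)" for j
  proof -
    have "sd (\<lambda>y. w1 y + e * q y) z (v j) \<le> sd w2 z (v j) + 2 * 0 / ((step_scale D \<delta> z)\<^sup>2 * \<delta>\<^sup>2)"
      by (rule second_difference_le[OF closed_domain zint \<delta> norm_B[OF v(1)]])
         (use d_le in \<open>force simp: d_def\<close>)
    moreover have "2 = sd (\<lambda>y. 1 * (norm (y - 0))\<^sup>2 + (0 \<bullet> y + 0)) z (v j)"
      using second_difference_quadratic[OF closed_domain zint \<delta> norm_B[OF v(1)], of 1 0 0 0] by simp
    moreover have "\<dots> \<le> sd q z (v j) + 2 * 0 / ((step_scale D \<delta> z)\<^sup>2 * \<delta>\<^sup>2)"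
      by (rule second_difference_le[OF closed_domain zint \<delta> norm_B[OF v(1)]])
         (use q_ge q[OF z(1)] in simp)
    hence "e * sd (\<lambda>y. 1 * (norm (y - 0))\<^sup>2 + (0 \<bullet> y + 0)) z (v j) \<le> e * sd q z (v j)"
      using e by (intro mult_left_mono) auto
    ultimately show ?thesis by (simp add: second_difference_add)
  qed
  hence "ma_flux (\<lambda>j. sd w1 z (v j) + 2 * e) \<le> ma_flux (\<lambda>j. sd w2 z (v j))" by (rule ma_flux_mono)
  moreover have "ma_flux (\<lambda>j. sd w1 z (v j)) < ma_flux (\<lambda>j. sd w1 z (v j) + 2 * e)"
    by (rule ma_flux_strict_mono) (use e in simp)
  ultimately have "T w1 z < T w2 z" using T_le[OF v(1), of w1 z] v(2) by linarith
  thus False using T[OF zi] by simp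
qed

text \<open>Contact from below with a paraboloid suffices, w need not be its interpolant. This
  allows boundary values to be replaced by larger ones.\<close>

lemma interp_quadratic_T:
  assumes x: "x \<in> interior_nodes \<T>" and A: "A \<ge> 0" and w: "w \<in> fe_space \<T>"
    and ge: "\<And>v. v \<in> mesh_nodes \<T> \<Longrightarrow> A * (norm (v - c))\<^sup>2 + (a \<bullet> v + b) \<le> w v"
    and eq: "w x = A * (norm (x - c))\<^sup>2 + (a \<bullet> x + b)"
  shows "(2 * A) ^ CARD('n) \<le> T w x"
proof -
  obtain v where v: "v \<in> B" "T w x = ma_flux (\<lambda>j. sd w x (v j))" using T_attained by blast
  note xi = node_frontier_or_interior(1)[OF x]
  have low: "A * (norm (y - c))\<^sup>2 + (a \<bullet> y + b) \<le> w y" if "y \<in> D" for y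
    by (rule fe_ge_convex[OF w convex_on_quadratic[OF A] ge that])
  have sd_ge: "2 * A \<le> sd w x (v j)" for j
  proof -
    have "sd (\<lambda>y. A * (norm (y - c))\<^sup>2 + (a \<bullet> y + b)) x (v j) \<le> sd w x (v j) + 2 * 0 / ((step_scale D \<delta> x)\<^sup>2 * \<delta>\<^sup>2)"
      by (rule second_difference_le[OF closed_domain xi \<delta> norm_B[OF v(1)]])
         (use low eq in force)
    thus ?thesis using second_difference_quadratic[OF closed_domain xi \<delta> norm_B[OF v(1)]] by simp
  qed
  have "ma_flux (\<lambda>j::'n. 2 * A) \<le> T w x" unfolding v(2) by (rule ma_flux_mono) (rule sd_ge)
  thus ?thesis using A by (simp add: ma_flux_eq_prod)
qed

lemma interp_affine_T:
  assumes x: "x \<in> interior_nodes \<T>"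
  shows "T (interp (\<lambda>y. a \<bullet> y + b)) x = 0"
proof -
  obtain v where v: "v \<in> B" "T (interp (\<lambda>y. a \<bullet> y + b)) x = ma_flux (\<lambda>j. sd (interp (\<lambda>y. a \<bullet> y + b)) x (v j))"
    using T_attained by blast
  note xi = node_frontier_or_interior(1)[OF x]
  have xD: "x \<in> D" using xi interior_subset by blast
  have "sd (interp (\<lambda>y. a \<bullet> y + b)) x (v j) = 0" for j
  proof -
    have "sd (interp (\<lambda>y. a \<bullet> y + b)) x (v j) = sd (\<lambda>y. 0 * (norm (y - 0))\<^sup>2 + (a \<bullet> y + b)) x (v j)"
      using step_scale_props(3,4)[OF closed_domain xi \<delta> norm_B[OF v(1)]] xD
      by (simp add: second_difference_def Let_def interp_affine)
    thus ?thesis using second_difference_quadratic[OF closed_domain xi \<delta> norm_B[OF v(1)], of 0 0] by simp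
  qed
  thus ?thesis unfolding v(2) by (simp add: ma_flux_eq_prod)
qed

text \<open>Perron's method among discrete subsolutions with the prescribed boundary values. The
  nodal supremum is a subsolution by monotonicity. Were the operator too large at a node x0, the
  value there could be raised slightly: at the other nodes this only increases the operator, so a
  larger subsolution would arise.\<close>

lemma discrete_solution_unique_existence:
  assumes f: "\<And>x. x \<in> interior_nodes \<T> \<Longrightarrow> f x \<ge> 0"
  shows "\<exists>!w. is_discrete_solution f g \<T> \<delta> B w"
proof -
  let ?N = "mesh_nodes \<T>" and ?I = "interior_nodes \<T>" and ?Bd = "boundary_nodes \<T>"
  have bN: "?Bd \<subseteq> ?N" by (auto simp: boundary_nodes_def)
  have iN: "?I \<subseteq> ?N" by (auto simp: interior_nodes_def)
  have NI: "v \<in> ?Bd \<or> v \<in> ?I" if "v \<in> ?N" for v using that by (auto simp: interior_nodes_def)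
  have IB: "v \<notin> ?Bd" if "v \<in> ?I" for v using that by (auto simp: interior_nodes_def)
  have ND: "v \<in> D" if "v \<in> ?N" for v using that nodes_subset by blast
  have finI: "finite ?I" and finB: "finite ?Bd" using finite_nodes iN bN finite_subset by blast+
  define S where "S = {w \<in> fe_space \<T>. (\<forall>x\<in>?Bd. w x = g x) \<and> (\<forall>x\<in>?I. f x \<le> T w x)}"
  obtain F where F: "F \<ge> 1" "\<And>x. x \<in> ?I \<Longrightarrow> f x \<le> F"
  proof -
    have "f x \<le> max 1 (\<Sum>x\<in>?I. f x)" if "x \<in> ?I" for x
      using member_le_sum[of x ?I f] f finI that by (simp add: le_max_iff_disj)
    thus thesis using that[of "max 1 (\<Sum>x\<in>?I. f x)"] by auto
  qed
  \<comment> \<open>The paraboloid has second differences F, and F^n \<ge> F \<ge> f because F \<ge>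
    1. The constant C below pushes it under g at the boundary nodes.\<close>
  define A where "A = F / 2"
  have A: "A \<ge> 0" "2 * A = F" using F by (auto simp: A_def)
  define C where "C = (\<Sum>v\<in>?Bd. \<bar>A * (norm (v - 0))\<^sup>2 - g v\<bar>)"
  have C: "A * (norm (v - 0))\<^sup>2 + (0 \<bullet> v + (- C)) \<le> g v" if "v \<in> ?Bd" for v
    using member_le_sum[of v ?Bd "\<lambda>v. \<bar>A * (norm (v - 0))\<^sup>2 - g v\<bar>"] finB that by (simp add: C_def)
  define w0 where "w0 = interp (\<lambda>v. if v \<in> ?Bd then g v else A * (norm (v - 0))\<^sup>2 + (0 \<bullet> v + (- C)))"
  have w0S: "w0 \<in> S" unfolding S_def
  proof (intro CollectI conjI ballI)
    show "w0 \<in> fe_space \<T>" by (simp add: w0_def interp_fe)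
    show "w0 x = g x" if "x \<in> ?Bd" for x using that bN by (auto simp: w0_def interp_node)
    show "f x \<le> T w0 x" if x: "x \<in> ?I" for x
    proof -
      have "f x \<le> (2 * A) ^ CARD('n)"
        using F(2)[OF x] power_increasing[of 1 "CARD('n)" F] F(1) A(2) by simp
      also have "\<dots> \<le> T w0 x"
      proof (rule interp_quadratic_T[OF x A(1)])
        show "w0 \<in> fe_space \<T>" by (simp add: w0_def interp_fe)
        show "A * (norm (v - 0))\<^sup>2 + (0 \<bullet> v + (- C)) \<le> w0 v" if "v \<in> ?N" for v
          using that C by (auto simp: w0_def interp_node)
        show "w0 x = A * (norm (x - 0))\<^sup>2 + (0 \<bullet> x + (- C))"
          using x iN IB by (auto simp: w0_def interp_node)
      qed
      finally show ?thesis .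
    qed
  qed
  define G where "G = (\<Sum>v\<in>?Bd. \<bar>g v\<bar>)"
  have G: "g v \<le> G" if "v \<in> ?Bd" for v
    using member_le_sum[of v ?Bd "\<lambda>v. \<bar>g v\<bar>"] finB that by (simp add: G_def)
  have upper: "w x \<le> G" if w: "w \<in> S" and x: "x \<in> D" for w x
  proof -
    have "w x \<le> interp (\<lambda>y. 0 \<bullet> y + G) x"
    proof (rule discrete_comparison[OF _ interp_fe _ _ x])
      show "w \<in> fe_space \<T>" using w by (simp add: S_def)
      show "T (interp (\<lambda>y. 0 \<bullet> y + G)) z \<le> T w z" if "z \<in> ?I" for z
        unfolding interp_affine_T[OF that] using w f[OF that] that by (force simp: S_def)
      show "w z \<le> interp (\<lambda>y. 0 \<bullet> y + G) z" if "z \<in> ?Bd" for z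
        using that bN w G by (auto simp: interp_node S_def)
    qed
    thus ?thesis using interp_affine[OF x, of 0 G] by simp
  qed
  \<comment> \<open>A supremum of finite element functions is in general not piecewise affine, so
    only its nodal values are kept and interpolated.\<close>
  define W where "W = (\<lambda>v. SUP w\<in>S. w v)"
  have bdd: "bdd_above ((\<lambda>w. w v) ` S)" if "v \<in> D" for v
    using upper that by (intro bdd_aboveI[of _ G]) auto
  define u where "u = interp W"
  have uN: "u v = W v" if "v \<in> ?N" for v using that by (simp add: u_def interp_node)
  have ufe: "u \<in> fe_space \<T>" by (simp add: u_def interp_fe)
  have S_le: "w y \<le> u y" if w: "w \<in> S" and y: "y \<in> D" for w y
  proof -
    have "w y \<le> u y + 0"
    proof (rule fe_le[OF _ ufe _ y])
      show "w \<in> fe_space \<T>" using w by (simp add: S_def)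
      show "w v \<le> u v + 0" if "v \<in> ?N" for v
        using that uN[OF that] cSUP_upper[OF w bdd[OF ND[OF that]]] by (simp add: W_def)
    qed
    thus ?thesis by simp
  qed
  have ubd: "u x = g x" if x: "x \<in> ?Bd" for x
  proof -
    have "(\<lambda>w. w x) ` S = {g x}" using x w0S by (auto simp: S_def)
    thus ?thesis using uN x bN by (auto simp: W_def)
  qed
  have Tu: "f x \<le> T u x" if x: "x \<in> ?I" for x
  proof -
    have xN: "x \<in> ?N" using x iN by blast
    note xi = node_frontier_or_interior(1)[OF x]
    obtain v where v: "v \<in> B" "T u x = ma_flux (\<lambda>j. sd u x (v j))" using T_attained by blast
    define k where "k = 2 / ((step_scale D \<delta> x)\<^sup>2 * \<delta>\<^sup>2)"
    have "f x \<le> ma_flux (\<lambda>j. sd u x (v j) + k * e)" if e: "e > 0" for e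
    proof -
      have "W x - e < W x" using e by simp
      then obtain w where w: "w \<in> S" "W x - e < w x"
        unfolding W_def using less_cSUP_iff[OF _ bdd[OF ND[OF xN]]] w0S by (metis empty_iff)
      have "sd w x (v j) \<le> sd u x (v j) + k * e" for j
      proof -
        have "sd w x (v j) \<le> sd u x (v j) + 2 * e / ((step_scale D \<delta> x)\<^sup>2 * \<delta>\<^sup>2)"
          by (rule second_difference_le[OF closed_domain xi \<delta> norm_B[OF v(1)]])
             (use S_le[OF w(1)] w(2) uN[OF xN] in force)
        thus ?thesis by (simp add: k_def)
      qed
      hence "ma_flux (\<lambda>j. sd w x (v j)) \<le> ma_flux (\<lambda>j. sd u x (v j) + k * e)" by (rule ma_flux_mono)
      thus ?thesis using T_le[OF v(1), of w x] w(1) x by (force simp: S_def)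
    qed
    hence "\<forall>\<^sub>F e in at_right 0. f x \<le> ma_flux (\<lambda>j. sd u x (v j) + k * e)"
      by (auto simp: eventually_at_filter)
    with ma_flux_tendsto show ?thesis unfolding v(2) by (intro tendsto_lowerbound) auto
  qed
  have Tu_eq: "T u x0 = f x0" if x0: "x0 \<in> ?I" for x0
  proof (rule ccontr)
    assume "T u x0 \<noteq> f x0"
    hence less: "f x0 < T u x0" using Tu[OF x0] by simp
    have x0N: "x0 \<in> ?N" using x0 iN by blast
    note xi = node_frontier_or_interior(1)[OF x0]
    \<comment> \<open>Raising the value at x0 by e lowers the second differences there by at most
      |k| e. As B is finite, one e works for all bases.\<close>
    define k where "k = - 2 / ((step_scale D \<delta> x0)\<^sup>2 * \<delta>\<^sup>2)"
    have "\<forall>\<^sub>F e in at_right 0. f x0 < ma_flux (\<lambda>j. sd u x0 (v j) + k * e)" if "v \<in> B" for v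
      by (rule order_tendstoD(1)[OF ma_flux_tendsto]) (use T_le[OF that, of u x0] less in simp)
    hence "\<forall>\<^sub>F e in at_right 0. \<forall>v\<in>B. f x0 < ma_flux (\<lambda>j. sd u x0 (v j) + k * e)"
      using B(1) by (simp add: eventually_ball_finite)
    moreover have "\<forall>\<^sub>F e in at_right (0::real). e > 0" by (simp add: eventually_at_filter)
    ultimately have ev: "\<forall>\<^sub>F e in at_right 0. e > 0 \<and> (\<forall>v\<in>B. f x0 < ma_flux (\<lambda>j. sd u x0 (v j) + k * e))"
      by eventually_elim simp
    obtain e where e: "e > 0" "\<And>v. v \<in> B \<Longrightarrow> f x0 < ma_flux (\<lambda>j. sd u x0 (v j) + k * e)"
      using eventually_happens'[OF trivial_limit_at_right_real ev] by blast
    define w where "w = interp (\<lambda>v. if v = x0 then W v + e else W v)"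
    have wfe: "w \<in> fe_space \<T>" by (simp add: w_def interp_fe)
    have wN: "w v = (if v = x0 then u v + e else u v)" if "v \<in> ?N" for v
      using that uN[OF that] by (auto simp add: w_def interp_node)
    have uw: "u y \<le> w y" if y: "y \<in> D" for y
    proof -
      have "u y \<le> w y + 0" by (rule fe_le[OF ufe wfe _ y]) (use wN e in auto)
      thus ?thesis by simp
    qed
    have "w \<in> S" unfolding S_def
    proof (intro CollectI conjI ballI wfe)
      show "w x = g x" if "x \<in> ?Bd" for x using that ubd wN bN IB[OF x0] by auto
      show "f x \<le> T w x" if x: "x \<in> ?I" for x
      proof -
        obtain v where v: "v \<in> B" "T w x = ma_flux (\<lambda>j. sd w x (v j))" using T_attained by blast
        have xN: "x \<in> ?N" using x iN by blast
        note xi' = node_frontier_or_interior(1)[OF x]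
        show ?thesis
        proof (cases "x = x0")
          case True
          have "sd u x0 (v j) + k * e \<le> sd w x0 (v j)" for j
          proof -
            have "sd u x0 (v j) \<le> sd w x0 (v j) + 2 * e / ((step_scale D \<delta> x0)\<^sup>2 * \<delta>\<^sup>2)"
              by (rule second_difference_le[OF closed_domain xi \<delta> norm_B[OF v(1)]])
                (use uw wN[OF x0N] in force)
            thus ?thesis by (simp add: k_def)
          qed
          hence "ma_flux (\<lambda>j. sd u x0 (v j) + k * e) \<le> T w x" unfolding True v(2)[unfolded True] by (rule ma_flux_mono)
          thus ?thesis using e(2)[OF v(1)] True by simp
        next
          case False
          have "sd u x (v j) \<le> sd w x (v j)" for j
          proof -
            have "sd u x (v j) \<le> sd w x (v j) + 2 * 0 / ((step_scale D \<delta> x)\<^sup>2 * \<delta>\<^sup>2)"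
              by (rule second_difference_le[OF closed_domain xi' \<delta> norm_B[OF v(1)]])
                (use uw wN[OF xN] False in force)
            thus ?thesis by simp
          qed
          hence "ma_flux (\<lambda>j. sd u x (v j)) \<le> T w x" unfolding v(2) by (rule ma_flux_mono)
          thus ?thesis using T_le[OF v(1), of u x] Tu[OF x] by linarith
        qed
      qed
    qed
    from S_le[OF this ND[OF x0N]] show False using wN[OF x0N] e(1) by simp
  qed
  have "is_discrete_solution f g \<T> \<delta> B u"
    unfolding is_discrete_solution_def using ufe ubd Tu_eq by blast
  moreover have "w = w'" if w: "is_discrete_solution f g \<T> \<delta> B w" "is_discrete_solution f g \<T> \<delta> B w'" for w w'
  proof (rule fe_eqI)
    show fe: "w \<in> fe_space \<T>" "w' \<in> fe_space \<T>" using w by (auto simp: is_discrete_solution_def)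
    fix v assume v: "v \<in> ?N"
    have "w v \<le> w' v" by (rule discrete_comparison[OF fe _ _ ND[OF v]]) (use w in \<open>auto simp: is_discrete_solution_def\<close>)
    moreover have "w' v \<le> w v" by (rule discrete_comparison[OF fe(2,1) _ _ ND[OF v]]) (use w in \<open>auto simp: is_discrete_solution_def\<close>)
    ultimately show "w v = w' v" by simp
  qed
  ultimately show ?thesis by blast
qed

end

section \<open>Half-relaxed limits\<close>

text \<open>An eventual bound that is uniform in a neighbourhood of x; it makes sense on the closure
  of \<open>\<Omega>\<close> although the functions are considered only in
  \<open>\<Omega>\<close>.\<close>

definition relaxed_bound :: "'a::metric_space set \<Rightarrow> (nat \<Rightarrow> 'a \<Rightarrow> real) \<Rightarrow> 'a \<Rightarrow> real \<Rightarrow> bool" where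
  "relaxed_bound \<Omega> w x c \<longleftrightarrow> (\<exists>d>0. \<exists>N. \<forall>n\<ge>N. \<forall>y\<in>\<Omega>. dist y x < d \<longrightarrow> w n y \<le> c)"

text \<open>The half-relaxed upper limit: the limsup of w n y as n \<rightarrow> \<infinity> and y
  \<rightarrow> x jointly. The lower limit is obtained from it by changing signs twice.\<close>

definition relaxed_limsup :: "'a::metric_space set \<Rightarrow> (nat \<Rightarrow> 'a \<Rightarrow> real) \<Rightarrow> 'a \<Rightarrow> real" where
  "relaxed_limsup \<Omega> w x = Inf {c. relaxed_bound \<Omega> w x c}"

locale bounded_sequence =
  fixes \<Omega> :: "'a::metric_space set" and w :: "nat \<Rightarrow> 'a \<Rightarrow> real" and m :: real
  assumes bound: "\<And>n y. y \<in> \<Omega> \<Longrightarrow> \<bar>w n y\<bar> \<le> m"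
begin

lemma relaxed_bound_mono: "relaxed_bound \<Omega> w x c \<Longrightarrow> c \<le> c' \<Longrightarrow> relaxed_bound \<Omega> w x c'"
  unfolding relaxed_bound_def by (meson order_trans)

lemma relaxed_bound_max: "relaxed_bound \<Omega> w x m"
  unfolding relaxed_bound_def using bound by (intro exI[of _ 1] conjI exI[of _ 0]) (auto simp: abs_le_iff)

lemma relaxed_bound_ge:
  assumes x: "x \<in> closure \<Omega>" and c: "relaxed_bound \<Omega> w x c"
  shows "- m \<le> c"
proof -
  obtain d N where d: "d > 0" "\<And>n y. n \<ge> N \<Longrightarrow> y \<in> \<Omega> \<Longrightarrow> dist y x < d \<Longrightarrow> w n y \<le> c"
    using c unfolding relaxed_bound_def by blast
  obtain y where y: "y \<in> \<Omega>" "dist y x < d" using x d(1) closure_approachable by blast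
  have "w N y \<le> c" using d(2)[OF order_refl y] .
  thus ?thesis using bound[OF y(1), of N] by (simp add: abs_le_iff)
qed

lemma relaxed_limsup_le:
  assumes x: "x \<in> closure \<Omega>" and c: "relaxed_bound \<Omega> w x c"
  shows "relaxed_limsup \<Omega> w x \<le> c"
  unfolding relaxed_limsup_def
  by (rule cInf_lower) (use c relaxed_bound_ge[OF x] in \<open>auto intro!: bdd_belowI[of _ "- m"]\<close>)

lemma relaxed_limsup_less:
  assumes x: "x \<in> closure \<Omega>" and c: "relaxed_limsup \<Omega> w x < c"
  shows "relaxed_bound \<Omega> w x c"
proof -
  have "{c. relaxed_bound \<Omega> w x c} \<noteq> {}" using relaxed_bound_max by blast
  from cInf_lessD[OF this c[unfolded relaxed_limsup_def]]
  obtain c' where "relaxed_bound \<Omega> w x c'" "c' < c" by blast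
  thus ?thesis using relaxed_bound_mono by simp
qed

lemma relaxed_limsup_frequently:
  assumes x: "x \<in> closure \<Omega>" and c: "c < relaxed_limsup \<Omega> w x" and d: "d > 0"
  shows "\<exists>n\<ge>N. \<exists>y\<in>\<Omega>. dist y x < d \<and> c < w n y"
proof (rule ccontr)
  assume "\<not> ?thesis"
  hence "relaxed_bound \<Omega> w x c" unfolding relaxed_bound_def using d by (meson not_le)
  from relaxed_limsup_le[OF x this] show False using c by simp
qed

lemma relaxed_limsup_usc: "usc_on (closure \<Omega>) (relaxed_limsup \<Omega> w)"
  unfolding usc_on_def
proof (intro ballI allI impI)
  fix x c assume x: "x \<in> closure \<Omega>" and c: "relaxed_limsup \<Omega> w x < c"
  define c' where "c' = (relaxed_limsup \<Omega> w x + c) / 2"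
  have c': "relaxed_limsup \<Omega> w x < c'" "c' < c" using c by (auto simp: c'_def)
  obtain d N where d: "d > 0" "\<And>n y. n \<ge> N \<Longrightarrow> y \<in> \<Omega> \<Longrightarrow> dist y x < d \<Longrightarrow> w n y \<le> c'"
    using relaxed_limsup_less[OF x c'(1)] unfolding relaxed_bound_def by blast
  have "relaxed_limsup \<Omega> w y < c" if y: "y \<in> closure \<Omega>" "dist y x < d / 2" for y
  proof -
    have "w n z \<le> c'" if "n \<ge> N" "z \<in> \<Omega>" "dist z y < d / 2" for n z
      using d(2)[OF that(1,2)] dist_triangle[of z x y] that(3) y(2) by simp
    hence "relaxed_bound \<Omega> w y c'" unfolding relaxed_bound_def using d(1)
      by (intro exI[of _ "d / 2"] conjI exI[of _ N]) auto
    thus ?thesis using relaxed_limsup_le[OF y(1)] c'(2) by fastforce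
  qed
  thus "\<exists>d>0. \<forall>y\<in>closure \<Omega>. dist y x < d \<longrightarrow> relaxed_limsup \<Omega> w y < c"
    using d(1) by (intro exI[of _ "d / 2"]) auto
qed

lemma relaxed_limsup_uminus:
  assumes x: "x \<in> closure \<Omega>"
  shows "- relaxed_limsup \<Omega> (\<lambda>n y. - w n y) x \<le> relaxed_limsup \<Omega> w x"
proof (rule ccontr)
  interpret neg: bounded_sequence \<Omega> "\<lambda>n y. - w n y" m
    by standard (use bound in auto)
  let ?a = "relaxed_limsup \<Omega> w x" and ?b = "relaxed_limsup \<Omega> (\<lambda>n y. - w n y) x"
  assume "\<not> - ?b \<le> ?a"
  define e where "e = (- ?b - ?a) / 3"
  have e: "e > 0" "?a + e < - (?b + e)" using \<open>\<not> - ?b \<le> ?a\<close> by (auto simp: e_def field_simps)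
  obtain d N where d: "d > 0" "\<And>n y. n \<ge> N \<Longrightarrow> y \<in> \<Omega> \<Longrightarrow> dist y x < d \<Longrightarrow> w n y \<le> ?a + e"
    using relaxed_limsup_less[OF x, of "?a + e"] e unfolding relaxed_bound_def by auto
  obtain d' N' where d': "d' > 0" "\<And>n y. n \<ge> N' \<Longrightarrow> y \<in> \<Omega> \<Longrightarrow> dist y x < d' \<Longrightarrow> - w n y \<le> ?b + e"
    using neg.relaxed_limsup_less[OF x, of "?b + e"] e unfolding relaxed_bound_def by auto
  obtain y where y: "y \<in> \<Omega>" "dist y x < min d d'" using x d(1) d'(1) closure_approachable
    by (metis min_less_iff_conj)
  have "w (max N N') y \<le> ?a + e" "- w (max N N') y \<le> ?b + e" using d(2) d'(2) y by auto
  thus False using e by linarith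
qed

end

section \<open>Geometry of the mesh and of the domain\<close>

lemma extreme_point_of_subset_iff:
  "x extreme_point_of S \<Longrightarrow> K \<subseteq> S \<Longrightarrow> x \<in> K \<Longrightarrow> x extreme_point_of K"
  unfolding extreme_point_of_def by blast

locale meshed_domain =
  fixes \<Omega> :: "(real ^ 'n) set" and h :: real and \<T>
  assumes \<Omega>: "open \<Omega>" "convex \<Omega>" "bounded \<Omega>" "\<Omega> \<noteq> {}" and mesh: "mesh_of \<Omega> h \<T>"
begin

sublocale simplicial_mesh \<T>
  by standard (use mesh in \<open>auto simp: mesh_of_def\<close>)

lemma domain_convex: "convex (\<Union>\<T>)"
  using mesh by (simp add: mesh_of_def)

lemma boundary_nodes_frontier: "x \<in> boundary_nodes \<T> \<Longrightarrow> x \<in> frontier \<Omega>"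
  using mesh by (auto simp: mesh_of_def)

text \<open>Extreme points of the convex computational domain are boundary nodes, which lie on the
  frontier of \<open>\<Omega>\<close>; Krein-Milman recovers the whole domain from them.\<close>

lemma domain_subset: "\<Union>\<T> \<subseteq> closure \<Omega>"
proof -
  have "{x. x extreme_point_of (\<Union>\<T>)} \<subseteq> boundary_nodes \<T>"
  proof
    fix x assume "x \<in> {x. x extreme_point_of (\<Union>\<T>)}"
    hence x: "x extreme_point_of (\<Union>\<T>)" by simp
    then obtain K where K: "K \<in> \<T>" "x \<in> K" unfolding extreme_point_of_def by blast
    have "x extreme_point_of K" by (rule extreme_point_of_subset_iff[OF x]) (use K in auto)
    hence "x \<in> mesh_nodes \<T>" using K by (auto simp: mesh_nodes_def)
    moreover have "x \<notin> interior (\<Union>\<T>)" using extreme_point_not_in_interior[OF x] .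
    ultimately show "x \<in> boundary_nodes \<T>"
      using nodes_subset closed_domain by (auto simp: boundary_nodes_def frontier_def)
  qed
  also have "\<dots> \<subseteq> closure \<Omega>" using boundary_nodes_frontier by (auto simp: frontier_def)
  finally have "convex hull {x. x extreme_point_of (\<Union>\<T>)} \<subseteq> closure \<Omega>"
    by (rule hull_minimal) (use \<Omega>(2) convex_closure in blast)
  thus ?thesis using Krein_Milman_Minkowski[OF compact_domain domain_convex] by simp
qed

lemma interior_domain_subset: "interior (\<Union>\<T>) \<subseteq> \<Omega>"
  using interior_mono[OF domain_subset] convex_interior_closure[OF \<Omega>(2)] \<Omega>(1) by (simp add: interior_open)

lemma interior_nodes_subset: "x \<in> interior_nodes \<T> \<Longrightarrow> x \<in> \<Omega>"
  using node_frontier_or_interior(1) interior_domain_subset by blast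

lemma domain_nonempty: "\<Union>\<T> \<noteq> {}"
proof -
  obtain K where K: "K \<in> \<T>" using ne by blast
  hence "int DIM(real ^ 'n) simplex K" using mesh by (simp add: mesh_of_def)
  hence "K \<noteq> {}" by auto
  thus ?thesis using K by blast
qed

lemma vertex_dist:
  assumes "K \<in> \<T>" "x \<in> K" "v \<in> vertices K"
  shows "dist x v \<le> h"
proof -
  have "dist x v \<le> diameter K"
    using assms vertices_subset compact_element compact_imp_bounded by (intro diameter_bounded_bound) auto
  also have "\<dots> \<le> h"
    using mesh assms(1) finite_mesh unfolding mesh_of_def by (auto intro!: Max_ge)
  finally show ?thesis .
qed

lemma infdist_domain_le:
  assumes x: "x \<in> \<Omega>"
  shows "infdist x (\<Union>\<T>) \<le> hausdorff_dist \<Omega> (\<Union>\<T>)"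
proof -
  obtain z where z: "z \<in> \<Union>\<T>" using domain_nonempty by blast
  obtain R where R: "\<And>y. y \<in> \<Omega> \<Longrightarrow> dist z y \<le> R" using \<Omega>(3) unfolding bounded_any_center[of _ z] by blast
  have "bdd_above ((\<lambda>x. infdist x (\<Union>\<T>)) ` \<Omega>)"
    using infdist_le2[OF z] R by (intro bdd_aboveI[of _ R]) (auto simp: dist_commute)
  hence "infdist x (\<Union>\<T>) \<le> (SUP x\<in>\<Omega>. infdist x (\<Union>\<T>))" using x by (intro cSUP_upper)
  thus ?thesis unfolding hausdorff_dist_def by simp
qed

text \<open>If y were missed, a hyperplane would separate it from the convex domain. Moving from y
  by r away from that hyperplane stays in \<open>\<Omega>\<close> but reaches a point at distance at
  least r from the domain.\<close>

lemma ball_subset_domain: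
  assumes b: "ball x (2 * r) \<subseteq> \<Omega>" and r: "r > 0" and d: "hausdorff_dist \<Omega> (\<Union>\<T>) < r"
  shows "ball x r \<subseteq> \<Union>\<T>"
proof (rule subsetI, rule ccontr)
  fix y assume y: "y \<in> ball x r" and out: "y \<notin> \<Union>\<T>"
  obtain a b where ab: "a \<bullet> y < b" "\<And>z. z \<in> \<Union>\<T> \<Longrightarrow> b < a \<bullet> z"
    using separating_hyperplane_closed_point[OF domain_convex closed_domain out] by blast
  obtain z0 where z0: "z0 \<in> \<Union>\<T>" using domain_nonempty by blast
  have a0: "a \<noteq> 0" using ab(1) ab(2)[OF z0] by auto
  define p where "p = y - (r / norm a) *\<^sub>R a"
  have "dist x p \<le> dist x y + dist y p" by (rule dist_triangle)
  also have "dist y p = r" using a0 r by (simp add: p_def dist_norm)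
  finally have "p \<in> \<Omega>" using y b by auto
  hence "infdist p (\<Union>\<T>) < r" using infdist_domain_le d by fastforce
  then obtain z where z: "z \<in> \<Union>\<T>" "dist p z < r"
    using infdist_attains_inf[OF closed_domain domain_nonempty, of p] by (metis)
  have "a \<bullet> z - a \<bullet> p \<le> norm a * norm (z - p)"
    using Cauchy_Schwarz_ineq2[of a "z - p"] by (simp add: inner_diff_right)
  also have "\<dots> \<le> norm a * r" using z(2) by (intro mult_left_mono) (auto simp: dist_norm norm_minus_commute)
  finally have "a \<bullet> z \<le> a \<bullet> p + norm a * r" by simp
  moreover have "a \<bullet> p = a \<bullet> y - r * norm a"
    using a0 by (simp add: p_def inner_diff_right dot_square_norm power2_eq_square)
  ultimately show False using ab(1) ab(2)[OF z(1)] by (simp add: mult.commute)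
qed

lemma closest_point_domain:
  assumes x: "x \<in> \<Omega>"
  shows "closest_point (\<Union>\<T>) x \<in> \<Union>\<T>" "dist x (closest_point (\<Union>\<T>) x) \<le> hausdorff_dist \<Omega> (\<Union>\<T>)"
proof -
  show "closest_point (\<Union>\<T>) x \<in> \<Union>\<T>" by (rule closest_point_in_set[OF closed_domain domain_nonempty])
  have "dist x (closest_point (\<Union>\<T>) x) = infdist x (\<Union>\<T>)"
    using closest_point_le[OF closed_domain] domain_nonempty closest_point_in_set[OF closed_domain domain_nonempty]
      infdist_attains_inf[OF closed_domain domain_nonempty, of x] infdist_le
    by (metis antisym)
  thus "dist x (closest_point (\<Union>\<T>) x) \<le> hausdorff_dist \<Omega> (\<Union>\<T>)" using infdist_domain_le[OF x] by simp
qed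

end

text \<open>The ball condition |x - z - R \<nu>| \<le> R with the square expanded: the distance to
  the supporting hyperplane dominates |x - z|^2. In this form it turns parabolic bounds into affine
  ones.\<close>

lemma uniformly_convex_normal:
  fixes \<Omega> :: "'a::euclidean_space set"
  assumes \<Omega>: "open \<Omega>" "uniformly_convex \<Omega>"
  obtains R where "R > 0" "\<And>z. z \<in> frontier \<Omega> \<Longrightarrow> \<exists>\<nu>. norm \<nu> = 1 \<and>
    (\<forall>x\<in>closure \<Omega>. (norm (x - z))\<^sup>2 \<le> 2 * R * (\<nu> \<bullet> (x - z)))"
proof -
  have cv: "convex \<Omega>" using \<Omega>(2) by (simp add: uniformly_convex_def)
  obtain R where R: "R > 0" "\<And>z \<nu>. z \<in> frontier \<Omega> \<Longrightarrow> norm \<nu> = 1 \<Longrightarrow> (\<forall>x\<in>\<Omega>. \<nu> \<bullet> (x - z) \<ge> 0) \<Longrightarrow>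
      \<Omega> \<subseteq> cball (z + R *\<^sub>R \<nu>) R"
    using \<Omega>(2) unfolding uniformly_convex_def by blast
  show thesis
  proof (rule that[OF R(1)])
    fix z assume z: "z \<in> frontier \<Omega>"
    hence zn: "z \<notin> \<Omega>" using \<Omega>(1) by (simp add: frontier_def interior_open)
    show "\<exists>\<nu>. norm \<nu> = 1 \<and> (\<forall>x\<in>closure \<Omega>. (norm (x - z))\<^sup>2 \<le> 2 * R * (\<nu> \<bullet> (x - z)))"
    proof (cases "\<Omega> = {}")
      case True
      thus ?thesis using z by simp
    next
      case False
      obtain a b where ab: "a \<noteq> 0" "\<forall>x\<in>{z}. a \<bullet> x \<le> b" "\<forall>x\<in>\<Omega>. b \<le> a \<bullet> x"
        using separating_hyperplane_sets[of "{z}" \<Omega>] cv zn False by auto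
      define \<nu> where "\<nu> = (1 / norm a) *\<^sub>R a"
      have n1: "norm \<nu> = 1" using ab(1) by (simp add: \<nu>_def)
      have "\<nu> \<bullet> (x - z) \<ge> 0" if "x \<in> \<Omega>" for x
      proof -
        have "a \<bullet> (x - z) \<ge> 0" using ab that by (force simp: inner_diff_right)
        thus ?thesis by (simp add: \<nu>_def)
      qed
      hence "\<Omega> \<subseteq> cball (z + R *\<^sub>R \<nu>) R" using R(2)[OF z n1] by blast
      hence "closure \<Omega> \<subseteq> cball (z + R *\<^sub>R \<nu>) R" by (rule closure_minimal) simp
      moreover have "(norm (x - z))\<^sup>2 \<le> 2 * R * (\<nu> \<bullet> (x - z))" if "x \<in> cball (z + R *\<^sub>R \<nu>) R" for x
      proof -
        have "norm (x - z - R *\<^sub>R \<nu>) \<le> R" using that by (simp add: dist_norm norm_minus_commute algebra_simps)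
        hence "(norm (x - z - R *\<^sub>R \<nu>))\<^sup>2 \<le> R\<^sup>2" by (intro power_mono) auto
        moreover have "(norm (x - z - R *\<^sub>R \<nu>))\<^sup>2 = (norm (x - z))\<^sup>2 - 2 * R * (\<nu> \<bullet> (x - z)) + R\<^sup>2"
        proof -
          define y where "y = x - z"
          have "\<nu> \<bullet> \<nu> = 1" using n1 by (simp add: norm_eq_1)
          thus ?thesis unfolding y_def[symmetric] power2_norm_eq_inner
            by (simp add: inner_diff_left inner_diff_right inner_commute[of y \<nu>] power2_eq_square algebra_simps)
        qed
        ultimately show ?thesis by simp
      qed
      ultimately show ?thesis using n1 by blast
    qed
  qed
qed

section \<open>Contact of discrete solutions with paraboloids\<close>

lemma quadratic_form_difference:
  fixes M :: "real ^ 'n ^ 'n"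
  assumes "\<And>z. norm (M *v z) \<le> norm z * \<beta>" "norm v = 1" "norm w = 1"
  shows "\<bar>v \<bullet> (M *v v) - w \<bullet> (M *v w)\<bar> \<le> 2 * \<beta> * norm (v - w)"
proof -
  have "v \<bullet> (M *v v) - w \<bullet> (M *v w) = (v - w) \<bullet> (M *v v) + w \<bullet> (M *v (v - w))"
    by (simp add: matrix_vector_mult_diff_distrib inner_diff_left inner_diff_right)
  moreover have "\<bar>(v - w) \<bullet> (M *v v)\<bar> \<le> norm (v - w) * \<beta>"
    using Cauchy_Schwarz_ineq2[of "v - w" "M *v v"] mult_left_mono[of "norm (M *v v)" \<beta> "norm (v - w)"]
      assms(1)[of v] assms(2) by simp
  moreover have "\<bar>w \<bullet> (M *v (v - w))\<bar> \<le> norm (v - w) * \<beta>"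
    using Cauchy_Schwarz_ineq2[of w "M *v (v - w)"] assms(1)[of "v - w"] assms(3) by simp
  ultimately have "\<bar>v \<bullet> (M *v v) - w \<bullet> (M *v w)\<bar> \<le> norm (v - w) * \<beta> + norm (v - w) * \<beta>" by linarith
  thus ?thesis by (simp add: mult_ac)
qed

context meshed_domain begin

text \<open>Expanding at y, the linear term disappears because the weights are barycentric; only the
  quadratic term at distance at most h remains.\<close>

lemma quadratic_interpolation_error:
  fixes M :: "real ^ 'n ^ 'n" and b c :: "real ^ 'n"
  assumes \<beta>: "\<And>z. norm (M *v z) \<le> norm z * \<beta>" "\<beta> \<ge> 0" and sym: "transpose M = M"
    and K: "K \<in> \<T>" "y \<in> K" and p: "\<And>v. v \<in> vertices K \<Longrightarrow> p v \<ge> 0" "sum p (vertices K) = 1"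
      "(\<Sum>v\<in>vertices K. p v *\<^sub>R v) = y"
  defines "\<phi> \<equiv> \<lambda>y. b \<bullet> (y - c) + (y - c) \<bullet> (M *v (y - c)) / 2"
  shows "\<bar>(\<Sum>v\<in>vertices K. p v * \<phi> v) - \<phi> y\<bar> \<le> \<beta> / 2 * h\<^sup>2"
proof -
  define g where "g = b + M *v (y - c)"
  have taylor: "\<phi> v = \<phi> y + g \<bullet> (v - y) + (v - y) \<bullet> (M *v (v - y)) / 2" for v
  proof -
    define z k where "z = y - c" and "k = v - y"
    have e: "v - c = z + k" by (simp add: z_def k_def)
    have "z \<bullet> (M *v k) = k \<bullet> (M *v z)" "(M *v z) \<bullet> k = k \<bullet> (M *v z)"
      by (rule symmetric_matrix_inner[OF sym], rule inner_commute)
    thus ?thesis unfolding \<phi>_def g_def e z_def[symmetric] k_def[symmetric]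
      by (simp add: matrix_vector_right_distrib inner_add_left inner_add_right add_divide_distrib)
  qed
  have "(\<Sum>v\<in>vertices K. p v *\<^sub>R (v - y)) = 0"
    using p(2,3) by (simp add: scaleR_diff_right sum_subtractf scaleR_sum_left[symmetric])
  hence zero: "(\<Sum>v\<in>vertices K. p v * (g \<bullet> (v - y))) = 0"
    by (simp add: inner_scaleR_right[symmetric] inner_sum_right[symmetric] del: inner_scaleR_right)
  have "(\<Sum>v\<in>vertices K. p v * \<phi> v) = (\<Sum>v\<in>vertices K. p v * \<phi> y + p v * (g \<bullet> (v - y)) + p v * ((v - y) \<bullet> (M *v (v - y)) / 2))"
    by (rule sum.cong[OF refl]) (subst taylor, simp add: algebra_simps)
  also have "\<dots> = \<phi> y + (\<Sum>v\<in>vertices K. p v * ((v - y) \<bullet> (M *v (v - y)) / 2))"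
    by (simp add: sum.distrib zero sum_distrib_right[symmetric] p(2))
  finally have "(\<Sum>v\<in>vertices K. p v * \<phi> v) - \<phi> y = (\<Sum>v\<in>vertices K. p v * ((v - y) \<bullet> (M *v (v - y)) / 2))" by simp
  also have "\<bar>\<dots>\<bar> \<le> (\<Sum>v\<in>vertices K. \<bar>p v * ((v - y) \<bullet> (M *v (v - y)) / 2)\<bar>)" by (rule sum_abs)
  also have "\<dots> \<le> (\<Sum>v\<in>vertices K. p v * (\<beta> / 2 * h\<^sup>2))"
  proof (rule sum_mono)
    fix v assume v: "v \<in> vertices K"
    have d: "norm (v - y) \<le> h" using vertex_dist[OF K v] by (simp add: dist_norm norm_minus_commute)
    have "\<bar>(v - y) \<bullet> (M *v (v - y))\<bar> \<le> norm (v - y) * norm (M *v (v - y))" by (rule Cauchy_Schwarz_ineq2)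
    also have "\<dots> \<le> norm (v - y) * (norm (v - y) * \<beta>)" by (intro mult_left_mono \<beta>) auto
    also have "\<dots> \<le> h * (h * \<beta>)" using d \<beta>(2) by (intro mult_mono) (auto intro: order_trans[OF norm_ge_zero])
    finally have "\<bar>(v - y) \<bullet> (M *v (v - y)) / 2\<bar> \<le> \<beta> / 2 * h\<^sup>2" by (simp add: power2_eq_square mult_ac)
    hence "p v * \<bar>(v - y) \<bullet> (M *v (v - y)) / 2\<bar> \<le> p v * (\<beta> / 2 * h\<^sup>2)" using p(1)[OF v] by (rule mult_left_mono)
    thus "\<bar>p v * ((v - y) \<bullet> (M *v (v - y)) / 2)\<bar> \<le> p v * (\<beta> / 2 * h\<^sup>2)" using p(1)[OF v] by (simp only: abs_mult abs_of_nonneg)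
  qed
  also have "\<dots> = \<beta> / 2 * h\<^sup>2" by (simp only: sum_distrib_right[symmetric] p(2) mult_1)
  finally show ?thesis .
qed

end

locale mesh_sequence =
  fixes \<Omega> :: "(real ^ 'n) set" and hs \<delta>s :: "nat \<Rightarrow> real" and Ts :: "nat \<Rightarrow> (real ^ 'n) set set"
  assumes \<Omega>: "open \<Omega>" "convex \<Omega>" "bounded \<Omega>" "\<Omega> \<noteq> {}"
    and mesh: "\<And>n. mesh_of \<Omega> (hs n) (Ts n)"
    and \<delta>s_pos: "\<And>n. \<delta>s n > 0"
    and limits: "hs \<longlonglongrightarrow> 0" "\<delta>s \<longlonglongrightarrow> 0" "(\<lambda>n. hs n / \<delta>s n) \<longlonglongrightarrow> 0"
      "(\<lambda>n. hausdorff_dist \<Omega> (\<Union>(Ts n))) \<longlonglongrightarrow> 0"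
begin

sublocale md: meshed_domain \<Omega> "hs n" "Ts n" for n
  by standard (use \<Omega> mesh in auto)

text \<open>The maximum of \<open>w n\<close> minus a strictly touching paraboloid is taken over the
  nodes near x0. At the maximising node the values of \<open>w n\<close> at the stencil points are
  bounded by barycentric weights, each with the interpolation error of the paraboloid. Affinity is
  assumed element by element, so that negated solutions can be inserted as well.\<close>

lemma discrete_contact:
  fixes w :: "nat \<Rightarrow> real ^ 'n \<Rightarrow> real"
  defines "W \<equiv> \<lambda>n. closest_point_extension (\<Union>(Ts n)) (w n)"
  assumes aff: "\<And>n K. K \<in> Ts n \<Longrightarrow> \<exists>a b. \<forall>x\<in>K. w n x = a \<bullet> x + b"
    and bound: "\<And>n y. y \<in> \<Omega> \<Longrightarrow> \<bar>W n y\<bar> \<le> m"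
    and jet: "superjet (relaxed_limsup \<Omega> W) x0 b M" and x0: "x0 \<in> \<Omega>" and e: "e > 0" and r: "r > 0"
  shows "\<exists>n\<ge>N. \<exists>z\<in>interior_nodes (Ts n). dist z x0 < r \<and>
    (\<forall>v. norm v = 1 \<longrightarrow> second_difference (\<Union>(Ts n)) (\<delta>s n) (w n) z v \<le> v \<bullet> (M *v v) + e)"
proof -
  interpret bounded_sequence \<Omega> W m by standard (rule bound)
  define U where "U = relaxed_limsup \<Omega> W"
  \<comment> \<open>This adds (e / 4) |y - x0|^2 to the paraboloid: one half absorbs the jet error,
    the other makes the contact strict. The remaining e / 2 in the conclusion is reserved for the
    interpolation error.\<close>
  define M' where "M' = M + (e / 2) *\<^sub>R mat 1"
  have symM: "transpose M = M" using jet by (simp add: superjet_def)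
  have sym: "transpose M' = M'" unfolding M'_def transpose_add transpose_scaleR symM transpose_mat ..
  have M'v: "h \<bullet> (M' *v h) = h \<bullet> (M *v h) + e / 2 * (norm h)\<^sup>2" for h
    by (simp add: M'_def matrix_vector_mult_add_rdistrib scaleR_matrix_vector inner_add_right power2_norm_eq_inner)
  obtain \<beta> where \<beta>: "\<beta> > 0" "\<And>z. norm (M' *v z) \<le> norm z * \<beta>"
    using bounded_linear.pos_bounded[OF matrix_vector_mul_bounded_linear[of M']] by blast
  define \<phi> where "\<phi> = (\<lambda>y. b \<bullet> (y - x0) + (y - x0) \<bullet> (M' *v (y - x0)) / 2)"
  have c\<phi>: "isCont \<phi> y" for y
  proof -
    have "continuous_on UNIV \<phi>" unfolding \<phi>_def by (intro continuous_intros) auto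
    thus ?thesis by (simp add: continuous_on_eq_continuous_at)
  qed
  have "\<forall>\<^sub>F y in nhds x0. U y \<le> U x0 + b \<bullet> (y - x0) + (y - x0) \<bullet> (M *v (y - x0)) / 2 + e / 8 * (norm (y - x0))\<^sup>2"
  proof -
    have "e / 8 > 0" using e by simp
    thus ?thesis using jet unfolding superjet_def U_def by blast
  qed
  then obtain d0 where d0: "d0 > 0" "\<And>y. dist y x0 < d0 \<Longrightarrow>
    U y \<le> U x0 + b \<bullet> (y - x0) + (y - x0) \<bullet> (M *v (y - x0)) / 2 + e / 8 * (norm (y - x0))\<^sup>2"
    unfolding eventually_nhds_metric by blast
  obtain d1 where d1: "d1 > 0" "ball x0 d1 \<subseteq> \<Omega>" using x0 \<Omega>(1) open_contains_ball by blast
  \<comment> \<open>The ball of radius 4 r1 lies in \<open>\<Omega>\<close>, so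
    \<open>ball_subset_domain\<close> puts the ball of radius 2 r1 into the mesh domain for late
    n.\<close>
  define r1 where "r1 = min r (min d0 d1) / 4"
  have r1: "r1 > 0" "r1 < r" "r1 < d0" "2 * (2 * r1) \<le> d1" using r d0(1) d1(1) by (auto simp: r1_def)
  have b\<Omega>: "ball x0 (2 * (2 * r1)) \<subseteq> \<Omega>" using d1(2) r1(4) by (meson order_trans subset_ball)
  have in\<Omega>: "y \<in> \<Omega>" if "dist y x0 \<le> r1" for y
    using b\<Omega> that r1(1) by (auto simp: subset_iff dist_commute)
  have Uq: "U y \<le> U x0 + \<phi> y - e / 8 * (norm (y - x0))\<^sup>2" if "dist y x0 \<le> r1" for y
    using d0(2)[of y] that r1(3) by (simp add: \<phi>_def M'v add_divide_distrib)
  \<comment> \<open>On the annulus between r1 / 2 and r1 strict contact leaves a gap of at least (e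
    / 8) (r1 / 2)^2 = 2 \<tau>. Half of it is spent on making the bound uniform over the compact
    annulus and over late n.\<close>
  define \<tau> where "\<tau> = e * r1\<^sup>2 / 64"
  have \<tau>: "\<tau> > 0" using e r1 by (simp add: \<tau>_def)
  define A where "A = cball x0 r1 - ball x0 (r1 / 2)"
  have cA: "compact A" unfolding A_def by (intro compact_diff) auto
  have "\<exists>d>0. \<exists>N. \<forall>n\<ge>N. \<forall>y\<in>\<Omega>. dist y a < d \<longrightarrow> W n y - \<phi> y \<le> U x0 - \<tau>" if a: "a \<in> A" for a
  proof -
    have ad: "dist a x0 \<le> r1" "r1 / 2 \<le> dist a x0" using a by (auto simp: A_def dist_commute)
    have "e / 8 * (norm (a - x0))\<^sup>2 \<ge> e / 8 * (r1 / 2)\<^sup>2"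
      using ad(2) e r1(1) by (intro mult_left_mono power_mono) (auto simp: dist_norm)
    hence Ua: "U a - \<phi> a \<le> U x0 - 2 * \<tau>" using Uq[OF ad(1)] by (simp add: \<tau>_def power_divide)
    have "a \<in> closure \<Omega>" using in\<Omega>[OF ad(1)] closure_subset by blast
    moreover have "U a < U a + \<tau> / 2" using \<tau> by simp
    ultimately have "relaxed_bound \<Omega> W a (U a + \<tau> / 2)"
      unfolding U_def by (rule relaxed_limsup_less)
    then obtain d N where d: "d > 0" "\<And>n y. n \<ge> N \<Longrightarrow> y \<in> \<Omega> \<Longrightarrow> dist y a < d \<Longrightarrow> W n y \<le> U a + \<tau> / 2"
      unfolding relaxed_bound_def by blast
    obtain d' where d': "d' > 0" "\<And>y. dist y a < d' \<Longrightarrow> dist (\<phi> y) (\<phi> a) < \<tau> / 2"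
      using c\<phi>[of a] \<tau> unfolding continuous_at_eps_delta by (meson half_gt_zero)
    have "W n y - \<phi> y \<le> U x0 - \<tau>" if "n \<ge> N" "y \<in> \<Omega>" "dist y a < min d d'" for n y
    proof -
      have "W n y \<le> U a + \<tau> / 2" using d(2) that by simp
      moreover have "\<bar>\<phi> y - \<phi> a\<bar> < \<tau> / 2" using d'(2)[of y] that by (simp add: dist_real_def)
      ultimately show ?thesis using Ua by linarith
    qed
    thus ?thesis using d(1) d'(1) by (intro exI[of _ "min d d'"] conjI exI[of _ N]) auto
  qed
  then obtain dd NN where dd: "\<And>a. a \<in> A \<Longrightarrow> dd a > 0"
     "\<And>a n y. a \<in> A \<Longrightarrow> n \<ge> NN a \<Longrightarrow> y \<in> \<Omega> \<Longrightarrow> dist y a < dd a \<Longrightarrow> W n y - \<phi> y \<le> U x0 - \<tau>" by metis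
  have "A \<subseteq> (\<Union>a\<in>A. ball a (dd a))" using dd(1) by auto
  then obtain F where F: "F \<subseteq> A" "finite F" "A \<subseteq> (\<Union>a\<in>F. ball a (dd a))"
    by (rule compactE_image[OF cA, rotated]) auto
  define N1 where "N1 = (\<Sum>a\<in>F. NN a)"
  have annulus: "W n y - \<phi> y \<le> U x0 - \<tau>" if n: "n \<ge> N1" and y: "y \<in> A" for n y
  proof -
    obtain a where a: "a \<in> F" "y \<in> ball a (dd a)" using F(3) y by blast
    have "NN a \<le> N1" unfolding N1_def using a(1) F(2) by (intro member_le_sum) auto
    moreover have "y \<in> \<Omega>" using y in\<Omega> by (auto simp: A_def dist_commute)
    ultimately show ?thesis using dd(2)[of a n y] a F(1) n by (auto simp: dist_commute)
  qed
  have "\<forall>\<^sub>F n in sequentially. hs n < r1 / 8 \<and> \<delta>s n < r1 / 4 \<and> hausdorff_dist \<Omega> (\<Union>(Ts n)) < 2 * r1 \<and>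
     \<beta> / 2 * (hs n)\<^sup>2 < \<tau> / 4 \<and> \<beta> * (hs n / \<delta>s n)\<^sup>2 < e / 2"
  proof (intro eventually_conj)
    show "\<forall>\<^sub>F n in sequentially. hs n < r1 / 8"
      by (rule order_tendstoD(2)[OF limits(1)]) (use r1(1) in simp)
    show "\<forall>\<^sub>F n in sequentially. \<delta>s n < r1 / 4"
      by (rule order_tendstoD(2)[OF limits(2)]) (use r1(1) in simp)
    show "\<forall>\<^sub>F n in sequentially. hausdorff_dist \<Omega> (\<Union>(Ts n)) < 2 * r1"
      by (rule order_tendstoD(2)[OF limits(4)]) (use r1(1) in simp)
    have t: "(\<lambda>n. \<beta> / 2 * (hs n)\<^sup>2) \<longlonglongrightarrow> \<beta> / 2 * 0\<^sup>2" "(\<lambda>n. \<beta> * (hs n / \<delta>s n)\<^sup>2) \<longlonglongrightarrow> \<beta> * 0\<^sup>2"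
      by (intro tendsto_intros limits)+
    show "\<forall>\<^sub>F n in sequentially. \<beta> / 2 * (hs n)\<^sup>2 < \<tau> / 4"
      by (rule order_tendstoD(2)[OF t(1)]) (use \<tau> in simp)
    show "\<forall>\<^sub>F n in sequentially. \<beta> * (hs n / \<delta>s n)\<^sup>2 < e / 2"
      by (rule order_tendstoD(2)[OF t(2)]) (use e in simp)
  qed
  \<comment> \<open>With these thresholds a stencil centred within r1 / 2 stays within 3 r1 / 4, and
    the vertices of the elements it meets stay within r1.\<close>
  then obtain N2 where N2: "\<And>n. n \<ge> N2 \<Longrightarrow> hs n < r1 / 8 \<and> \<delta>s n < r1 / 4 \<and> hausdorff_dist \<Omega> (\<Union>(Ts n)) < 2 * r1 \<and>
     \<beta> / 2 * (hs n)\<^sup>2 < \<tau> / 4 \<and> \<beta> * (hs n / \<delta>s n)\<^sup>2 < e / 2" unfolding eventually_sequentially by blast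
  obtain d2 where d2: "d2 > 0" "\<And>y. dist y x0 < d2 \<Longrightarrow> dist (\<phi> y) (\<phi> x0) < \<tau> / 4"
    using c\<phi>[of x0] \<tau> unfolding continuous_at_eps_delta by (meson divide_pos_pos zero_less_numeral)
  have "x0 \<in> closure \<Omega>" using x0 closure_subset by blast
  moreover have "U x0 - \<tau> / 4 < relaxed_limsup \<Omega> W x0" using \<tau> by (simp add: U_def)
  moreover have "min d2 (r1 / 4) > 0" using d2(1) r1(1) by simp
  ultimately obtain n y where n: "n \<ge> max N (max N1 N2)" and y: "y \<in> \<Omega>" "dist y x0 < min d2 (r1 / 4)"
    "U x0 - \<tau> / 4 < W n y"
    using relaxed_limsup_frequently by meson
  have nn: "hs n < r1 / 8" "\<delta>s n < r1 / 4" "hausdorff_dist \<Omega> (\<Union>(Ts n)) < 2 * r1"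
     "\<beta> / 2 * (hs n)\<^sup>2 < \<tau> / 4" "\<beta> * (hs n / \<delta>s n)\<^sup>2 < e / 2" using N2[of n] n by auto
  let ?D = "\<Union>(Ts n)" and ?h = "hs n" and ?\<delta> = "\<delta>s n"
  have bD: "ball x0 (2 * r1) \<subseteq> ?D"
    by (rule md.ball_subset_domain[OF b\<Omega> _ nn(3)]) (use r1 in simp)
  have WD: "W n p = w n p" if "p \<in> ?D" for p using that by (simp add: W_def closest_point_extension_def)
  have inD: "p \<in> ?D" if "dist p x0 \<le> r1" for p using that bD r1(1) by (auto simp: subset_iff dist_commute)
  have err: "\<bar>(\<Sum>v\<in>vertices K. p v * \<phi> v) - \<phi> y\<bar> \<le> \<beta> / 2 * ?h\<^sup>2"
    if "K \<in> Ts n" "y \<in> K" "\<And>v. v \<in> vertices K \<Longrightarrow> p v \<ge> 0" "sum p (vertices K) = 1"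
      "(\<Sum>v\<in>vertices K. p v *\<^sub>R v) = y" for K y p
    unfolding \<phi>_def
    by (rule md.quadratic_interpolation_error[OF \<beta>(2) _ sym that]) (use \<beta>(1) in simp)
  define \<psi> where "\<psi> = (\<lambda>v. w n v - \<phi> v)"
  have yD: "y \<in> ?D" using inD y(2) r1(1) by simp
  obtain K where K: "K \<in> Ts n" "y \<in> K" using yD by blast
  \<comment> \<open>Transfers near-maximality from the arbitrary point y, supplied by the relaxed
    limit, to a node: otherwise the convex combination at y would be too small.\<close>
  have "\<exists>v\<in>vertices K. U x0 - \<tau> < \<psi> v"
  proof (rule md.fe_weights[OF K])
    fix p assume p: "\<And>v. v \<in> vertices K \<Longrightarrow> 0 \<le> p v" "sum p (vertices K) = 1" "(\<Sum>v\<in>vertices K. p v *\<^sub>R v) = y"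
      "\<And>u. (\<And>K. K \<in> Ts n \<Longrightarrow> \<exists>a b. \<forall>x\<in>K. u x = a \<bullet> x + b) \<Longrightarrow> u y = (\<Sum>v\<in>vertices K. p v * u v)"
    show ?thesis
    proof (rule ccontr)
      assume "\<not> ?thesis"
      hence le: "\<And>v. v \<in> vertices K \<Longrightarrow> \<psi> v \<le> U x0 - \<tau>" by (meson not_le)
      have "w n y = (\<Sum>v\<in>vertices K. p v * w n v)" by (rule p(4)) (rule aff)
      hence split: "w n y = (\<Sum>v\<in>vertices K. p v * \<psi> v) + (\<Sum>v\<in>vertices K. p v * \<phi> v)"
        by (simp add: \<psi>_def sum.distrib[symmetric] algebra_simps)
      have "(\<Sum>v\<in>vertices K. p v * \<psi> v) \<le> (\<Sum>v\<in>vertices K. p v * (U x0 - \<tau>))"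
        by (intro sum_mono mult_left_mono le p)
      also have "\<dots> = U x0 - \<tau>" by (simp only: sum_distrib_right[symmetric] p(2) mult_1)
      finally have "w n y \<le> U x0 - \<tau> + \<phi> y + \<tau> / 4" using split err[OF K p(1-3)] nn(4) by linarith
      moreover have "\<bar>\<phi> y\<bar> < \<tau> / 4" using d2(2)[of y] y(2) by (simp add: dist_real_def \<phi>_def)
      ultimately show False using y(3) WD[OF yD] \<tau> by linarith
    qed
  qed
  then obtain v1 where v1: "v1 \<in> vertices K" "U x0 - \<tau> < \<psi> v1" by blast
  define Z where "Z = {v \<in> mesh_nodes (Ts n). dist v x0 \<le> r1}"
  have "dist v1 x0 \<le> dist v1 y + dist y x0" by (rule dist_triangle)
  hence "v1 \<in> Z" using md.vertex_dist[OF K v1(1)] nn(1) y(2) v1(1) K(1) md.mesh_nodes_eq[of n] r1(1)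
    by (auto simp: Z_def dist_commute)
  moreover have finZ: "finite Z" unfolding Z_def using md.finite_nodes by simp
  ultimately have "Max (\<psi> ` Z) \<in> \<psi> ` Z" by (intro Max_in) auto
  then obtain z where z: "z \<in> Z" "Max (\<psi> ` Z) = \<psi> z" by blast
  have zmax: "\<psi> v \<le> \<psi> z" if "v \<in> Z" for v unfolding z(2)[symmetric] using that finZ by (intro Max_ge) auto
  have zd: "dist z x0 \<le> r1" using z(1) by (simp add: Z_def)
  \<comment> \<open>The annulus values stay below that of v1, so the maximiser over Z is in the
    inner half. This makes it an interior node with full stencil, and maximal among all nodes that
    matter at the stencil points.\<close>
  have zh: "dist z x0 < r1 / 2"
  proof (rule ccontr)
    assume "\<not> dist z x0 < r1 / 2"
    hence "z \<in> A" using zd by (simp add: A_def dist_commute)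
    hence "W n z - \<phi> z \<le> U x0 - \<tau>" using annulus n by simp
    moreover have "W n z = w n z" using WD inD zd by blast
    ultimately show False using zmax[OF \<open>v1 \<in> Z\<close>] v1(2) by (simp add: \<psi>_def)
  qed
  have "z \<in> interior ?D" using bD zh r1(1) by (intro interiorI[of "ball x0 (2 * r1)"]) (auto simp: dist_commute)
  hence zint: "z \<in> interior_nodes (Ts n)"
    using z(1) by (auto simp: Z_def interior_nodes_def boundary_nodes_def frontier_def)
  have "cball z ?\<delta> \<subseteq> ?D"
  proof
    fix p assume "p \<in> cball z ?\<delta>"
    hence "dist p x0 \<le> r1" using dist_triangle[of p x0 z] zh nn(2) r1(1) by (simp add: dist_commute)
    thus "p \<in> ?D" by (rule inD)
  qed
  hence \<rho>1: "step_scale ?D ?\<delta> z = 1"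
    by (rule step_scale_props(5)[OF md.closed_domain \<open>z \<in> interior ?D\<close> \<delta>s_pos])
  have up: "w n p \<le> \<psi> z + \<phi> p + \<beta> / 2 * ?h\<^sup>2" if pd: "dist p z \<le> ?\<delta>" for p
  proof -
    have pd': "dist p x0 < 3 * r1 / 4" using dist_triangle[of p x0 z] zh nn(2) pd by (simp add: dist_commute)
    have "p \<in> ?D" using inD pd' r1(1) by simp
    then obtain K where K: "K \<in> Ts n" "p \<in> K" by blast
    show ?thesis
    proof (rule md.fe_weights[OF K])
      fix l assume l: "\<And>v. v \<in> vertices K \<Longrightarrow> 0 \<le> l v" "sum l (vertices K) = 1" "(\<Sum>v\<in>vertices K. l v *\<^sub>R v) = p"
        "\<And>u. (\<And>K. K \<in> Ts n \<Longrightarrow> \<exists>a b. \<forall>x\<in>K. u x = a \<bullet> x + b) \<Longrightarrow> u p = (\<Sum>v\<in>vertices K. l v * u v)"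
      have "\<psi> v \<le> \<psi> z" if v: "v \<in> vertices K" for v
      proof (rule zmax)
        have "dist v x0 \<le> dist v p + dist p x0" by (rule dist_triangle)
        thus "v \<in> Z" using md.vertex_dist[OF K v] nn(1) pd' r1(1) v K(1) md.mesh_nodes_eq[of n]
          by (auto simp: Z_def dist_commute)
      qed
      hence "(\<Sum>v\<in>vertices K. l v * \<psi> v) \<le> (\<Sum>v\<in>vertices K. l v * \<psi> z)"
        by (intro sum_mono mult_left_mono l) auto
      also have "\<dots> = \<psi> z" by (simp only: sum_distrib_right[symmetric] l(2) mult_1)
      finally have "(\<Sum>v\<in>vertices K. l v * \<psi> v) \<le> \<psi> z" .
      moreover have "w n p = (\<Sum>v\<in>vertices K. l v * w n v)" by (rule l(4)) (rule aff)
      hence "w n p = (\<Sum>v\<in>vertices K. l v * \<psi> v) + (\<Sum>v\<in>vertices K. l v * \<phi> v)"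
        by (simp add: \<psi>_def sum.distrib[symmetric] algebra_simps)
      ultimately show ?thesis using err[OF K l(1-3)] by linarith
    qed
  qed
  have "second_difference ?D ?\<delta> (w n) z v \<le> v \<bullet> (M *v v) + e" if v: "norm v = 1" for v
  proof -
    have "w n (z + ?\<delta> *\<^sub>R v) \<le> \<psi> z + \<phi> (z + ?\<delta> *\<^sub>R v) + \<beta> / 2 * ?h\<^sup>2"
      "w n (z - ?\<delta> *\<^sub>R v) \<le> \<psi> z + \<phi> (z - ?\<delta> *\<^sub>R v) + \<beta> / 2 * ?h\<^sup>2"
      using \<delta>s_pos[of n] v by (intro up; simp add: dist_norm)+
    moreover have "\<phi> (z + ?\<delta> *\<^sub>R v) - 2 * \<phi> z + \<phi> (z - ?\<delta> *\<^sub>R v) = ?\<delta>\<^sup>2 * (v \<bullet> (M' *v v))"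
    proof -
      define y k where "y = z - x0" and "k = ?\<delta> *\<^sub>R v"
      have ee: "z + k - x0 = y + k" "z - k - x0 = y - k" by (simp_all add: y_def)
      have "\<phi> (z + k) - 2 * \<phi> z + \<phi> (z - k) = k \<bullet> (M' *v k)"
        unfolding \<phi>_def ee y_def[symmetric]
        by (simp add: matrix_vector_right_distrib matrix_vector_mult_diff_distrib inner_add_left inner_add_right
            inner_diff_left inner_diff_right add_divide_distrib diff_divide_distrib)
      thus ?thesis by (simp add: k_def matrix_vector_mult_scaleR power2_eq_square)
    qed
    ultimately have "w n (z + ?\<delta> *\<^sub>R v) - 2 * w n z + w n (z - ?\<delta> *\<^sub>R v) \<le> ?\<delta>\<^sup>2 * (v \<bullet> (M' *v v)) + \<beta> * ?h\<^sup>2"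
      unfolding \<psi>_def by linarith
    hence "(w n (z + ?\<delta> *\<^sub>R v) - 2 * w n z + w n (z - ?\<delta> *\<^sub>R v)) / ?\<delta>\<^sup>2 \<le> (?\<delta>\<^sup>2 * (v \<bullet> (M' *v v)) + \<beta> * ?h\<^sup>2) / ?\<delta>\<^sup>2"
      by (rule divide_right_mono) simp
    also have "\<dots> = v \<bullet> (M' *v v) + \<beta> * (?h / ?\<delta>)\<^sup>2"
      using \<delta>s_pos[of n] by (simp add: add_divide_distrib power_divide)
    also have "\<dots> \<le> v \<bullet> (M *v v) + e" using nn(5) v by (simp add: M'v)
    finally show ?thesis by (simp add: second_difference_def \<rho>1)
  qed
  thus ?thesis using n zint zh r1(1,2) by (intro exI[of _ n] conjI bexI[of _ z]) auto
qed

end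

section \<open>Convergence of the two-scale method\<close>

lemma closest_point_extension_uminus:
  "closest_point_extension D (\<lambda>y. - w y) = (\<lambda>y. - closest_point_extension D w y)"
  by (auto simp: closest_point_extension_def)

locale two_scale =
  fixes \<Omega> :: "(real ^ 'n) set" and f g :: "real ^ 'n \<Rightarrow> real" and H :: "real set"
    and \<T> :: "real \<Rightarrow> (real ^ 'n) set set" and S :: "real \<Rightarrow> (real ^ 'n) set"
    and B :: "real \<Rightarrow> ('n \<Rightarrow> real ^ 'n) set"
  assumes \<Omega>: "open \<Omega>" "\<Omega> \<noteq> {}" "bounded \<Omega>" and uc: "uniformly_convex \<Omega>"
    and f: "continuous_on \<Omega> f" "bounded (f ` \<Omega>)" "\<And>x. x \<in> \<Omega> \<Longrightarrow> f x \<ge> 0"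
    and g: "continuous_on (frontier \<Omega>) g"
    and mf: "mesh_family \<Omega> H \<T>"
    and dirs: "\<And>\<theta>. \<theta> > 0 \<Longrightarrow> direction_sets \<theta> (S \<theta>) (B \<theta>)"
begin

lemma cv: "convex \<Omega>"
  using uc by (simp add: uniformly_convex_def)

lemma meshed: "h \<in> H \<Longrightarrow> meshed_domain \<Omega> h (\<T> h)"
  by standard (use \<Omega> cv mf in \<open>auto simp: mesh_family_def\<close>)

lemma problem:
  assumes "h \<in> H" "\<delta> > 0" "\<theta> > 0"
  shows "discrete_problem (\<T> h) \<delta> (B \<theta>)"
proof -
  interpret meshed_domain \<Omega> h "\<T> h" by (rule meshed[OF assms(1)])
  have d: "direction_sets \<theta> (S \<theta>) (B \<theta>)" by (rule dirs[OF assms(3)])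
  have "\<forall>v\<in>orthonormal_bases. \<exists>v'\<in>B \<theta>. \<forall>j. norm (v j - v' j) \<le> \<theta>"
    using d unfolding direction_sets_def by blast
  from bspec[OF this axis_orthonormal] have "B \<theta> \<noteq> {}" by blast
  thus ?thesis by unfold_locales (use d assms in \<open>auto simp: direction_sets_def\<close>)
qed

definition uh :: "real \<Rightarrow> real \<Rightarrow> real \<Rightarrow> real ^ 'n \<Rightarrow> real" where
  "uh h \<delta> \<theta> = discrete_solution f g (\<T> h) \<delta> (B \<theta>)"

lemma discrete_unique:
  assumes "h \<in> H" "\<delta> > 0" "\<theta> > 0"
  shows "\<exists>!w. is_discrete_solution f g (\<T> h) \<delta> (B \<theta>) w"
proof -
  interpret meshed_domain \<Omega> h "\<T> h" by (rule meshed[OF assms(1)])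
  interpret discrete_problem "\<T> h" \<delta> "B \<theta>" by (rule problem[OF assms])
  show ?thesis by (rule discrete_solution_unique_existence) (use f(3) interior_nodes_subset in blast)
qed

lemma uh_solution:
  assumes "h \<in> H" "\<delta> > 0" "\<theta> > 0"
  shows "is_discrete_solution f g (\<T> h) \<delta> (B \<theta>) (uh h \<delta> \<theta>)"
  unfolding uh_def discrete_solution_def by (rule theI'[OF discrete_unique[OF assms]])

lemma frontier_nonempty: "frontier \<Omega> \<noteq> {}"
proof
  assume "frontier \<Omega> = {}"
  hence "closed \<Omega>" using \<Omega>(1) by (simp add: frontier_def interior_open closure_subset_eq)
  hence "\<Omega> = UNIV" using clopen[of \<Omega>] \<Omega>(1,2) by blast
  thus False using \<Omega>(3) not_bounded_UNIV by metis
qed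

lemma compact_frontier': "compact (frontier \<Omega>)"
  using \<Omega>(3) by (rule compact_frontier_bounded)

text \<open>Near a boundary point \<open>z\<close> the domain lies in a ball touching the boundary at \<open>z\<close>, so that
  \<open>(norm (x - z))\<^sup>2\<close> is controlled by the distance to a supporting hyperplane at \<open>z\<close>. This turns
  parabolic bounds on \<open>g\<close> into an affine supersolution and a quadratic subsolution.\<close>

lemma barrier:
  assumes \<eta>: "\<eta> > 0"
  obtains C where "C \<ge> 0" "\<And>z h \<delta> \<theta> x. z \<in> frontier \<Omega> \<Longrightarrow> h \<in> H \<Longrightarrow> \<delta> > 0 \<Longrightarrow> \<theta> > 0 \<Longrightarrow> x \<in> \<Union>(\<T> h) \<Longrightarrow>
    \<bar>uh h \<delta> \<theta> x - g z\<bar> \<le> \<eta> + C * norm (x - z)"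
proof -
  obtain R where R: "R > 0" "\<And>z. z \<in> frontier \<Omega> \<Longrightarrow> \<exists>\<nu>. norm \<nu> = 1 \<and>
    (\<forall>x\<in>closure \<Omega>. (norm (x - z))\<^sup>2 \<le> 2 * R * (\<nu> \<bullet> (x - z)))"
    using uniformly_convex_normal[OF \<Omega>(1) uc] by metis
  have "bounded (g ` frontier \<Omega>)"
    using compact_continuous_image[OF g compact_frontier'] compact_imp_bounded by blast
  then obtain G where G: "\<And>z. z \<in> frontier \<Omega> \<Longrightarrow> \<bar>g z\<bar> \<le> G" by (auto simp: bounded_real)
  have G0: "G \<ge> 0" using G frontier_nonempty by (meson abs_ge_zero all_not_in_conv order_trans)
  have "uniformly_continuous_on (frontier \<Omega>) g" by (rule compact_uniformly_continuous[OF g compact_frontier'])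
  then obtain d where d: "d > 0" "\<And>x z. x \<in> frontier \<Omega> \<Longrightarrow> z \<in> frontier \<Omega> \<Longrightarrow> dist z x < d \<Longrightarrow> dist (g z) (g x) < \<eta>"
    using \<eta> unfolding uniformly_continuous_on_def by meson
  \<comment> \<open>Beyond distance d the term K |x - z|^2 exceeds 2 G, the largest oscillation of
    g; within d uniform continuity gives \<eta>. Thus K is independent of z.\<close>
  define K where "K = 2 * G / d\<^sup>2"
  have K0: "K \<ge> 0" using G0 by (simp add: K_def)
  have gK: "\<bar>g x - g z\<bar> \<le> \<eta> + K * (norm (x - z))\<^sup>2" if "x \<in> frontier \<Omega>" "z \<in> frontier \<Omega>" for x z
  proof (cases "dist x z < d")
    case True
    hence "\<bar>g x - g z\<bar> < \<eta>" using d(2)[OF that(2,1)] by (simp add: dist_real_def)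
    moreover have "K * (norm (x - z))\<^sup>2 \<ge> 0" using K0 by simp
    ultimately show ?thesis by linarith
  next
    case False
    hence "K * d\<^sup>2 \<le> K * (norm (x - z))\<^sup>2" using K0 d(1) by (intro mult_left_mono power_mono) (auto simp: dist_norm)
    moreover have "K * d\<^sup>2 = 2 * G" using d(1) by (simp add: K_def)
    moreover have "\<bar>g x - g z\<bar> \<le> 2 * G" using G[OF that(1)] G[OF that(2)] by linarith
    ultimately show ?thesis using \<eta> by linarith
  qed
  obtain F where F: "F \<ge> 1" "\<And>x. x \<in> \<Omega> \<Longrightarrow> f x \<le> F"
  proof -
    obtain a where "\<forall>x\<in>\<Omega>. \<bar>f x\<bar> \<le> a" using f(2) by (auto simp: bounded_real)
    thus thesis using that[of "max 1 a"] by fastforce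
  qed
  define A where "A = F / 2"
  have A: "A \<ge> 0" "2 * A = F" using F by (auto simp: A_def)
  define C where "C = 2 * R * (K + A)"
  have C0: "C \<ge> 0" using R K0 A by (simp add: C_def)
  show thesis
  proof (rule that[OF C0])
    fix z h and \<delta> \<theta> :: real and x assume z: "z \<in> frontier \<Omega>" and h: "h \<in> H" and \<delta>: "\<delta> > 0" and \<theta>: "\<theta> > 0" and x: "x \<in> \<Union>(\<T> h)"
    interpret meshed_domain \<Omega> h "\<T> h" by (rule meshed[OF h])
    interpret discrete_problem "\<T> h" \<delta> "B \<theta>" by (rule problem[OF h \<delta> \<theta>])
    have sol: "uh h \<delta> \<theta> \<in> fe_space (\<T> h)" "\<And>x. x \<in> boundary_nodes (\<T> h) \<Longrightarrow> uh h \<delta> \<theta> x = g x"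
      "\<And>x. x \<in> interior_nodes (\<T> h) \<Longrightarrow> T (uh h \<delta> \<theta>) x = f x"
      using uh_solution[OF h \<delta> \<theta>] by (auto simp: is_discrete_solution_def)
    obtain \<nu> where \<nu>: "norm \<nu> = 1" "\<And>x. x \<in> closure \<Omega> \<Longrightarrow> (norm (x - z))\<^sup>2 \<le> 2 * R * (\<nu> \<bullet> (x - z))"
      using R(2)[OF z] by blast
    have bn: "y \<in> mesh_nodes (\<T> h)" "y \<in> frontier \<Omega>" "y \<in> closure \<Omega>" if "y \<in> boundary_nodes (\<T> h)" for y
      using that boundary_nodes_frontier[OF that] by (auto simp: boundary_nodes_def frontier_def)
    \<comment> \<open>The upper barrier. On boundary nodes its slope term 2 R K \<nu> . (y - z)
      dominates K |y - z|^2; being affine, it has zero operator, at most f.\<close>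
    define a b where "a = (2 * R * K) *\<^sub>R \<nu>" and "b = g z + \<eta> - (2 * R * K) * (\<nu> \<bullet> z)"
    have ab: "a \<bullet> y + b = g z + \<eta> + K * (2 * R * (\<nu> \<bullet> (y - z)))" for y
      by (simp add: a_def b_def inner_diff_right algebra_simps)
    have "uh h \<delta> \<theta> x \<le> interp (\<lambda>y. a \<bullet> y + b) x"
    proof (rule discrete_comparison[OF sol(1) interp_fe _ _ x])
      show "T (interp (\<lambda>y. a \<bullet> y + b)) y \<le> T (uh h \<delta> \<theta>) y" if "y \<in> interior_nodes (\<T> h)" for y
        using interp_affine_T[OF that] sol(3)[OF that] f(3) interior_nodes_subset[OF that] by simp
      show "uh h \<delta> \<theta> y \<le> interp (\<lambda>y. a \<bullet> y + b) y" if y: "y \<in> boundary_nodes (\<T> h)" for y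
      proof -
        have "K * (norm (y - z))\<^sup>2 \<le> K * (2 * R * (\<nu> \<bullet> (y - z)))"
          using \<nu>(2)[OF bn(3)[OF y]] K0 by (rule mult_left_mono)
        thus ?thesis using gK[OF bn(2)[OF y] z] sol(2)[OF y] interp_node[OF bn(1)[OF y]] ab[of y] by (simp add: abs_le_iff)
      qed
    qed
    hence up: "uh h \<delta> \<theta> x \<le> g z + \<eta> + K * (2 * R * (\<nu> \<bullet> (x - z)))"
      using interp_affine[OF x, of a b] ab[of x] by simp
    \<comment> \<open>The lower barrier. The paraboloid with 2 A = F makes the operator at least f;
      the slope must outweigh both its A |y - z|^2 and the K |y - z|^2 of the boundary data, hence K
      + A.\<close>
    define a' b' where "a' = (- (2 * R * (K + A))) *\<^sub>R \<nu>" and "b' = g z - \<eta> + (2 * R * (K + A)) * (\<nu> \<bullet> z)"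
    have ab': "a' \<bullet> y + b' = g z - \<eta> - (K + A) * (2 * R * (\<nu> \<bullet> (y - z)))" for y
      by (simp add: a'_def b'_def inner_diff_right algebra_simps)
    define l where "l = (\<lambda>y. A * (norm (y - z))\<^sup>2 + (a' \<bullet> y + b'))"
    have "interp l x \<le> uh h \<delta> \<theta> x"
    proof (rule discrete_comparison[OF interp_fe sol(1) _ _ x])
      show "T (uh h \<delta> \<theta>) y \<le> T (interp l) y" if y: "y \<in> interior_nodes (\<T> h)" for y
      proof -
        have "f y \<le> (2 * A) ^ CARD('n)"
          using F(2)[OF interior_nodes_subset[OF y]] power_increasing[of 1 "CARD('n)" F] F(1) A(2) by simp
        also have "\<dots> \<le> T (interp l) y"
          by (rule interp_quadratic_T[OF y A(1) interp_fe, of z a' b'])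
            (use node_frontier_or_interior(2)[OF y] in \<open>auto simp: interp_node l_def\<close>)
        finally show ?thesis using sol(3)[OF y] by simp
      qed
      show "interp l y \<le> uh h \<delta> \<theta> y" if y: "y \<in> boundary_nodes (\<T> h)" for y
      proof -
        have "(K + A) * (norm (y - z))\<^sup>2 \<le> (K + A) * (2 * R * (\<nu> \<bullet> (y - z)))"
          using \<nu>(2)[OF bn(3)[OF y]] K0 A(1) by (intro mult_left_mono) auto
        hence "l y \<le> g z - \<eta> - K * (norm (y - z))\<^sup>2"
          unfolding l_def ab' by (simp add: distrib_right)
        thus ?thesis using gK[OF bn(2)[OF y] z] sol(2)[OF y] interp_node[OF bn(1)[OF y]] by (simp add: abs_le_iff)
      qed
    qed
    moreover have "l x \<le> interp l x"
      by (rule fe_ge_convex[OF interp_fe _ _ x]) (auto simp: l_def interp_node intro!: convex_on_quadratic A(1))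
    moreover have "l x \<ge> g z - \<eta> - (K + A) * (2 * R * (\<nu> \<bullet> (x - z)))"
      unfolding l_def ab' using A(1) by simp
    ultimately have low: "uh h \<delta> \<theta> x \<ge> g z - \<eta> - (K + A) * (2 * R * (\<nu> \<bullet> (x - z)))" by linarith
    have \<nu>x: "\<nu> \<bullet> (x - z) \<le> norm (x - z)" using Cauchy_Schwarz_ineq2[of \<nu> "x - z"] \<nu>(1) by simp
    have "K * (2 * R * (\<nu> \<bullet> (x - z))) \<le> C * norm (x - z)"
    proof -
      have "K * (2 * R * (\<nu> \<bullet> (x - z))) \<le> K * (2 * R * norm (x - z))" using \<nu>x K0 R(1) by (intro mult_left_mono) auto
      also have "\<dots> \<le> (K + A) * (2 * R * norm (x - z))" using A(1) R(1) by (intro mult_right_mono) auto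
      also have "\<dots> = C * norm (x - z)" by (simp add: C_def algebra_simps)
      finally show ?thesis .
    qed
    moreover have "(K + A) * (2 * R * (\<nu> \<bullet> (x - z))) \<le> C * norm (x - z)"
    proof -
      have "(K + A) * (2 * R * (\<nu> \<bullet> (x - z))) \<le> (K + A) * (2 * R * norm (x - z))"
        using \<nu>x K0 A R(1) by (intro mult_left_mono) auto
      also have "\<dots> = C * norm (x - z)" by (simp add: C_def algebra_simps)
      finally show ?thesis .
    qed
    ultimately show "\<bar>uh h \<delta> \<theta> x - g z\<bar> \<le> \<eta> + C * norm (x - z)" using up low by (simp add: abs_le_iff)
  qed
qed

section \<open>The extended solutions: boundary control and uniform bounds\<close>

definition ext where
  "ext h \<delta> \<theta> = closest_point_extension (\<Union>(\<T> h)) (uh h \<delta> \<theta>)"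

lemma ext_node:
  assumes h: "h \<in> H" and y: "y \<in> \<Omega>"
  obtains x where "x \<in> \<Union>(\<T> h)" "ext h \<delta> \<theta> y = uh h \<delta> \<theta> x" "dist y x \<le> hausdorff_dist \<Omega> (\<Union>(\<T> h))"
proof -
  interpret meshed_domain \<Omega> h "\<T> h" by (rule meshed[OF h])
  show thesis
  proof (cases "y \<in> \<Union>(\<T> h)")
    case True
    have "0 \<le> hausdorff_dist \<Omega> (\<Union>(\<T> h))" using infdist_domain_le[OF y] infdist_nonneg order_trans by blast
    thus ?thesis using that[of y] True by (simp add: ext_def closest_point_extension_def)
  next
    case False
    thus ?thesis using that[OF closest_point_domain(1)[OF y] _ closest_point_domain(2)[OF y]]
      by (simp add: ext_def closest_point_extension_def)
  qed
qed

lemma ext_barrier: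
  assumes \<eta>: "\<eta> > 0"
  obtains C where "C \<ge> 0" "\<And>z h \<delta> \<theta> y. z \<in> frontier \<Omega> \<Longrightarrow> h \<in> H \<Longrightarrow> \<delta> > 0 \<Longrightarrow> \<theta> > 0 \<Longrightarrow> y \<in> \<Omega> \<Longrightarrow>
    \<bar>ext h \<delta> \<theta> y - g z\<bar> \<le> \<eta> + C * (norm (y - z) + hausdorff_dist \<Omega> (\<Union>(\<T> h)))"
proof (rule barrier[OF \<eta>])
  fix C assume C: "C \<ge> 0" "\<And>z h \<delta> \<theta> x. z \<in> frontier \<Omega> \<Longrightarrow> h \<in> H \<Longrightarrow> \<delta> > 0 \<Longrightarrow> \<theta> > 0 \<Longrightarrow> x \<in> \<Union>(\<T> h) \<Longrightarrow>
    \<bar>uh h \<delta> \<theta> x - g z\<bar> \<le> \<eta> + C * norm (x - z)"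
  show thesis
  proof (rule that[OF C(1)])
    fix z h and \<delta> \<theta> :: real and y assume a: "z \<in> frontier \<Omega>" "h \<in> H" "\<delta> > 0" "\<theta> > 0" "y \<in> \<Omega>"
    obtain x where x: "x \<in> \<Union>(\<T> h)" "ext h \<delta> \<theta> y = uh h \<delta> \<theta> x" "dist y x \<le> hausdorff_dist \<Omega> (\<Union>(\<T> h))"
      using ext_node[OF a(2,5)] by metis
    have "norm (x - z) \<le> norm (y - z) + hausdorff_dist \<Omega> (\<Union>(\<T> h))"
      using dist_triangle[of x z y] x(3) by (simp add: dist_norm norm_minus_commute)
    hence "C * norm (x - z) \<le> C * (norm (y - z) + hausdorff_dist \<Omega> (\<Union>(\<T> h)))" using C(1) by (rule mult_left_mono)
    thus "\<bar>ext h \<delta> \<theta> y - g z\<bar> \<le> \<eta> + C * (norm (y - z) + hausdorff_dist \<Omega> (\<Union>(\<T> h)))"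
      using C(2)[OF a(1-4) x(1)] x(2) by simp
  qed
qed

lemma ext_bounded:
  obtains m where "\<And>h \<delta> \<theta> y. h \<in> H \<Longrightarrow> \<delta> > 0 \<Longrightarrow> \<theta> > 0 \<Longrightarrow> y \<in> \<Omega> \<Longrightarrow> \<bar>ext h \<delta> \<theta> y\<bar> \<le> m"
proof (rule barrier[OF zero_less_one])
  fix C assume C: "C \<ge> 0" "\<And>z h \<delta> \<theta> x. z \<in> frontier \<Omega> \<Longrightarrow> h \<in> H \<Longrightarrow> \<delta> > 0 \<Longrightarrow> \<theta> > 0 \<Longrightarrow> x \<in> \<Union>(\<T> h) \<Longrightarrow>
    \<bar>uh h \<delta> \<theta> x - g z\<bar> \<le> 1 + C * norm (x - z)"
  obtain z where z: "z \<in> frontier \<Omega>" using frontier_nonempty by blast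
  obtain D where D: "\<And>x. x \<in> closure \<Omega> \<Longrightarrow> dist z x \<le> D"
    using bounded_closure[OF \<Omega>(3)] unfolding bounded_any_center[of _ z] by blast
  show thesis
  proof (rule that)
    fix h and \<delta> \<theta> :: real and y assume a: "h \<in> H" "\<delta> > 0" "\<theta> > 0" "y \<in> \<Omega>"
    interpret meshed_domain \<Omega> h "\<T> h" by (rule meshed[OF a(1)])
    obtain x where x: "x \<in> \<Union>(\<T> h)" "ext h \<delta> \<theta> y = uh h \<delta> \<theta> x" using ext_node[OF a(1,4)] by metis
    have "x \<in> closure \<Omega>" using domain_subset x(1) by blast
    hence "norm (x - z) \<le> D" using D[of x] by (simp add: dist_norm norm_minus_commute)
    hence "C * norm (x - z) \<le> C * D" using C(1) by (rule mult_left_mono)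
    thus "\<bar>ext h \<delta> \<theta> y\<bar> \<le> \<bar>g z\<bar> + 1 + C * D" using C(2)[OF z a(1-3) x(1)] x(2) by linarith
  qed
qed

lemma viscosity_unique:
  assumes u: "is_viscosity_solution \<Omega> f g u" and w: "is_viscosity_solution \<Omega> f g w"
  shows "u = w"
proof -
  have le: "u x \<le> w x" if u: "is_viscosity_solution \<Omega> f g u" and w: "is_viscosity_solution \<Omega> f g w"
    and x: "x \<in> closure \<Omega>" for u w x
  proof (rule ma_comparison[OF \<Omega>(1,3) _ _ _ _ _ f(1) f(3) _ x])
    have cu: "continuous_on (closure \<Omega>) u" "continuous_on (closure \<Omega>) w"
      using u w by (auto simp: is_viscosity_solution_def)
    show "usc_on (closure \<Omega>) u" "usc_on (closure \<Omega>) (\<lambda>x. - w x)"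
      using cu by (auto intro!: continuous_on_imp_usc continuous_intros)
    show "continuous_on \<Omega> u" using cu(1) closure_subset continuous_on_subset by blast
    show "ma_subsolution \<Omega> f u" by (rule viscosity_solution_imp_ma(1)[OF \<Omega>(1) cv u])
    show "ma_supersolution \<Omega> f w" by (rule viscosity_solution_imp_ma(2)[OF \<Omega>(1) cv w])
    show "u x \<le> w x" if "x \<in> frontier \<Omega>" for x using that u w by (auto simp: is_viscosity_solution_def)
  qed
  show ?thesis
  proof
    fix x show "u x = w x"
    proof (cases "x \<in> closure \<Omega>")
      case True
      show ?thesis using le[OF u w True] le[OF w u True] by simp
    next
      case False
      thus ?thesis using u w by (metis extensional_arb is_viscosity_solution_def)
    qed
  qed
qed

end

locale two_scale_sequence = two_scale +
  fixes hs \<delta>s \<theta>s :: "nat \<Rightarrow> real"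
  assumes hs: "\<And>n. hs n \<in> H" and pos: "\<And>n. \<delta>s n > 0" "\<And>n. \<theta>s n > 0"
    and lim: "hs \<longlonglongrightarrow> 0" "\<delta>s \<longlonglongrightarrow> 0" "\<theta>s \<longlonglongrightarrow> 0" "(\<lambda>n. hs n / \<delta>s n) \<longlonglongrightarrow> 0"
begin

lemma hausdorff_tendsto: "(\<lambda>n. hausdorff_dist \<Omega> (\<Union>(\<T> (hs n)))) \<longlonglongrightarrow> 0"
proof -
  have "filterlim hs (at 0 within H) sequentially"
    unfolding filterlim_at using lim(1) hs mf by (auto simp: mesh_family_def intro!: always_eventually)
      (metis greaterThan_iff less_irrefl subsetD)
  moreover have "((\<lambda>h. hausdorff_dist \<Omega> (\<Union>(\<T> h))) \<longlongrightarrow> 0) (at 0 within H)" using mf by (simp add: mesh_family_def)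
  ultimately show ?thesis by (rule filterlim_compose[rotated])
qed

sublocale ms: mesh_sequence \<Omega> hs \<delta>s "\<lambda>n. \<T> (hs n)"
  by standard (use \<Omega> cv pos lim hausdorff_tendsto mf hs in \<open>auto simp: mesh_family_def\<close>)

definition W where "W n = ext (hs n) (\<delta>s n) (\<theta>s n)"

definition U where "U = relaxed_limsup \<Omega> W"

text \<open>The half-relaxed lower limit of the same sequence.\<close>

definition V where "V = (\<lambda>x. - relaxed_limsup \<Omega> (\<lambda>n y. - W n y) x)"

lemma W_bounded: obtains m where "bounded_sequence \<Omega> W m" "bounded_sequence \<Omega> (\<lambda>n y. - W n y) m"
proof (rule ext_bounded)
  fix m assume m: "\<And>h \<delta> \<theta> y. h \<in> H \<Longrightarrow> \<delta> > 0 \<Longrightarrow> \<theta> > 0 \<Longrightarrow> y \<in> \<Omega> \<Longrightarrow> \<bar>ext h \<delta> \<theta> y\<bar> \<le> m"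
  have "bounded_sequence \<Omega> W m" "bounded_sequence \<Omega> (\<lambda>n y. - W n y) m"
    by (unfold_locales; simp add: W_def m hs pos)+
  thus thesis by (rule that)
qed

lemma problem_n: "discrete_problem (\<T> (hs n)) (\<delta>s n) (B (\<theta>s n))"
  by (rule problem[OF hs pos])

lemma solution_n: "is_discrete_solution f g (\<T> (hs n)) (\<delta>s n) (B (\<theta>s n)) (uh (hs n) (\<delta>s n) (\<theta>s n))"
  by (rule uh_solution[OF hs pos])

lemma affine_n: "K \<in> \<T> (hs n) \<Longrightarrow> \<exists>a b. \<forall>x\<in>K. uh (hs n) (\<delta>s n) (\<theta>s n) x = a \<bullet> x + b"
  using solution_n[of n] by (auto simp: is_discrete_solution_def fe_space_def)

lemma f_near:
  assumes "x0 \<in> \<Omega>" "e > 0"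
  obtains r where "r > 0" "\<And>z. z \<in> \<Omega> \<Longrightarrow> dist z x0 < r \<Longrightarrow> \<bar>f z - f x0\<bar> < e"
proof -
  obtain r where "r > 0" "\<And>z. z \<in> \<Omega> \<Longrightarrow> dist z x0 < r \<Longrightarrow> dist (f z) (f x0) < e"
    using f(1) assms unfolding continuous_on_iff by meson
  thus thesis using that[of r] by (simp add: dist_real_def)
qed

text \<open>For a fixed basis v the operator is at most the flux at an admissible basis close to v,
  and contact bounds that flux by the one of M. Passing to the limit before taking signs apart,
  \<open>ma_flux_nonneg_imp\<close> yields nonnegativity and the product bound together.\<close>

lemma U_subsolution: "ma_subsolution \<Omega> f U"
  unfolding ma_subsolution_def
proof (intro ballI allI impI)
  fix x0 b and M :: "real ^ 'a ^ 'a" and v :: "'a \<Rightarrow> real ^ 'a"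
  assume x0: "x0 \<in> \<Omega>" and jet: "superjet U x0 b M" and v: "v \<in> orthonormal_bases"
  obtain m where m: "bounded_sequence \<Omega> W m" by (rule W_bounded)
  define s where "s = (\<lambda>j. v j \<bullet> (M *v v j))"
  obtain \<beta> where \<beta>: "\<beta> > 0" "\<And>z. norm (M *v z) \<le> norm z * \<beta>"
    using bounded_linear.pos_bounded[OF matrix_vector_mul_bounded_linear[of M]] by blast
  \<comment> \<open>In 2 * e, one e comes from the contact and one from replacing v by an admissible
    basis, which changes the form by at most 2 \<beta> \<theta>. The last e is the oscillation of f
    near x0.\<close>
  have "f x0 \<le> ma_flux (\<lambda>j. s j + 2 * e) + e" if e: "e > 0" for e
  proof -
    obtain r where r: "r > 0" "\<And>z. z \<in> \<Omega> \<Longrightarrow> dist z x0 < r \<Longrightarrow> \<bar>f z - f x0\<bar> < e"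
      using f_near[OF x0 e] by metis
    have t: "(\<lambda>n. 2 * \<beta> * \<theta>s n) \<longlonglongrightarrow> 2 * \<beta> * 0" by (intro tendsto_intros lim)
    have "\<forall>\<^sub>F n in sequentially. 2 * \<beta> * \<theta>s n < e" by (rule order_tendstoD(2)[OF t]) (use e in simp)
    then obtain N where N: "\<And>n. n \<ge> N \<Longrightarrow> 2 * \<beta> * \<theta>s n < e" unfolding eventually_sequentially by blast
    have "\<exists>n\<ge>N. \<exists>z\<in>interior_nodes (\<T> (hs n)). dist z x0 < r \<and>
      (\<forall>v. norm v = 1 \<longrightarrow> second_difference (\<Union>(\<T> (hs n))) (\<delta>s n) (uh (hs n) (\<delta>s n) (\<theta>s n)) z v \<le> v \<bullet> (M *v v) + e)"
    proof (rule ms.discrete_contact[OF affine_n _ _ x0 e r(1)])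
      show "\<bar>closest_point_extension (\<Union>(\<T> (hs n))) (uh (hs n) (\<delta>s n) (\<theta>s n)) y\<bar> \<le> m" if "y \<in> \<Omega>" for n y
        using bounded_sequence.bound[OF m that, of n] by (simp add: W_def ext_def)
      show "superjet (relaxed_limsup \<Omega> (\<lambda>n. closest_point_extension (\<Union>(\<T> (hs n))) (uh (hs n) (\<delta>s n) (\<theta>s n)))) x0 b M"
        using jet by (simp add: U_def W_def[abs_def] ext_def[abs_def])
    qed
    then obtain n z where n: "n \<ge> N" and z: "z \<in> interior_nodes (\<T> (hs n))" "dist z x0 < r"
      and sd: "\<And>v. norm v = 1 \<Longrightarrow> second_difference (\<Union>(\<T> (hs n))) (\<delta>s n) (uh (hs n) (\<delta>s n) (\<theta>s n)) z v \<le> v \<bullet> (M *v v) + e"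
      by blast
    interpret dp: discrete_problem "\<T> (hs n)" "\<delta>s n" "B (\<theta>s n)" by (rule problem_n)
    obtain v' where v': "v' \<in> B (\<theta>s n)" "\<And>j. norm (v j - v' j) \<le> \<theta>s n"
      using dirs[OF pos(2)[of n]] v unfolding direction_sets_def by blast
    have v'n: "norm (v' j) = 1" "norm (v j) = 1" for j
      using dp.norm_B[OF v'(1)] orthonormal_basesD(3)[OF v] by auto
    have "f z = two_scale_operator (\<Union>(\<T> (hs n))) (\<delta>s n) (B (\<theta>s n)) (uh (hs n) (\<delta>s n) (\<theta>s n)) z"
      using solution_n[of n] z(1) by (simp add: is_discrete_solution_def)
    also have "\<dots> \<le> ma_flux (\<lambda>j. second_difference (\<Union>(\<T> (hs n))) (\<delta>s n) (uh (hs n) (\<delta>s n) (\<theta>s n)) z (v' j))"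
      by (rule dp.T_le[OF v'(1)])
    also have "\<dots> \<le> ma_flux (\<lambda>j. s j + 2 * e)"
    proof (rule ma_flux_mono)
      fix j
      have "\<bar>v' j \<bullet> (M *v v' j) - v j \<bullet> (M *v v j)\<bar> \<le> 2 * \<beta> * norm (v' j - v j)"
        by (rule quadratic_form_difference[OF \<beta>(2) v'n])
      also have "\<dots> \<le> 2 * \<beta> * \<theta>s n" using v'(2)[of j] \<beta>(1) by (intro mult_left_mono) (auto simp: norm_minus_commute)
      also have "\<dots> < e" using N[OF n] .
      finally show "second_difference (\<Union>(\<T> (hs n))) (\<delta>s n) (uh (hs n) (\<delta>s n) (\<theta>s n)) z (v' j) \<le> s j + 2 * e"
        using sd[OF v'n(1)[of j]] by (simp add: s_def abs_if split: if_splits)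
    qed
    finally have "f z \<le> ma_flux (\<lambda>j. s j + 2 * e)" .
    moreover have "\<bar>f z - f x0\<bar> < e" using r(2) z ms.md.interior_nodes_subset by blast
    ultimately show ?thesis by linarith
  qed
  hence "\<forall>\<^sub>F e in at_right 0. f x0 \<le> ma_flux (\<lambda>j. s j + 2 * e) + e" by (auto simp: eventually_at_filter)
  moreover have "((\<lambda>e. ma_flux (\<lambda>j. s j + 2 * e) + e) \<longlongrightarrow> ma_flux s + 0) (at_right 0)"
    by (intro tendsto_add ma_flux_tendsto tendsto_ident_at)
  ultimately have "f x0 \<le> ma_flux s + 0" by (intro tendsto_lowerbound) auto
  hence "ma_flux s \<ge> f x0" by simp
  from ma_flux_nonneg_imp[OF this f(3)[OF x0]]
  show "(\<forall>j. 0 \<le> v j \<bullet> (M *v v j)) \<and> f x0 \<le> (\<Prod>j\<in>UNIV. v j \<bullet> (M *v v j))" by (simp add: s_def)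
qed

text \<open>Contact for the negated solutions bounds the second differences from below by the form
  of M - e I in every direction. The operator is attained at some orthonormal basis, where
  Hadamard's inequality bounds the product below by det (M - e I). Taking e < c keeps this matrix
  definite, so that the flux is a plain product.\<close>

lemma V_supersolution: "ma_supersolution \<Omega> f V"
  unfolding ma_supersolution_def
proof (intro ballI allI impI, elim conjE)
  fix x0 b and M :: "real ^ 'a ^ 'a"
  assume x0: "x0 \<in> \<Omega>" and jet: "subjet V x0 b M" and pd: "pos_def M"
  have sym: "transpose M = M" using pd by (simp add: pos_def_def)
  obtain m where m: "bounded_sequence \<Omega> (\<lambda>n y. - W n y) m" by (rule W_bounded)
  obtain c where c: "c > 0" "\<And>h. c * (norm h)\<^sup>2 \<le> h \<bullet> (M *v h)" using quadratic_form_lower_bound[OF pd] by blast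
  have "det (M + ((- 1) * e) *\<^sub>R mat 1) \<le> f x0 + e" if e: "e > 0" "e < c" for e
  proof -
    let ?M = "M + ((- 1) * e) *\<^sub>R mat 1"
    have Me: "h \<bullet> (?M *v h) = h \<bullet> (M *v h) - e * (norm h)\<^sup>2" for h
      by (simp only: matrix_vector_mult_add_rdistrib scaleR_matrix_vector inner_add_right inner_scaleR_right
          power2_norm_eq_inner matrix_vector_mul_lid)
    have pde: "pos_def ?M" unfolding pos_def_def
    proof (intro conjI allI impI)
      show "transpose ?M = ?M" unfolding transpose_add transpose_scaleR sym transpose_mat ..
      fix h :: "real ^ 'a" assume "h \<noteq> 0"
      hence "e * (norm h)\<^sup>2 < c * (norm h)\<^sup>2" using e by simp
      thus "0 < h \<bullet> (?M *v h)" using c(2)[of h] unfolding Me by linarith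
    qed
    obtain r where r: "r > 0" "\<And>z. z \<in> \<Omega> \<Longrightarrow> dist z x0 < r \<Longrightarrow> \<bar>f z - f x0\<bar> < e"
      using f_near[OF x0 e(1)] by metis
    have "\<exists>n\<ge>0. \<exists>z\<in>interior_nodes (\<T> (hs n)). dist z x0 < r \<and>
      (\<forall>v. norm v = 1 \<longrightarrow> second_difference (\<Union>(\<T> (hs n))) (\<delta>s n) (\<lambda>y. - uh (hs n) (\<delta>s n) (\<theta>s n) y) z v \<le> v \<bullet> ((- M) *v v) + e)"
    proof (rule ms.discrete_contact[OF _ _ _ x0 e(1) r(1)])
      show "\<exists>a b. \<forall>x\<in>K. - uh (hs n) (\<delta>s n) (\<theta>s n) x = a \<bullet> x + b" if K: "K \<in> \<T> (hs n)" for n K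
      proof -
        obtain a b where "\<forall>x\<in>K. uh (hs n) (\<delta>s n) (\<theta>s n) x = a \<bullet> x + b" using affine_n[OF K] by blast
        hence "\<forall>x\<in>K. - uh (hs n) (\<delta>s n) (\<theta>s n) x = (- a) \<bullet> x + (- b)" by simp
        thus ?thesis by blast
      qed
      show "\<bar>closest_point_extension (\<Union>(\<T> (hs n))) (\<lambda>y. - uh (hs n) (\<delta>s n) (\<theta>s n) y) y\<bar> \<le> m" if "y \<in> \<Omega>" for n y
        using bounded_sequence.bound[OF m that, of n] by (simp add: W_def ext_def closest_point_extension_uminus)
      show "superjet (relaxed_limsup \<Omega> (\<lambda>n. closest_point_extension (\<Union>(\<T> (hs n))) (\<lambda>y. - uh (hs n) (\<delta>s n) (\<theta>s n) y))) x0 (- b) (- M)"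
        using jet by (simp add: V_def W_def[abs_def] ext_def[abs_def] closest_point_extension_uminus subjet_def)
    qed
    then obtain n z where z: "z \<in> interior_nodes (\<T> (hs n))" "dist z x0 < r"
      and sd: "\<And>v. norm v = 1 \<Longrightarrow> second_difference (\<Union>(\<T> (hs n))) (\<delta>s n) (\<lambda>y. - uh (hs n) (\<delta>s n) (\<theta>s n) y) z v \<le> v \<bullet> ((- M) *v v) + e"
      by blast
    interpret dp: discrete_problem "\<T> (hs n)" "\<delta>s n" "B (\<theta>s n)" by (rule problem_n)
    obtain v where v: "v \<in> B (\<theta>s n)" "two_scale_operator (\<Union>(\<T> (hs n))) (\<delta>s n) (B (\<theta>s n)) (uh (hs n) (\<delta>s n) (\<theta>s n)) z =
      ma_flux (\<lambda>j. second_difference (\<Union>(\<T> (hs n))) (\<delta>s n) (uh (hs n) (\<delta>s n) (\<theta>s n)) z (v j))"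
      using dp.T_attained by blast
    have vo: "v \<in> orthonormal_bases" using v(1) dp.B(3) by blast
    have vn: "norm (v j) = 1" for j by (rule dp.norm_B[OF v(1)])
    have neg: "second_difference D' d' (\<lambda>y. - u' y) z' v' = - second_difference D' d' u' z' v'" for D' d' u' z' v'
      by (simp add: second_difference_def Let_def diff_divide_distrib add_divide_distrib)
    have "det ?M \<le> (\<Prod>j\<in>UNIV. v j \<bullet> (?M *v v j))"
      using pos_def_diagonalization[OF pde] vo by metis
    also have "\<dots> = ma_flux (\<lambda>j. v j \<bullet> (?M *v v j))"
    proof (rule ma_flux_eq_prod[symmetric])
      show "0 \<le> v j \<bullet> (?M *v v j)" for j
        using pde vn[of j] unfolding pos_def_def by (metis less_imp_le norm_zero zero_neq_one)
    qed
    also have "\<dots> \<le> ma_flux (\<lambda>j. second_difference (\<Union>(\<T> (hs n))) (\<delta>s n) (uh (hs n) (\<delta>s n) (\<theta>s n)) z (v j))"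
    proof (rule ma_flux_mono)
      fix j show "v j \<bullet> (?M *v v j) \<le> second_difference (\<Union>(\<T> (hs n))) (\<delta>s n) (uh (hs n) (\<delta>s n) (\<theta>s n)) z (v j)"
        using sd[OF vn[of j]] unfolding Me neg by (simp add: vn uminus_matrix_vector)
    qed
    also have "\<dots> = f z"
      using solution_n[of n] z(1) v(2) by (simp add: is_discrete_solution_def)
    finally have "det ?M \<le> f z" .
    moreover have "\<bar>f z - f x0\<bar> < e" using r(2) z ms.md.interior_nodes_subset by blast
    ultimately show ?thesis by linarith
  qed
  hence "\<forall>\<^sub>F e in at_right 0. det (M + ((- 1) * e) *\<^sub>R mat 1) \<le> f x0 + e"
    using c(1) unfolding eventually_at_right_field by (intro exI[of _ c]) auto
  moreover have "((\<lambda>e. f x0 + e) \<longlongrightarrow> f x0 + 0) (at_right 0)" by (intro tendsto_intros)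
  ultimately have "det M \<le> f x0 + 0"
    by (intro tendsto_le[OF _ _ tendsto_det_shift[of M "-1"]]) auto
  thus "det M \<le> f x0" by simp
qed

lemma boundary_values:
  assumes z: "z \<in> frontier \<Omega>"
  shows "U z \<le> g z" "g z \<le> V z"
proof -
  obtain m where m: "bounded_sequence \<Omega> W m" "bounded_sequence \<Omega> (\<lambda>n y. - W n y) m" by (rule W_bounded)
  have zc: "z \<in> closure \<Omega>" using z by (simp add: frontier_def)
  have near: "relaxed_bound \<Omega> W z (g z + e) \<and> relaxed_bound \<Omega> (\<lambda>n y. - W n y) z (- g z + e)" if e: "e > 0" for e
  proof (rule ext_barrier[of "e / 2"])
    show "e / 2 > 0" using e by simp
    fix C assume C: "C \<ge> 0" "\<And>z h \<delta> \<theta> y. z \<in> frontier \<Omega> \<Longrightarrow> h \<in> H \<Longrightarrow> \<delta> > 0 \<Longrightarrow> \<theta> > 0 \<Longrightarrow> y \<in> \<Omega> \<Longrightarrow>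
      \<bar>ext h \<delta> \<theta> y - g z\<bar> \<le> e / 2 + C * (norm (y - z) + hausdorff_dist \<Omega> (\<Union>(\<T> h)))"
    define k where "k = C + 1"
    \<comment> \<open>Ensures C (d + d) \<le> e / 2: one d bounds |y - z|, the other the Hausdorff
      distance.\<close>
    define d where "d = e / (4 * k)"
    have k: "k > 0" using C(1) by (simp add: k_def)
    have d: "d > 0" "4 * (C * d) \<le> e"
    proof -
      show "d > 0" using e k by (simp add: d_def)
      have "4 * (k * d) = e" using k by (simp add: d_def)
      hence "4 * ((C + 1) * d) = e" by (simp only: k_def)
      moreover have "C * d \<le> (C + 1) * d" using \<open>d > 0\<close> by (intro mult_right_mono) auto
      ultimately show "4 * (C * d) \<le> e" by linarith
    qed
    have "\<forall>\<^sub>F n in sequentially. hausdorff_dist \<Omega> (\<Union>(\<T> (hs n))) < d" by (rule order_tendstoD(2)[OF hausdorff_tendsto d(1)])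
    then obtain N where N: "\<And>n. n \<ge> N \<Longrightarrow> hausdorff_dist \<Omega> (\<Union>(\<T> (hs n))) < d" unfolding eventually_sequentially by blast
    have "\<bar>W n y - g z\<bar> \<le> e" if "n \<ge> N" "y \<in> \<Omega>" "dist y z < d" for n y
    proof -
      have "C * (norm (y - z) + hausdorff_dist \<Omega> (\<Union>(\<T> (hs n)))) \<le> C * (d + d)"
        using N[OF that(1)] that(3) C(1) by (intro mult_left_mono add_mono) (auto simp: dist_norm)
      thus ?thesis using C(2)[OF z hs pos(1) pos(2) that(2), of n n n] d(2) by (simp add: W_def distrib_left)
    qed
    hence "\<And>n y. n \<ge> N \<Longrightarrow> y \<in> \<Omega> \<Longrightarrow> dist y z < d \<Longrightarrow> W n y \<le> g z + e \<and> - W n y \<le> - g z + e"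
      by (force simp: abs_le_iff)
    thus ?thesis unfolding relaxed_bound_def using d(1) by blast
  qed
  show "U z \<le> g z"
  proof (rule field_le_epsilon)
    fix e :: real assume "e > 0"
    thus "U z \<le> g z + e" unfolding U_def using near bounded_sequence.relaxed_limsup_le[OF m(1) zc] by blast
  qed
  show "g z \<le> V z"
  proof (rule field_le_epsilon)
    fix e :: real assume "e > 0"
    hence "- V z \<le> - g z + e" unfolding V_def using near bounded_sequence.relaxed_limsup_le[OF m(2) zc] by simp
    thus "g z \<le> V z + e" by simp
  qed
qed

text \<open>The order of deduction matters: the subsolution property makes U convex, convexity makes
  it continuous in \<open>\<Omega>\<close>, and this continuity is what comparison demands of U.
  Comparison gives U \<le> V, while V \<le> U holds by construction.\<close>

lemma U_V:
  shows "convex_on \<Omega> U" "usc_on (closure \<Omega>) U" "usc_on (closure \<Omega>) (\<lambda>x. - V x)"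
    and "x \<in> closure \<Omega> \<Longrightarrow> U x = V x" "z \<in> frontier \<Omega> \<Longrightarrow> U z = g z"
proof -
  obtain m where m: "bounded_sequence \<Omega> W m" "bounded_sequence \<Omega> (\<lambda>n y. - W n y) m" by (rule W_bounded)
  show us: "usc_on (closure \<Omega>) U" unfolding U_def by (rule bounded_sequence.relaxed_limsup_usc[OF m(1)])
  show vs: "usc_on (closure \<Omega>) (\<lambda>x. - V x)" unfolding V_def using bounded_sequence.relaxed_limsup_usc[OF m(2)] by simp
  show cu: "convex_on \<Omega> U"
    by (rule ma_subsolution_convex[OF \<Omega>(1) cv usc_on_subset[OF us closure_subset] U_subsolution])
  have cont: "continuous_on \<Omega> U" by (rule convex_on_continuous[OF \<Omega>(1) cu])
  have VU: "V x \<le> U x" if "x \<in> closure \<Omega>" for x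
    unfolding V_def U_def by (rule bounded_sequence.relaxed_limsup_uminus[OF m(1) that])
  have UV: "U x \<le> V x" if x: "x \<in> closure \<Omega>" for x
  proof (rule ma_comparison[OF \<Omega>(1,3) us cont U_subsolution vs V_supersolution f(1) _ _ x])
    show "f y \<ge> 0" if "y \<in> \<Omega>" for y by (rule f(3)[OF that])
    show "U y \<le> V y" if "y \<in> frontier \<Omega>" for y using boundary_values[OF that] by linarith
  qed
  show eq: "U x = V x" if "x \<in> closure \<Omega>" for x using VU[OF that] UV[OF that] by simp
  show "U z = g z" if z: "z \<in> frontier \<Omega>"
  proof -
    have "z \<in> closure \<Omega>" using z by (simp add: frontier_def)
    from eq[OF this] show ?thesis using boundary_values[OF z] by simp
  qed
qed

text \<open>U is upper semicontinuous and V lower semicontinuous, and they coincide on the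
  closure.\<close>

lemma U_continuous: "continuous_on (closure \<Omega>) U"
  unfolding continuous_on_iff
proof (intro ballI allI impI)
  fix x and e :: real assume x: "x \<in> closure \<Omega>" and e: "e > 0"
  obtain d1 where d1: "d1 > 0" "\<And>y. y \<in> closure \<Omega> \<Longrightarrow> dist y x < d1 \<Longrightarrow> U y < U x + e"
    using U_V(2)[unfolded usc_on_def, rule_format, OF x, of "U x + e"] e by auto
  obtain d2 where d2: "d2 > 0" "\<And>y. y \<in> closure \<Omega> \<Longrightarrow> dist y x < d2 \<Longrightarrow> - V y < - V x + e"
    using U_V(3)[unfolded usc_on_def, rule_format, OF x, of "- V x + e"] e by auto
  have "dist (U y) (U x) < e" if "y \<in> closure \<Omega>" "dist y x < min d1 d2" for y
    using d1(2)[of y] d2(2)[of y] that U_V(4)[OF that(1)] U_V(4)[OF x] by (simp add: dist_real_def abs_less_iff)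
  thus "\<exists>d>0. \<forall>x'\<in>closure \<Omega>. dist x' x < d \<longrightarrow> dist (U x') (U x) < e"
    using d1(1) d2(1) by (intro exI[of _ "min d1 d2"]) auto
qed

lemma U_convex: "convex_on (closure \<Omega>) U"
proof (rule convex_onI)
  show "convex (closure \<Omega>)" by (rule convex_closure[OF cv])
  fix t x y assume t: "0 < t" "t < (1::real)" and x: "x \<in> closure \<Omega>" and y: "y \<in> closure \<Omega>"
  obtain xs where xs: "\<And>n. xs n \<in> \<Omega>" "xs \<longlonglongrightarrow> x" using x closure_sequential by blast
  obtain ys where ys: "\<And>n. ys n \<in> \<Omega>" "ys \<longlonglongrightarrow> y" using y closure_sequential by blast
  have lim: "(\<lambda>n. U (p n)) \<longlonglongrightarrow> U q" if "\<And>n. p n \<in> \<Omega>" "p \<longlonglongrightarrow> q" "q \<in> closure \<Omega>" for p q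
    by (rule continuous_on_tendsto_compose[OF U_continuous that(2,3)])
      (use that(1) closure_subset in \<open>auto intro!: always_eventually\<close>)
  have mem: "(1 - t) *\<^sub>R a + t *\<^sub>R b \<in> \<Omega>" if "a \<in> \<Omega>" "b \<in> \<Omega>" for a b
    using cv that t by (intro convexD) auto
  have memc: "(1 - t) *\<^sub>R x + t *\<^sub>R y \<in> closure \<Omega>"
    using convex_closure[OF cv] x y t by (intro convexD) auto
  have "(\<lambda>n. U ((1 - t) *\<^sub>R xs n + t *\<^sub>R ys n)) \<longlonglongrightarrow> U ((1 - t) *\<^sub>R x + t *\<^sub>R y)"
    by (rule lim[OF _ _ memc]) (use mem xs ys in \<open>auto intro!: tendsto_intros\<close>)
  moreover have "(\<lambda>n. (1 - t) * U (xs n) + t * U (ys n)) \<longlonglongrightarrow> (1 - t) * U x + t * U y"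
    by (intro tendsto_intros lim xs ys x y)
  moreover have "U ((1 - t) *\<^sub>R xs n + t *\<^sub>R ys n) \<le> (1 - t) * U (xs n) + t * U (ys n)" for n
    using convex_onD[OF U_V(1), of t] xs(1) ys(1) t by simp
  ultimately show "U ((1 - t) *\<^sub>R x + t *\<^sub>R y) \<le> (1 - t) * U x + t * U y"
    by (intro LIMSEQ_le[of "\<lambda>n. U ((1 - t) *\<^sub>R xs n + t *\<^sub>R ys n)"]) auto
qed

lemma limit_viscosity_solution: "is_viscosity_solution \<Omega> f g (restrict U (closure \<Omega>))"
proof -
  let ?u = "restrict U (closure \<Omega>)"
  have near: "\<forall>\<^sub>F y in nhds x. ?u y = U y" if "x \<in> \<Omega>" for x
  proof -
    have "\<forall>\<^sub>F y in nhds x. y \<in> \<Omega>" by (rule eventually_nhds_in_open[OF \<Omega>(1) that])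
    thus ?thesis by eventually_elim (use closure_subset in auto)
  qed
  have uU: "?u x = U x" if "x \<in> \<Omega>" for x using that closure_subset by auto
  have UV: "\<forall>\<^sub>F y in nhds x. U y = V y" if "x \<in> \<Omega>" for x
  proof -
    have "\<forall>\<^sub>F y in nhds x. y \<in> \<Omega>" by (rule eventually_nhds_in_open[OF \<Omega>(1) that])
    thus ?thesis by eventually_elim (use U_V(4) closure_subset in blast)
  qed
  have supU: "ma_supersolution \<Omega> f U"
    unfolding ma_supersolution_def
  proof (intro ballI allI impI, elim conjE)
    fix x b M assume x: "x \<in> \<Omega>" and j: "subjet U x b M" and pd: "pos_def M"
    have "U x = V x" using U_V(4) x closure_subset by blast
    hence "\<forall>\<^sub>F y in nhds x. U x - V x \<ge> U y - V y" "\<forall>\<^sub>F y in nhds x. V y - U y \<ge> V x - U x"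
      using UV[OF x] by (auto elim: eventually_mono)
    hence "subjet V x b M" using subjet_touch[OF j] by blast
    thus "det M \<le> f x" using V_supersolution x pd unfolding ma_supersolution_def by blast
  qed
  have test: "det (hessian \<phi> x) \<ge> f x" if "convex_on \<Omega> \<phi>" "C2_on \<Omega> \<phi>" "x \<in> \<Omega>"
    "\<forall>\<^sub>F y in nhds x. ?u y - \<phi> y \<le> ?u x - \<phi> x" for \<phi> x
  proof (rule ma_imp_viscosity_test(1)[OF \<Omega>(1) U_subsolution supU that(1-3) f(3)[OF that(3)]])
    show "\<forall>\<^sub>F y in nhds x. U y - \<phi> y \<le> U x - \<phi> x"
      using that(4) near[OF that(3)] by eventually_elim (use uU[OF that(3)] in simp)
  qed
  have test2: "det (hessian \<phi> x) \<le> f x" if "convex_on \<Omega> \<phi>" "C2_on \<Omega> \<phi>" "x \<in> \<Omega>"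
    "\<forall>\<^sub>F y in nhds x. ?u y - \<phi> y \<ge> ?u x - \<phi> x" for \<phi> x
  proof (rule ma_imp_viscosity_test(2)[OF \<Omega>(1) U_subsolution supU that(1-3) f(3)[OF that(3)]])
    show "\<forall>\<^sub>F y in nhds x. U y - \<phi> y \<ge> U x - \<phi> x"
      using that(4) near[OF that(3)] by eventually_elim (use uU[OF that(3)] in simp)
  qed
  have "continuous_on (closure \<Omega>) ?u"
    by (rule continuous_on_eq[OF U_continuous]) simp
  moreover have "convex_on (closure \<Omega>) ?u"
  proof (rule convex_onI[OF _ convex_closure[OF cv]])
    fix t x y assume t: "0 < t" "t < (1::real)" and xy: "x \<in> closure \<Omega>" "y \<in> closure \<Omega>"
    have "(1 - t) *\<^sub>R x + t *\<^sub>R y \<in> closure \<Omega>" using convex_closure[OF cv] xy t by (intro convexD) auto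
    thus "?u ((1 - t) *\<^sub>R x + t *\<^sub>R y) \<le> (1 - t) * ?u x + t * ?u y"
      using convex_onD[OF U_convex, of t x y] t xy by simp
  qed
  moreover have "?u x = g x" if "x \<in> frontier \<Omega>" for x
    using that U_V(5) by (simp add: frontier_def)
  ultimately show ?thesis unfolding is_viscosity_solution_def using test test2 by auto
qed

text \<open>Around each point of the closure the relaxed bounds from U and from V = U hold for all
  late n on a common neighbourhood; compactness makes this uniform up to the boundary.\<close>

lemma uniform_convergence:
  assumes e: "e > 0"
  shows "\<exists>N. \<forall>n\<ge>N. \<forall>y\<in>\<Omega>. dist (W n y) (U y) < e"
proof -
  obtain m where m: "bounded_sequence \<Omega> W m" "bounded_sequence \<Omega> (\<lambda>n y. - W n y) m" by (rule W_bounded)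
  have "\<exists>d>0. \<exists>N. \<forall>n\<ge>N. \<forall>y\<in>\<Omega>. dist y x < d \<longrightarrow> dist (W n y) (U y) < e" if x: "x \<in> closure \<Omega>" for x
  proof -
    have e3: "e / 3 > 0" using e by simp
    have "relaxed_bound \<Omega> W x (U x + e / 3)"
      by (rule bounded_sequence.relaxed_limsup_less[OF m(1) x]) (use e in \<open>simp add: U_def\<close>)
    then obtain d1 N1 where d1: "d1 > 0" "\<And>n y. n \<ge> N1 \<Longrightarrow> y \<in> \<Omega> \<Longrightarrow> dist y x < d1 \<Longrightarrow> W n y \<le> U x + e / 3"
      unfolding relaxed_bound_def by blast
    have "relaxed_bound \<Omega> (\<lambda>n y. - W n y) x (- V x + e / 3)"
      by (rule bounded_sequence.relaxed_limsup_less[OF m(2) x]) (use e in \<open>simp add: V_def\<close>)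
    then obtain d2 N2 where d2: "d2 > 0" "\<And>n y. n \<ge> N2 \<Longrightarrow> y \<in> \<Omega> \<Longrightarrow> dist y x < d2 \<Longrightarrow> - W n y \<le> - V x + e / 3"
      unfolding relaxed_bound_def by blast
    obtain d3 where d3: "d3 > 0" "\<And>y. y \<in> closure \<Omega> \<Longrightarrow> dist y x < d3 \<Longrightarrow> dist (U y) (U x) < e / 3"
      using U_continuous x e3 unfolding continuous_on_iff by meson
    have "dist (W n y) (U y) < e" if "n \<ge> max N1 N2" "y \<in> \<Omega>" "dist y x < min d1 (min d2 d3)" for n y
    proof -
      have "W n y \<le> U x + e / 3" "- W n y \<le> - U x + e / 3" using d1(2)[of n y] d2(2)[of n y] that U_V(4)[OF x] by auto
      moreover have "\<bar>U y - U x\<bar> < e / 3" using d3(2)[of y] that closure_subset by (auto simp: dist_real_def)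
      ultimately show ?thesis unfolding dist_real_def by linarith
    qed
    thus ?thesis using d1(1) d2(1) d3(1) by (intro exI[of _ "min d1 (min d2 d3)"] conjI exI[of _ "max N1 N2"]) auto
  qed
  then obtain d N where d: "\<And>x. x \<in> closure \<Omega> \<Longrightarrow> d x > 0"
    "\<And>x n y. x \<in> closure \<Omega> \<Longrightarrow> n \<ge> N x \<Longrightarrow> y \<in> \<Omega> \<Longrightarrow> dist y x < d x \<Longrightarrow> dist (W n y) (U y) < e" by metis
  have "closure \<Omega> \<subseteq> (\<Union>x\<in>closure \<Omega>. ball x (d x))" using d(1) by auto
  moreover have "compact (closure \<Omega>)" using \<Omega>(3) by simp
  ultimately obtain F where F: "F \<subseteq> closure \<Omega>" "finite F" "closure \<Omega> \<subseteq> (\<Union>x\<in>F. ball x (d x))"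
    using compactE_image[of "closure \<Omega>" "closure \<Omega>" "\<lambda>x. ball x (d x)"] by (metis open_ball)
  have "dist (W n y) (U y) < e" if n: "n \<ge> (\<Sum>x\<in>F. N x)" and y: "y \<in> \<Omega>" for n y
  proof -
    obtain x where x: "x \<in> F" "y \<in> ball x (d x)" using F(3) y closure_subset by blast
    have "N x \<le> (\<Sum>x\<in>F. N x)" using x(1) F(2) by (intro member_le_sum) auto
    thus ?thesis using d(2)[of x n y] x F(1) n y by (auto simp: dist_commute)
  qed
  thus ?thesis by blast
qed

end

section \<open>From sequences to the two-scale limit filter\<close>

context two_scale begin

lemma viscosity_exists: "\<exists>u. is_viscosity_solution \<Omega> f g u"
proof -
  have "0 islimpt H" and Hp: "H \<subseteq> {0<..}" using mf by (auto simp: mesh_family_def)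
  then obtain hs where hs: "\<And>n. hs n \<in> H - {0}" "hs \<longlonglongrightarrow> 0" unfolding islimpt_sequential by blast
  have hpos: "hs n > 0" for n using hs(1)[of n] Hp by auto
  have sq: "(\<lambda>n. sqrt (hs n)) \<longlonglongrightarrow> sqrt 0" by (intro tendsto_real_sqrt hs(2))
  \<comment> \<open>One admissible sequence is enough for existence: \<delta> = \<theta> = sqrt h
    gives h / \<delta> = sqrt h, which tends to 0.\<close>
  interpret two_scale_sequence \<Omega> f g H \<T> S B hs "\<lambda>n. sqrt (hs n)" "\<lambda>n. sqrt (hs n)"
  proof unfold_locales
    show "(\<lambda>n. hs n / sqrt (hs n)) \<longlonglongrightarrow> 0"
      using sq hpos by (simp add: real_div_sqrt less_imp_le)
  qed (use hs hpos sq in auto)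
  show ?thesis using limit_viscosity_solution by blast
qed

text \<open>Meant for the contrapositive: if closeness does not hold eventually, every cube of side
  1 / (n + 1) in h, \<delta>, \<theta> and h / \<delta> contains a bad triple.\<close>

lemma eventually_two_scale_limit:
  assumes d: "d > 0" and P: "\<And>h \<delta> \<theta>. h \<in> H \<Longrightarrow> 0 < \<delta> \<Longrightarrow> 0 < \<theta> \<Longrightarrow> \<bar>h\<bar> < d \<Longrightarrow> \<delta> < d \<Longrightarrow> \<theta> < d \<Longrightarrow> \<bar>h / \<delta>\<bar> < d \<Longrightarrow> P (h, \<delta>, \<theta>)"
  shows "eventually P (two_scale_limit H)"
proof -
  have "\<forall>\<^sub>F h in at 0 within H. h \<in> H \<and> \<bar>h\<bar> < d"
    unfolding eventually_at using d by (intro exI[of _ d]) (auto simp: dist_real_def)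
  moreover have "\<forall>\<^sub>F \<delta> in at_right (0::real). 0 < \<delta> \<and> \<delta> < d"
    unfolding eventually_at_right_field using d by blast
  ultimately have "\<forall>\<^sub>F p in (at 0 within H) \<times>\<^sub>F at_right 0 \<times>\<^sub>F at_right 0.
     (fst p \<in> H \<and> \<bar>fst p\<bar> < d) \<and> (0 < fst (snd p) \<and> fst (snd p) < d) \<and> (0 < snd (snd p) \<and> snd (snd p) < d)"
    by (intro eventually_prodI[of _ _ "\<lambda>p. (0 < fst p \<and> fst p < d) \<and> (0 < snd p \<and> snd p < d)"] eventually_prodI)
  moreover have "\<forall>\<^sub>F p in filtercomap (\<lambda>(h, \<delta>, \<theta>). h / \<delta>) (nhds 0). \<bar>(\<lambda>(h, \<delta>, \<theta>). h / \<delta>) p\<bar> < d"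
  proof (rule eventually_filtercomapI)
    show "\<forall>\<^sub>F x in nhds (0::real). \<bar>x\<bar> < d"
      unfolding eventually_nhds_metric using d by (intro exI[of _ d]) (auto simp: dist_real_def)
  qed
  ultimately show ?thesis unfolding two_scale_limit_def eventually_inf
    using P by (intro exI conjI) (assumption, assumption, auto)
qed

text \<open>A sequence of bad triples satisfies the assumptions of
  \<open>two_scale_sequence\<close>, so its solutions converge uniformly to its own limit U.
  Uniqueness identifies U with u on \<open>\<Omega>\<close>, so the triples are good from some index
  on.\<close>

lemma convergence:
  assumes u: "is_viscosity_solution \<Omega> f g u"
  shows "uniform_limit \<Omega> (\<lambda>(h, \<delta>, \<theta>). ext h \<delta> \<theta>) u (two_scale_limit H)"
proof (rule uniform_limitI, rule ccontr)
  fix e :: real assume e: "e > 0"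
  assume no: "\<not> (\<forall>\<^sub>F p in two_scale_limit H. \<forall>x\<in>\<Omega>. dist ((case p of (h, \<delta>, \<theta>) \<Rightarrow> ext h \<delta> \<theta>) x) (u x) < e)"
  have "\<exists>h \<delta> \<theta>. h \<in> H \<and> 0 < \<delta> \<and> 0 < \<theta> \<and> \<bar>h\<bar> < 1 / real (Suc n) \<and> \<delta> < 1 / real (Suc n) \<and> \<theta> < 1 / real (Suc n) \<and>
      \<bar>h / \<delta>\<bar> < 1 / real (Suc n) \<and> \<not> (\<forall>x\<in>\<Omega>. dist (ext h \<delta> \<theta> x) (u x) < e)" for n
  proof (rule ccontr)
    assume neg: "\<not> ?thesis"
    have "\<forall>\<^sub>F p in two_scale_limit H. \<forall>x\<in>\<Omega>. dist ((case p of (h, \<delta>, \<theta>) \<Rightarrow> ext h \<delta> \<theta>) x) (u x) < e"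
      by (rule eventually_two_scale_limit[of "1 / real (Suc n)"]) (use neg in auto)
    thus False using no by blast
  qed
  then obtain hs \<delta>s \<theta>s where s: "\<And>n. hs n \<in> H" "\<And>n. 0 < \<delta>s n" "\<And>n. 0 < \<theta>s n" "\<And>n. \<bar>hs n\<bar> < 1 / real (Suc n)"
    "\<And>n. \<delta>s n < 1 / real (Suc n)" "\<And>n. \<theta>s n < 1 / real (Suc n)" "\<And>n. \<bar>hs n / \<delta>s n\<bar> < 1 / real (Suc n)"
    and bad: "\<And>n. \<not> (\<forall>x\<in>\<Omega>. dist (ext (hs n) (\<delta>s n) (\<theta>s n) x) (u x) < e)" by metis
  have squeeze: "a \<longlonglongrightarrow> 0" if "\<And>n. \<bar>a n\<bar> < 1 / real (Suc n)" for a :: "nat \<Rightarrow> real"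
    by (rule Lim_null_comparison[OF _ LIMSEQ_Suc[OF lim_1_over_n]])
      (use that in \<open>auto intro!: always_eventually less_imp_le\<close>)
  interpret two_scale_sequence \<Omega> f g H \<T> S B hs \<delta>s \<theta>s
  proof unfold_locales
    show "hs \<longlonglongrightarrow> 0" "(\<lambda>n. hs n / \<delta>s n) \<longlonglongrightarrow> 0" by (intro squeeze s)+
    show "\<delta>s \<longlonglongrightarrow> 0" "\<theta>s \<longlonglongrightarrow> 0" by (intro squeeze; use s in \<open>simp add: abs_of_pos\<close>)+
  qed (use s in auto)
  obtain N where "\<forall>n\<ge>N. \<forall>y\<in>\<Omega>. dist (W n y) (U y) < e" using uniform_convergence[OF e] by blast
  moreover have "u = restrict U (closure \<Omega>)" by (rule viscosity_unique[OF u limit_viscosity_solution])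
  hence "u y = U y" if "y \<in> \<Omega>" for y using that closure_subset by auto
  ultimately have "\<forall>x\<in>\<Omega>. dist (ext (hs N) (\<delta>s N) (\<theta>s N) x) (u x) < e" by (simp add: W_def)
  thus False using bad by blast
qed

end

theorem theorem5p7:
  fixes \<Omega> :: "(real ^ 'n) set"
    and f g :: "real ^ 'n \<Rightarrow> real"
    and H :: "real set"
    and \<T> :: "real \<Rightarrow> (real ^ 'n) set set"
    and S :: "real \<Rightarrow> (real ^ 'n) set"
    and B :: "real \<Rightarrow> ('n \<Rightarrow> real ^ 'n) set"
  assumes "CARD('n) \<ge> 2"
    and "open \<Omega>" and "connected \<Omega>" and "\<Omega> \<noteq> {}" and "bounded \<Omega>"
    and "uniformly_convex \<Omega>"
    and "continuous_on \<Omega> f" and "bounded (f ` \<Omega>)" and "\<forall>x\<in>\<Omega>. f x \<ge> 0"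
    and "continuous_on (frontier \<Omega>) g"
    and "mesh_family \<Omega> H \<T>"
    and "\<And>\<theta>. \<theta> > 0 \<Longrightarrow> direction_sets \<theta> (S \<theta>) (B \<theta>)"
  shows "(\<forall>h\<in>H. \<forall>\<delta>>0. \<forall>\<theta>>0. \<exists>!w. is_discrete_solution f g (\<T> h) \<delta> (B \<theta>) w) \<and>
    (\<exists>!u. is_viscosity_solution \<Omega> f g u) \<and>
    (\<forall>u. is_viscosity_solution \<Omega> f g u \<longrightarrow>
       uniform_limit \<Omega>
         (\<lambda>(h, \<delta>, \<theta>). closest_point_extension (\<Union>(\<T> h)) (discrete_solution f g (\<T> h) \<delta> (B \<theta>)))
         u (two_scale_limit H))"
proof -
  interpret two_scale \<Omega> f g H \<T> S B
    by unfold_locales (use assms in auto)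
  have "\<forall>h\<in>H. \<forall>\<delta>>0. \<forall>\<theta>>0. \<exists>!w. is_discrete_solution f g (\<T> h) \<delta> (B \<theta>) w"
    using discrete_unique by blast
  moreover have "\<exists>!u. is_viscosity_solution \<Omega> f g u"
    using viscosity_exists viscosity_unique by blast
  moreover have "uniform_limit \<Omega>
      (\<lambda>(h, \<delta>, \<theta>). closest_point_extension (\<Union>(\<T> h)) (discrete_solution f g (\<T> h) \<delta> (B \<theta>)))
      u (two_scale_limit H)" if "is_viscosity_solution \<Omega> f g u" for u
    using convergence[OF that] unfolding ext_def uh_def .
  ultimately show ?thesis by blast
qed

end
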